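(* Let $d\in\mathbb{N}$, $a\in(0,\infty)$, and let $\alpha_m,\beta_m,\gamma_m,\xi,A$, $X_t^{(m)}$, $\tau^{(m)}$, $Y^{(m)}$ be as in the context. Assume that, as $m\to\infty$, $1-\mathbb{E}\alpha_m\sim a/m$, $1-\mathbb{E}\alpha_m^2\sim 2a/m$ and $\beta_m\sim 1/\sqrt m$, that $\mathbb{E}\xi=0$, $\mathbb{E}\|\xi\|^2<\infty$, and that the matrix $\Sigma:=\mathbb{E}\xi\xi^T$ has full rank. Moreover, assume that $\mathbb{E}Y^{(m)}\to\mu\in\mathbb{R}^d$ and $\mathbb{E}\tau^{(m)}\to\widehat\tau\in[1,\infty]$ as $m\to\infty$. If $\widehat\tau\in[1,\infty)$, assume additionally that there exists a random variable $\tau$ such that $\tau^{(m)}\to\tau$ in probability as $m\to\infty$. Put $$p:=\begin{cases}1-\mathbb{E}\tau/\widehat\tau, & \widehat\tau\in[1,\infty),\\ 1,&\widehat\tau=\infty.\end{cases}$$ Then $p\in[0,1]$ and, as $m\to\infty$, $$Y^{(m)}\overset{d}{\longrightarrow}Y:=B_1\cdot Z ,$$ where $B_1$ and $Z$ are independent, $\mathbb{P}(B_1=1)=p=1-\mathbb{P}(B_1=0)$ (so that the limit is the constant $0$ if $p=0$), and, if $p>0$, $Z$ is a $d$-dimensional random vector with an absolutely continuous distribution that is characterised by the following properties. (i) The characteristic function of $Z$ satisfies $\varphi_Z(0)=1$ and, for $u\in\mathbb{R}^d\setminus\{0\}$, $$\varphi_Z(u)=\left(1+\mathbf{i}\,\frac{\sqrt{2a}\,\langle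 u,\mu\rangle}{p\sqrt{u^T\Sigma u}}\int_0^{\sqrt{u^T\Sigma u}/\sqrt{2a}}\exp\left(\frac{t^2}{2}\right)dt\right)\exp\left(-\frac{u^T\Sigma u}{4a}\right).$$ (ii) $Z$ has the density (for $x\in\mathbb{R}^d\setminus\{0\}$) $$f_Z(x)=\frac{a^{d/2}}{\sqrt{\det(\Sigma)}\,\pi^{d/2}}\exp(-a\,x^T\Sigma^{-1}x)+\widetilde f_Z(x),$$ where for odd $d$ $$\widetilde f_Z(x)=\frac{(-2)^{\frac{d-1}{2}}a^{\frac{d+2}{2}}}{\sqrt{\det(\Sigma)}\,\kappa_{d-1}\,(d-1)!!\,p}\,\langle\Sigma^{-1}\mu,x\rangle\,h^{((d-1)/2)}(a\,x^T\Sigma^{-1}x),$$ and for even $d$ $$\widetilde f_Z(x)=\frac{(-2)^{\frac d2}a^{\frac{d+3}{2}}}{\sqrt{\det(\Sigma)}\,\kappa_d\,d!!\,p}\,\langle\Sigma^{-1}\mu,x\rangle\int_{-\infty}^{\infty}h^{(d/2)}\big(a(x^T\Sigma^{-1}x+z^2)\big)\,dz.$$ Here $h(s)=e^{-s}/\sqrt s$ for $s>0$, $h^{(k)}$ is its $k$-th derivative ($h^{(0)}=h$), $\kappa_d$ is the volume of the $d$-dimensional unit ball ($\kappa_0=1$), and $(2k)!!=2k\cdot 2(k-1)\cdots 4\cdot 2$ ($0!!=1$). (iii) For any $v\in\mathbb{R}^d\setminus\{0\}$, $$\langle v,Z\rangle\overset{d}{=}\frac{\sqrt{v^T\Sigma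 v}}{\sqrt{2a}}\,B_{2,v}\,|N|,$$ where $N$ and $B_{2,v}$ are independent random variables, $N$ is standard normal, and $B_{2,v}$ has the two-point distribution $$\mathbb{P}(B_{2,v}=1)=\frac12+\frac{\sqrt{\pi a}\,\langle v,\mu\rangle}{2p\sqrt{v^T\Sigma v}},\qquad \mathbb{P}(B_{2,v}=-1)=\frac12-\frac{\sqrt{\pi a}\,\langle v,\mu\rangle}{2p\sqrt{v^T\Sigma v}}.$$
   Context: Setting. $\|\cdot\|$ is the Euclidean norm on $\mathbb{R}^d$ and $B^d(x,r)$ the open ball with centre $x$ and radius $r$. $\{\alpha_m\}_{m\in\mathbb{N}}$ are positive random variables with finite first two moments, $\{\beta_m\}_{m\in\mathbb{N}}$ are real constants, $\{\gamma_m\}_{m\in\mathbb{N}}$ are positive real numbers, and $A\subseteq\mathbb{R}^d$ is a measurable set with $B^d(0,\underline r)\subseteq A\subseteq B^d(0,\overline r)$ for some $\underline r,\overline r\in(0,\infty)$. All random objects live on one probability space. $\{\xi_t\}_{t\in\mathbb{N}}$ are i.i.d. copies of a random vector $\xi$ in $\mathbb{R}^d$ (the same sequence for all $m$); for each $m$, $\{\alpha_{m,t}\}_{t\in\mathbb{N}}$ are i.i.d. copies of $\alpha_m$, independent of $\{\xi_t\}_{t\in\mathbb{N}}$. Define $X_0^{(m)}=0$, $X_{t+1}^{(m)}=\alpha_{m,t+1}X_t^{(m)}+\beta_m\xi_{t+1}$; $\tau^{(m)}=\min\{t\ge1: X_t^{(m)}\in\gamma_mA\}$; and $Y_0^{(m)}=0$,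 $Y_{t+1}^{(m)}=\alpha_{m,t+1}Y_t^{(m)}\mathbf{1}\{Y_t^{(m)}\notin\gamma_mA\}+\beta_m\xi_{t+1}$. Standing assumption: for all $m$, $\mathbb{P}(\alpha_m\in[d/(d+1),1))>0$ and $\mathbb{E}\alpha_m<1$. Together with $\mathbb{E}\xi=0$, $\mathbb{E}\|\xi\|^2<\infty$ this guarantees that $\mathbb{E}\tau^{(m)}<\infty$ and that the Markov chain $\{Y_t^{(m)}\}_{t}$ has a unique stationary distribution, namely $\pi^{(m)}(\cdot)=\frac{1}{\mathbb{E}\tau^{(m)}}\mathbb{E}\sum_{j=1}^{\tau^{(m)}}\mathbf{1}\{X_j^{(m)}\in\cdot\}$. $Y^{(m)}$ denotes a random vector with distribution $\pi^{(m)}$; equivalently $Y^{(m)}\overset{d}{=}\alpha_mY^{(m)}\mathbf{1}\{Y^{(m)}\notin\gamma_mA\}+\beta_m\xi$ with $\alpha_m,Y^{(m)},\xi$ independent on the right-hand side. *)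

theory Defs
  imports "HOL-Probability.Probability" "HOL-Library.Landau_Symbols"
begin

text \<open>The library's \<open>indep_var\<close> needs both variables to have values in the same type; this is its
  characterisation \<open>indep_var_eq\<close> for values in different types (the preimages of the measurable
  sets already form a \<open>\<sigma>\<close>-algebra).\<close>

definition indep_rv ::
  "'a measure \<Rightarrow> 'b measure \<Rightarrow> ('a \<Rightarrow> 'b) \<Rightarrow> 'c measure \<Rightarrow> ('a \<Rightarrow> 'c) \<Rightarrow> bool"
where
  "indep_rv M K U L V \<longleftrightarrow>
     U \<in> measurable M K \<and> V \<in> measurable M L \<and>
     prob_space.indep_set M {U -` B \<inter> space M |B. B \<in> sets K} {V -` B \<inter> space M |B. B \<in> sets L}"

primrec X_proc ::
  "(nat \<Rightarrow> 'a \<Rightarrow> real) \<Rightarrow> real \<Rightarrow> (nat \<Rightarrow> 'a \<Rightarrow> 'v::real_vector) \<Rightarrow> nat \<Rightarrow> 'a \<Rightarrow> 'v"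
where
  "X_proc al b xi 0 \<omega> = 0"
| "X_proc al b xi (Suc t) \<omega> = al (Suc t) \<omega> *\<^sub>R X_proc al b xi t \<omega> + b *\<^sub>R xi (Suc t) \<omega>"

text \<open>The first return time takes the value \<open>\<infinity>\<close> where the set is never reached
  (the infimum of the empty set).\<close>

definition first_hit :: "(nat \<Rightarrow> 'a \<Rightarrow> 'v) \<Rightarrow> 'v set \<Rightarrow> 'a \<Rightarrow> enat" where
  "first_hit X S \<omega> = (INF t \<in> {t. 1 \<le> t \<and> X t \<omega> \<in> S}. enat t)"

definition mean_time :: "'a measure \<Rightarrow> ('a \<Rightarrow> enat) \<Rightarrow> ennreal" where
  "mean_time M \<tau> = (\<integral>\<^sup>+\<omega>. ennreal_of_enat (\<tau> \<omega>) \<partial>M)"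

text \<open>The number \<open>(1 / E \<tau>) * E (\<Sum>j = 1..\<tau>. 1{X\<^sub>j \<in> B})\<close>. With \<open>\<tau>\<close> the hitting time of
  \<open>\<gamma>A\<close> by \<open>X\<close>, this is, as a function of the Borel set \<open>B\<close>, the stationary distribution
  of the chain \<open>Y\<^sub>t\<^sub>+\<^sub>1 = \<alpha>\<^sub>t\<^sub>+\<^sub>1 Y\<^sub>t 1{Y\<^sub>t \<notin> \<gamma>A} + \<beta> \<xi>\<^sub>t\<^sub>+\<^sub>1\<close>.\<close>

definition cycle_occupation ::
  "'a measure \<Rightarrow> (nat \<Rightarrow> 'a \<Rightarrow> 'v) \<Rightarrow> ('a \<Rightarrow> enat) \<Rightarrow> 'v set \<Rightarrow> ennreal"
where
  "cycle_occupation M X \<tau> B =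
     (\<integral>\<^sup>+\<omega>. (\<Sum>j. if 1 \<le> j \<and> enat j \<le> \<tau> \<omega> then indicator B (X j \<omega>) else 0) \<partial>M) / mean_time M \<tau>"

definition conv_in_prob_enat :: "'a measure \<Rightarrow> (nat \<Rightarrow> 'a \<Rightarrow> enat) \<Rightarrow> ('a \<Rightarrow> real) \<Rightarrow> bool" where
  "conv_in_prob_enat M \<tau> T \<longleftrightarrow>
     (\<forall>\<epsilon>>0. (\<lambda>m. measure M {\<omega> \<in> space M. ereal \<epsilon> < \<bar>ereal_of_enat (\<tau> m \<omega>) - ereal (T \<omega>)\<bar>})
        \<longlonglongrightarrow> 0)"

text \<open>The library's \<open>weak_conv_m\<close> is restricted to distributions on the real line.\<close>

definition weak_conv_law :: "(nat \<Rightarrow> 'v::topological_space measure) \<Rightarrow> 'v measure \<Rightarrow> bool" where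
  "weak_conv_law \<mu>s \<mu> \<longleftrightarrow>
     (\<forall>f :: 'v \<Rightarrow> real. continuous_on UNIV f \<and> bounded (range f) \<longrightarrow>
        (\<lambda>n. \<integral>x. f x \<partial>\<mu>s n) \<longlonglongrightarrow> (\<integral>x. f x \<partial>\<mu>))"

definition borel_prob :: "'v::topological_space measure \<Rightarrow> bool" where
  "borel_prob \<nu> \<longleftrightarrow> prob_space \<nu> \<and> sets \<nu> = sets borel"

text \<open>The library's \<open>char\<close> is restricted to the real line.\<close>

definition char_vec :: "'v::real_inner measure \<Rightarrow> 'v \<Rightarrow> complex" where
  "char_vec \<nu> u = (CLINT x|\<nu>. iexp (u \<bullet> x))"

definition second_moment_matrix :: "'a measure \<Rightarrow> ('a \<Rightarrow> real^'n) \<Rightarrow> real^'n^'n" where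
  "second_moment_matrix M xi = (\<chi> i j. (\<integral>\<omega>. xi \<omega> $ i * xi \<omega> $ j \<partial>M))"

definition quad :: "real^'n^'n \<Rightarrow> real^'n \<Rightarrow> real" where
  "quad S x = x \<bullet> (S *v x)"

fun double_fact :: "nat \<Rightarrow> nat" where
  "double_fact 0 = 1"
| "double_fact (Suc 0) = 1"
| "double_fact (Suc (Suc n)) = Suc (Suc n) * double_fact n"

definition hfun :: "real \<Rightarrow> real" where
  "hfun s = exp (- s) / sqrt s"

text \<open>Only used at points \<open>s > 0\<close>, where \<open>hfun\<close> is smooth.\<close>

definition hderiv :: "nat \<Rightarrow> real \<Rightarrow> real" where
  "hderiv k = (deriv ^^ k) hfun"

definition f_tilde :: "real \<Rightarrow> real \<Rightarrow> real^'n \<Rightarrow> real^'n^'n \<Rightarrow> real^'n \<Rightarrow> real" where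
  "f_tilde a p \<mu> S x =
     (let d = CARD('n); Si = matrix_inv S in
      if odd d then
        (- 2) ^ ((d - 1) div 2) * a powr ((real d + 2) / 2)
          / (sqrt (det S) * unit_ball_vol (real (d - 1)) * real (double_fact (d - 1)) * p)
          * ((Si *v \<mu>) \<bullet> x) * hderiv ((d - 1) div 2) (a * quad Si x)
      else
        (- 2) ^ (d div 2) * a powr ((real d + 3) / 2)
          / (sqrt (det S) * unit_ball_vol (real d) * real (double_fact d) * p)
          * ((Si *v \<mu>) \<bullet> x) * (LINT z|lborel. hderiv (d div 2) (a * (quad Si x + z\<^sup>2))))"

definition f_Z :: "real \<Rightarrow> real \<Rightarrow> real^'n \<Rightarrow> real^'n^'n \<Rightarrow> real^'n \<Rightarrow> real" where
  "f_Z a p \<mu> S x =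
     a powr (real CARD('n) / 2) / (sqrt (det S) * pi powr (real CARD('n) / 2))
       * exp (- (a * quad (matrix_inv S) x)) + f_tilde a p \<mu> S x"

definition char_property ::
  "real \<Rightarrow> real \<Rightarrow> real^'n \<Rightarrow> real^'n^'n \<Rightarrow> (real^'n) measure \<Rightarrow> bool"
where
  "char_property a p \<mu> S \<nu> \<longleftrightarrow>
     char_vec \<nu> 0 = 1 \<and>
     (\<forall>u. u \<noteq> 0 \<longrightarrow> char_vec \<nu> u =
        (1 + \<i> * complex_of_real
           (sqrt (2 * a) * (u \<bullet> \<mu>) / (p * sqrt (quad S u))
             * integral {0 .. sqrt (quad S u) / sqrt (2 * a)} (\<lambda>t. exp (t\<^sup>2 / 2))))
         * complex_of_real (exp (- (quad S u / (4 * a)))))"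

text \<open>The density is prescribed off the origin only. Nonnegativity is demanded explicitly,
  because \<open>ennreal\<close> would silently replace negative values by \<open>0\<close>.\<close>

definition density_property ::
  "real \<Rightarrow> real \<Rightarrow> real^'n \<Rightarrow> real^'n^'n \<Rightarrow> (real^'n) measure \<Rightarrow> bool"
where
  "density_property a p \<mu> S \<nu> \<longleftrightarrow>
     (\<exists>f. f \<in> borel_measurable borel \<and> (\<forall>x. 0 \<le> f x) \<and> (\<forall>x. x \<noteq> 0 \<longrightarrow> f x = f_Z a p \<mu> S x) \<and>
          \<nu> = density lborel (\<lambda>x. ennreal (f x)))"

definition projection_property ::
  "real \<Rightarrow> real \<Rightarrow> real^'n \<Rightarrow> real^'n^'n \<Rightarrow> (real^'n) measure \<Rightarrow> bool"
where
  "projection_property a p \<mu> S \<nu> \<longleftrightarrow>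
     (\<forall>v. v \<noteq> 0 \<longrightarrow>
        (\<exists>(Q :: (real \<times> real) measure) B2 N.
           prob_space Q \<and> prob_space.indep_var Q borel B2 borel N \<and>
           distributed Q lborel N std_normal_density \<and>
           measure Q {\<omega> \<in> space Q. B2 \<omega> = 1}
             = 1/2 + sqrt (pi * a) * (v \<bullet> \<mu>) / (2 * p * sqrt (quad S v)) \<and>
           measure Q {\<omega> \<in> space Q. B2 \<omega> = - 1}
             = 1/2 - sqrt (pi * a) * (v \<bullet> \<mu>) / (2 * p * sqrt (quad S v)) \<and>
           distr \<nu> borel (\<lambda>x. v \<bullet> x)
             = distr Q borel (\<lambda>\<omega>. sqrt (quad S v) / sqrt (2 * a) * B2 \<omega> * \<bar>N \<omega>\<bar>)))"

end

theory Submission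
  imports Defs "HOL-Real_Asymp.Real_Asymp"
begin

text \<open>Stationarity gives a functional equation for the characteristic function of \<open>Y\<^sup>(\<^sup>m\<^sup>)\<close>. Rescaled by
  \<open>m\<close> it turns in the limit into a linear first order equation along rays \<open>t u\<close>, whose inhomogeneity
  consists of the drift \<open>\<langle>u, \<mu>\<rangle>\<close> and of the second order contribution of the resets. By the cycle formula
  and Wald's second identity the latter is \<open>-(1 - p) u\<^sup>T \<Sigma> u / 2\<close>. Solving the equation with the
  integrating factor \<open>exp (c t\<^sup>2)\<close> identifies the limit of the characteristic functions.

  The limit \<open>\<mu>\<close> is constrained: in dimension at least two only \<open>\<mu> = 0\<close> is compatible with the convergence,
  since a drift would need more mass near the origin than a Gaussian law has. There the limit is
  Gaussian; in dimension one it is a Gaussian law tilted by the sign of its argument.\<close>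

section \<open>Characteristic functions on Euclidean spaces\<close>

text \<open>The mean of the limiting return time may be smaller than the limit of the means, since
  the return times need not be uniformly integrable; the missing proportion is \<open>p\<close>.
  Uniform control is available for the second moment of the stopped state: it lies within radius
  \<open>\<gamma> r_out\<close>, while a cycle of more than one step needs a first jump of length at
  least \<open>\<gamma> r_in\<close>, so the unknown scale \<open>\<gamma>\<close> cancels. The
  chains share the noise, which couples the rescaled chain at each fixed time with one random walk.
  In the ray equation neither the characteristic function nor its radial derivative is known to
  converge; one combination does, and it is the one that the integrating factor integrates. Whether
  the computed limit is a characteristic function is open until a law is exhibited. Before that,
  information comes from even test functions: the symmetrised laws converge to a Gaussian law mixed
  with a point mass at 0. This gives the bound on \<open>\<mu>\<close> that keeps the weights in
  (iii) between 0 and 1, and it enters the comparison of masses near the origin.\<close>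

lemma borel_probD:
  assumes "borel_prob \<nu>"
  shows "prob_space \<nu>" "sets \<nu> = sets borel" "space \<nu> = UNIV"
  using assms sets_eq_imp_space_eq[of \<nu> borel] by (auto simp: borel_prob_def)

lemma (in prob_space) borel_prob_distr:
  "f \<in> borel_measurable M \<Longrightarrow> borel_prob (distr M borel f)"
  by (simp add: borel_prob_def prob_space_distr)

section \<open>The standard normal law on a Euclidean space\<close>

definition std_gauss :: "'a::euclidean_space measure" where
  "std_gauss = density lborel (\<lambda>x. ennreal (\<Prod>b\<in>Basis. std_normal_density (x \<bullet> b)))"

lemma prod_std_normal_density:
  fixes x :: "'a::euclidean_space"
  shows "(\<Prod>b\<in>Basis. std_normal_density (x \<bullet> b))
    = (1 / sqrt (2 * pi)) ^ DIM('a) * exp (- (norm x)\<^sup>2 / 2)"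
proof -
  have "(\<Prod>b\<in>Basis. std_normal_density (x \<bullet> b))
      = (1 / sqrt (2 * pi)) ^ DIM('a) * exp (\<Sum>b\<in>Basis. - (x \<bullet> b)\<^sup>2 / 2)"
    by (simp add: std_normal_density_def prod.distrib exp_sum power_divide prod_dividef)
  also have "(\<Sum>b\<in>Basis. - (x \<bullet> b)\<^sup>2 / 2) = - (norm x)\<^sup>2 / 2"
    unfolding power2_norm_eq_inner euclidean_inner[of x x]
    by (simp add: sum_negf sum_divide_distrib power2_eq_square)
  finally show ?thesis .
qed

lemma sets_std_gauss [simp, measurable_cong]: "sets std_gauss = sets borel"
  by (simp add: std_gauss_def)

lemma space_std_gauss [simp]: "space std_gauss = UNIV"
  by (simp add: std_gauss_def)

lemma prob_space_std_gauss: "prob_space (std_gauss :: 'a::euclidean_space measure)"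
proof
  have "emeasure (std_gauss :: 'a measure) (space std_gauss)
      = (\<integral>\<^sup>+x. (\<Prod>b\<in>Basis. ennreal (std_normal_density ((x::'a) \<bullet> b))) \<partial>lborel)"
    unfolding std_gauss_def by (subst emeasure_density) (auto simp: prod_ennreal)
  also have "\<dots> = (\<Prod>b\<in>(Basis::'a set). (\<integral>\<^sup>+x. ennreal (std_normal_density x) \<partial>lborel))"
    by (rule nn_integral_lborel_prod) auto
  also have "\<dots> = 1"
    by (simp add: nn_integral_eq_integral)
  finally show "emeasure (std_gauss :: 'a measure) (space std_gauss) = 1" .
qed

lemma borel_prob_std_gauss: "borel_prob std_gauss"
  by (simp add: borel_prob_def prob_space_std_gauss)

lemma integrable_iexp_inner:
  fixes \<nu> :: "'a::euclidean_space measure"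
  assumes "borel_prob \<nu>"
  shows "integrable \<nu> (\<lambda>x. iexp (u \<bullet> x))"
proof -
  interpret prob_space \<nu> using assms by (rule borel_probD)
  have [measurable_cong]: "sets \<nu> = sets borel" using assms by (rule borel_probD)
  show ?thesis
    by (rule integrable_const_bound[where B=1]) auto
qed

text \<open>Density and exponential both factor over the coordinates. With Lebesgue measure written
  as the image of a product of line measures, the integral splits into one-dimensional normal
  characteristic functions.\<close>

lemma char_vec_std_gauss:
  fixes u :: "'a::euclidean_space"
  shows "char_vec std_gauss u = complex_of_real (exp (- (norm u)\<^sup>2 / 2))"
proof -
  define F where "F = (\<lambda>b t. complex_of_real (std_normal_density t) * iexp ((u \<bullet> b) * t))"
  have [measurable]: "F b \<in> borel_measurable borel" for b
    unfolding F_def by measurable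
  have intF: "integrable lborel (F b)" for b
  proof -
    have "integrable std_normal_distribution (\<lambda>t. iexp ((u \<bullet> b) * t))"
    proof -
      interpret real_distribution std_normal_distribution by (rule real_dist_normal_dist)
      show ?thesis by (rule integrable_const_bound[where B=1]) auto
    qed
    then show ?thesis
      by (subst (asm) integrable_density) (auto simp: F_def scaleR_conv_of_real)
  qed
  have F_val: "(LINT t|lborel. F b t) = complex_of_real (exp (- (u \<bullet> b)\<^sup>2 / 2))" for b
  proof -
    have "char std_normal_distribution (u \<bullet> b) = (LINT t|lborel. F b t)"
      unfolding char_def F_def by (subst integral_density) (auto simp: scaleR_conv_of_real)
    then show ?thesis by (simp add: char_std_normal_distribution)
  qed
  have "char_vec std_gauss u = (CLINT x|lborel. (\<Prod>b\<in>Basis. F b (x \<bullet> b)))"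
  proof -
    have "char_vec std_gauss u
        = (CLINT x|lborel. (\<Prod>b\<in>Basis. std_normal_density (x \<bullet> b)) *\<^sub>R iexp (u \<bullet> x))"
      unfolding char_vec_def std_gauss_def
      by (subst integral_density) (auto intro!: prod_nonneg)
    also have "\<dots> = (CLINT x|lborel. (\<Prod>b\<in>Basis. F b (x \<bullet> b)))"
    proof (rule Bochner_Integration.integral_cong[OF refl])
      fix x :: 'a
      have "iexp (u \<bullet> x) = (\<Prod>b\<in>Basis. iexp ((u \<bullet> b) * (x \<bullet> b)))"
        by (subst euclidean_inner) (simp add: exp_sum sum_distrib_left)
      then show "(\<Prod>b\<in>Basis. std_normal_density (x \<bullet> b)) *\<^sub>R iexp (u \<bullet> x)
          = (\<Prod>b\<in>Basis. F b (x \<bullet> b))"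
        by (simp add: F_def prod.distrib scaleR_conv_of_real)
    qed
    finally show ?thesis .
  qed
  also have "\<dots> = (CLINT f|(\<Pi>\<^sub>M b\<in>(Basis::'a set). lborel).
      (\<Prod>b\<in>Basis. F b ((\<Sum>c\<in>Basis. f c *\<^sub>R c) \<bullet> b)))"
    by (subst lborel_eq, subst integral_distr) auto
  also have "\<dots> = (CLINT f|(\<Pi>\<^sub>M b\<in>(Basis::'a set). lborel). (\<Prod>b\<in>Basis. F b (f b)))"
    by (intro Bochner_Integration.integral_cong refl prod.cong)
       (simp add: inner_sum_left inner_Basis if_distrib cong: if_cong)
  also have "\<dots> = (\<Prod>b\<in>(Basis::'a set). LINT t|lborel. F b t)"
  proof -
    interpret product_sigma_finite "\<lambda>_::'a. lborel :: real measure" by standard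
    show ?thesis by (rule product_integral_prod) (auto intro: intF)
  qed
  also have "\<dots> = complex_of_real (exp (\<Sum>b\<in>Basis. - (u \<bullet> b)\<^sup>2 / 2))"
    by (simp add: F_val exp_sum)
  also have "(\<Sum>b\<in>Basis. - (u \<bullet> b)\<^sup>2 / 2) = - (norm u)\<^sup>2 / 2"
    unfolding power2_norm_eq_inner euclidean_inner[of u u]
    by (simp add: sum_negf sum_divide_distrib power2_eq_square)
  finally show ?thesis .
qed

section \<open>Characteristic functions and Gaussian smoothing\<close>

lemma norm_char_vec_le_1:
  fixes \<nu> :: "'a::euclidean_space measure"
  assumes "borel_prob \<nu>"
  shows "cmod (char_vec \<nu> u) \<le> 1"
proof -
  interpret prob_space \<nu> using assms by (rule borel_probD)
  have "cmod (char_vec \<nu> u) \<le> (\<integral>x. cmod (iexp (u \<bullet> x)) \<partial>\<nu>)"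
    unfolding char_vec_def by (rule integral_norm_bound)
  then show ?thesis by (simp add: prob_space)
qed

lemma measurable_char_vec [measurable]:
  fixes \<nu> :: "'a::euclidean_space measure"
  assumes "borel_prob \<nu>"
  shows "char_vec \<nu> \<in> borel_measurable borel"
proof -
  interpret prob_space \<nu> using assms by (rule borel_probD)
  have [measurable_cong]: "sets \<nu> = sets borel" using assms by (rule borel_probD)
  show ?thesis unfolding char_vec_def[abs_def] by measurable
qed

text \<open>The Gaussian kernel is, up to a factor, its own characteristic function; hence the density
  of \<open>\<nu>\<close> smoothed by a Gaussian is an average of the characteristic function of \<open>\<nu>\<close>.\<close>

lemma gauss_kernel_average:
  fixes \<nu> :: "'a::euclidean_space measure"
  assumes \<nu>: "borel_prob \<nu>"
  shows "complex_of_real (\<integral>x. exp (- (norm (c *\<^sub>R (y - x)))\<^sup>2 / 2) \<partial>\<nu>)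
    = (CLINT w|std_gauss. iexp (c * (w \<bullet> y)) * char_vec \<nu> (- c *\<^sub>R w))"
proof -
  interpret \<nu>: prob_space \<nu> using \<nu> by (rule borel_probD)
  interpret G: prob_space "std_gauss :: 'a measure" by (rule prob_space_std_gauss)
  interpret P: pair_sigma_finite \<nu> "std_gauss :: 'a measure" ..
  interpret PP: prob_space "\<nu> \<Otimes>\<^sub>M (std_gauss :: 'a measure)"
    by (simp add: prob_space_pair \<nu>.prob_space_axioms G.prob_space_axioms)
  have [measurable_cong]: "sets \<nu> = sets borel" using \<nu> by (rule borel_probD)
  have "complex_of_real (\<integral>x. exp (- (norm (c *\<^sub>R (y - x)))\<^sup>2 / 2) \<partial>\<nu>)
      = (CLINT x|\<nu>. CLINT w|std_gauss. iexp ((c *\<^sub>R (y - x)) \<bullet> w))"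
    unfolding integral_complex_of_real[symmetric]
    by (intro Bochner_Integration.integral_cong refl) (simp only: char_vec_std_gauss[symmetric] char_vec_def)
  also have "\<dots> = (CLINT w|std_gauss. CLINT x|\<nu>. iexp ((c *\<^sub>R (y - x)) \<bullet> w))"
    by (rule P.Fubini_integral[symmetric], rule PP.integrable_const_bound[where B=1]) auto
  also have "\<dots> = (CLINT w|std_gauss. iexp (c * (w \<bullet> y)) * char_vec \<nu> (- c *\<^sub>R w))"
  proof (rule Bochner_Integration.integral_cong[OF refl])
    fix w :: 'a
    have "(CLINT x|\<nu>. iexp ((c *\<^sub>R (y - x)) \<bullet> w))
        = (CLINT x|\<nu>. iexp (c * (w \<bullet> y)) * iexp ((- c *\<^sub>R w) \<bullet> x))"
      by (intro Bochner_Integration.integral_cong refl)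
         (simp add: exp_add[symmetric] algebra_simps inner_diff_left inner_commute)
    then show "(CLINT x|\<nu>. iexp ((c *\<^sub>R (y - x)) \<bullet> w))
        = iexp (c * (w \<bullet> y)) * char_vec \<nu> (- c *\<^sub>R w)"
      unfolding char_vec_def by simp
  qed
  finally show ?thesis .
qed

text \<open>The substitution \<open>y = x + z / c\<close> turns Gaussian noise of size
  \<open>1 / c\<close> into a kernel in \<open>y - x\<close>, and Fubini moves \<open>\<nu>\<close>
  inside. On the right \<open>\<nu>\<close> enters only through the kernel average, hence only
  through its characteristic function.\<close>

lemma gauss_smoothing:
  fixes f :: "'a::euclidean_space \<Rightarrow> real"
  assumes \<nu>: "borel_prob \<nu>" and f: "integrable lborel f" and [measurable]: "f \<in> borel_measurable borel"
    and bd: "\<And>x. \<bar>f x\<bar> \<le> B" and c: "0 < c"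
  shows "(\<integral>x. \<integral>z. f (x + (1 / c) *\<^sub>R z) \<partial>std_gauss \<partial>\<nu>)
    = (c / sqrt (2 * pi)) ^ DIM('a)
        * (\<integral>y. f y * (\<integral>x. exp (- (norm (c *\<^sub>R (y - x)))\<^sup>2 / 2) \<partial>\<nu>) \<partial>lborel)"
proof -
  interpret \<nu>: prob_space \<nu> using \<nu> by (rule borel_probD)
  interpret P: pair_sigma_finite \<nu> "lborel :: 'a measure" ..
  have [measurable_cong]: "sets \<nu> = sets borel" using \<nu> by (rule borel_probD)
  let ?K = "\<lambda>x y. exp (- (norm (c *\<^sub>R (y - x :: 'a)))\<^sup>2 / 2) :: real"
  have inner: "(\<integral>z. f (x + (1 / c) *\<^sub>R z) \<partial>std_gauss)
      = (c / sqrt (2 * pi)) ^ DIM('a) * (\<integral>y. f y * ?K x y \<partial>lborel)" for x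
  proof -
    have "(\<integral>y. f y * ?K x y \<partial>lborel)
        = (\<integral>y. f y * ?K x y \<partial>density (distr lborel borel (\<lambda>z. x + (1 / c) *\<^sub>R z)) (\<lambda>_. ennreal (\<bar>1 / c\<bar> ^ DIM('a))))"
      using c by (subst lborel_affine[of "1/c" x]) auto
    also have "\<dots> = (1 / c) ^ DIM('a) * (\<integral>z. f (x + (1 / c) *\<^sub>R z) * exp (- (norm z)\<^sup>2 / 2) \<partial>lborel)"
      using c by (subst integral_density) (auto simp: integral_distr)
    finally have eq: "(\<integral>y. f y * ?K x y \<partial>lborel)
        = (1 / c) ^ DIM('a) * (\<integral>z. f (x + (1 / c) *\<^sub>R z) * exp (- (norm z)\<^sup>2 / 2) \<partial>lborel)" .
    have "(\<integral>z. f (x + (1 / c) *\<^sub>R z) \<partial>std_gauss)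
        = (\<integral>z. (1 / sqrt (2 * pi)) ^ DIM('a) * (f (x + (1 / c) *\<^sub>R z) * exp (- (norm z)\<^sup>2 / 2)) \<partial>lborel)"
      unfolding std_gauss_def prod_std_normal_density
      by (subst integral_density) (auto simp: mult_ac)
    also have "\<dots> = (1 / sqrt (2 * pi)) ^ DIM('a) * (\<integral>z. f (x + (1 / c) *\<^sub>R z) * exp (- (norm z)\<^sup>2 / 2) \<partial>lborel)"
      by simp
    finally show ?thesis
      unfolding eq using c by (simp add: field_simps power_divide)
  qed
  have "(\<integral>x. \<integral>z. f (x + (1 / c) *\<^sub>R z) \<partial>std_gauss \<partial>\<nu>)
      = (c / sqrt (2 * pi)) ^ DIM('a) * (\<integral>x. \<integral>y. f y * ?K x y \<partial>lborel \<partial>\<nu>)"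
    by (simp add: inner)
  also have "(\<integral>x. \<integral>y. f y * ?K x y \<partial>lborel \<partial>\<nu>) = (\<integral>y. \<integral>x. f y * ?K x y \<partial>\<nu> \<partial>lborel)"
  proof (rule P.Fubini_integral[symmetric])
    have "integrable (\<nu> \<Otimes>\<^sub>M lborel) (\<lambda>z. f (snd z))"
    proof (rule P.Fubini_integrable)
      show "integrable \<nu> (\<lambda>x. LINT y|lborel. norm (f (snd (x, y))))" by simp
    qed (use f in auto)
    then show "integrable (\<nu> \<Otimes>\<^sub>M lborel) (\<lambda>(x, y). f y * ?K x y)"
      by (rule Bochner_Integration.integrable_bound)
         (auto simp: abs_mult split_beta intro!: AE_I2 mult_left_le)
  qed
  also have "\<dots> = (\<integral>y. f y * (\<integral>x. ?K x y \<partial>\<nu>) \<partial>lborel)"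
    by simp
  finally show ?thesis .
qed

text \<open>Dominated convergence is used twice: over the Gaussian frequencies, where characteristic
  functions are bounded by 1, and over \<open>y\<close>, where \<open>\<bar>f y\<bar>\<close> is an
  integrable majorant.\<close>

lemma tendsto_gauss_smoothing:
  fixes f :: "'a::euclidean_space \<Rightarrow> real"
  assumes \<nu>s: "\<And>n. borel_prob (\<nu>s n)" and \<nu>: "borel_prob \<nu>"
    and conv: "\<And>u. (\<lambda>n. char_vec (\<nu>s n) u) \<longlonglongrightarrow> char_vec \<nu> u"
    and f: "integrable lborel f" and [measurable]: "f \<in> borel_measurable borel"
    and bd: "\<And>x. \<bar>f x\<bar> \<le> B" and c: "0 < c"
  shows "(\<lambda>n. \<integral>x. \<integral>z. f (x + (1 / c) *\<^sub>R z) \<partial>std_gauss \<partial>\<nu>s n)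
    \<longlonglongrightarrow> (\<integral>x. \<integral>z. f (x + (1 / c) *\<^sub>R z) \<partial>std_gauss \<partial>\<nu>)"
proof -
  let ?I = "\<lambda>\<nu> y. (\<integral>x. exp (- (norm (c *\<^sub>R (y - x :: 'a)))\<^sup>2 / 2) \<partial>\<nu>) :: real"
  interpret G: prob_space "std_gauss :: 'a measure" by (rule prob_space_std_gauss)
  note [measurable] = measurable_char_vec[OF \<nu>s] measurable_char_vec[OF \<nu>]
  have pointwise: "(\<lambda>n. ?I (\<nu>s n) y) \<longlonglongrightarrow> ?I \<nu> y" for y
  proof -
    have "(\<lambda>n. complex_of_real (?I (\<nu>s n) y)) \<longlonglongrightarrow> complex_of_real (?I \<nu> y)"
      unfolding gauss_kernel_average[OF \<nu>s] gauss_kernel_average[OF \<nu>]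
      by (rule integral_dominated_convergence[where w="\<lambda>_. 1"])
         (auto simp: norm_mult norm_char_vec_le_1[OF \<nu>s] intro!: AE_I2 tendsto_intros conv)
    then show ?thesis by (simp add: tendsto_of_real_iff)
  qed
  have I_bd: "0 \<le> ?I \<nu>' y \<and> ?I \<nu>' y \<le> 1" if "borel_prob \<nu>'" for \<nu>' y
  proof -
    interpret prob_space \<nu>' using that by (rule borel_probD)
    have [measurable_cong]: "sets \<nu>' = sets borel" using that by (rule borel_probD)
    have "?I \<nu>' y \<le> (\<integral>x. 1 \<partial>\<nu>')"
      by (intro integral_mono integrable_const_bound[where B=1]) auto
    then show ?thesis by (simp add: prob_space)
  qed
  have meas: "?I \<nu>' \<in> borel_measurable borel" if "borel_prob \<nu>'" for \<nu>'
  proof -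
    interpret prob_space \<nu>' using that by (rule borel_probD)
    have [measurable_cong]: "sets \<nu>' = sets borel" using that by (rule borel_probD)
    show ?thesis by measurable
  qed
  have meas': "(\<lambda>y. f y * ?I \<nu>' y) \<in> borel_measurable lborel" if "borel_prob \<nu>'" for \<nu>'
    using borel_measurable_times[OF \<open>f \<in> borel_measurable borel\<close> meas[OF that]]
    by simp
  have "(\<lambda>n. \<integral>y. f y * ?I (\<nu>s n) y \<partial>lborel) \<longlonglongrightarrow> (\<integral>y. f y * ?I \<nu> y \<partial>lborel)"
  proof (rule integral_dominated_convergence[where w="\<lambda>y. \<bar>f y\<bar>"])
    show "AE y in lborel. (\<lambda>n. f y * ?I (\<nu>s n) y) \<longlonglongrightarrow> f y * ?I \<nu> y"
      by (intro AE_I2 tendsto_intros pointwise)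
    show "AE y in lborel. norm (f y * ?I (\<nu>s n) y) \<le> \<bar>f y\<bar>" for n
      using I_bd[OF \<nu>s] by (auto simp: abs_mult intro!: AE_I2 mult_left_le)
  qed (use f meas'[OF \<nu>s] meas'[OF \<nu>] in \<open>blast intro: integrable_abs\<close>)+
  then show ?thesis
    unfolding gauss_smoothing[OF \<nu>s f \<open>f \<in> borel_measurable borel\<close> bd c]
      gauss_smoothing[OF \<nu> f \<open>f \<in> borel_measurable borel\<close> bd c]
    by (intro tendsto_intros)
qed

section \<open>Levy's continuity theorem and uniqueness\<close>

lemma compact_support_uniformly_continuous:
  fixes f :: "'a::euclidean_space \<Rightarrow> real"
  assumes cont: "continuous_on UNIV f" and supp: "\<And>x. R < norm x \<Longrightarrow> f x = 0" and e: "0 < e"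
  obtains d where "0 < d" "\<And>x y. norm (x - y) < d \<Longrightarrow> \<bar>f x - f y\<bar> < e"
proof -
  have "uniformly_continuous_on (cball 0 (R + 1)) f"
    by (intro compact_uniformly_continuous continuous_on_subset[OF cont]) auto
  then obtain d where d: "0 < d"
    "\<And>x y. x \<in> cball 0 (R + 1) \<Longrightarrow> y \<in> cball 0 (R + 1) \<Longrightarrow> dist y x < d \<Longrightarrow> dist (f y) (f x) < e"
    unfolding uniformly_continuous_on_def using e by meson
  show ?thesis
  proof (rule that[of "min d 1"])
    fix x y :: 'a assume xy: "norm (x - y) < min d 1"
    have "norm x \<le> norm y + norm (x - y)" "norm y \<le> norm x + norm (x - y)"
      using norm_triangle_sub[of x y] norm_triangle_sub[of y x] by (auto simp: norm_minus_commute)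
    then consider "norm x \<le> R + 1" "norm y \<le> R + 1" | "R < norm x" "R < norm y"
      using xy by fastforce
    then show "\<bar>f x - f y\<bar> < e"
    proof cases
      case 1
      then show ?thesis using d(2)[of y x] xy by (auto simp: dist_norm)
    next
      case 2
      then show ?thesis using e supp by auto
    qed
  qed (use d in auto)
qed

text \<open>Uniform continuity makes the error of smoothing by noise of size \<open>1 / k\<close>
  small uniformly over all probability laws, so one \<open>k\<close> serves the whole sequence and
  its limit, and the smoothed integrals converge.\<close>

lemma weak_conv_compact_support:
  fixes f :: "'a::euclidean_space \<Rightarrow> real"
  assumes \<nu>s: "\<And>n. borel_prob (\<nu>s n)" and \<nu>: "borel_prob \<nu>"
    and conv: "\<And>u. (\<lambda>n. char_vec (\<nu>s n) u) \<longlonglongrightarrow> char_vec \<nu> u"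
    and cont: "continuous_on UNIV f" and bd: "\<And>x. \<bar>f x\<bar> \<le> B"
    and supp: "\<And>x. R < norm x \<Longrightarrow> f x = 0"
  shows "(\<lambda>n. \<integral>x. f x \<partial>\<nu>s n) \<longlonglongrightarrow> (\<integral>x. f x \<partial>\<nu>)"
proof (rule LIMSEQ_I)
  fix e :: real assume e: "0 < e"
  have B: "0 \<le> B" using bd[of 0] by simp
  interpret G: prob_space "std_gauss :: 'a measure" by (rule prob_space_std_gauss)
  have [measurable]: "f \<in> borel_measurable borel"
    using cont by (rule borel_measurable_continuous_onI)
  have int_f: "integrable lborel f"
  proof (rule Bochner_Integration.integrable_bound)
    show "integrable lborel (\<lambda>x::'a. B * indicator (cball 0 R) x :: real)"
      using emeasure_bounded_finite[of "cball (0::'a) R"] by (auto simp: integrable_indicator_iff)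
    show "AE x in lborel. norm (f x) \<le> norm (B * indicator (cball 0 R) x :: real)"
      using bd supp B by (auto intro!: AE_I2 simp: indicator_def)
  qed auto
  \<comment> \<open>Smoothing costs \<open>2 * e'\<close> for each of the two laws and the smoothed
    integrals differ by \<open>e'\<close>, in total five eighths of \<open>e\<close>.\<close>
  define e' where "e' = e / 8"
  have e': "0 < e'" using e by (simp add: e'_def)
  obtain d where d: "0 < d" "\<And>x y. norm (x - y) < d \<Longrightarrow> \<bar>f x - f y\<bar> < e'"
    using compact_support_uniformly_continuous[OF cont supp e'] by blast
  have "(\<lambda>k. measure (std_gauss::'a measure) (- ball 0 (d * real k))) \<longlonglongrightarrow> measure (std_gauss::'a measure) (\<Inter>k. - ball 0 (d * real k))"
    by (rule G.finite_Lim_measure_decseq)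
       (use d(1) in \<open>auto simp: decseq_def elim!: less_le_trans intro!: mult_left_mono\<close>)
  also have "(\<Inter>k. - ball 0 (d * real k)) = ({} :: 'a set)"
  proof -
    have "\<exists>k. norm x < d * real k" for x :: 'a
      using ex_less_of_nat_mult[OF d(1), of "norm x"] by (auto simp: mult.commute)
    then show ?thesis by (simp add: set_eq_iff)
  qed
  finally have "(\<lambda>k. measure (std_gauss::'a measure) (- ball 0 (d * real k))) \<longlonglongrightarrow> 0" by simp
  \<comment> \<open>The summand 1 keeps the denominator positive when \<open>B = 0\<close>.\<close>
  moreover have "0 < e' / (2 * B + 1)" using e' B by simp
  ultimately have "\<forall>\<^sub>F k in sequentially. measure (std_gauss::'a measure) (- ball 0 (d * real k)) < e' / (2 * B + 1)"
    by (rule order_tendstoD)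
  then have "\<forall>\<^sub>F k in sequentially. measure (std_gauss::'a measure) (- ball 0 (d * real k)) < e' / (2 * B + 1) \<and> 0 < k"
    using eventually_gt_at_top by eventually_elim auto
  then obtain k :: nat where k: "measure (std_gauss::'a measure) (- ball 0 (d * real k)) < e' / (2 * B + 1)" "0 < k"
    by (auto simp: eventually_sequentially)
  let ?S = "\<lambda>\<nu>. (\<integral>x. \<integral>z. f (x + (1 / real k) *\<^sub>R z) \<partial>std_gauss \<partial>\<nu>)"
  have fbd: "\<bar>f x - f y\<bar> \<le> 2 * B" for x y
    using bd[of x] bd[of y] by linarith
  have approx: "\<bar>(\<integral>x. f x \<partial>\<nu>') - ?S \<nu>'\<bar> \<le> 2 * e'" if \<nu>': "borel_prob \<nu>'" for \<nu>' :: "'a measure"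
  proof -
    interpret prob_space \<nu>' using \<nu>' by (rule borel_probD)
    have [measurable_cong]: "sets \<nu>' = sets borel" using \<nu>' by (rule borel_probD)
    have intz: "integrable std_gauss (\<lambda>z. f (x + (1 / real k) *\<^sub>R z))" for x
      by (rule G.integrable_const_bound[where B=B]) (use bd in auto)
    have abs_int: "\<bar>\<integral>z. f (x + (1 / real k) *\<^sub>R z) \<partial>std_gauss\<bar> \<le> B" for x
    proof -
      have "\<bar>\<integral>z. f (x + (1 / real k) *\<^sub>R z) \<partial>std_gauss\<bar> \<le> (\<integral>z. B \<partial>(std_gauss :: 'a measure))"
        by (rule order_trans[OF integral_abs_bound], rule integral_mono) (use intz bd in auto)
      then show ?thesis using G.prob_space by simp
    qed
    have pw: "\<bar>f x - (\<integral>z. f (x + (1 / real k) *\<^sub>R z) \<partial>std_gauss)\<bar> \<le> 2 * e'" for x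
    proof -
      have "f x - (\<integral>z. f (x + (1 / real k) *\<^sub>R z) \<partial>std_gauss) = (\<integral>z. f x - f (x + (1 / real k) *\<^sub>R z) \<partial>std_gauss)"
        using G.prob_space intz by (subst Bochner_Integration.integral_diff) auto
      also have "\<bar>\<dots>\<bar> \<le> (\<integral>z. \<bar>f x - f (x + (1 / real k) *\<^sub>R z)\<bar> \<partial>std_gauss)"
        by (rule integral_abs_bound)
      also have "\<dots> \<le> (\<integral>z. e' + 2 * B * indicator (- ball 0 (d * real k)) z \<partial>(std_gauss :: 'a measure))"
      proof (rule integral_mono)
        show "\<bar>f x - f (x + (1 / real k) *\<^sub>R z)\<bar> \<le> e' + 2 * B * indicator (- ball 0 (d * real k)) z" for z
        proof (cases "z \<in> ball 0 (d * real k)")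
          case True
          then have "norm (x - (x + (1 / real k) *\<^sub>R z)) < d" using k(2) by (simp add: field_simps)
          then show ?thesis using d(2)[of x "x + (1 / real k) *\<^sub>R z"] True by simp
        next
          case False
          then show ?thesis using fbd[of x "x + (1 / real k) *\<^sub>R z"] e' by simp
        qed
      qed (use intz in \<open>auto intro!: G.integrable_const_bound[where B="e' + 2 * B"] simp: indicator_def e' less_imp_le B\<close>)
      also have "\<dots> = e' + 2 * B * measure (std_gauss::'a measure) (- ball 0 (d * real k))"
        using G.prob_space by (subst Bochner_Integration.integral_add)
          (auto intro!: G.integrable_const_bound[where B="1"] integrable_mult_right)
      also have "\<dots> \<le> e' + 2 * B * (e' / (2 * B + 1))"
        using k(1) B by (intro add_left_mono mult_left_mono) auto
      also have "2 * B * (e' / (2 * B + 1)) \<le> e'"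
        using B e' by (simp add: field_simps)
      finally show ?thesis by simp
    qed
    have i1: "integrable \<nu>' f" by (rule integrable_const_bound[where B=B]) (use bd in auto)
    have i2: "integrable \<nu>' (\<lambda>x. \<integral>z. f (x + (1 / real k) *\<^sub>R z) \<partial>std_gauss)"
      by (rule integrable_const_bound[where B=B]) (use abs_int in auto)
    have "\<bar>(\<integral>x. f x \<partial>\<nu>') - ?S \<nu>'\<bar> = \<bar>\<integral>x. f x - (\<integral>z. f (x + (1 / real k) *\<^sub>R z) \<partial>std_gauss) \<partial>\<nu>'\<bar>"
      using i1 i2 by simp
    also have "\<dots> \<le> (\<integral>x. 2 * e' \<partial>\<nu>')"
      by (rule order_trans[OF integral_abs_bound], rule integral_mono) (use i1 i2 pw in auto)
    finally show ?thesis by (simp add: prob_space)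
  qed
  have "(\<lambda>n. ?S (\<nu>s n)) \<longlonglongrightarrow> ?S \<nu>"
    by (rule tendsto_gauss_smoothing[OF \<nu>s \<nu> conv int_f _ bd]) (use k(2) in auto)
  from LIMSEQ_D[OF this e'] obtain n0 where n0: "\<And>n. n0 \<le> n \<Longrightarrow> \<bar>?S (\<nu>s n) - ?S \<nu>\<bar> < e'"
    by auto
  show "\<exists>n0. \<forall>n\<ge>n0. norm ((\<integral>x. f x \<partial>\<nu>s n) - (\<integral>x. f x \<partial>\<nu>)) < e"
  proof (intro exI[of _ n0] allI impI)
    fix n assume "n0 \<le> n"
    then show "norm ((\<integral>x. f x \<partial>\<nu>s n) - (\<integral>x. f x \<partial>\<nu>)) < e"
      using n0[of n] approx[OF \<nu>s[of n]] approx[OF \<nu>] e unfolding e'_def real_norm_def by linarith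
  qed
qed

text \<open>Convergence on compactly supported functions becomes weak convergence because the limit
  is a probability law: a cutoff that keeps almost all of its mass keeps almost all of the mass of
  the late \<open>\<nu>s n\<close> as well, which is tightness.\<close>

theorem char_vec_continuity:
  fixes \<nu> :: "'a::euclidean_space measure"
  assumes \<nu>s: "\<And>n. borel_prob (\<nu>s n)" and \<nu>: "borel_prob \<nu>"
    and conv: "\<And>u. (\<lambda>n. char_vec (\<nu>s n) u) \<longlonglongrightarrow> char_vec \<nu> u"
  shows "weak_conv_law \<nu>s \<nu>"
  unfolding weak_conv_law_def
proof (intro allI impI, elim conjE)
  fix f :: "'a \<Rightarrow> real" assume cont: "continuous_on UNIV f" and "bounded (range f)"
  then obtain B where B: "0 < B" "\<And>x. \<bar>f x\<bar> \<le> B"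
    by (auto simp: bounded_pos)
  have [measurable]: "f \<in> borel_measurable borel"
    using cont by (rule borel_measurable_continuous_onI)
  \<comment> \<open>Continuous cutoffs, equal to 1 on the ball of radius \<open>k\<close> and to 0
    outside radius \<open>k + 1\<close>. The mass cut off is 1 minus the integral of
    \<open>h k\<close>, itself an integral of a compactly supported function.\<close>
  define h :: "nat \<Rightarrow> 'a \<Rightarrow> real" where "h k x = max 0 (min 1 (real k + 1 - norm x))" for k x
  have h_cont: "continuous_on UNIV (h k)" for k
    unfolding h_def by (intro continuous_intros)
  have [measurable]: "h k \<in> borel_measurable borel" for k
    using h_cont by (rule borel_measurable_continuous_onI)
  have h01: "0 \<le> h k x" "h k x \<le> 1" for k x by (auto simp: h_def)
  have h_supp: "h k x = 0" if "real k + 1 < norm x" for k x using that by (simp add: h_def)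
  have h_lim: "(\<lambda>k. h k x) \<longlonglongrightarrow> 1" for x
  proof (rule tendsto_eventually)
    obtain k0 :: nat where "norm x \<le> real k0" using real_arch_simple by blast
    then have "h k x = 1" if "k0 \<le> k" for k using that by (simp add: h_def)
    then show "\<forall>\<^sub>F k in sequentially. h k x = 1" by (auto simp: eventually_sequentially)
  qed
  have err: "\<bar>(\<integral>x. f x \<partial>\<nu>') - (\<integral>x. f x * h k x \<partial>\<nu>')\<bar> \<le> B * (1 - (\<integral>x. h k x \<partial>\<nu>'))"
    if \<nu>': "borel_prob \<nu>'" for \<nu>' k
  proof -
    interpret prob_space \<nu>' using \<nu>' by (rule borel_probD)
    have [measurable_cong]: "sets \<nu>' = sets borel" using \<nu>' by (rule borel_probD)
    have i: "integrable \<nu>' f" "integrable \<nu>' (\<lambda>x. f x * h k x)" "integrable \<nu>' (h k)"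
      using B h01[of k] order_trans[OF mult_left_le[OF h01(2)[of k] abs_ge_zero] B(2)]
      by (auto intro!: integrable_const_bound[where B=B]
        integrable_const_bound[where f="h k" and B=1] simp: abs_mult)
    have "\<bar>(\<integral>x. f x \<partial>\<nu>') - (\<integral>x. f x * h k x \<partial>\<nu>')\<bar> = \<bar>\<integral>x. f x * (1 - h k x) \<partial>\<nu>'\<bar>"
      using i by (simp add: algebra_simps)
    also have "\<dots> \<le> (\<integral>x. B * (1 - h k x) \<partial>\<nu>')"
    proof (rule order_trans[OF integral_abs_bound], rule integral_mono)
      show "\<bar>f x * (1 - h k x)\<bar> \<le> B * (1 - h k x)" for x
        using B h01[of k x] by (simp add: abs_mult mult_right_mono)
      show "integrable \<nu>' (\<lambda>x. \<bar>f x * (1 - h k x)\<bar>)"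
        using i by (intro integrable_abs) (simp add: algebra_simps)
    qed (use i in auto)
    also have "\<dots> = B * (1 - (\<integral>x. h k x \<partial>\<nu>'))"
      using i by (simp add: prob_space)
    finally show ?thesis .
  qed
  show "(\<lambda>n. \<integral>x. f x \<partial>\<nu>s n) \<longlonglongrightarrow> (\<integral>x. f x \<partial>\<nu>)"
  proof (rule LIMSEQ_I)
    fix e :: real assume e: "0 < e"
    \<comment> \<open>With this choice the mass cut off from a late \<open>\<nu>s n\<close> costs at
      most \<open>2 * B * e'\<close>, a quarter of \<open>e\<close>.\<close>
    define e' where "e' = e / (8 * B)"
    have e': "0 < e'" using e B by (simp add: e'_def)
    have "(\<lambda>k. \<integral>x. h k x \<partial>\<nu>) \<longlonglongrightarrow> (\<integral>x. 1 \<partial>\<nu>)"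
    proof -
      interpret prob_space \<nu> using \<nu> by (rule borel_probD)
      have [measurable_cong]: "sets \<nu> = sets borel" using \<nu> by (rule borel_probD)
      show ?thesis
        by (rule integral_dominated_convergence[where w="\<lambda>_. 1"])
           (auto intro!: AE_I2 h_lim simp: h01)
    qed
    then have "(\<lambda>k. \<integral>x. h k x \<partial>\<nu>) \<longlonglongrightarrow> 1"
      using prob_space.prob_space[OF borel_probD(1)[OF \<nu>]] by simp
    from LIMSEQ_D[OF this e'] obtain k where k: "\<bar>(\<integral>x. h k x \<partial>\<nu>) - 1\<bar> < e'" by auto
    have l1: "(\<lambda>n. \<integral>x. h k x \<partial>\<nu>s n) \<longlonglongrightarrow> (\<integral>x. h k x \<partial>\<nu>)"
      by (rule weak_conv_compact_support[OF \<nu>s \<nu> conv h_cont, where B=1 and R="real k + 1"])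
         (use h01 h_supp in auto)
    have l2: "(\<lambda>n. \<integral>x. f x * h k x \<partial>\<nu>s n) \<longlonglongrightarrow> (\<integral>x. f x * h k x \<partial>\<nu>)"
    proof (rule weak_conv_compact_support[OF \<nu>s \<nu> conv, where B=B and R="real k + 1"])
      show "continuous_on UNIV (\<lambda>x. f x * h k x)" by (intro continuous_intros cont h_cont)
      show "\<bar>f x * h k x\<bar> \<le> B" for x
        using B(2)[of x] h01[of k x] by (simp add: abs_mult order_trans[OF mult_left_le])
    qed (use h_supp in auto)
    have "0 < e / 4" using e by simp
    from LIMSEQ_D[OF l1 e'] LIMSEQ_D[OF l2 this] obtain n1 n2
      where n1: "\<And>n. n1 \<le> n \<Longrightarrow> \<bar>(\<integral>x. h k x \<partial>\<nu>s n) - (\<integral>x. h k x \<partial>\<nu>)\<bar> < e'"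
        and n2: "\<And>n. n2 \<le> n \<Longrightarrow> \<bar>(\<integral>x. f x * h k x \<partial>\<nu>s n) - (\<integral>x. f x * h k x \<partial>\<nu>)\<bar> < e / 4"
      by auto
    show "\<exists>n0. \<forall>n\<ge>n0. norm ((\<integral>x. f x \<partial>\<nu>s n) - (\<integral>x. f x \<partial>\<nu>)) < e"
    proof (intro exI[of _ "max n1 n2"] allI impI)
      fix n assume n: "max n1 n2 \<le> n"
      have "1 - (\<integral>x. h k x \<partial>\<nu>s n) \<le> 2 * e'" "1 - (\<integral>x. h k x \<partial>\<nu>) \<le> e'"
        using n1[of n] n k by (simp_all add: abs_less_iff)
      then have "B * (1 - (\<integral>x. h k x \<partial>\<nu>s n)) \<le> B * (2 * e')" "B * (1 - (\<integral>x. h k x \<partial>\<nu>)) \<le> B * e'"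
        using B(1) by (auto intro: mult_left_mono)
      moreover have "B * e' = e / 8" using B(1) by (simp add: e'_def)
      ultimately have "\<bar>(\<integral>x. f x \<partial>\<nu>s n) - (\<integral>x. f x * h k x \<partial>\<nu>s n)\<bar> \<le> e / 4"
        "\<bar>(\<integral>x. f x \<partial>\<nu>) - (\<integral>x. f x * h k x \<partial>\<nu>)\<bar> \<le> e / 8"
        using err[OF \<nu>s[of n], of k] err[OF \<nu>, of k] by linarith+
      then show "norm ((\<integral>x. f x \<partial>\<nu>s n) - (\<integral>x. f x \<partial>\<nu>)) < e"
        using n2[of n] n e unfolding real_norm_def by linarith
    qed
  qed
qed

text \<open>The continuity theorem for a constant sequence equates the integrals of bounded
  continuous functions. The functions \<open>max 0 (1 - k * infdist x S)\<close> decrease to the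
  indicator of a nonempty closed \<open>S\<close>, and closed sets form an intersection-stable
  generator.\<close>

theorem char_vec_uniqueness:
  fixes \<nu> \<nu>' :: "'a::euclidean_space measure"
  assumes \<nu>: "borel_prob \<nu>" and \<nu>': "borel_prob \<nu>'" and eq: "\<And>u. char_vec \<nu> u = char_vec \<nu>' u"
  shows "\<nu> = \<nu>'"
proof -
  have "weak_conv_law (\<lambda>_. \<nu>) \<nu>'"
    by (rule char_vec_continuity[OF \<nu> \<nu>']) (simp add: eq)
  then have int_eq: "(\<integral>x. f x \<partial>\<nu>) = (\<integral>x. f x \<partial>\<nu>')"
    if "continuous_on UNIV f" "bounded (range f)" for f :: "'a \<Rightarrow> real"
    using that unfolding weak_conv_law_def by (auto simp: LIMSEQ_const_iff)
  have closed_lim: "(\<lambda>k. \<integral>x. max 0 (1 - real k * infdist x S) \<partial>\<rho>) \<longlonglongrightarrow> measure \<rho> S"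
    if \<rho>: "borel_prob \<rho>" and S: "closed S" "S \<noteq> {}" for S and \<rho> :: "'a measure"
  proof -
    interpret prob_space \<rho> using \<rho> by (rule borel_probD)
    have [measurable_cong]: "sets \<rho> = sets borel" using \<rho> by (rule borel_probD)
    have [measurable]: "S \<in> sets borel" using S by auto
    have "(\<lambda>k. \<integral>x. max 0 (1 - real k * infdist x S) \<partial>\<rho>) \<longlonglongrightarrow> (\<integral>x. indicator S x \<partial>\<rho>)"
    proof (rule integral_dominated_convergence[where w="\<lambda>_. 1"])
      show "AE x in \<rho>. (\<lambda>k. max 0 (1 - real k * infdist x S)) \<longlonglongrightarrow> indicator S x"
      proof (intro AE_I2)
        fix x
        show "(\<lambda>k. max 0 (1 - real k * infdist x S)) \<longlonglongrightarrow> indicator S x"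
        proof (cases "x \<in> S")
          case False
          then have pos: "0 < infdist x S"
            using S by (metis in_closed_iff_infdist_zero infdist_nonneg order_le_less)
          obtain k0 :: nat where k0: "1 < real k0 * infdist x S"
            using ex_less_of_nat_mult[OF pos, of 1] by auto
          have "max 0 (1 - real k * infdist x S) = indicator S x" if "k0 \<le> k" for k
          proof -
            have "real k0 * infdist x S \<le> real k * infdist x S"
              using that pos by (intro mult_right_mono) auto
            then show ?thesis using k0 False by simp
          qed
          then show ?thesis
            by (intro tendsto_eventually) (auto simp: eventually_sequentially)
        qed simp
      qed
      show "(\<lambda>x. max 0 (1 - real k * infdist x S)) \<in> borel_measurable \<rho>" for k
        unfolding measurable_cong_sets[OF borel_probD(2)[OF \<rho>] refl]
        by (intro borel_measurable_continuous_onI continuous_intros)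
    qed (auto simp: infdist_nonneg)
    then show ?thesis by simp
  qed
  have closed_eq: "emeasure \<nu> S = emeasure \<nu>' S" if S: "closed S" for S
  proof (cases "S = {}")
    case False
    have "(\<integral>x. max 0 (1 - real k * infdist x S) \<partial>\<nu>) = (\<integral>x. max 0 (1 - real k * infdist x S) \<partial>\<nu>')" for k
    proof (rule int_eq)
      show "continuous_on UNIV (\<lambda>x. max 0 (1 - real k * infdist x S))"
        by (intro continuous_intros)
      show "bounded (range (\<lambda>x. max 0 (1 - real k * infdist x S)))"
        by (auto simp: bounded_iff infdist_nonneg intro!: exI[of _ 1])
    qed
    then have "measure \<nu> S = measure \<nu>' S"
      using closed_lim[OF \<nu> S False] closed_lim[OF \<nu>' S False] LIMSEQ_unique by auto
    then show ?thesis
      using \<nu> \<nu>' by (simp add: borel_prob_def finite_measure.emeasure_eq_measure prob_space_def)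
  qed simp
  show ?thesis
  proof (rule measure_eqI_generator_eq[where E="Collect closed" and \<Omega>=UNIV and A="\<lambda>_. UNIV"])
    show "Int_stable (Collect closed :: 'a set set)" by (auto simp: Int_stable_def)
    show "sets \<nu> = sigma_sets UNIV (Collect closed)" "sets \<nu>' = sigma_sets UNIV (Collect closed)"
      using \<nu> \<nu>' by (simp_all add: borel_probD borel_eq_closed)
    show "emeasure \<nu> UNIV \<noteq> \<infinity>"
      using \<nu> by (simp add: borel_prob_def finite_measure.emeasure_finite prob_space_def)
  qed (auto intro: closed_eq)
qed

section \<open>Stationary laws and the integrating factor\<close>

text \<open>The parameter of the rays. As a probability measure it makes constants integrable
  majorants, and since it ignores \<open>t = 0\<close>, division by \<open>t\<close> is
  harmless.\<close>

definition unit_unif :: "real measure" where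
  "unit_unif = density lborel (indicator {0..1})"

lemma sets_unit_unif [simp, measurable_cong]: "sets unit_unif = sets borel"
  by (simp add: unit_unif_def)

lemma prob_space_unit_unif: "prob_space unit_unif"
  by standard (simp add: unit_unif_def emeasure_density)

lemma AE_unit_unif: "AE t in unit_unif. 0 < t \<and> t \<le> 1"
  unfolding unit_unif_def
  by (subst AE_density) (use AE_lborel_singleton[of 0] in \<open>auto simp: indicator_def\<close>)

lemma integral_unit_unif:
  fixes f :: "real \<Rightarrow> 'b::{banach, second_countable_topology}"
  assumes "f \<in> borel_measurable borel"
  shows "(\<integral>t. f t \<partial>unit_unif) = (\<integral>t. indicator {0..1} t *\<^sub>R f t \<partial>lborel)"
  unfolding unit_unif_def ennreal_indicator[symmetric]
  by (subst integral_density) (use assms in auto)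

text \<open>The integrand is the derivative in \<open>t\<close> of
  \<open>iexp (t * s) * exp (c * t^2)\<close>.\<close>

lemma iexp_gauss_FTC:
  "(CLINT t|unit_unif. (\<i> * s + 2 * c * t) * iexp (t * s) * exp (c * t\<^sup>2)) = iexp s * exp c - 1"
proof -
  let ?F = "\<lambda>t. iexp (t * s) * exp (complex_of_real (c * t\<^sup>2))"
  let ?f = "\<lambda>t. (\<i> * s + 2 * c * t) * iexp (t * s) * exp (complex_of_real (c * t\<^sup>2))"
  have "(CLINT t|unit_unif. ?f t) = (CLBINT t. indicator {0..1} t *\<^sub>R ?f t)"
    by (rule integral_unit_unif) measurable
  also have "\<dots> = ?F 1 - ?F 0"
  proof (rule integral_FTC_Icc)
    fix t :: real
    have "((\<lambda>z. exp (\<i> * (z * s)) * exp (complex_of_real c * z\<^sup>2)) has_field_derivative ?f t) (at (complex_of_real t))"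
      by (auto intro!: derivative_eq_intros simp: algebra_simps power2_eq_square)
    from has_vector_derivative_real_field[OF this]
    show "(?F has_vector_derivative ?f t) (at t within {0..1})"
      by (simp add: o_def has_vector_derivative_at_within)
  qed (auto intro!: continuous_intros)
  also have "\<dots> = iexp s * exp c - 1" by (simp add: exp_of_real)
  finally show ?thesis by (simp only: exp_of_real)
qed

lemma norm_iexp_taylor1: "cmod (iexp x - 1) \<le> \<bar>x\<bar>"
  using iexp_approx1[of x 0] by simp

lemma norm_iexp_taylor2: "cmod (iexp x - 1 - \<i> * x) \<le> x\<^sup>2 / 2"
proof -
  have "(\<Sum>k\<le>1. (\<i> * complex_of_real x) ^ k / fact k) = 1 + \<i> * x" by simp
  then show ?thesis using iexp_approx1[of x 1] by (simp add: diff_diff_eq numeral_2_eq_2)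
qed

lemma (in pair_sigma_finite) integrable_prod_mult:
  fixes f :: "'a \<Rightarrow> 'c::{real_normed_field, banach, second_countable_topology}"
  assumes f: "integrable M1 f" and g: "integrable M2 g"
  shows "integrable (M1 \<Otimes>\<^sub>M M2) (\<lambda>z. f (fst z) * g (snd z))"
proof (rule Fubini_integrable)
  note [measurable] = borel_measurable_integrable[OF f] borel_measurable_integrable[OF g]
  show "(\<lambda>z. f (fst z) * g (snd z)) \<in> borel_measurable (M1 \<Otimes>\<^sub>M M2)" by measurable
  show "integrable M1 (\<lambda>x. LINT y|M2. norm (f (fst (x, y)) * g (snd (x, y))))"
    using f by (simp add: norm_mult)
qed (use g in auto)

lemma (in pair_sigma_finite) integral_prod_mult:
  fixes f :: "'a \<Rightarrow> 'c::{real_normed_field, banach, second_countable_topology}"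
  assumes f: "integrable M1 f" and g: "integrable M2 g"
  shows "(\<integral>z. f (fst z) * g (snd z) \<partial>(M1 \<Otimes>\<^sub>M M2)) = (\<integral>x. f x \<partial>M1) * (\<integral>y. g y \<partial>M2)"
  using integral_fst'[OF integrable_prod_mult[OF f g]] by (simp add: integrable_prod_mult[OF f g])

text \<open>\<open>P\<close> is a stationary law of the recursion \<open>y \<mapsto> \<alpha> y 1{y \<notin> D} + b \<xi>\<close>, where \<open>\<alpha>\<close> and \<open>\<xi>\<close>
  have the laws \<open>La\<close> and \<open>Lx\<close>.\<close>

locale reset_law = La: prob_space La + Lx: prob_space Lx + P: prob_space P
  for La :: "real measure" and Lx :: "'v::euclidean_space measure" and P :: "'v measure" +
  fixes D :: "'v set" and b :: real
  assumes sets_La [simp, measurable_cong]: "sets La = sets borel"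
    and sets_Lx [simp, measurable_cong]: "sets Lx = sets borel"
    and sets_P [simp, measurable_cong]: "sets P = sets borel"
    and D_meas [measurable]: "D \<in> sets borel"
    and La_sq: "integrable La (\<lambda>a. a\<^sup>2)"
    and Lx_sq: "integrable Lx (\<lambda>x. (norm x)\<^sup>2)"
    and P_sq: "integrable P (\<lambda>y. (norm y)\<^sup>2)"
    and Lx_mean: "(\<integral>x. x \<partial>Lx) = 0"
    and stat: "P = distr (P \<Otimes>\<^sub>M (La \<Otimes>\<^sub>M Lx)) borel
        (\<lambda>z. fst (snd z) *\<^sub>R (if fst z \<in> D then 0 else fst z) + b *\<^sub>R snd (snd z))"
begin

definition w :: "'v \<Rightarrow> 'v" where "w y = (if y \<in> D then 0 else y)"

lemma w_measurable [measurable]: "w \<in> borel_measurable borel"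
  unfolding w_def[abs_def] by measurable

lemma norm_w_le: "norm (w y) \<le> norm y" by (simp add: w_def)

sublocale L: pair_prob_space La Lx ..
sublocale PL: pair_prob_space P "La \<Otimes>\<^sub>M Lx" ..

definition a1 :: real where "a1 = (\<integral>a. a \<partial>La)"
definition a2 :: real where "a2 = (\<integral>a. a\<^sup>2 \<partial>La)"
definition V :: real where "V = (\<integral>y. (norm y)\<^sup>2 \<partial>P)"

lemma int_La: "integrable La (\<lambda>a. a)"
  using La.square_integrable_imp_integrable[OF _ La_sq] by simp

lemma int_Lx: "integrable Lx (\<lambda>x. x)"
proof -
  have "integrable Lx norm" using Lx.square_integrable_imp_integrable[OF _ Lx_sq] by simp
  then show ?thesis by (simp add: integrable_norm_iff)
qed

lemma int_P: "integrable P (\<lambda>y. y)"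
proof -
  have "integrable P norm" using P.square_integrable_imp_integrable[OF _ P_sq] by simp
  then show ?thesis by (simp add: integrable_norm_iff)
qed

lemma int_w: "integrable P w"
  by (rule Bochner_Integration.integrable_bound[OF int_P]) (auto simp: norm_w_le)

lemma inner_w_le: "\<bar>u \<bullet> w y\<bar> \<le> norm u * norm y"
  using Cauchy_Schwarz_ineq2[of u "w y"] norm_w_le[of y]
  by (meson mult_left_mono norm_ge_zero order_trans)

lemma inner_w_sq_le: "(u \<bullet> w y)\<^sup>2 \<le> (norm u)\<^sup>2 * (norm y)\<^sup>2"
  using power_mono[OF inner_w_le[of u y], of 2] by (simp add: power_mult_distrib)

lemma int_w_sq: "integrable P (\<lambda>y. (u \<bullet> w y)\<^sup>2)"
  by (rule Bochner_Integration.integrable_bound[OF integrable_mult_right[OF P_sq, of "(norm u)\<^sup>2"]])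
     (auto simp: inner_w_sq_le)

lemma integral_w_sq_le: "(\<integral>y. (u \<bullet> w y)\<^sup>2 \<partial>P) \<le> (norm u)\<^sup>2 * V"
proof -
  have "(\<integral>y. (u \<bullet> w y)\<^sup>2 \<partial>P) \<le> (\<integral>y. (norm u)\<^sup>2 * (norm y)\<^sup>2 \<partial>P)"
    by (intro integral_mono int_w_sq integrable_mult_right P_sq inner_w_sq_le)
  then show ?thesis by (simp add: V_def)
qed

lemma V_nonneg: "0 \<le> V" by (simp add: V_def)

lemma int_inner_w: "integrable P (\<lambda>y. u \<bullet> w y)"
  by (intro integrable_inner_right int_w)

text \<open>The crude bound \<open>norm y \<le> 1 + (norm y)^2\<close> lets \<open>V\<close> alone
  control first moments, uniformly over a family with bounded \<open>V\<close>.\<close>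

lemma integral_abs_w_le: "(\<integral>y. \<bar>u \<bullet> w y\<bar> \<partial>P) \<le> norm u * (1 + V)"
proof -
  have "(\<integral>y. \<bar>u \<bullet> w y\<bar> \<partial>P) \<le> (\<integral>y. norm u * (1 + (norm y)\<^sup>2) \<partial>P)"
  proof (rule integral_mono)
    show "\<bar>u \<bullet> w y\<bar> \<le> norm u * (1 + (norm y)\<^sup>2)" for y
    proof -
      have "2 * norm y \<le> 1 + (norm y)\<^sup>2"
        using zero_le_power2[of "norm y - 1"] by (simp add: power2_eq_square algebra_simps)
      then have "norm y \<le> 1 + (norm y)\<^sup>2" using norm_ge_zero[of y] by linarith
      then show ?thesis using inner_w_le[of u y] by (meson mult_left_mono norm_ge_zero order_trans)
    qed
  qed (auto intro!: integrable_abs int_inner_w integrable_mult_right P_sq)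
  also have "\<dots> = norm u * (1 + V)" using P_sq by (simp add: V_def P.prob_space)
  finally show ?thesis .
qed

text \<open>The innovation is centred and the multiplier is independent of the state, so only the
  factor \<open>a1\<close> remains. As \<open>1 - a1\<close> is small, this fixes to first order the
  mean that the resets remove.\<close>

lemma mean_eq: "(\<integral>y. y \<partial>P) = a1 *\<^sub>R (\<integral>y. w y \<partial>P)"
proof (rule euclidean_eqI)
  fix u :: 'v assume "u \<in> Basis"
  have i1: "integrable (La \<Otimes>\<^sub>M Lx) (\<lambda>z. fst z)" "(\<integral>z. fst z \<partial>(La \<Otimes>\<^sub>M Lx)) = a1"
    using L.integrable_prod_mult[OF int_La, of "\<lambda>_. 1"] L.integral_prod_mult[OF int_La, of "\<lambda>_. 1"]
    by (simp_all add: a1_def Lx.prob_space)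
  have i2: "integrable (La \<Otimes>\<^sub>M Lx) (\<lambda>z. u \<bullet> snd z)" "(\<integral>z. u \<bullet> snd z \<partial>(La \<Otimes>\<^sub>M Lx)) = 0"
    using L.integrable_prod_mult[of "\<lambda>_. 1" "\<lambda>x. u \<bullet> x"] L.integral_prod_mult[of "\<lambda>_. 1" "\<lambda>x. u \<bullet> x"]
      int_Lx Lx_mean by simp_all
  have j1: "integrable (P \<Otimes>\<^sub>M (La \<Otimes>\<^sub>M Lx)) (\<lambda>z. (u \<bullet> w (fst z)) * fst (snd z))"
    "(\<integral>z. (u \<bullet> w (fst z)) * fst (snd z) \<partial>(P \<Otimes>\<^sub>M (La \<Otimes>\<^sub>M Lx))) = (u \<bullet> (\<integral>y. w y \<partial>P)) * a1"
    using PL.integrable_prod_mult[OF int_inner_w[of u] i1(1)] PL.integral_prod_mult[OF int_inner_w[of u] i1(1)]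
      int_w i1 by simp_all
  have j2: "integrable (P \<Otimes>\<^sub>M (La \<Otimes>\<^sub>M Lx)) (\<lambda>z. u \<bullet> snd (snd z))"
    "(\<integral>z. u \<bullet> snd (snd z) \<partial>(P \<Otimes>\<^sub>M (La \<Otimes>\<^sub>M Lx))) = 0"
    using PL.integrable_prod_mult[of "\<lambda>_. 1", OF _ i2(1)] PL.integral_prod_mult[of "\<lambda>_. 1", OF _ i2(1)] i2
    by simp_all
  have "(\<integral>y. u \<bullet> y \<partial>P) = (\<integral>y. u \<bullet> y \<partial>distr (P \<Otimes>\<^sub>M (La \<Otimes>\<^sub>M Lx)) borel
      (\<lambda>z. fst (snd z) *\<^sub>R (if fst z \<in> D then 0 else fst z) + b *\<^sub>R snd (snd z)))"
    using stat by simp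
  also have "\<dots> = (\<integral>z. (u \<bullet> w (fst z)) * fst (snd z) + b * (u \<bullet> snd (snd z)) \<partial>(P \<Otimes>\<^sub>M (La \<Otimes>\<^sub>M Lx)))"
    by (subst integral_distr) (auto simp: inner_add_right w_def intro!: Bochner_Integration.integral_cong)
  also have "\<dots> = (u \<bullet> (\<integral>y. w y \<partial>P)) * a1"
    using j1 j2 by simp
  finally show "(\<integral>y. y \<partial>P) \<bullet> u = (a1 *\<^sub>R (\<integral>y. w y \<partial>P)) \<bullet> u"
    using int_P by (simp add: inner_commute mult.commute)
qed

section \<open>The functional equation of the characteristic function\<close>

definition phi_al :: "real \<Rightarrow> complex" where "phi_al s = (CLINT a|La. iexp (a * s))"
definition psi :: "'v \<Rightarrow> complex" where "psi u = (CLINT x|Lx. iexp (b * (u \<bullet> x)))"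
text \<open>Characteristic function of the state after the reset; the limit argument solves for it
  rather than for \<open>char_vec P\<close>.\<close>

definition W :: "'v \<Rightarrow> complex" where "W u = (CLINT y|P. iexp (u \<bullet> w y))"
definition AW :: "'v \<Rightarrow> complex" where "AW u = (CLINT y|P. phi_al (u \<bullet> w y))"
text \<open>The radial derivative of \<open>W\<close>: at \<open>t = 1\<close> it is the derivative
  of \<open>t \<mapsto> W (t u)\<close>.\<close>

definition E :: "'v \<Rightarrow> complex" where "E u = (CLINT y|P. \<i> * (u \<bullet> w y) * iexp (u \<bullet> w y))"
text \<open>What the resets change in the characteristic function beyond the mean; with the linear
  term removed it is of the order of a second moment.\<close>

definition G :: "'v \<Rightarrow> complex" where
  "G u = (CLINT y|P. indicator D y *\<^sub>R (iexp (u \<bullet> y) - 1 - \<i> * (u \<bullet> y)))"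

lemma phi_al_measurable [measurable]: "phi_al \<in> borel_measurable borel"
  unfolding phi_al_def[abs_def] by measurable

lemma norm_phi_al: "cmod (phi_al s) \<le> 1"
  using integral_norm_bound[of La "\<lambda>a. iexp (a * s)"] La.prob_space by (simp add: phi_al_def)

lemma norm_W: "cmod (W u) \<le> 1"
  using integral_norm_bound[of P "\<lambda>y. iexp (u \<bullet> w y)"] P.prob_space by (simp add: W_def)

lemma int_iexp_w: "integrable P (\<lambda>y. iexp (u \<bullet> w y))"
  by (rule P.integrable_const_bound[where B=1]) auto

lemma int_phi_w: "integrable P (\<lambda>y. phi_al (u \<bullet> w y))"
  by (rule P.integrable_const_bound[where B=1]) (auto simp: norm_phi_al)

lemma int_E: "integrable P (\<lambda>y. \<i> * (u \<bullet> w y) * iexp (u \<bullet> w y))"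
  by (rule Bochner_Integration.integrable_bound[OF int_inner_w[of u]]) (auto simp: norm_mult)

lemma norm_E: "cmod (E u) \<le> norm u * (1 + V)"
  using integral_norm_bound[of P "\<lambda>y. \<i> * (u \<bullet> w y) * iexp (u \<bullet> w y)"] integral_abs_w_le[of u]
  by (simp add: E_def norm_mult)

lemma char_eq: "char_vec P u = psi u * AW u"
proof -
  have "char_vec P u = (CLINT y|distr (P \<Otimes>\<^sub>M (La \<Otimes>\<^sub>M Lx)) borel
      (\<lambda>z. fst (snd z) *\<^sub>R (if fst z \<in> D then 0 else fst z) + b *\<^sub>R snd (snd z)). iexp (u \<bullet> y))"
    unfolding char_vec_def using stat by simp
  also have "\<dots> = (CLINT z|P \<Otimes>\<^sub>M (La \<Otimes>\<^sub>M Lx). iexp (fst (snd z) * (u \<bullet> w (fst z))) * iexp (b * (u \<bullet> snd (snd z))))"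
    by (subst integral_distr) (auto simp: inner_add_right w_def ring_distribs exp_add intro!: Bochner_Integration.integral_cong)
  also have "\<dots> = (CLINT y|P. CLINT z|La \<Otimes>\<^sub>M Lx. iexp (fst z * (u \<bullet> w y)) * iexp (b * (u \<bullet> snd z)))"
    by (subst PL.integral_fst'[symmetric])
       (auto intro!: PL.integrable_const_bound[where B=1] simp: norm_mult)
  also have "\<dots> = (CLINT y|P. phi_al (u \<bullet> w y) * psi u)"
    unfolding phi_al_def psi_def
    by (intro Bochner_Integration.integral_cong refl L.integral_prod_mult)
       (auto intro!: La.integrable_const_bound[where B=1] Lx.integrable_const_bound[where B=1])
  finally show ?thesis by (simp add: AW_def mult.commute)
qed

text \<open>A Taylor expansion at multiplier 1: after \<open>iexp s\<close> is factored out, the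
  remainder in \<open>(1 - a) * s\<close> is at most half its square, and the second moment of
  \<open>1 - a\<close> is \<open>1 - 2 * a1 + a2\<close>.\<close>

lemma phi_al_approx:
  "cmod (phi_al s - iexp s + (1 - a1) * (\<i> * s * iexp s)) \<le> (1 - 2 * a1 + a2) * s\<^sup>2 / 2"
proof -
  have i: "integrable La (\<lambda>a. iexp (a * s))" by (rule La.integrable_const_bound[where B=1]) auto
  have i2: "integrable La (\<lambda>a. (1 - complex_of_real a) * (\<i> * s * iexp s))"
    using int_La by (intro integrable_mult_left Bochner_Integration.integrable_diff integrable_of_real) auto
  have eq: "phi_al s - iexp s + (1 - a1) * (\<i> * s * iexp s)
      = (CLINT a|La. iexp (a * s) - iexp s + (1 - complex_of_real a) * (\<i> * s * iexp s))"
    using i i2 int_La by (simp add: phi_al_def a1_def La.prob_space of_real_diff)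
  have "cmod (phi_al s - iexp s + (1 - a1) * (\<i> * s * iexp s)) \<le> (LINT a|La. cmod (iexp (a * s) - iexp s + (1 - complex_of_real a) * (\<i> * s * iexp s)))"
    unfolding eq by (rule integral_norm_bound)
  also have "\<dots> \<le> (LINT a|La. (1 - 2 * a + a\<^sup>2) * s\<^sup>2 / 2)"
  proof (rule integral_mono)
    fix a
    have "iexp (a * s) = iexp s * iexp (- (1 - a) * s)"
      by (simp add: exp_add[symmetric] algebra_simps)
    then have "iexp (a * s) - iexp s + (1 - complex_of_real a) * (\<i> * s * iexp s)
        = iexp s * (iexp (- (1 - a) * s) - 1 - \<i> * complex_of_real (- (1 - a) * s))"
      by (simp add: algebra_simps)
    then have "cmod (iexp (a * s) - iexp s + (1 - complex_of_real a) * (\<i> * s * iexp s))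
        \<le> (- (1 - a) * s)\<^sup>2 / 2"
      using norm_iexp_taylor2[of "- (1 - a) * s"] by (simp add: norm_mult)
    also have "\<dots> = (1 - 2 * a + a\<^sup>2) * s\<^sup>2 / 2" by (simp add: power2_eq_square algebra_simps)
    finally show "cmod (iexp (a * s) - iexp s + (1 - complex_of_real a) * (\<i> * s * iexp s)) \<le> (1 - 2 * a + a\<^sup>2) * s\<^sup>2 / 2" .
  qed (use i i2 int_La La_sq in auto)
  also have "\<dots> = (1 - 2 * a1 + a2) * s\<^sup>2 / 2"
    using int_La La_sq by (simp add: a1_def a2_def La.prob_space)
  finally show ?thesis .
qed

lemma a_var_nonneg: "0 \<le> 1 - 2 * a1 + a2"
  using order_trans[OF norm_ge_zero phi_al_approx[of 1]] by simp

lemma AW_approx: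
  "cmod (AW u - W u + (1 - a1) * E u) \<le> (1 - 2 * a1 + a2) * ((norm u)\<^sup>2 * V) / 2"
proof -
  have eq: "AW u - W u + (1 - a1) * E u
      = (CLINT y|P. phi_al (u \<bullet> w y) - iexp (u \<bullet> w y) + (1 - a1) * (\<i> * (u \<bullet> w y) * iexp (u \<bullet> w y)))"
    using int_iexp_w[of u] int_phi_w[of u] int_E[of u] by (simp add: AW_def W_def E_def)
  have "cmod (AW u - W u + (1 - a1) * E u) \<le> (LINT y|P. cmod (phi_al (u \<bullet> w y) - iexp (u \<bullet> w y) + (1 - a1) * (\<i> * (u \<bullet> w y) * iexp (u \<bullet> w y))))"
    unfolding eq by (rule integral_norm_bound)
  also have "\<dots> \<le> (LINT y|P. (1 - 2 * a1 + a2) * (u \<bullet> w y)\<^sup>2 / 2)"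
    using int_iexp_w[of u] int_phi_w[of u] int_E[of u] int_w_sq[of u]
    by (intro integral_mono phi_al_approx integrable_norm) auto
  also have "\<dots> = (1 - 2 * a1 + a2) * (LINT y|P. (u \<bullet> w y)\<^sup>2) / 2" by simp
  also have "\<dots> \<le> (1 - 2 * a1 + a2) * ((norm u)\<^sup>2 * V) / 2"
    using integral_w_sq_le[of u] a_var_nonneg by (intro divide_right_mono mult_left_mono) auto
  finally show ?thesis .
qed

text \<open>Outside \<open>D\<close> the states before and after the reset agree; on
  \<open>D\<close> the latter is 0 and the difference is \<open>iexp (u \<bullet> y) - 1\<close>.
  Splitting off its linear term leaves \<open>G\<close>, and the linear term is the mean removed by
  the reset.\<close>

lemma balance: "char_vec P u - W u = G u + \<i> * (u \<bullet> ((\<integral>y. y \<partial>P) - (\<integral>y. w y \<partial>P)))"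
proof -
  have i1: "integrable P (\<lambda>y. iexp (u \<bullet> y))" by (rule P.integrable_const_bound[where B=1]) auto
  have i2: "integrable P (\<lambda>y. u \<bullet> (y - w y))" using int_P int_w by auto
  have "G u = (CLINT y|P. iexp (u \<bullet> y) - iexp (u \<bullet> w y) - \<i> * complex_of_real (u \<bullet> (y - w y)))"
    unfolding G_def by (intro Bochner_Integration.integral_cong) (auto simp: w_def)
  also have "\<dots> = char_vec P u - W u - \<i> * complex_of_real (\<integral>y. u \<bullet> (y - w y) \<partial>P)"
    using i1 i2 int_iexp_w[of u] by (simp add: char_vec_def W_def)
  also have "(\<integral>y. u \<bullet> (y - w y) \<partial>P) = u \<bullet> ((\<integral>y. y \<partial>P) - (\<integral>y. w y \<partial>P))"
    using int_P int_w by simp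
  finally show ?thesis by simp
qed

text \<open>Integrating along the ray \<open>t u\<close> with the integrating factor \<open>exp (c t\<^sup>2)\<close>.\<close>

lemma W_ray:
  assumes c: "0 \<le> c"
  shows "(CLINT t|unit_unif. (E (t *\<^sub>R u) / t + 2 * c * t * W (t *\<^sub>R u)) * exp (c * t\<^sup>2)) = W u * exp c - 1"
proof -
  interpret U: prob_space unit_unif by (rule prob_space_unit_unif)
  interpret PU: pair_sigma_finite P unit_unif ..
  let ?f = "\<lambda>s t. (\<i> * s + 2 * c * t) * iexp (t * s) * exp (c * t\<^sup>2)"
  have integral_lin: "(\<integral>y. (f y / t + k * g y) * d \<partial>P) = ((\<integral>y. f y \<partial>P) / t + k * (\<integral>y. g y \<partial>P)) * d"
    if "integrable P f" "integrable P g" for f g :: "'v \<Rightarrow> complex" and t k d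
    using that by simp
  have int: "integrable (P \<Otimes>\<^sub>M unit_unif) (\<lambda>(y, t). ?f (u \<bullet> w y) t)"
  proof (rule Bochner_Integration.integrable_bound)
    show "integrable (P \<Otimes>\<^sub>M unit_unif) (\<lambda>z. (\<bar>u \<bullet> w (fst z)\<bar> + 2 * c) * exp c * 1)"
      using PU.integrable_prod_mult[of "\<lambda>y. (\<bar>u \<bullet> w y\<bar> + 2 * c) * exp c" "\<lambda>_. 1"] int_inner_w[of u] by simp
    \<comment> \<open>The majorant holds only for \<open>t\<close> in the unit interval, hence
      almost everywhere.\<close>
    have "AE z in P \<Otimes>\<^sub>M unit_unif. 0 < snd z \<and> snd z \<le> 1"
    proof (rule PU.AE_pair_measure)
      show "{z \<in> space (P \<Otimes>\<^sub>M unit_unif). 0 < snd z \<and> snd z \<le> 1} \<in> sets (P \<Otimes>\<^sub>M unit_unif)"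
        by measurable
    qed (use AE_unit_unif in auto)
    then show "AE z in P \<Otimes>\<^sub>M unit_unif. norm (case z of (y, t) \<Rightarrow> ?f (u \<bullet> w y) t)
        \<le> norm ((\<bar>u \<bullet> w (fst z)\<bar> + 2 * c) * exp c * 1)"
    proof eventually_elim
      case (elim z)
      then have t: "0 < snd z" "snd z \<le> 1" by auto
      have "cmod (\<i> * (u \<bullet> w (fst z)) + 2 * c * snd z) \<le> \<bar>u \<bullet> w (fst z)\<bar> + 2 * c * snd z"
        using t c by (intro order_trans[OF norm_triangle_ineq]) (auto simp: norm_mult)
      also have "\<dots> \<le> \<bar>u \<bullet> w (fst z)\<bar> + 2 * c"
        using t c by (simp add: mult_left_le)
      finally have 1: "cmod (\<i> * (u \<bullet> w (fst z)) + 2 * c * snd z) \<le> \<bar>u \<bullet> w (fst z)\<bar> + 2 * c" .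
      have "c * (snd z)\<^sup>2 \<le> c" using t c by (intro mult_left_le power_le_one) auto
      then have "exp (c * (snd z)\<^sup>2) \<le> exp c" by simp
      then have "cmod (\<i> * (u \<bullet> w (fst z)) + 2 * c * snd z) * exp (c * (snd z)\<^sup>2) \<le> (\<bar>u \<bullet> w (fst z)\<bar> + 2 * c) * exp c"
        using 1 c by (intro mult_mono) auto
      then show ?case using c by (simp add: split_beta norm_mult abs_mult)
    qed
  qed measurable
  have "W u * exp c - 1 = (CLINT y|P. iexp (u \<bullet> w y) * exp c - 1)"
    using int_iexp_w[of u] by (simp add: W_def P.prob_space)
  also have "\<dots> = (CLINT y|P. CLINT t|unit_unif. ?f (u \<bullet> w y) t)"
    by (simp only: iexp_gauss_FTC exp_of_real)
  also have "\<dots> = (CLINT t|unit_unif. CLINT y|P. ?f (u \<bullet> w y) t)"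
    by (rule PU.Fubini_integral[symmetric, OF int])
  also have "\<dots> = (CLINT t|unit_unif. (E (t *\<^sub>R u) / t + 2 * c * t * W (t *\<^sub>R u)) * exp (c * t\<^sup>2))"
  proof (rule integral_cong_AE)
    show "AE t in unit_unif. (CLINT y|P. ?f (u \<bullet> w y) t)
        = (E (t *\<^sub>R u) / t + 2 * c * t * W (t *\<^sub>R u)) * exp (c * t\<^sup>2)"
      using AE_unit_unif
    proof eventually_elim
      case (elim t)
      \<comment> \<open>For \<open>t > 0\<close> the factor \<open>u \<bullet> w y\<close> is
        written as \<open>((t u) \<bullet> w y) / t\<close>, which produces the radial derivative at
        \<open>t u\<close>.\<close>
      have "(CLINT y|P. ?f (u \<bullet> w y) t)
          = (CLINT y|P. ((\<i> * ((t *\<^sub>R u) \<bullet> w y) * iexp ((t *\<^sub>R u) \<bullet> w y)) / t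
              + 2 * c * t * iexp ((t *\<^sub>R u) \<bullet> w y)) * exp (c * t\<^sup>2))"
        using elim by (intro Bochner_Integration.integral_cong) (auto simp: field_simps)
      also have "\<dots> = (E (t *\<^sub>R u) / t + 2 * c * t * W (t *\<^sub>R u)) * exp (c * t\<^sup>2)"
        unfolding E_def W_def by (rule integral_lin[OF int_E int_iexp_w])
      finally show ?case .
    qed
    show "(\<lambda>t. (E (t *\<^sub>R u) / t + 2 * c * t * W (t *\<^sub>R u)) * exp (c * t\<^sup>2)) \<in> borel_measurable unit_unif"
      unfolding E_def W_def by measurable
  qed measurable
  finally show ?thesis by (simp only: exp_of_real)
qed

end

section \<open>Passage to the limit in the functional equation\<close>

definition gauss_ray :: "real \<Rightarrow> real" where
  "gauss_ray c = (\<integral>t. exp (c * t\<^sup>2) \<partial>unit_unif)"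

text \<open>Centring permits subtraction of the linear Taylor term, after which a multiple of
  \<open>(u \<bullet> x)^2\<close> dominates. Pointwise the third order remainder vanishes, because
  \<open>b n\<close> tends to 0 when \<open>r * b^2\<close> tends to 1 and \<open>r\<close> to
  infinity.\<close>

lemma tendsto_psi:
  fixes Lx :: "'v::euclidean_space measure" and r b :: "nat \<Rightarrow> real"
  assumes Lx: "prob_space Lx" and [measurable_cong]: "sets Lx = sets borel"
    and sq: "integrable Lx (\<lambda>x. (norm x)\<^sup>2)" and mean: "(\<integral>x. x \<partial>Lx) = 0"
    and r: "filterlim r at_top sequentially" and b: "(\<lambda>n. r n * (b n)\<^sup>2) \<longlonglongrightarrow> 1"
  shows "(\<lambda>n. r n * ((CLINT x|Lx. iexp (b n * (u \<bullet> x))) - 1)) \<longlonglongrightarrow> complex_of_real (- (\<integral>x. (u \<bullet> x)\<^sup>2 \<partial>Lx) / 2)"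
proof -
  interpret prob_space Lx by fact
  have i1: "integrable Lx (\<lambda>x. x)"
  proof -
    have "integrable Lx norm" using square_integrable_imp_integrable[OF _ sq] by simp
    then show ?thesis by (simp add: integrable_norm_iff)
  qed
  have i2: "integrable Lx (\<lambda>x. (u \<bullet> x)\<^sup>2)"
  proof (rule Bochner_Integration.integrable_bound[OF integrable_mult_right[OF sq, of "(norm u)\<^sup>2"]])
    have "(u \<bullet> x)\<^sup>2 \<le> (norm u)\<^sup>2 * (norm x)\<^sup>2" for x
      using power_mono[OF Cauchy_Schwarz_ineq2[of u x], of 2] by (simp add: power_mult_distrib)
    then show "AE x in Lx. norm ((u \<bullet> x)\<^sup>2) \<le> norm ((norm u)\<^sup>2 * (norm x)\<^sup>2)" by simp
  qed simp
  have "Bseq (\<lambda>n. r n * (b n)\<^sup>2)" using b by (intro convergent_imp_Bseq convergentI)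
  then obtain B where B: "\<And>n. \<bar>r n * (b n)\<^sup>2\<bar> \<le> B" unfolding Bseq_def by auto
  have "(\<lambda>n. inverse (r n)) \<longlonglongrightarrow> 0" using r by (rule tendsto_inverse_0_at_top)
  from tendsto_mult[OF b this] have "(\<lambda>n. r n * (b n)\<^sup>2 * inverse (r n)) \<longlonglongrightarrow> 0" by simp
  moreover have "\<forall>\<^sub>F n in sequentially. 0 < r n" using r by (simp add: filterlim_at_top_dense)
  then have "\<forall>\<^sub>F n in sequentially. r n * (b n)\<^sup>2 * inverse (r n) = (b n)\<^sup>2"
    by eventually_elim simp
  ultimately have b0: "(\<lambda>n. (b n)\<^sup>2) \<longlonglongrightarrow> 0"
    by (rule Lim_transform_eventually)
  then have b0: "b \<longlonglongrightarrow> 0"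
    using tendsto_real_sqrt[OF b0] by (simp add: tendsto_rabs_zero_iff)
  let ?g = "\<lambda>n x. complex_of_real (r n) * (iexp (b n * (u \<bullet> x)) - 1 - \<i> * complex_of_real (b n * (u \<bullet> x)))"
  have eq: "r n * ((CLINT x|Lx. iexp (b n * (u \<bullet> x))) - 1) = (CLINT x|Lx. ?g n x)" for n
  proof -
    have "integrable Lx (\<lambda>x. iexp (b n * (u \<bullet> x)))" by (rule integrable_const_bound[where B=1]) auto
    moreover have "integrable Lx (\<lambda>x. complex_of_real (b n * (u \<bullet> x)))"
      using i1 by (intro integrable_of_real) auto
    moreover have "(CLINT x|Lx. complex_of_real (b n * (u \<bullet> x))) = 0"
      using i1 mean by (simp del: of_real_mult)
    ultimately show ?thesis by (simp add: prob_space del: of_real_mult)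
  qed
  have "(\<lambda>n. CLINT x|Lx. ?g n x) \<longlonglongrightarrow> (CLINT x|Lx. complex_of_real (- (u \<bullet> x)\<^sup>2 / 2))"
  proof (rule integral_dominated_convergence[where w="\<lambda>x. B * ((u \<bullet> x)\<^sup>2 / 2)"])
    show "integrable Lx (\<lambda>x. B * ((u \<bullet> x)\<^sup>2 / 2))" using i2 by simp
    show "AE x in Lx. norm (?g n x) \<le> B * ((u \<bullet> x)\<^sup>2 / 2)" for n
    proof (intro AE_I2)
      fix x
      have "norm (?g n x) \<le> \<bar>r n\<bar> * ((b n * (u \<bullet> x))\<^sup>2 / 2)"
        unfolding norm_mult norm_of_real by (intro mult_left_mono norm_iexp_taylor2) auto
      also have "\<dots> = \<bar>r n * (b n)\<^sup>2\<bar> * ((u \<bullet> x)\<^sup>2 / 2)" by (simp add: abs_mult power_mult_distrib)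
      also have "\<dots> \<le> B * ((u \<bullet> x)\<^sup>2 / 2)" using B by (intro mult_right_mono) auto
      finally show "norm (?g n x) \<le> B * ((u \<bullet> x)\<^sup>2 / 2)" .
    qed
    show "AE x in Lx. (\<lambda>n. ?g n x) \<longlonglongrightarrow> complex_of_real (- (u \<bullet> x)\<^sup>2 / 2)"
    proof (intro AE_I2)
      fix x
      define s where "s = u \<bullet> x"
      have *: "cmod (?g n x - complex_of_real (- (r n * (b n)\<^sup>2) * s\<^sup>2 / 2)) \<le> \<bar>r n * (b n)\<^sup>2\<bar> * \<bar>b n\<bar> * (\<bar>s\<bar> ^ 3 / 6)" for n
      proof -
        have "?g n x - complex_of_real (- (r n * (b n)\<^sup>2) * s\<^sup>2 / 2)
            = complex_of_real (r n) * (iexp (b n * s) - (\<Sum>k\<le>2. (\<i> * complex_of_real (b n * s)) ^ k / fact k))"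
          by (simp add: s_def numeral_2_eq_2 power2_eq_square field_simps)
        then have "cmod (?g n x - complex_of_real (- (r n * (b n)\<^sup>2) * s\<^sup>2 / 2))
            \<le> \<bar>r n\<bar> * (\<bar>b n * s\<bar> ^ Suc 2 / fact (Suc 2))"
          using iexp_approx1[of "b n * s" 2] by (simp only: norm_mult norm_of_real mult_left_mono abs_ge_zero)
        also have "\<dots> = \<bar>r n * (b n)\<^sup>2\<bar> * \<bar>b n\<bar> * (\<bar>s\<bar> ^ 3 / 6)"
          by (simp add: abs_mult power_mult_distrib power2_eq_square power3_eq_cube fact_numeral
              del: abs_mult_self_eq abs_power2)
        finally show ?thesis .
      qed
      have "(\<lambda>n. \<bar>r n * (b n)\<^sup>2\<bar> * \<bar>b n\<bar> * (\<bar>s\<bar> ^ 3 / 6)) \<longlonglongrightarrow> \<bar>1\<bar> * \<bar>0\<bar> * (\<bar>s\<bar> ^ 3 / 6)"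
        by (intro tendsto_intros b b0)
      then have l1: "(\<lambda>n. ?g n x - complex_of_real (- (r n * (b n)\<^sup>2) * s\<^sup>2 / 2)) \<longlonglongrightarrow> 0"
        by (intro Lim_null_comparison[OF always_eventually[OF allI[OF *]]]) simp
      have l2: "(\<lambda>n. complex_of_real (- (r n * (b n)\<^sup>2) * s\<^sup>2 / 2)) \<longlonglongrightarrow> complex_of_real (- 1 * s\<^sup>2 / 2)"
        by (intro tendsto_intros b) simp
      show "(\<lambda>n. ?g n x) \<longlonglongrightarrow> complex_of_real (- (u \<bullet> x)\<^sup>2 / 2)"
        using tendsto_add[OF l1 l2] unfolding diff_add_cancel s_def[symmetric] by simp
    qed
  qed measurable
  moreover have "(CLINT x|Lx. complex_of_real (- (u \<bullet> x)\<^sup>2 / 2)) = complex_of_real (- (\<integral>x. (u \<bullet> x)\<^sup>2 \<partial>Lx) / 2)"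
    unfolding integral_complex_of_real by simp
  ultimately show ?thesis unfolding eq by simp
qed

text \<open>\<open>q\<close> is the mass that the limit law has at \<open>0\<close>.\<close>

definition limit_char :: "real \<Rightarrow> real \<Rightarrow> real \<Rightarrow> complex" where
  "limit_char q c m = q + (1 - q) * exp (- c) + \<i> * (m * (exp (- c) * gauss_ray c))"

text \<open>Multiplied by \<open>r n\<close>, the identity \<open>char_vec = psi * AW\<close> is
  split into the differences \<open>psi - 1\<close>, \<open>AW - W\<close> and
  \<open>char_vec - W\<close>. They account for \<open>- Q / 2 * W\<close>, \<open>- a * E\<close>
  and the inhomogeneity, so \<open>a * E + Q / 2 * W\<close> converges although neither
  \<open>E\<close> nor \<open>W\<close> is known to. \<open>W_ray\<close> integrates exactly this
  combination.\<close>

theorem tendsto_char_reset_law: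
  fixes Lx :: "'v::euclidean_space measure" and r b :: "nat \<Rightarrow> real"
  assumes R: "\<And>n. reset_law (La n) Lx (P n) (D n) (b n)"
    and r: "filterlim r at_top sequentially" and a: "0 < a"
    and A1: "(\<lambda>n. r n * (1 - reset_law.a1 (La n))) \<longlonglongrightarrow> a"
    and A2: "(\<lambda>n. r n * (1 - reset_law.a2 (La n))) \<longlonglongrightarrow> 2 * a"
    and b: "(\<lambda>n. r n * (b n)\<^sup>2) \<longlonglongrightarrow> 1"
    and V: "\<And>n. reset_law.V (P n) \<le> C"
    and G: "\<And>u. (\<lambda>n. r n * reset_law.G (P n) (D n) u) \<longlonglongrightarrow> complex_of_real (- q * (\<integral>x. (u \<bullet> x)\<^sup>2 \<partial>Lx) / 2)"
    and mean: "(\<lambda>n. \<integral>y. y \<partial>P n) \<longlonglongrightarrow> \<mu>"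
  shows "(\<lambda>n. char_vec (P n) u) \<longlonglongrightarrow> limit_char q ((\<integral>x. (u \<bullet> x)\<^sup>2 \<partial>Lx) / (4 * a)) (u \<bullet> \<mu>)"
proof -
  define Q where "Q u = (\<integral>x. (u \<bullet> x)\<^sup>2 \<partial>Lx)" for u
  define a1 where "a1 n = reset_law.a1 (La n)" for n
  define a2 where "a2 n = reset_law.a2 (La n)" for n
  define W where "W n = reset_law.W (P n) (D n)" for n
  define AW where "AW n = reset_law.AW (La n) (P n) (D n)" for n
  define E where "E n = reset_law.E (P n) (D n)" for n
  define G' where "G' n = reset_law.G (P n) (D n)" for n
  define psi where "psi n = reset_law.psi Lx (b n)" for n
  define Wm where "Wm n = (\<integral>y. reset_law.w (D n) y \<partial>P n)" for n
  define Ym where "Ym n = (\<integral>y. y \<partial>P n)" for n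
  note defs = a1_def a2_def W_def AW_def E_def G'_def psi_def Wm_def Ym_def
  have psi_lim: "(\<lambda>n. r n * (psi n u - 1)) \<longlonglongrightarrow> complex_of_real (- Q u / 2)" for u
  proof -
    interpret R: reset_law "La 0" Lx "P 0" "D 0" "b 0" by (rule R)
    have "psi n u = (CLINT x|Lx. iexp (b n * (u \<bullet> x)))" for n
      unfolding defs using reset_law.psi_def[OF R, of n u] by simp
    then show ?thesis unfolding Q_def
      using tendsto_psi[OF R.Lx.prob_space_axioms R.sets_Lx R.Lx_sq R.Lx_mean r b, of u] by simp
  qed
  have C: "0 \<le> C" using order_trans[OF reset_law.V_nonneg[OF R[of 0]] V[of 0]] .
  have rpos: "\<forall>\<^sub>F n in sequentially. 0 < r n" using r by (simp add: filterlim_at_top_dense)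
  have rinv: "(\<lambda>n. inverse (r n)) \<longlonglongrightarrow> 0" using r by (rule tendsto_inverse_0_at_top)
  have null: "f \<longlonglongrightarrow> 0" if "(\<lambda>n. r n * f n) \<longlonglongrightarrow> l" for f :: "nat \<Rightarrow> complex" and l
  proof -
    have "(\<lambda>n. (r n * f n) * complex_of_real (inverse (r n))) \<longlonglongrightarrow> l * complex_of_real 0"
      by (intro tendsto_intros that rinv)
    moreover have "\<forall>\<^sub>F n in sequentially. (r n * f n) * complex_of_real (inverse (r n)) = f n"
      using rpos by eventually_elim simp
    ultimately show ?thesis using Lim_transform_eventually by fastforce
  qed
  have a1_1: "a1 \<longlonglongrightarrow> 1"
  proof -
    have "(\<lambda>n. complex_of_real (r n) * complex_of_real (1 - a1 n)) \<longlonglongrightarrow> complex_of_real a"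
      unfolding of_real_mult[symmetric] using A1 unfolding a1_def by (rule tendsto_of_real)
    from null[OF this] have "(\<lambda>n. complex_of_real (1 - a1 n)) \<longlonglongrightarrow> complex_of_real 0" by simp
    then have "(\<lambda>n. 1 - a1 n) \<longlonglongrightarrow> 0" by (simp only: tendsto_of_real_iff)
    from tendsto_diff[OF tendsto_const this, of 1] show ?thesis by simp
  qed
  \<comment> \<open>The second moment of \<open>1 - \<alpha>\<close> is of smaller order than
    \<open>1 / r\<close>: the rates \<open>a\<close> and \<open>2 * a\<close> of the two moments
    cancel.\<close>
  have var0: "(\<lambda>n. r n * (1 - 2 * a1 n + a2 n)) \<longlonglongrightarrow> 0"
  proof -
    have "(\<lambda>n. 2 * (r n * (1 - a1 n)) - r n * (1 - a2 n)) \<longlonglongrightarrow> 2 * a - 2 * a"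
      unfolding a1_def a2_def by (intro tendsto_intros A1 A2)
    then show ?thesis by (simp add: algebra_simps)
  qed
  have bnd: "cmod (E n u) \<le> norm u * (1 + C)" for n u
    unfolding E_def using order_trans[OF reset_law.norm_E[OF R[of n], of u]] V[of n]
    by (simp add: mult_left_mono)
  have bndW: "cmod (W n u) \<le> 1" for n u
    unfolding W_def by (rule reset_law.norm_W[OF R])
  have AWd: "(\<lambda>n. r n * (AW n u - W n u) + r n * (1 - a1 n) * E n u) \<longlonglongrightarrow> 0" for u
  proof (rule Lim_null_comparison)
    show "\<forall>\<^sub>F n in sequentially. norm (r n * (AW n u - W n u) + r n * (1 - a1 n) * E n u)
        \<le> r n * (1 - 2 * a1 n + a2 n) * ((norm u)\<^sup>2 * C / 2)"
      using rpos
    proof eventually_elim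
      case (elim n)
      have "r n * (AW n u - W n u) + r n * (1 - a1 n) * E n u = r n * (AW n u - W n u + (1 - a1 n) * E n u)"
        by (simp add: algebra_simps)
      also have "norm \<dots> = r n * norm (AW n u - W n u + (1 - a1 n) * E n u)"
        using elim by (simp only: norm_mult norm_of_real abs_of_pos)
      also have "\<dots> \<le> r n * ((1 - 2 * a1 n + a2 n) * ((norm u)\<^sup>2 * C) / 2)"
      proof -
        have "norm (AW n u - W n u + (1 - a1 n) * E n u) \<le> (1 - 2 * a1 n + a2 n) * ((norm u)\<^sup>2 * reset_law.V (P n)) / 2"
          unfolding defs by (rule reset_law.AW_approx[OF R])
        also have "\<dots> \<le> (1 - 2 * a1 n + a2 n) * ((norm u)\<^sup>2 * C) / 2"
          unfolding defs using V[of n] reset_law.a_var_nonneg[OF R[of n]]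
          by (intro divide_right_mono mult_left_mono) auto
        finally show ?thesis using elim by (intro mult_left_mono) auto
      qed
      finally show ?case by (simp add: mult_ac)
    qed
    show "(\<lambda>n. r n * (1 - 2 * a1 n + a2 n) * ((norm u)\<^sup>2 * C / 2)) \<longlonglongrightarrow> 0"
      by (rule tendsto_mult_left_zero[OF var0])
  qed
  have aE: "(\<lambda>n. complex_of_real (a - r n * (1 - a1 n)) * E n u) \<longlonglongrightarrow> 0" for u
  proof (rule Lim_null_comparison)
    show "\<forall>\<^sub>F n in sequentially. norm (complex_of_real (a - r n * (1 - a1 n)) * E n u) \<le> \<bar>a - r n * (1 - a1 n)\<bar> * (norm u * (1 + C))"
      unfolding norm_mult norm_of_real by (intro always_eventually allI mult_left_mono bnd abs_ge_zero)
    have "(\<lambda>n. \<bar>a - r n * (1 - a1 n)\<bar> * (norm u * (1 + C))) \<longlonglongrightarrow> \<bar>a - a\<bar> * (norm u * (1 + C))"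
      unfolding a1_def by (intro tendsto_intros A1)
    then show "(\<lambda>n. \<bar>a - r n * (1 - a1 n)\<bar> * (norm u * (1 + C))) \<longlonglongrightarrow> 0" by simp
  qed
  have AW0: "(\<lambda>n. AW n u - W n u) \<longlonglongrightarrow> 0" for u
  proof -
    have 1: "(\<lambda>n. (r n * (AW n u - W n u + (1 - a1 n) * E n u))) \<longlonglongrightarrow> 0"
      using AWd[of u] by (simp add: algebra_simps)
    have 2: "(\<lambda>n. complex_of_real (1 - a1 n) * E n u) \<longlonglongrightarrow> 0"
    proof (rule Lim_null_comparison)
      show "\<forall>\<^sub>F n in sequentially. norm (complex_of_real (1 - a1 n) * E n u) \<le> \<bar>1 - a1 n\<bar> * (norm u * (1 + C))"
        unfolding norm_mult norm_of_real by (intro always_eventually allI mult_left_mono bnd abs_ge_zero)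
      have "(\<lambda>n. \<bar>1 - a1 n\<bar> * (norm u * (1 + C))) \<longlonglongrightarrow> \<bar>1 - 1\<bar> * (norm u * (1 + C))"
        by (intro tendsto_intros a1_1)
      then show "(\<lambda>n. \<bar>1 - a1 n\<bar> * (norm u * (1 + C))) \<longlonglongrightarrow> 0" by simp
    qed
    from tendsto_diff[OF null[OF 1] 2] show ?thesis by simp
  qed
  \<comment> \<open>The drift arises here: \<open>Ym = a1 Wm\<close> makes \<open>Ym - Wm\<close>
    equal to \<open>- (1 - a1) / a1\<close> times \<open>Ym\<close>, which is of order
    \<open>1 / r\<close>.\<close>
  have mean_diff: "(\<lambda>n. r n * (u \<bullet> (Ym n - Wm n))) \<longlonglongrightarrow> - a * (u \<bullet> \<mu>)" for u
  proof -
    have "\<forall>\<^sub>F n in sequentially. 0 < a1 n" using a1_1 by (rule order_tendstoD) simp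
    then have ev: "\<forall>\<^sub>F n in sequentially. (- (r n * (1 - a1 n)) / a1 n) * (u \<bullet> Ym n) = r n * (u \<bullet> (Ym n - Wm n))"
    proof eventually_elim
      case (elim n)
      have "Ym n = a1 n *\<^sub>R Wm n" unfolding defs by (rule reset_law.mean_eq[OF R])
      then show ?case using elim by (simp add: inner_diff_right field_simps)
    qed
    have "(\<lambda>n. (- (r n * (1 - a1 n)) / a1 n) * (u \<bullet> Ym n)) \<longlonglongrightarrow> (- a / 1) * (u \<bullet> \<mu>)"
      unfolding Ym_def using A1[folded a1_def] a1_1 by (intro tendsto_intros mean) simp_all
    then show ?thesis using Lim_transform_eventually[OF _ ev] by simp
  qed
  have YW: "(\<lambda>n. r n * (char_vec (P n) u - W n u)) \<longlonglongrightarrow> - complex_of_real (q * Q u / 2) - \<i> * complex_of_real (a * (u \<bullet> \<mu>))" for u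
  proof -
    have "r n * (char_vec (P n) u - W n u) = r n * G' n u + \<i> * complex_of_real (r n * (u \<bullet> (Ym n - Wm n)))" for n
      unfolding defs reset_law.balance[OF R] by (simp add: algebra_simps)
    then have "(\<lambda>n. r n * (char_vec (P n) u - W n u)) \<longlonglongrightarrow> complex_of_real (- q * Q u / 2) + \<i> * complex_of_real (- a * (u \<bullet> \<mu>))"
      using tendsto_add[OF G[of u] tendsto_mult[OF tendsto_const tendsto_of_real[OF mean_diff[of u]], of \<i>]]
      unfolding Q_def G'_def by simp
    then show ?thesis by simp
  qed
  have key: "(\<lambda>n. a * E n u + (Q u / 2) * W n u) \<longlonglongrightarrow> complex_of_real (q * Q u / 2) + \<i> * complex_of_real (a * (u \<bullet> \<mu>))" for u
  proof -
    \<comment> \<open>A purely algebraic identity once \<open>char_vec\<close> is replaced by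
      \<open>psi * AW\<close>; every summand on the right has a known limit.\<close>
    have eq: "a * E n u + (Q u / 2) * W n u
        = complex_of_real (a - r n * (1 - a1 n)) * E n u + (r n * (AW n u - W n u) + r n * (1 - a1 n) * E n u)
          + (Q u / 2 + r n * (psi n u - 1)) * W n u + (r n * (psi n u - 1)) * (AW n u - W n u)
          - r n * (char_vec (P n) u - W n u)" for n
    proof -
      have "char_vec (P n) u = psi n u * AW n u" unfolding defs by (rule reset_law.char_eq[OF R])
      then show ?thesis by (simp add: algebra_simps)
    qed
    have 3: "(\<lambda>n. (Q u / 2 + r n * (psi n u - 1)) * W n u) \<longlonglongrightarrow> 0"
    proof (rule Lim_null_comparison)
      show "\<forall>\<^sub>F n in sequentially. norm ((Q u / 2 + r n * (psi n u - 1)) * W n u) \<le> norm (Q u / 2 + r n * (psi n u - 1))"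
        using bndW by (intro always_eventually allI) (auto simp: norm_mult intro: mult_left_le)
      have "(\<lambda>n. norm (Q u / 2 + r n * (psi n u - 1))) \<longlonglongrightarrow> norm (Q u / 2 + complex_of_real (- Q u / 2))"
        by (intro tendsto_intros psi_lim)
      then show "(\<lambda>n. norm (Q u / 2 + r n * (psi n u - 1))) \<longlonglongrightarrow> 0" by simp
    qed
    have "(\<lambda>n. a * E n u + (Q u / 2) * W n u) \<longlonglongrightarrow> 0 + 0 + 0 + complex_of_real (- Q u / 2) * 0
        - (- complex_of_real (q * Q u / 2) - \<i> * complex_of_real (a * (u \<bullet> \<mu>)))"
      unfolding eq by (intro tendsto_intros aE AWd 3 psi_lim AW0 YW)
    then show ?thesis by (simp add: add.commute)
  qed
  \<comment> \<open>With this \<open>c\<close>, and as \<open>Q\<close> is homogeneous of degree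
    two, the key combination at \<open>t u\<close> divided by \<open>a * t\<close> is
    \<open>E (t u) / t + 2 * c * t * W (t u)\<close>, the integrand of \<open>W_ray\<close>.\<close>
  define c where "c = Q u / (4 * a)"
  have Q0: "0 \<le> Q u" by (simp add: Q_def)
  have c0: "0 \<le> c" using Q0 a by (simp add: c_def)
  have Qt: "Q (t *\<^sub>R u) = t\<^sup>2 * Q u" for t by (simp add: Q_def power_mult_distrib)
  interpret U: prob_space unit_unif by (rule prob_space_unit_unif)
  have lim_int: "(\<lambda>n. CLINT t|unit_unif. (E n (t *\<^sub>R u) / t + 2 * c * t * W n (t *\<^sub>R u)) * exp (c * t\<^sup>2))
      \<longlonglongrightarrow> (CLINT t|unit_unif. (\<i> * (u \<bullet> \<mu>) + 2 * c * t * q) * exp (c * t\<^sup>2))"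
  proof (rule integral_dominated_convergence[where w="\<lambda>t. (norm u * (1 + C) + 2 * c) * exp c"])
    show "(\<lambda>t. (E n (t *\<^sub>R u) / t + 2 * c * t * W n (t *\<^sub>R u)) * exp (c * t\<^sup>2)) \<in> borel_measurable unit_unif" for n
    proof -
      interpret R: reset_law "La n" Lx "P n" "D n" "b n" by (rule R)
      show ?thesis unfolding E_def W_def R.E_def R.W_def by measurable
    qed
    show "AE t in unit_unif. norm ((E n (t *\<^sub>R u) / t + 2 * c * t * W n (t *\<^sub>R u)) * exp (c * t\<^sup>2))
        \<le> (norm u * (1 + C) + 2 * c) * exp c" for n
      using AE_unit_unif
    proof eventually_elim
      case (elim t)
      \<comment> \<open>The bound on \<open>E\<close> is linear in its argument, so division by
        \<open>t\<close> keeps a constant majorant.\<close>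
      have "norm (E n (t *\<^sub>R u) / t) \<le> norm u * (1 + C)"
        using bnd[of n "t *\<^sub>R u"] elim by (simp add: norm_divide field_simps)
      moreover have "norm (2 * c * t * W n (t *\<^sub>R u)) \<le> 2 * c"
        using bndW[of n "t *\<^sub>R u"] elim c0 by (simp add: norm_mult mult_le_one mult_left_le mult.assoc)
      ultimately have "norm (E n (t *\<^sub>R u) / t + 2 * c * t * W n (t *\<^sub>R u)) \<le> norm u * (1 + C) + 2 * c"
        by (meson add_mono norm_triangle_ineq order_trans)
      moreover have "exp (c * t\<^sup>2) \<le> exp c"
        using elim c0 by (simp add: mult_left_le power_le_one)
      ultimately show ?case unfolding norm_mult using C c0 by (intro mult_mono) auto
    qed
    show "AE t in unit_unif. (\<lambda>n. (E n (t *\<^sub>R u) / t + 2 * c * t * W n (t *\<^sub>R u)) * exp (c * t\<^sup>2))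
        \<longlonglongrightarrow> (\<i> * (u \<bullet> \<mu>) + 2 * c * t * q) * exp (c * t\<^sup>2)"
      using AE_unit_unif
    proof eventually_elim
      case (elim t)
      have "(\<lambda>n. (a * E n (t *\<^sub>R u) + (Q (t *\<^sub>R u) / 2) * W n (t *\<^sub>R u)) / (t * a))
          \<longlonglongrightarrow> (complex_of_real (q * Q (t *\<^sub>R u) / 2) + \<i> * complex_of_real (a * ((t *\<^sub>R u) \<bullet> \<mu>))) / (t * a)"
        using elim a by (intro tendsto_divide key tendsto_const) auto
      moreover have "(a * E n (t *\<^sub>R u) + (Q (t *\<^sub>R u) / 2) * W n (t *\<^sub>R u)) / (t * a)
          = E n (t *\<^sub>R u) / t + 2 * c * t * W n (t *\<^sub>R u)" for n
        using elim a unfolding Qt c_def by (simp add: field_simps power2_eq_square)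
      moreover have "(complex_of_real (q * Q (t *\<^sub>R u) / 2) + \<i> * complex_of_real (a * ((t *\<^sub>R u) \<bullet> \<mu>))) / (t * a)
          = \<i> * (u \<bullet> \<mu>) + 2 * c * t * q"
        using elim a unfolding Qt c_def by (simp add: field_simps power2_eq_square)
      ultimately show ?case by (intro tendsto_mult tendsto_const) simp
    qed
  qed (simp_all, measurable)
  have int_gr: "integrable unit_unif (\<lambda>t. exp (c * t\<^sup>2))"
  proof (rule U.integrable_const_bound[where B="exp c"])
    show "AE t in unit_unif. norm (exp (c * t\<^sup>2)) \<le> exp c"
      using AE_unit_unif by eventually_elim (use c0 in \<open>simp add: mult_left_le power_le_one\<close>)
  qed simp
  have int_tg: "integrable unit_unif (\<lambda>t. complex_of_real (2 * c * t * exp (c * t\<^sup>2)))"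
  proof (rule U.integrable_const_bound[where B="2 * c * exp c"])
    show "AE t in unit_unif. norm (complex_of_real (2 * c * t * exp (c * t\<^sup>2))) \<le> 2 * c * exp c"
      using AE_unit_unif
    proof eventually_elim
      case (elim t)
      have "exp (c * t\<^sup>2) \<le> exp c" using elim c0 by (simp add: mult_left_le power_le_one)
      then have "2 * c * t * exp (c * t\<^sup>2) \<le> 2 * c * 1 * exp c"
        using elim c0 by (intro mult_mono) auto
      then show ?case using elim c0 by (simp only: norm_of_real) simp
    qed
  qed simp
  have "(CLINT t|unit_unif. (\<i> * (u \<bullet> \<mu>) + 2 * c * t * q) * exp (c * t\<^sup>2))
      = (CLINT t|unit_unif. (\<i> * (u \<bullet> \<mu>)) * complex_of_real (exp (c * t\<^sup>2)) + q * complex_of_real (2 * c * t * exp (c * t\<^sup>2)))"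
    by (intro Bochner_Integration.integral_cong) (auto simp: algebra_simps)
  also have "\<dots> = \<i> * (u \<bullet> \<mu>) * gauss_ray c + q * (CLINT t|unit_unif. complex_of_real (2 * c * t * exp (c * t\<^sup>2)))"
    using int_gr int_tg
    by (subst Bochner_Integration.integral_add) (auto simp: gauss_ray_def simp del: of_real_mult intro!: integrable_mult_right)
  \<comment> \<open>The case \<open>s = 0\<close> of the integrating factor identity.\<close>
  also have "(CLINT t|unit_unif. complex_of_real (2 * c * t * exp (c * t\<^sup>2))) = exp c - 1"
    using iexp_gauss_FTC[of 0 c] by (simp add: exp_of_real)
  finally have lim_val: "(CLINT t|unit_unif. (\<i> * (u \<bullet> \<mu>) + 2 * c * t * q) * exp (c * t\<^sup>2))
      = \<i> * (u \<bullet> \<mu>) * gauss_ray c + q * (exp c - 1)" by simp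
  have "(\<lambda>n. W n u * exp c - 1) \<longlonglongrightarrow> \<i> * (u \<bullet> \<mu>) * gauss_ray c + q * (exp c - 1)"
    using lim_int unfolding lim_val unfolding E_def W_def reset_law.W_ray[OF R c0]
    by (simp only: exp_of_real)
  from tendsto_mult[OF tendsto_add[OF this tendsto_const[of 1]] tendsto_const[of "exp (- complex_of_real c)"]]
  have "(\<lambda>n. W n u * (exp c * exp (- complex_of_real c)))
      \<longlonglongrightarrow> (\<i> * (u \<bullet> \<mu>) * gauss_ray c + q * (exp c - 1) + 1) * exp (- complex_of_real c)"
    by (simp add: algebra_simps)
  moreover have "complex_of_real (exp c) * exp (- complex_of_real c) = 1"
    by (simp add: exp_of_real[symmetric] exp_minus_inverse)
  moreover have "(\<i> * (u \<bullet> \<mu>) * gauss_ray c + q * (exp c - 1) + 1) * exp (- complex_of_real c) = limit_char q c (u \<bullet> \<mu>)"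
    using calculation(2) by (simp add: limit_char_def algebra_simps exp_of_real[symmetric])
  ultimately have "(\<lambda>n. W n u) \<longlonglongrightarrow> limit_char q c (u \<bullet> \<mu>)" by simp
  \<comment> \<open>\<open>r\<close> times \<open>char_vec - W\<close> converges, so the difference
    itself tends to 0 and both have the same limit.\<close>
  from tendsto_add[OF null[OF YW[of u]] this] show ?thesis
    unfolding c_def Q_def by simp
qed

section \<open>Cycles of the chain\<close>

lemma less_first_hit_iff: "enat t < first_hit X S \<omega> \<longleftrightarrow> (\<forall>s\<in>{1..t}. X s \<omega> \<notin> S)"
proof
  assume "enat t < first_hit X S \<omega>"
  then show "\<forall>s\<in>{1..t}. X s \<omega> \<notin> S"
    unfolding first_hit_def by (force dest: less_INF_D)
next
  assume none: "\<forall>s\<in>{1..t}. X s \<omega> \<notin> S"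
  have "enat (Suc t) \<le> first_hit X S \<omega>"
    unfolding first_hit_def
  proof (rule INF_greatest)
    fix s assume "s \<in> {s. 1 \<le> s \<and> X s \<omega> \<in> S}"
    with none have "\<not> s \<le> t" by auto
    then show "enat (Suc t) \<le> enat s" by simp
  qed
  then show "enat t < first_hit X S \<omega>"
    by (simp add: Suc_ile_eq)
qed

lemma first_hit_pos: "0 < first_hit X S \<omega>"
  using less_first_hit_iff[of 0 X S \<omega>] by (simp add: zero_enat_def)

lemma first_hit_eq_Suc_iff:
  "first_hit X S \<omega> = enat (Suc t) \<longleftrightarrow> enat t < first_hit X S \<omega> \<and> X (Suc t) \<omega> \<in> S"
proof -
  have "first_hit X S \<omega> = enat (Suc t) \<longleftrightarrow> enat t < first_hit X S \<omega> \<and> \<not> enat (Suc t) < first_hit X S \<omega>"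
    by (cases "first_hit X S \<omega>") auto
  also have "\<dots> \<longleftrightarrow> enat t < first_hit X S \<omega> \<and> X (Suc t) \<omega> \<in> S"
    unfolding less_first_hit_iff by (auto simp: atLeastAtMostSuc_conv)
  finally show ?thesis .
qed

section \<open>Independence of the past and the next step\<close>

lemma suminf_shift_ennreal: "f 0 = 0 \<Longrightarrow> (\<Sum>n. f n) = (\<Sum>n. f (Suc n) :: ennreal)"
  using sums_Suc[of f "\<Sum>n. f (Suc n)"] by (simp add: sums_unique[symmetric] summable_sums)

lemma restrict_in_space_PiM: "restrict f I \<in> space (PiM I (\<lambda>_. borel))"
  by (simp add: space_PiM)

lemma sets_past_next:
  assumes A: "A \<in> sets (PiM {1..t} (\<lambda>_. borel))" and B: "B \<in> sets borel"
  shows "{f \<in> space (PiM {1..} (\<lambda>_. borel :: 'b::topological_space measure)).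
      restrict f {1..t} \<in> A \<and> f (Suc t) \<in> B} \<in> sets (PiM {1::nat..} (\<lambda>_. borel))"
proof -
  have 1: "(\<lambda>f. restrict f {1..t}) \<in> measurable (PiM {1..} (\<lambda>_. borel)) (PiM {1..t} (\<lambda>_. borel :: 'b measure))"
    by (rule measurable_restrict_subset) auto
  have 2: "(\<lambda>f. f (Suc t)) \<in> measurable (PiM {1..} (\<lambda>_. borel)) (borel :: 'b measure)"
    by (rule measurable_component_singleton) auto
  have "{f \<in> space (PiM {1..} (\<lambda>_. borel :: 'b measure)). restrict f {1..t} \<in> A \<and> f (Suc t) \<in> B}
     = ((\<lambda>f. restrict f {1..t}) -` A \<inter> space (PiM {1..} (\<lambda>_. borel :: 'b measure)))
       \<inter> ((\<lambda>f. f (Suc t)) -` B \<inter> space (PiM {1..} (\<lambda>_. borel :: 'b measure)))"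
    by (auto simp del: space_borel)
  then show ?thesis
    using measurable_sets[OF 1 A] measurable_sets[OF 2 B] by auto
qed

text \<open>Restrictions of an independent family to disjoint index sets are independent; the next
  value is treated as a function on the one-point index set \<open>{Suc t}\<close>.\<close>

lemma (in prob_space) indep_past_next:
  fixes Z :: "nat \<Rightarrow> 'a \<Rightarrow> 'b::topological_space"
  assumes ind: "indep_vars (\<lambda>_. borel) Z {1..}"
    and A: "A \<in> sets (PiM {1..t} (\<lambda>_. borel))" and B: "B \<in> sets borel"
  shows "prob {\<omega> \<in> space M. (\<lambda>s\<in>{1..t}. Z s \<omega>) \<in> A \<and> Z (Suc t) \<omega> \<in> B}
    = prob {\<omega> \<in> space M. (\<lambda>s\<in>{1..t}. Z s \<omega>) \<in> A} * prob {\<omega> \<in> space M. Z (Suc t) \<omega> \<in> B}"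
proof -
  let ?B = "{f \<in> space (PiM {Suc t} (\<lambda>_. borel :: 'b measure)). f (Suc t) \<in> B}"
  have r: "(\<lambda>s\<in>{Suc t}. Z s \<omega>) \<in> space (PiM {Suc t} (\<lambda>_. borel))" for \<omega>
    by (rule restrict_in_space_PiM)
  have "indep_var (PiM {1..t} (\<lambda>_. borel)) (\<lambda>\<omega>. \<lambda>s\<in>{1..t}. Z s \<omega>)
      (PiM {Suc t} (\<lambda>_. borel)) (\<lambda>\<omega>. \<lambda>s\<in>{Suc t}. Z s \<omega>)"
    by (rule indep_var_restrict[OF ind]) auto
  moreover have "?B \<in> sets (PiM {Suc t} (\<lambda>_. borel))"
    using B by measurable
  ultimately have "prob ((\<lambda>\<omega>. (\<lambda>s\<in>{1..t}. Z s \<omega>, \<lambda>s\<in>{Suc t}. Z s \<omega>)) -` (A \<times> ?B) \<inter> space M)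
      = prob ((\<lambda>\<omega>. \<lambda>s\<in>{1..t}. Z s \<omega>) -` A \<inter> space M) * prob ((\<lambda>\<omega>. \<lambda>s\<in>{Suc t}. Z s \<omega>) -` ?B \<inter> space M)"
    by (rule indep_varD[OF _ A])
  moreover have "(\<lambda>\<omega>. (\<lambda>s\<in>{1..t}. Z s \<omega>, \<lambda>s\<in>{Suc t}. Z s \<omega>)) -` (A \<times> ?B) \<inter> space M
      = {\<omega> \<in> space M. (\<lambda>s\<in>{1..t}. Z s \<omega>) \<in> A \<and> Z (Suc t) \<omega> \<in> B}"
    "(\<lambda>\<omega>. \<lambda>s\<in>{Suc t}. Z s \<omega>) -` ?B \<inter> space M = {\<omega> \<in> space M. Z (Suc t) \<omega> \<in> B}"
    "(\<lambda>\<omega>. \<lambda>s\<in>{1..t}. Z s \<omega>) -` A \<inter> space M = {\<omega> \<in> space M. (\<lambda>s\<in>{1..t}. Z s \<omega>) \<in> A}"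
    using r by (auto simp del: space_borel)
  ultimately show ?thesis by simp
qed

locale reset_chain = prob_space M
  for M :: "'a measure" and al :: "nat \<Rightarrow> 'a \<Rightarrow> real" and b :: real
    and xi :: "nat \<Rightarrow> 'a \<Rightarrow> 'v::euclidean_space" and D :: "'v set"
    and La :: "real measure" and Lx :: "'v measure" +
  assumes al_rv: "\<And>t. 1 \<le> t \<Longrightarrow> al t \<in> borel_measurable M"
    and xi_rv: "\<And>t. 1 \<le> t \<Longrightarrow> xi t \<in> borel_measurable M"
    and al_law: "\<And>t. 1 \<le> t \<Longrightarrow> distr M borel (al t) = La"
    and xi_law: "\<And>t. 1 \<le> t \<Longrightarrow> distr M borel (xi t) = Lx"
    and al_indep: "indep_vars (\<lambda>_. borel) al {1..}"
    and xi_indep: "indep_vars (\<lambda>_. borel) xi {1..}"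
    and al_xi_indep: "indep_rv M (PiM {1..} (\<lambda>_. borel)) (\<lambda>\<omega>. \<lambda>t\<in>{1..}. al t \<omega>)
        (PiM {1..} (\<lambda>_. borel)) (\<lambda>\<omega>. \<lambda>t\<in>{1..}. xi t \<omega>)"
    and D_meas [measurable]: "D \<in> sets borel"
    and zero_in_D: "0 \<in> D"
begin

abbreviation X :: "nat \<Rightarrow> 'a \<Rightarrow> 'v" where "X \<equiv> X_proc al b xi"

abbreviation \<tau> :: "'a \<Rightarrow> enat" where "\<tau> \<equiv> first_hit X D"

lemma al_rv_Suc [measurable]: "al (Suc t) \<in> borel_measurable M" by (rule al_rv) simp
lemma xi_rv_Suc [measurable]: "xi (Suc t) \<in> borel_measurable M" by (rule xi_rv) simp

lemma prob_space_La: "prob_space La" and sets_La [simp, measurable_cong]: "sets La = sets borel"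
  and prob_space_Lx: "prob_space Lx" and sets_Lx [simp, measurable_cong]: "sets Lx = sets borel"
  using prob_space_distr[OF al_rv_Suc[of 0]] prob_space_distr[OF xi_rv_Suc[of 0]]
    al_law[of "Suc 0"] xi_law[of "Suc 0"] by auto

sublocale La: prob_space La by (rule prob_space_La)
sublocale Lx: prob_space Lx by (rule prob_space_Lx)
sublocale L: pair_prob_space La Lx ..

definition past :: "nat \<Rightarrow> 'a \<Rightarrow> (nat \<Rightarrow> real) \<times> (nat \<Rightarrow> 'v)" where
  "past t \<omega> = (\<lambda>s\<in>{1..t}. al s \<omega>, \<lambda>s\<in>{1..t}. xi s \<omega>)"

text \<open>The information in the first \<open>t\<close> multipliers and innovations. Measurability
  with respect to it takes the place of adaptedness to a filtration.\<close>

definition F :: "nat \<Rightarrow> 'a measure" where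
  "F t = vimage_algebra (space M) (past t) (PiM {1..t} (\<lambda>_. borel) \<Otimes>\<^sub>M PiM {1..t} (\<lambda>_. borel))"

lemma space_F [simp]: "space (F t) = space M"
  by (simp add: F_def)

lemma past_measurable: "past t \<in> measurable (F t) (PiM {1..t} (\<lambda>_. borel) \<Otimes>\<^sub>M PiM {1..t} (\<lambda>_. borel))"
  unfolding F_def
  by (rule measurable_vimage_algebra1) (auto simp: past_def space_pair_measure space_PiM)

lemma past_measurable_M: "past t \<in> measurable M (PiM {1..t} (\<lambda>_. borel) \<Otimes>\<^sub>M PiM {1..t} (\<lambda>_. borel))"
  unfolding past_def using al_rv xi_rv
  by (intro measurable_Pair measurable_restrict) auto

lemma sets_F_le: "sets (F t) \<subseteq> sets M"
  unfolding F_def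
  by (rule sets_vimage_algebra2[THEN ord_eq_le_trans])
     (use past_measurable_M[of t] in \<open>auto simp: measurable_space dest: measurable_sets\<close>)

lemma measurable_F_imp_M: "V \<in> measurable (F t) L \<Longrightarrow> V \<in> measurable M L"
  using sets_F_le[of t] by (auto simp: measurable_def)

lemma al_measurable_F: "s \<in> {1..t} \<Longrightarrow> al s \<in> borel_measurable (F t)"
proof -
  assume s: "s \<in> {1..t}"
  have "(\<lambda>\<omega>. fst (past t \<omega>) s) \<in> borel_measurable (F t)"
    using measurable_compose[OF measurable_compose[OF past_measurable measurable_fst] measurable_component_singleton[OF s]] .
  then show ?thesis using s by (simp add: past_def)
qed

lemma xi_measurable_F: "s \<in> {1..t} \<Longrightarrow> xi s \<in> borel_measurable (F t)"
proof -
  assume s: "s \<in> {1..t}"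
  have "(\<lambda>\<omega>. snd (past t \<omega>) s) \<in> borel_measurable (F t)"
    using measurable_compose[OF measurable_compose[OF past_measurable measurable_snd] measurable_component_singleton[OF s]] .
  then show ?thesis using s by (simp add: past_def)
qed

lemma X_measurable_F: "s \<le> t \<Longrightarrow> X s \<in> borel_measurable (F t)"
proof (induction s)
  case (Suc s)
  have [measurable]: "al (Suc s) \<in> borel_measurable (F t)" "xi (Suc s) \<in> borel_measurable (F t)"
    "X s \<in> borel_measurable (F t)"
    using Suc al_measurable_F[of "Suc s" t] xi_measurable_F[of "Suc s" t] by auto
  show ?case unfolding X_proc.simps[abs_def] by measurable
next
  case 0
  have "X 0 = (\<lambda>_. 0)" by auto
  then show ?case by simp
qed

lemma X_measurable [measurable]: "X t \<in> borel_measurable M"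
  by (rule measurable_F_imp_M[OF X_measurable_F[OF order_refl]])

lemma tau_gt_measurable_F: "Measurable.pred (F t) (\<lambda>\<omega>. enat t < \<tau> \<omega>)"
proof -
  have [measurable]: "X s \<in> borel_measurable (F t)" if "s \<in> {1..t}" for s
    using that by (intro X_measurable_F) auto
  show ?thesis unfolding less_first_hit_iff by measurable
qed

lemma tau_gt_measurable [measurable]: "Measurable.pred M (\<lambda>\<omega>. enat t < \<tau> \<omega>)"
  by (rule measurable_F_imp_M[OF tau_gt_measurable_F])

lemma tau_measurable [measurable]: "\<tau> \<in> measurable M (count_space UNIV)"
proof (rule measurable_compose_countable'[where I="UNIV" and f="\<lambda>x _. x" and g=\<tau>, simplified])
  have "\<tau> -` {x} \<inter> space M \<in> sets M" for x
  proof (cases x)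
    case (enat n)
    show ?thesis
    proof (cases n)
      case 0
      then have "\<tau> -` {x} \<inter> space M = {}"
        using enat first_hit_pos[of X D] by (auto simp: zero_enat_def[symmetric])
      then show ?thesis by simp
    next
      case (Suc t)
      then have "\<tau> -` {x} \<inter> space M = {\<omega> \<in> space M. enat t < \<tau> \<omega> \<and> X (Suc t) \<omega> \<in> D}"
        using enat by (auto simp: first_hit_eq_Suc_iff)
      then show ?thesis by simp
    qed
  next
    case infinity
    have "\<tau> \<omega> = \<infinity> \<longleftrightarrow> (\<forall>t. enat t < \<tau> \<omega>)" for \<omega> by (cases "\<tau> \<omega>") auto
    then have "\<tau> -` {x} \<inter> space M = {\<omega> \<in> space M. \<forall>t. enat t < \<tau> \<omega>}"
      using infinity by auto
    then show ?thesis by simp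
  qed
  then show "\<tau> \<in> measurable M (count_space UNIV)"
    by (subst measurable_count_space_eq_countable) auto
qed auto

text \<open>Three independences are combined: of the multipliers, of the innovations, and of the two
  sequences from each other. They give the product formula for rectangles of past events and of
  next-step events. Both classes are intersection-stable, so it extends to the generated
  sigma-algebras.\<close>

lemma indep_F_next:
  assumes A: "A \<in> sets (F t)" and S: "S \<in> sets (borel \<Otimes>\<^sub>M borel)"
  shows "prob (A \<inter> ((\<lambda>\<omega>. (al (Suc t) \<omega>, xi (Suc t) \<omega>)) -` S \<inter> space M))
    = prob A * prob ((\<lambda>\<omega>. (al (Suc t) \<omega>, xi (Suc t) \<omega>)) -` S \<inter> space M)"
proof -
  define P1 where "P1 = {{\<omega> \<in> space M. (\<lambda>s\<in>{1..t}. al s \<omega>) \<in> A \<and> (\<lambda>s\<in>{1..t}. xi s \<omega>) \<in> B} | A B.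
      A \<in> sets (PiM {1..t} (\<lambda>_. borel :: real measure)) \<and> B \<in> sets (PiM {1..t} (\<lambda>_. borel :: 'v measure))}"
  define P2 where "P2 = {{\<omega> \<in> space M. al (Suc t) \<omega> \<in> A \<and> xi (Suc t) \<omega> \<in> B} | A B.
      A \<in> sets borel \<and> B \<in> sets borel}"
  have [measurable]: "(\<lambda>\<omega>. \<lambda>s\<in>{1..t}. al s \<omega>) \<in> measurable M (PiM {1..t} (\<lambda>_. borel))"
    "(\<lambda>\<omega>. \<lambda>s\<in>{1..t}. xi s \<omega>) \<in> measurable M (PiM {1..t} (\<lambda>_. borel))"
    using al_rv xi_rv by (intro measurable_restrict; simp)+
  have prod: "prob {\<omega> \<in> space M. (\<lambda>t\<in>{1..}. al t \<omega>) \<in> U \<and> (\<lambda>t\<in>{1..}. xi t \<omega>) \<in> W}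
      = prob {\<omega> \<in> space M. (\<lambda>t\<in>{1..}. al t \<omega>) \<in> U} * prob {\<omega> \<in> space M. (\<lambda>t\<in>{1..}. xi t \<omega>) \<in> W}"
    if "U \<in> sets (PiM {1..} (\<lambda>_. borel))" "W \<in> sets (PiM {1..} (\<lambda>_. borel))" for U W
  proof -
    have "prob (((\<lambda>\<omega>. \<lambda>t\<in>{1..}. al t \<omega>) -` U \<inter> space M) \<inter> ((\<lambda>\<omega>. \<lambda>t\<in>{1..}. xi t \<omega>) -` W \<inter> space M))
        = prob ((\<lambda>\<omega>. \<lambda>t\<in>{1..}. al t \<omega>) -` U \<inter> space M) * prob ((\<lambda>\<omega>. \<lambda>t\<in>{1..}. xi t \<omega>) -` W \<inter> space M)"
      by (rule indep_setD[OF al_xi_indep[unfolded indep_rv_def, THEN conjunct2, THEN conjunct2]])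
         (use that in auto)
    then show ?thesis by (simp add: vimage_def Int_def conj_ac)
  qed
  \<comment> \<open>Separates multipliers from innovations; each factor is an event of one sequence
    up to time \<open>Suc t\<close>, which is split at \<open>t\<close> afterwards.\<close>
  have prod': "prob {\<omega> \<in> space M. ((\<lambda>s\<in>{1..t}. al s \<omega>) \<in> A1 \<and> al (Suc t) \<omega> \<in> B1) \<and> ((\<lambda>s\<in>{1..t}. xi s \<omega>) \<in> A2 \<and> xi (Suc t) \<omega> \<in> B2)}
      = prob {\<omega> \<in> space M. (\<lambda>s\<in>{1..t}. al s \<omega>) \<in> A1 \<and> al (Suc t) \<omega> \<in> B1}
      * prob {\<omega> \<in> space M. (\<lambda>s\<in>{1..t}. xi s \<omega>) \<in> A2 \<and> xi (Suc t) \<omega> \<in> B2}"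
    if [measurable]: "A1 \<in> sets (PiM {1..t} (\<lambda>_. borel))" "A2 \<in> sets (PiM {1..t} (\<lambda>_. borel))"
      "B1 \<in> sets borel" "B2 \<in> sets borel" for A1 A2 B1 B2
  proof -
    have re: "restrict (\<lambda>t\<in>{1..}. f t) {1..t} = restrict f {1..t}" for f :: "nat \<Rightarrow> 'z"
      by (auto simp: restrict_def)
    show ?thesis
      using prod[of "{f \<in> space (PiM {1..} (\<lambda>_. borel)). restrict f {1..t} \<in> A1 \<and> f (Suc t) \<in> B1}"
                    "{f \<in> space (PiM {1..} (\<lambda>_. borel)). restrict f {1..t} \<in> A2 \<and> f (Suc t) \<in> B2}",
        OF sets_past_next[OF that(1,3)] sets_past_next[OF that(2,4)]]
      by (simp add: re restrict_in_space_PiM conj_assoc del: space_borel)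
  qed
  have "indep_set P1 P2"
  proof (rule indep_setI)
    show "P1 \<subseteq> events" "P2 \<subseteq> events" by (auto simp: P1_def P2_def simp del: One_nat_def)
    fix a c assume "a \<in> P1" "c \<in> P2"
    then obtain A1 A2 B1 B2 where a: "a = {\<omega> \<in> space M. (\<lambda>s\<in>{1..t}. al s \<omega>) \<in> A1 \<and> (\<lambda>s\<in>{1..t}. xi s \<omega>) \<in> A2}"
      and c: "c = {\<omega> \<in> space M. al (Suc t) \<omega> \<in> B1 \<and> xi (Suc t) \<omega> \<in> B2}"
      and S: "A1 \<in> sets (PiM {1..t} (\<lambda>_. borel))" "A2 \<in> sets (PiM {1..t} (\<lambda>_. borel))" "B1 \<in> sets borel" "B2 \<in> sets borel"
      unfolding P1_def P2_def by blast
    have "a \<inter> c = {\<omega> \<in> space M. ((\<lambda>s\<in>{1..t}. al s \<omega>) \<in> A1 \<and> al (Suc t) \<omega> \<in> B1) \<and> ((\<lambda>s\<in>{1..t}. xi s \<omega>) \<in> A2 \<and> xi (Suc t) \<omega> \<in> B2)}"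
      unfolding a c by auto
    then have "prob (a \<inter> c) = prob {\<omega> \<in> space M. (\<lambda>s\<in>{1..t}. al s \<omega>) \<in> A1 \<and> al (Suc t) \<omega> \<in> B1}
        * prob {\<omega> \<in> space M. (\<lambda>s\<in>{1..t}. xi s \<omega>) \<in> A2 \<and> xi (Suc t) \<omega> \<in> B2}"
      using prod'[OF S] by simp
    also have "\<dots> = (prob {\<omega> \<in> space M. (\<lambda>s\<in>{1..t}. al s \<omega>) \<in> A1} * prob {\<omega> \<in> space M. al (Suc t) \<omega> \<in> B1})
        * (prob {\<omega> \<in> space M. (\<lambda>s\<in>{1..t}. xi s \<omega>) \<in> A2} * prob {\<omega> \<in> space M. xi (Suc t) \<omega> \<in> B2})"
      by (simp only: indep_past_next[OF al_indep S(1,3)] indep_past_next[OF xi_indep S(2,4)])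
    also have "\<dots> = (prob {\<omega> \<in> space M. (\<lambda>s\<in>{1..t}. al s \<omega>) \<in> A1} * prob {\<omega> \<in> space M. (\<lambda>s\<in>{1..t}. xi s \<omega>) \<in> A2})
        * (prob {\<omega> \<in> space M. al (Suc t) \<omega> \<in> B1} * prob {\<omega> \<in> space M. xi (Suc t) \<omega> \<in> B2})"
      by simp
    \<comment> \<open>The regrouped factors are recombined by the same formula, with the whole space
      in the two unconstrained places.\<close>
    also have "prob {\<omega> \<in> space M. (\<lambda>s\<in>{1..t}. al s \<omega>) \<in> A1} * prob {\<omega> \<in> space M. (\<lambda>s\<in>{1..t}. xi s \<omega>) \<in> A2} = prob a"
      unfolding a using prod'[OF S(1,2), of UNIV UNIV] by simp
    also have "prob {\<omega> \<in> space M. al (Suc t) \<omega> \<in> B1} * prob {\<omega> \<in> space M. xi (Suc t) \<omega> \<in> B2} = prob c"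
      unfolding c using prod'[of "space (PiM {1..t} (\<lambda>_. borel))" "space (PiM {1..t} (\<lambda>_. borel))" B1 B2] S(3,4)
      by (simp add: restrict_in_space_PiM del: space_borel)
    finally show "prob (a \<inter> c) = prob a * prob c" .
  qed
  moreover have "Int_stable P1"
    unfolding Int_stable_def
  proof (intro ballI)
    fix a c assume "a \<in> P1" "c \<in> P1"
    then obtain A1 A2 B1 B2 where eqs: "a = {\<omega> \<in> space M. (\<lambda>s\<in>{1..t}. al s \<omega>) \<in> A1 \<and> (\<lambda>s\<in>{1..t}. xi s \<omega>) \<in> A2}"
      "c = {\<omega> \<in> space M. (\<lambda>s\<in>{1..t}. al s \<omega>) \<in> B1 \<and> (\<lambda>s\<in>{1..t}. xi s \<omega>) \<in> B2}"
      and S: "A1 \<in> sets (PiM {1..t} (\<lambda>_. borel))" "A2 \<in> sets (PiM {1..t} (\<lambda>_. borel))"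
        "B1 \<in> sets (PiM {1..t} (\<lambda>_. borel))" "B2 \<in> sets (PiM {1..t} (\<lambda>_. borel))"
      unfolding P1_def by blast
    have "a \<inter> c = {\<omega> \<in> space M. (\<lambda>s\<in>{1..t}. al s \<omega>) \<in> A1 \<inter> B1 \<and> (\<lambda>s\<in>{1..t}. xi s \<omega>) \<in> A2 \<inter> B2}"
      unfolding eqs by auto
    then show "a \<inter> c \<in> P1"
      unfolding P1_def using S by (intro CollectI exI[of _ "A1 \<inter> B1"] exI[of _ "A2 \<inter> B2"]) auto
  qed
  moreover have "Int_stable P2"
    unfolding Int_stable_def
  proof (intro ballI)
    fix a c assume "a \<in> P2" "c \<in> P2"
    then obtain A1 A2 B1 B2 where eqs: "a = {\<omega> \<in> space M. al (Suc t) \<omega> \<in> A1 \<and> xi (Suc t) \<omega> \<in> A2}"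
      "c = {\<omega> \<in> space M. al (Suc t) \<omega> \<in> B1 \<and> xi (Suc t) \<omega> \<in> B2}"
      and S: "A1 \<in> sets borel" "A2 \<in> sets borel" "B1 \<in> sets borel" "B2 \<in> sets borel"
      unfolding P2_def by blast
    have "a \<inter> c = {\<omega> \<in> space M. al (Suc t) \<omega> \<in> A1 \<inter> B1 \<and> xi (Suc t) \<omega> \<in> A2 \<inter> B2}"
      unfolding eqs by auto
    then show "a \<inter> c \<in> P2"
      unfolding P2_def using S by (intro CollectI exI[of _ "A1 \<inter> B1"] exI[of _ "A2 \<inter> B2"]) auto
  qed
  ultimately have ind: "indep_set (sigma_sets (space M) P1) (sigma_sets (space M) P2)"
    by (rule indep_set_sigma_sets)
  have P1s: "sets (sigma (space M) P1) = sigma_sets (space M) P1" and P2s: "sets (sigma (space M) P2) = sigma_sets (space M) P2"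
    by (auto intro!: sets_measure_of simp: P1_def P2_def)
  \<comment> \<open>Measurability of \<open>past t\<close> for the sigma-algebra generated by
    \<open>P1\<close> places every event of \<open>F t\<close> in it.\<close>
  have "past t \<in> measurable (sigma (space M) P1) (PiM {1..t} (\<lambda>_. borel) \<Otimes>\<^sub>M PiM {1..t} (\<lambda>_. borel))"
    unfolding past_def
  proof (rule measurable_Pair; rule measurableI)
    fix U assume "U \<in> sets (PiM {1..t} (\<lambda>_. borel :: real measure))"
    then have "{\<omega> \<in> space M. (\<lambda>s\<in>{1..t}. al s \<omega>) \<in> U \<and> (\<lambda>s\<in>{1..t}. xi s \<omega>) \<in> space (PiM {1..t} (\<lambda>_. borel))} \<in> P1"
      unfolding P1_def by blast
    also have "{\<omega> \<in> space M. (\<lambda>s\<in>{1..t}. al s \<omega>) \<in> U \<and> (\<lambda>s\<in>{1..t}. xi s \<omega>) \<in> space (PiM {1..t} (\<lambda>_. borel))}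
        = (\<lambda>x. \<lambda>s\<in>{1..t}. al s x) -` U \<inter> space (sigma (space M) P1)"
      by (auto simp: space_measure_of_conv restrict_in_space_PiM simp del: space_borel)
    finally show "(\<lambda>x. \<lambda>s\<in>{1..t}. al s x) -` U \<inter> space (sigma (space M) P1) \<in> sets (sigma (space M) P1)"
      unfolding P1s by (rule sigma_sets.Basic)
  next
    fix U assume "U \<in> sets (PiM {1..t} (\<lambda>_. borel :: 'v measure))"
    then have "{\<omega> \<in> space M. (\<lambda>s\<in>{1..t}. al s \<omega>) \<in> space (PiM {1..t} (\<lambda>_. borel)) \<and> (\<lambda>s\<in>{1..t}. xi s \<omega>) \<in> U} \<in> P1"
      unfolding P1_def by blast
    also have "{\<omega> \<in> space M. (\<lambda>s\<in>{1..t}. al s \<omega>) \<in> space (PiM {1..t} (\<lambda>_. borel)) \<and> (\<lambda>s\<in>{1..t}. xi s \<omega>) \<in> U}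
        = (\<lambda>x. \<lambda>s\<in>{1..t}. xi s x) -` U \<inter> space (sigma (space M) P1)"
      by (auto simp: space_measure_of_conv restrict_in_space_PiM simp del: space_borel)
    finally show "(\<lambda>x. \<lambda>s\<in>{1..t}. xi s x) -` U \<inter> space (sigma (space M) P1) \<in> sets (sigma (space M) P1)"
      unfolding P1s by (rule sigma_sets.Basic)
  qed (simp_all add: restrict_in_space_PiM del: space_borel)
  then have "(\<lambda>x. x) \<in> measurable (sigma (space M) P1) (F t)"
    unfolding F_def by (intro measurable_vimage_algebra2) (auto simp: space_measure_of_conv)
  from measurable_sets[OF this A] have A': "A \<in> sigma_sets (space M) P1"
    using sets.sets_into_space[OF A] by (simp add: P1s space_measure_of_conv Int_absorb2)
  have "(\<lambda>\<omega>. (al (Suc t) \<omega>, xi (Suc t) \<omega>)) \<in> measurable (sigma (space M) P2) (borel \<Otimes>\<^sub>M borel)"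
  proof (rule measurable_Pair; rule measurableI)
    fix U :: "real set" assume "U \<in> sets borel"
    then have "{\<omega> \<in> space M. al (Suc t) \<omega> \<in> U \<and> xi (Suc t) \<omega> \<in> UNIV} \<in> P2"
      unfolding P2_def by (intro CollectI exI[of _ U] exI[of _ UNIV]) auto
    also have "{\<omega> \<in> space M. al (Suc t) \<omega> \<in> U \<and> xi (Suc t) \<omega> \<in> UNIV} = al (Suc t) -` U \<inter> space (sigma (space M) P2)"
      by (auto simp: space_measure_of_conv)
    finally show "al (Suc t) -` U \<inter> space (sigma (space M) P2) \<in> sets (sigma (space M) P2)"
      unfolding P2s by (rule sigma_sets.Basic)
  next
    fix U :: "'v set" assume "U \<in> sets borel"
    then have "{\<omega> \<in> space M. al (Suc t) \<omega> \<in> UNIV \<and> xi (Suc t) \<omega> \<in> U} \<in> P2"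
      unfolding P2_def by (intro CollectI exI[of _ UNIV] exI[of _ U]) auto
    also have "{\<omega> \<in> space M. al (Suc t) \<omega> \<in> UNIV \<and> xi (Suc t) \<omega> \<in> U} = xi (Suc t) -` U \<inter> space (sigma (space M) P2)"
      by (auto simp: space_measure_of_conv)
    finally show "xi (Suc t) -` U \<inter> space (sigma (space M) P2) \<in> sets (sigma (space M) P2)"
      unfolding P2s by (rule sigma_sets.Basic)
  qed auto
  from measurable_sets[OF this S] have "(\<lambda>\<omega>. (al (Suc t) \<omega>, xi (Suc t) \<omega>)) -` S \<inter> space M \<in> sigma_sets (space M) P2"
    by (simp add: P2s space_measure_of_conv)
  from indep_setD[OF ind A' this] show ?thesis .
qed

lemma law_next: "distr M (borel \<Otimes>\<^sub>M borel) (\<lambda>\<omega>. (al (Suc t) \<omega>, xi (Suc t) \<omega>)) = La \<Otimes>\<^sub>M Lx"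
proof (rule pair_measure_eqI[symmetric])
  fix A B assume AB: "A \<in> sets La" "B \<in> sets Lx"
  then have [measurable]: "A \<in> sets borel" "B \<in> sets borel" by auto
  have a0: "al s \<in> borel_measurable M" and x0: "xi s \<in> borel_measurable M" if "1 \<le> s" for s
    using that al_rv xi_rv by auto
  let ?U = "{f \<in> space (PiM {1..} (\<lambda>_. borel :: real measure)). f (Suc t) \<in> A}"
  let ?W = "{f \<in> space (PiM {1..} (\<lambda>_. borel :: 'v measure)). f (Suc t) \<in> B}"
  have cm: "(\<lambda>f. f (Suc t)) \<in> measurable (PiM {1..} (\<lambda>_. borel)) (borel :: 'z::topological_space measure)"
    by (rule measurable_component_singleton) auto
  have UW: "?U \<in> sets (PiM {1..} (\<lambda>_. borel))" "?W \<in> sets (PiM {1..} (\<lambda>_. borel))"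
    using measurable_sets[OF cm, of A] measurable_sets[OF cm, of B] by (auto simp: vimage_def Int_def conj_ac)
  have "prob (((\<lambda>\<omega>. \<lambda>t\<in>{1..}. al t \<omega>) -` ?U \<inter> space M) \<inter> ((\<lambda>\<omega>. \<lambda>t\<in>{1..}. xi t \<omega>) -` ?W \<inter> space M))
      = prob ((\<lambda>\<omega>. \<lambda>t\<in>{1..}. al t \<omega>) -` ?U \<inter> space M) * prob ((\<lambda>\<omega>. \<lambda>t\<in>{1..}. xi t \<omega>) -` ?W \<inter> space M)"
    by (rule indep_setD[OF al_xi_indep[unfolded indep_rv_def, THEN conjunct2, THEN conjunct2]])
       (use UW in blast)+
  moreover have "((\<lambda>\<omega>. \<lambda>t\<in>{1..}. al t \<omega>) -` ?U \<inter> space M) = al (Suc t) -` A \<inter> space M"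
    "((\<lambda>\<omega>. \<lambda>t\<in>{1..}. xi t \<omega>) -` ?W \<inter> space M) = xi (Suc t) -` B \<inter> space M"
    by (auto simp: space_PiM)
  ultimately have "prob ((al (Suc t) -` A \<inter> space M) \<inter> (xi (Suc t) -` B \<inter> space M))
      = prob (al (Suc t) -` A \<inter> space M) * prob (xi (Suc t) -` B \<inter> space M)" by simp
  moreover have "(\<lambda>\<omega>. (al (Suc t) \<omega>, xi (Suc t) \<omega>)) -` (A \<times> B) \<inter> space M
      = (al (Suc t) -` A \<inter> space M) \<inter> (xi (Suc t) -` B \<inter> space M)" by auto
  ultimately show "emeasure La A * emeasure Lx B
      = emeasure (distr M (borel \<Otimes>\<^sub>M borel) (\<lambda>\<omega>. (al (Suc t) \<omega>, xi (Suc t) \<omega>))) (A \<times> B)"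
    using al_law[of "Suc t"] xi_law[of "Suc t"]
    by (subst emeasure_distr) (auto simp: emeasure_eq_measure ennreal_mult[symmetric] emeasure_distr
          La.emeasure_eq_measure[symmetric] Lx.emeasure_eq_measure[symmetric] dest!: sym[of _ La] sym[of _ Lx])
qed (auto simp: La.sigma_finite_measure_axioms Lx.sigma_finite_measure_axioms intro!: sets_pair_measure_cong)

lemma law_past_next:
  assumes V: "V \<in> measurable (F t) L"
  shows "distr M (L \<Otimes>\<^sub>M (borel \<Otimes>\<^sub>M borel)) (\<lambda>\<omega>. (V \<omega>, (al (Suc t) \<omega>, xi (Suc t) \<omega>)))
    = distr M L V \<Otimes>\<^sub>M (La \<Otimes>\<^sub>M Lx)"
proof (rule pair_measure_eqI[symmetric])
  have VM [measurable]: "V \<in> measurable M L" by (rule measurable_F_imp_M[OF V])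
  interpret V: prob_space "distr M L V" by (rule prob_space_distr[OF VM])
  show "sigma_finite_measure (distr M L V)" "sigma_finite_measure (La \<Otimes>\<^sub>M Lx)"
    by (rule V.sigma_finite_measure_axioms L.sigma_finite_measure_axioms)+
  show "sets (distr M L V \<Otimes>\<^sub>M La \<Otimes>\<^sub>M Lx)
      = sets (distr M (L \<Otimes>\<^sub>M borel \<Otimes>\<^sub>M borel) (\<lambda>\<omega>. (V \<omega>, al (Suc t) \<omega>, xi (Suc t) \<omega>)))"
    by (simp cong: sets_pair_measure_cong)
  fix A B assume A: "A \<in> sets (distr M L V)" and "B \<in> sets (La \<Otimes>\<^sub>M Lx)"
  then have B [measurable]: "B \<in> sets (borel \<Otimes>\<^sub>M borel)" by (simp cong: sets_pair_measure_cong)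
  have A' [measurable]: "A \<in> sets L" using A by simp
  let ?N = "\<lambda>\<omega>. (al (Suc t) \<omega>, xi (Suc t) \<omega>)"
  have "(\<lambda>\<omega>. (V \<omega>, ?N \<omega>)) -` (A \<times> B) \<inter> space M = (V -` A \<inter> space M) \<inter> (?N -` B \<inter> space M)" by auto
  moreover have "V -` A \<inter> space M \<in> sets (F t)" using measurable_sets[OF V A'] by simp
  ultimately have "emeasure M ((\<lambda>\<omega>. (V \<omega>, ?N \<omega>)) -` (A \<times> B) \<inter> space M)
      = emeasure M (V -` A \<inter> space M) * emeasure M (?N -` B \<inter> space M)"
    using indep_F_next[OF _ B] by (simp add: emeasure_eq_measure ennreal_mult)
  then show "emeasure (distr M L V) A * emeasure (La \<Otimes>\<^sub>M Lx) B
      = emeasure (distr M (L \<Otimes>\<^sub>M (borel \<Otimes>\<^sub>M borel)) (\<lambda>\<omega>. (V \<omega>, ?N \<omega>))) (A \<times> B)"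
    unfolding law_next[of t, symmetric] by (simp add: emeasure_distr)
qed

text \<open>Conditioning on the past in the form of Fubini's theorem: the joint law is a product, so
  the next pair is integrated out with the past held fixed.\<close>

lemma nn_integral_next:
  assumes V: "V \<in> measurable (F t) L" and f [measurable]: "f \<in> borel_measurable (L \<Otimes>\<^sub>M (borel \<Otimes>\<^sub>M borel))"
  shows "(\<integral>\<^sup>+\<omega>. f (V \<omega>, (al (Suc t) \<omega>, xi (Suc t) \<omega>)) \<partial>M)
    = (\<integral>\<^sup>+\<omega>. \<integral>\<^sup>+z. f (V \<omega>, z) \<partial>(La \<Otimes>\<^sub>M Lx) \<partial>M)"
proof -
  have VM [measurable]: "V \<in> measurable M L" by (rule measurable_F_imp_M[OF V])
  have [measurable_cong]: "sets (La \<Otimes>\<^sub>M Lx) = sets (borel \<Otimes>\<^sub>M borel)" by (rule sets_pair_measure_cong) auto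
  have "(\<integral>\<^sup>+\<omega>. f (V \<omega>, (al (Suc t) \<omega>, xi (Suc t) \<omega>)) \<partial>M)
      = (\<integral>\<^sup>+y. f y \<partial>distr M (L \<Otimes>\<^sub>M (borel \<Otimes>\<^sub>M borel)) (\<lambda>\<omega>. (V \<omega>, (al (Suc t) \<omega>, xi (Suc t) \<omega>))))"
    by (subst nn_integral_distr) auto
  also have "\<dots> = (\<integral>\<^sup>+v. \<integral>\<^sup>+z. f (v, z) \<partial>(La \<Otimes>\<^sub>M Lx) \<partial>distr M L V)"
    unfolding law_past_next[OF V] by (rule L.nn_integral_fst[symmetric]) measurable
  also have "\<dots> = (\<integral>\<^sup>+\<omega>. \<integral>\<^sup>+z. f (V \<omega>, z) \<partial>(La \<Otimes>\<^sub>M Lx) \<partial>M)"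
    by (subst nn_integral_distr) auto
  finally show ?thesis .
qed

end

section \<open>Markov property, occupation measure and stationarity of the cycle law\<close>

lemma ennreal_divide_mult_cancel: "e \<noteq> 0 \<Longrightarrow> e \<noteq> \<top> \<Longrightarrow> a / e * e = (a::ennreal)"
  by (simp add: mult.commute[of _ e] ennreal_times_divide mult_divide_eq_ennreal[of e a, unfolded mult.commute[of a]])

declare X_proc.simps(2) [simp del]

context reset_chain
begin

text \<open>The transition operator of the chain without reset; a reset is expressed by evaluating
  it at 0.\<close>

definition K :: "('v \<Rightarrow> ennreal) \<Rightarrow> 'v \<Rightarrow> ennreal" where
  "K f x = (\<integral>\<^sup>+z. f (fst z *\<^sub>R x + b *\<^sub>R snd z) \<partial>(La \<Otimes>\<^sub>M Lx))"

lemma K_measurable [measurable]: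
  assumes [measurable]: "f \<in> borel_measurable borel"
  shows "K f \<in> borel_measurable borel"
proof -
  have [measurable_cong]: "sets (La \<Otimes>\<^sub>M Lx) = sets (borel \<Otimes>\<^sub>M borel)" by (rule sets_pair_measure_cong) auto
  show ?thesis unfolding K_def[abs_def] by measurable
qed

lemma markov:
  assumes [measurable]: "f \<in> borel_measurable borel"
  shows "(\<integral>\<^sup>+\<omega>. (if enat t < \<tau> \<omega> then f (X (Suc t) \<omega>) else 0) \<partial>M)
    = (\<integral>\<^sup>+\<omega>. (if enat t < \<tau> \<omega> then K f (X t \<omega>) else 0) \<partial>M)"
proof -
  let ?V = "\<lambda>\<omega>. (X t \<omega>, enat t < \<tau> \<omega>)"
  let ?f = "\<lambda>z. if snd (fst z) then f (fst (snd z) *\<^sub>R fst (fst z) + b *\<^sub>R snd (snd z)) else 0"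
  have V: "?V \<in> measurable (F t) (borel \<Otimes>\<^sub>M count_space UNIV)"
    by (intro measurable_Pair X_measurable_F tau_gt_measurable_F order_refl)
  have "(\<integral>\<^sup>+\<omega>. ?f (?V \<omega>, (al (Suc t) \<omega>, xi (Suc t) \<omega>)) \<partial>M)
      = (\<integral>\<^sup>+\<omega>. \<integral>\<^sup>+z. ?f (?V \<omega>, z) \<partial>(La \<Otimes>\<^sub>M Lx) \<partial>M)"
    by (rule nn_integral_next[OF V]) measurable
  also have "\<dots> = (\<integral>\<^sup>+\<omega>. (if enat t < \<tau> \<omega> then K f (X t \<omega>) else 0) \<partial>M)"
    by (intro nn_integral_cong) (auto simp: K_def)
  finally show ?thesis
    by (simp add: X_proc.simps(2) cong: if_cong)
qed

end

locale stationary_reset_chain = reset_chain +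
  fixes P :: "'b measure"
  assumes P_prob: "prob_space P" and P_sets [simp, measurable_cong]: "sets P = sets borel"
    and P_law: "\<And>B. B \<in> sets borel \<Longrightarrow> emeasure P B = cycle_occupation M X \<tau> B"
begin

sublocale P: prob_space P by (rule P_prob)

definition e :: real where "e = enn2real (mean_time M \<tau>)"

definition w :: "'b \<Rightarrow> 'b" where "w y = (if y \<in> D then 0 else y)"

lemma w_measurable [measurable]: "w \<in> borel_measurable borel"
  unfolding w_def[abs_def] by measurable

lemma mean_time_ge_1: "1 \<le> mean_time M \<tau>"
proof -
  have "1 \<le> ennreal_of_enat (\<tau> \<omega>)" for \<omega>
    using first_hit_pos[of X D \<omega>] ennreal_of_enat_le_iff[of 1 "\<tau> \<omega>"]
    by (metis ennreal_of_enat_1 ileI1 one_eSuc)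
  then have "(\<integral>\<^sup>+\<omega>. 1 \<partial>M) \<le> mean_time M \<tau>"
    unfolding mean_time_def by (intro nn_integral_mono) auto
  then show ?thesis by (simp add: emeasure_space_1)
qed

lemma mean_time_eq: "mean_time M \<tau> = ennreal e"
proof -
  have "emeasure P UNIV = 1" using P.emeasure_space_1 sets_eq_imp_space_eq[OF P_sets] by simp
  \<comment> \<open>With an infinite mean the quotient in \<open>cycle_occupation\<close> would be 0
    on every set, because division by \<open>top\<close> gives 0 in \<open>ennreal\<close>; this
    contradicts total mass 1.\<close>
  then have "mean_time M \<tau> \<noteq> \<top>"
    using P_law[of UNIV] by (auto simp: cycle_occupation_def)
  then show ?thesis by (simp add: e_def top.not_eq_extremum)
qed

lemma e_ge_1: "1 \<le> e"
  using mean_time_ge_1 unfolding mean_time_eq by simp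

lemma tau_finite: "AE \<omega> in M. \<tau> \<omega> \<noteq> \<infinity>"
proof -
  have "AE \<omega> in M. ennreal_of_enat (\<tau> \<omega>) \<noteq> \<infinity>"
  proof (rule nn_integral_PInf_AE)
    show "(\<integral>\<^sup>+\<omega>. ennreal_of_enat (\<tau> \<omega>) \<partial>M) \<noteq> \<infinity>"
      using mean_time_eq unfolding mean_time_def by simp
  qed measurable
  then show ?thesis by eventually_elim (metis ennreal_of_enat_infty)
qed

lemma tau_tail_sum: "(\<Sum>t. ennreal (prob {\<omega> \<in> space M. enat t < \<tau> \<omega>})) = ennreal e"
  unfolding mean_time_eq[symmetric] mean_time_def
  by (subst nn_integral_enat_function) (auto simp: emeasure_eq_measure)

lemma occupation_emeasure:
  assumes [measurable]: "B \<in> sets borel"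
  shows "ennreal e * emeasure P B = (\<Sum>t. \<integral>\<^sup>+\<omega>. (if enat t < \<tau> \<omega> then indicator B (X (Suc t) \<omega>) else 0) \<partial>M)"
proof -
  have [measurable]: "Measurable.pred M (\<lambda>\<omega>. 1 \<le> j \<and> enat j \<le> \<tau> \<omega>)" for j by measurable
  have "ennreal e * emeasure P B
      = (\<integral>\<^sup>+\<omega>. (\<Sum>j. if 1 \<le> j \<and> enat j \<le> \<tau> \<omega> then indicator B (X j \<omega>) else 0) \<partial>M)"
    using e_ge_1 unfolding P_law[OF assms] cycle_occupation_def mean_time_eq
    by (subst mult.commute, intro ennreal_divide_mult_cancel) auto
  \<comment> \<open>The times \<open>j\<close> from 1 to \<open>\<tau>\<close> become
    \<open>t = j - 1\<close>, so that the condition reads \<open>t < \<tau>\<close>, an event known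
    at time \<open>t\<close>.\<close>
  also have "\<dots> = (\<integral>\<^sup>+\<omega>. (\<Sum>t. if enat t < \<tau> \<omega> then indicator B (X (Suc t) \<omega>) else 0) \<partial>M)"
    by (intro nn_integral_cong, subst suminf_shift_ennreal) (auto simp: Suc_ile_eq)
  also have "\<dots> = (\<Sum>t. \<integral>\<^sup>+\<omega>. (if enat t < \<tau> \<omega> then indicator B (X (Suc t) \<omega>) else 0) \<partial>M)"
    by (rule nn_integral_suminf) measurable
  finally show ?thesis .
qed

text \<open>Sum over times and expectation form one integral over the product of the times with the
  probability space. The image of this measure under the state is \<open>e\<close> times
  \<open>P\<close>, which carries the formula from sets to functions.\<close>

lemma occupation:
  assumes [measurable]: "f \<in> borel_measurable borel"
  shows "ennreal e * (\<integral>\<^sup>+y. f y \<partial>P)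
    = (\<Sum>t. \<integral>\<^sup>+\<omega>. (if enat t < \<tau> \<omega> then f (X (Suc t) \<omega>) else 0) \<partial>M)"
proof -
  let ?N = "count_space (UNIV::nat set) \<Otimes>\<^sub>M M"
  let ?i = "\<lambda>z. if enat (fst z) < \<tau> (snd z) then 1 else 0 :: ennreal"
  let ?X = "\<lambda>z. X (Suc (fst z)) (snd z)"
  have [measurable]: "?i \<in> borel_measurable ?N" "?X \<in> borel_measurable ?N"
    by (rule measurable_pair_measure_countable1; simp)+
  define Occ where "Occ = distr (density ?N ?i) borel ?X"
  have Occ: "(\<integral>\<^sup>+y. g y \<partial>Occ) = (\<Sum>t. \<integral>\<^sup>+\<omega>. (if enat t < \<tau> \<omega> then g (X (Suc t) \<omega>) else 0) \<partial>M)"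
    if [measurable]: "g \<in> borel_measurable borel" for g
  proof -
    have "(\<integral>\<^sup>+y. g y \<partial>Occ) = (\<integral>\<^sup>+z. ?i z * g (?X z) \<partial>?N)"
      unfolding Occ_def by (simp add: nn_integral_distr nn_integral_density)
    also have "\<dots> = (\<integral>\<^sup>+t. \<integral>\<^sup>+\<omega>. ?i (t, \<omega>) * g (?X (t, \<omega>)) \<partial>M \<partial>count_space UNIV)"
      by (rule nn_integral_fst[symmetric]) measurable
    also have "\<dots> = (\<Sum>t. \<integral>\<^sup>+\<omega>. ?i (t, \<omega>) * g (?X (t, \<omega>)) \<partial>M)"
      by (rule nn_integral_count_space_nat)
    also have "(\<lambda>t. \<integral>\<^sup>+\<omega>. ?i (t, \<omega>) * g (?X (t, \<omega>)) \<partial>M)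
        = (\<lambda>t. \<integral>\<^sup>+\<omega>. (if enat t < \<tau> \<omega> then g (X (Suc t) \<omega>) else 0) \<partial>M)"
      by (intro ext nn_integral_cong) auto
    finally show ?thesis .
  qed
  have "Occ = scale_measure (ennreal e) P"
  proof (rule measure_eqI)
    fix B assume "B \<in> sets Occ"
    then have [measurable]: "B \<in> sets borel" by (simp add: Occ_def)
    have "emeasure Occ B = (\<integral>\<^sup>+y. indicator B y \<partial>Occ)" by (simp add: Occ_def)
    also have "\<dots> = ennreal e * emeasure P B"
      by (subst Occ) (simp_all add: occupation_emeasure)
    finally show "emeasure Occ B = emeasure (scale_measure (ennreal e) P) B" by simp
  qed (simp add: Occ_def)
  then show ?thesis
    using Occ[OF assms] by (simp add: nn_integral_scale_measure)
qed

text \<open>At time \<open>t + 1\<close> of a cycle the chain either returns, and restarts from 0,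
  or moves on from its state. Returns have total probability 1 and so supply exactly the initial
  term \<open>K f 0\<close> that the shifted sum lacks; the Markov property then advances every term
  by one step.\<close>

lemma stationary:
  assumes f [measurable]: "f \<in> borel_measurable borel"
  shows "(\<integral>\<^sup>+y. f y \<partial>P) = (\<integral>\<^sup>+y. K f (w y) \<partial>P)"
proof -
  let ?a = "\<lambda>t. \<integral>\<^sup>+\<omega>. (if enat t < \<tau> \<omega> then K f (X t \<omega>) else 0) \<partial>M"
  let ?q = "\<lambda>t. emeasure M {\<omega> \<in> space M. \<tau> \<omega> = enat (Suc t)}"
  have "ennreal e * (\<integral>\<^sup>+y. K f (w y) \<partial>P)
      = (\<Sum>t. \<integral>\<^sup>+\<omega>. (if enat t < \<tau> \<omega> then K f (w (X (Suc t) \<omega>)) else 0) \<partial>M)"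
    by (rule occupation) measurable
  also have "\<dots> = (\<Sum>t. K f 0 * ?q t + ?a (Suc t))"
  proof (rule suminf_cong)
    fix t
    have "(\<integral>\<^sup>+\<omega>. (if enat t < \<tau> \<omega> then K f (w (X (Suc t) \<omega>)) else 0) \<partial>M)
        = (\<integral>\<^sup>+\<omega>. K f 0 * indicator {\<omega> \<in> space M. \<tau> \<omega> = enat (Suc t)} \<omega>
            + (if enat (Suc t) < \<tau> \<omega> then K f (X (Suc t) \<omega>) else 0) \<partial>M)"
    proof (rule nn_integral_cong)
      fix \<omega> assume "\<omega> \<in> space M"
      have "enat (Suc t) < \<tau> \<omega> \<longleftrightarrow> enat t < \<tau> \<omega> \<and> X (Suc t) \<omega> \<notin> D"
        unfolding less_first_hit_iff by (auto simp: atLeastAtMostSuc_conv)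
      then show "(if enat t < \<tau> \<omega> then K f (w (X (Suc t) \<omega>)) else 0)
        = K f 0 * indicator {\<omega> \<in> space M. \<tau> \<omega> = enat (Suc t)} \<omega>
            + (if enat (Suc t) < \<tau> \<omega> then K f (X (Suc t) \<omega>) else 0)"
        using \<open>\<omega> \<in> space M\<close> by (auto simp: w_def first_hit_eq_Suc_iff indicator_def)
    qed
    also have "\<dots> = K f 0 * ?q t + ?a (Suc t)"
      by (subst nn_integral_add) (auto simp: nn_integral_cmult_indicator)
    finally show "(\<integral>\<^sup>+\<omega>. (if enat t < \<tau> \<omega> then K f (w (X (Suc t) \<omega>)) else 0) \<partial>M)
        = K f 0 * ?q t + ?a (Suc t)" .
  qed
  also have "\<dots> = K f 0 * (\<Sum>t. ?q t) + (\<Sum>t. ?a (Suc t))"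
    by (simp add: suminf_add[symmetric])
  also have "(\<Sum>t. ?q t) = 1"
  proof -
    have "(\<Sum>t. ?q t) = emeasure M (\<Union>t. {\<omega> \<in> space M. \<tau> \<omega> = enat (Suc t)})"
      by (rule suminf_emeasure) (auto simp: disjoint_family_on_def)
    also have "\<dots> = emeasure M (space M)"
    proof (rule emeasure_eq_AE)
      have "(\<exists>t. \<tau> \<omega> = enat (Suc t)) \<longleftrightarrow> \<tau> \<omega> \<noteq> \<infinity>" for \<omega>
        using first_hit_pos[of X D \<omega>] by (cases "\<tau> \<omega>") (auto simp: zero_enat_def gr0_conv_Suc)
      then show "AE \<omega> in M. (\<omega> \<in> (\<Union>t. {\<omega> \<in> space M. \<tau> \<omega> = enat (Suc t)})) = (\<omega> \<in> space M)"
        using tau_finite by auto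
    qed auto
    finally show ?thesis by (simp add: emeasure_space_1)
  qed
  also have "K f 0 * 1 + (\<Sum>t. ?a (Suc t)) = (\<Sum>t. ?a t)"
  proof -
    have "?a 0 = K f 0"
      using first_hit_pos[of X D] by (simp add: zero_enat_def emeasure_space_1)
    moreover have "(\<lambda>t. ?a t) sums ((\<Sum>t. ?a (Suc t)) + ?a 0)"
      by (rule sums_Suc) (simp add: summable_sums)
    ultimately show ?thesis by (simp add: sums_unique[symmetric] add.commute)
  qed
  also have "\<dots> = ennreal e * (\<integral>\<^sup>+y. f y \<partial>P)"
    by (simp add: occupation markov)
  finally show ?thesis
    using e_ge_1 by (simp add: ennreal_mult_cancel_left)
qed

text \<open>On the null event without return \<open>the_enat\<close> gives an arbitrary time, which
  no integral detects.\<close>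

definition Xstop :: "'a \<Rightarrow> 'b" where "Xstop \<omega> = X (the_enat (\<tau> \<omega>)) \<omega>"

lemma Xstop_measurable [measurable]: "Xstop \<in> borel_measurable M"
  unfolding Xstop_def[abs_def]
  by (rule measurable_compose_countable[where f="\<lambda>n. X n"]) measurable

lemma Xstop_in_D: "\<tau> \<omega> \<noteq> \<infinity> \<Longrightarrow> Xstop \<omega> \<in> D"
proof -
  assume "\<tau> \<omega> \<noteq> \<infinity>"
  then obtain t where "\<tau> \<omega> = enat (Suc t)"
    using first_hit_pos[of X D \<omega>] by (cases "\<tau> \<omega>") (auto simp: zero_enat_def gr0_conv_Suc)
  then show ?thesis using first_hit_eq_Suc_iff[of X D \<omega> t] by (simp add: Xstop_def)
qed

text \<open>Within a cycle \<open>D\<close> is entered at the return time only, so the occupation of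
  a subset of \<open>D\<close> counts just the stopped state. This turns \<open>G\<close> into an
  expectation over \<open>Xstop\<close>.\<close>

lemma stopped_law: "distr M borel Xstop = density P (\<lambda>y. ennreal (e * indicator D y))"
proof (rule measure_eqI)
  fix B assume "B \<in> sets (distr M borel Xstop)"
  then have B [measurable]: "B \<in> sets borel" by simp
  let ?q = "\<lambda>t. {\<omega> \<in> space M. \<tau> \<omega> = enat (Suc t) \<and> X (Suc t) \<omega> \<in> B}"
  have "emeasure (density P (\<lambda>y. ennreal (e * indicator D y))) B = (\<integral>\<^sup>+y. ennreal e * indicator (B \<inter> D) y \<partial>P)"
    using e_ge_1 by (subst emeasure_density)
      (auto intro!: nn_integral_cong simp: ennreal_mult indicator_def)
  also have "\<dots> = ennreal e * emeasure P (B \<inter> D)"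
    by (subst nn_integral_cmult_indicator) auto
  also have "\<dots> = (\<Sum>t. \<integral>\<^sup>+\<omega>. (if enat t < \<tau> \<omega> then indicator (B \<inter> D) (X (Suc t) \<omega>) else 0) \<partial>M)"
    by (rule occupation_emeasure) measurable
  also have "\<dots> = (\<Sum>t. emeasure M (?q t))"
  proof (rule suminf_cong)
    fix t
    have "(\<integral>\<^sup>+\<omega>. (if enat t < \<tau> \<omega> then indicator (B \<inter> D) (X (Suc t) \<omega>) else 0) \<partial>M)
        = (\<integral>\<^sup>+\<omega>. indicator (?q t) \<omega> \<partial>M)"
      by (intro nn_integral_cong) (auto simp: first_hit_eq_Suc_iff indicator_def)
    then show "(\<integral>\<^sup>+\<omega>. (if enat t < \<tau> \<omega> then indicator (B \<inter> D) (X (Suc t) \<omega>) else 0) \<partial>M) = emeasure M (?q t)"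
      by simp
  qed
  also have "\<dots> = emeasure M (\<Union>t. ?q t)"
    by (rule suminf_emeasure) (auto simp: disjoint_family_on_def)
  also have "\<dots> = emeasure M (Xstop -` B \<inter> space M)"
  proof (rule emeasure_eq_AE)
    have "(\<exists>t. \<tau> \<omega> = enat (Suc t) \<and> X (Suc t) \<omega> \<in> B) \<longleftrightarrow> Xstop \<omega> \<in> B" if "\<tau> \<omega> \<noteq> \<infinity>" for \<omega>
      using that first_hit_pos[of X D \<omega>]
      by (cases "\<tau> \<omega>") (auto simp: zero_enat_def gr0_conv_Suc Xstop_def)
    then show "AE \<omega> in M. (\<omega> \<in> (\<Union>t. ?q t)) = (\<omega> \<in> Xstop -` B \<inter> space M)"
      using tau_finite by auto
  qed auto
  finally show "emeasure (distr M borel Xstop) B = emeasure (density P (\<lambda>y. ennreal (e * indicator D y))) B"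
    by (simp add: emeasure_distr)
qed simp

lemma integral_Xstop:
  fixes f :: "'b \<Rightarrow> 'c::{banach, second_countable_topology}"
  assumes [measurable]: "f \<in> borel_measurable borel"
  shows "(\<integral>\<omega>. f (Xstop \<omega>) \<partial>M) = e *\<^sub>R (\<integral>y. indicator D y *\<^sub>R f y \<partial>P)"
proof -
  have "(\<integral>\<omega>. f (Xstop \<omega>) \<partial>M) = (\<integral>y. f y \<partial>distr M borel Xstop)"
    by (subst integral_distr) auto
  also have "\<dots> = (\<integral>y. (e * indicator D y) *\<^sub>R f y \<partial>P)"
    unfolding stopped_law using e_ge_1 by (subst integral_density) auto
  also have "\<dots> = e *\<^sub>R (\<integral>y. indicator D y *\<^sub>R f y \<partial>P)"
    by (simp flip: scaleR_scaleR)
  finally show ?thesis .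
qed

end

context reset_chain
begin

lemma sets_LL [measurable_cong]: "sets (La \<Otimes>\<^sub>M Lx) = sets (borel \<Otimes>\<^sub>M borel)"
  by (rule sets_pair_measure_cong) auto

end

context stationary_reset_chain
begin

lemma stationary_distr:
  "P = distr (P \<Otimes>\<^sub>M (La \<Otimes>\<^sub>M Lx)) borel
      (\<lambda>z. fst (snd z) *\<^sub>R (if fst z \<in> D then 0 else fst z) + b *\<^sub>R snd (snd z))"
    (is "P = distr ?PL borel ?f")
proof (rule measure_eqI)
  have [measurable]: "?f \<in> borel_measurable ?PL" by measurable
  fix B assume "B \<in> sets P"
  then have [measurable]: "B \<in> sets borel" by simp
  have "emeasure P B = (\<integral>\<^sup>+y. indicator B y \<partial>P)" by simp
  also have "\<dots> = (\<integral>\<^sup>+y. K (indicator B) (w y) \<partial>P)"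
    by (rule stationary) measurable
  also have "\<dots> = (\<integral>\<^sup>+y. \<integral>\<^sup>+z. indicator B (?f (y, z)) \<partial>(La \<Otimes>\<^sub>M Lx) \<partial>P)"
    by (simp add: K_def w_def cong: if_cong)
  also have "\<dots> = (\<integral>\<^sup>+z. indicator B (?f z) \<partial>?PL)"
    by (rule L.nn_integral_fst) measurable
  also have "\<dots> = (\<integral>\<^sup>+y. indicator B y \<partial>distr ?PL borel ?f)"
    by (subst nn_integral_distr) auto
  finally show "emeasure P B = emeasure (distr ?PL borel ?f) B" by simp
qed simp

end

section \<open>Second moments of the chain and of its stationary law\<close>

locale moment_chain = stationary_reset_chain +
  assumes al_sq: "integrable La (\<lambda>a. a\<^sup>2)"
    and xi_sq: "integrable Lx (\<lambda>x. (norm x)\<^sup>2)"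
    and xi_mean: "(\<integral>x. x \<partial>Lx) = 0"
    and al_sq_less_1: "(\<integral>a. a\<^sup>2 \<partial>La) < 1"
begin

definition \<alpha>2 :: real where "\<alpha>2 = (\<integral>a. a\<^sup>2 \<partial>La)"
definition s2 :: real where "s2 = (\<integral>x. (norm x)\<^sup>2 \<partial>Lx)"
definition Q :: "'b \<Rightarrow> real" where "Q u = (\<integral>x. (u \<bullet> x)\<^sup>2 \<partial>Lx)"

lemma \<alpha>2_bounds: "0 \<le> \<alpha>2" "\<alpha>2 < 1"
  using al_sq_less_1 by (auto simp: \<alpha>2_def)

lemma s2_nonneg: "0 \<le> s2" by (simp add: s2_def)

lemma int_al: "integrable La (\<lambda>a. a)"
  using La.square_integrable_imp_integrable[OF _ al_sq] by simp

lemma int_xi: "integrable Lx (\<lambda>x. x)"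
proof -
  have "integrable Lx norm" using Lx.square_integrable_imp_integrable[OF _ xi_sq] by simp
  then show ?thesis by (simp add: integrable_norm_iff)
qed

lemma int_xi_inner_sq: "integrable Lx (\<lambda>x. (u \<bullet> x)\<^sup>2)"
proof (rule Bochner_Integration.integrable_bound[OF integrable_mult_right[OF xi_sq, of "(norm u)\<^sup>2"]])
  have "(u \<bullet> x)\<^sup>2 \<le> (norm u)\<^sup>2 * (norm x)\<^sup>2" for x
    using power_mono[OF Cauchy_Schwarz_ineq2[of u x], of 2] by (simp add: power_mult_distrib)
  then show "AE x in Lx. norm ((u \<bullet> x)\<^sup>2) \<le> norm ((norm u)\<^sup>2 * (norm x)\<^sup>2)" by simp
qed simp

lemma nn_integral_shift_sq:
  "(\<integral>\<^sup>+x. ennreal ((norm (v + b *\<^sub>R x))\<^sup>2) \<partial>Lx) = ennreal ((norm v)\<^sup>2 + b\<^sup>2 * s2)"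
proof -
  have eq: "(norm (v + b *\<^sub>R x))\<^sup>2 = (norm v)\<^sup>2 + 2 * b * (v \<bullet> x) + b\<^sup>2 * (norm x)\<^sup>2" for x
    unfolding power2_norm_eq_inner
    by (simp add: inner_add_left inner_add_right inner_commute power2_eq_square algebra_simps)
  have "integrable Lx (\<lambda>x. (norm v)\<^sup>2 + 2 * b * (v \<bullet> x) + b\<^sup>2 * (norm x)\<^sup>2)"
    using int_xi xi_sq by auto
  then have "(\<integral>\<^sup>+x. ennreal ((norm (v + b *\<^sub>R x))\<^sup>2) \<partial>Lx)
      = ennreal (\<integral>x. (norm v)\<^sup>2 + 2 * b * (v \<bullet> x) + b\<^sup>2 * (norm x)\<^sup>2 \<partial>Lx)"
    unfolding eq[symmetric] by (intro nn_integral_eq_integral) auto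
  also have "(\<integral>x. (norm v)\<^sup>2 + 2 * b * (v \<bullet> x) + b\<^sup>2 * (norm x)\<^sup>2 \<partial>Lx) = (norm v)\<^sup>2 + b\<^sup>2 * s2"
    using int_xi xi_sq xi_mean by (simp add: s2_def Lx.prob_space)
  finally show ?thesis .
qed

lemma nn_integral_shift_inner_sq:
  "(\<integral>\<^sup>+x. ennreal ((c + u \<bullet> x)\<^sup>2) \<partial>Lx) = ennreal (c\<^sup>2 + Q u)"
proof -
  have eq: "(c + u \<bullet> x)\<^sup>2 = c\<^sup>2 + 2 * c * (u \<bullet> x) + (u \<bullet> x)\<^sup>2" for x
    by (simp add: power2_eq_square algebra_simps)
  have "integrable Lx (\<lambda>x. c\<^sup>2 + 2 * c * (u \<bullet> x) + (u \<bullet> x)\<^sup>2)"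
    using int_xi int_xi_inner_sq by auto
  then have "(\<integral>\<^sup>+x. ennreal ((c + u \<bullet> x)\<^sup>2) \<partial>Lx) = ennreal (\<integral>x. c\<^sup>2 + 2 * c * (u \<bullet> x) + (u \<bullet> x)\<^sup>2 \<partial>Lx)"
    unfolding eq[symmetric] by (intro nn_integral_eq_integral) auto
  also have "(\<integral>x. c\<^sup>2 + 2 * c * (u \<bullet> x) + (u \<bullet> x)\<^sup>2 \<partial>Lx) = c\<^sup>2 + Q u"
    using int_xi int_xi_inner_sq xi_mean by (simp add: Q_def Lx.prob_space)
  finally show ?thesis .
qed

lemma K_norm_sq: "K (\<lambda>y. ennreal ((norm y)\<^sup>2)) x = ennreal (\<alpha>2 * (norm x)\<^sup>2 + b\<^sup>2 * s2)"
proof -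
  have "K (\<lambda>y. ennreal ((norm y)\<^sup>2)) x
      = (\<integral>\<^sup>+a. \<integral>\<^sup>+y. ennreal ((norm (a *\<^sub>R x + b *\<^sub>R y))\<^sup>2) \<partial>Lx \<partial>La)"
    unfolding K_def by (subst Lx.nn_integral_fst[symmetric]) simp_all
  also have "\<dots> = (\<integral>\<^sup>+a. ennreal (a\<^sup>2 * (norm x)\<^sup>2 + b\<^sup>2 * s2) \<partial>La)"
    unfolding nn_integral_shift_sq by (simp add: power_mult_distrib)
  also have "\<dots> = ennreal (\<integral>a. a\<^sup>2 * (norm x)\<^sup>2 + b\<^sup>2 * s2 \<partial>La)"
    using al_sq s2_nonneg by (intro nn_integral_eq_integral) auto
  also have "(\<integral>a. a\<^sup>2 * (norm x)\<^sup>2 + b\<^sup>2 * s2 \<partial>La) = \<alpha>2 * (norm x)\<^sup>2 + b\<^sup>2 * s2"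
    using al_sq by (simp add: \<alpha>2_def La.prob_space)
  finally show ?thesis .
qed

lemma X_sq_step:
  "(\<integral>\<^sup>+\<omega>. ennreal ((norm (X (Suc t) \<omega>))\<^sup>2) \<partial>M) = (\<integral>\<^sup>+\<omega>. ennreal (\<alpha>2 * (norm (X t \<omega>))\<^sup>2 + b\<^sup>2 * s2) \<partial>M)"
proof -
  let ?f = "\<lambda>z. ennreal ((norm (fst (snd z) *\<^sub>R fst z + b *\<^sub>R snd (snd z)))\<^sup>2)"
  have "(\<integral>\<^sup>+\<omega>. ?f (X t \<omega>, (al (Suc t) \<omega>, xi (Suc t) \<omega>)) \<partial>M) = (\<integral>\<^sup>+\<omega>. \<integral>\<^sup>+z. ?f (X t \<omega>, z) \<partial>(La \<Otimes>\<^sub>M Lx) \<partial>M)"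
    by (rule nn_integral_next[OF X_measurable_F[OF order_refl]]) measurable
  also have "\<dots> = (\<integral>\<^sup>+\<omega>. K (\<lambda>y. ennreal ((norm y)\<^sup>2)) (X t \<omega>) \<partial>M)"
    by (simp add: K_def)
  finally show ?thesis by (simp add: K_norm_sq X_proc.simps(2))
qed

lemma X_sq_finite: "(\<integral>\<^sup>+\<omega>. ennreal ((norm (X t \<omega>))\<^sup>2) \<partial>M) < \<infinity>"
proof (induction t)
  case (Suc t)
  have "(\<integral>\<^sup>+\<omega>. ennreal (\<alpha>2 * (norm (X t \<omega>))\<^sup>2 + b\<^sup>2 * s2) \<partial>M)
      = ennreal \<alpha>2 * (\<integral>\<^sup>+\<omega>. ennreal ((norm (X t \<omega>))\<^sup>2) \<partial>M) + ennreal (b\<^sup>2 * s2)"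
    using \<alpha>2_bounds s2_nonneg
    by (simp add: ennreal_plus ennreal_mult nn_integral_add nn_integral_cmult emeasure_space_1)
  also have "\<dots> < \<infinity>" using Suc by (auto simp: ennreal_mult_less_top)
  finally show ?case unfolding X_sq_step .
qed simp

lemma X_sq_int: "integrable M (\<lambda>\<omega>. (norm (X t \<omega>))\<^sup>2)"
  by (rule integrableI_nonneg) (use X_sq_finite in auto)

text \<open>Stationarity suggests \<open>V \<le> \<alpha>2 * V + b^2 * s2\<close>, which says
  nothing while \<open>V\<close> may be infinite. The sum over the cycle is therefore cut off at
  \<open>N\<close>: the partial sums are finite by induction and satisfy the same recursion.\<close>

lemma P_sq_bound: "(\<integral>\<^sup>+y. ennreal ((norm y)\<^sup>2) \<partial>P) \<le> ennreal (b\<^sup>2 * s2 / (1 - \<alpha>2))"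
proof -
  define n where "n t = (\<integral>\<^sup>+\<omega>. (if enat t < \<tau> \<omega> then ennreal ((norm (X (Suc t) \<omega>))\<^sup>2) else 0) \<partial>M)" for t
  define p where "p t = emeasure M {\<omega> \<in> space M. enat t < \<tau> \<omega>}" for t
  have n_eq: "n t = ennreal \<alpha>2 * (\<integral>\<^sup>+\<omega>. (if enat t < \<tau> \<omega> then ennreal ((norm (X t \<omega>))\<^sup>2) else 0) \<partial>M)
      + ennreal (b\<^sup>2 * s2) * p t" for t
  proof -
    have "n t = (\<integral>\<^sup>+\<omega>. (if enat t < \<tau> \<omega> then ennreal (\<alpha>2 * (norm (X t \<omega>))\<^sup>2 + b\<^sup>2 * s2) else 0) \<partial>M)"
      unfolding n_def by (subst markov) (simp_all add: K_norm_sq cong: if_cong)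
    also have "\<dots> = (\<integral>\<^sup>+\<omega>. ennreal \<alpha>2 * (if enat t < \<tau> \<omega> then ennreal ((norm (X t \<omega>))\<^sup>2) else 0)
        + ennreal (b\<^sup>2 * s2) * indicator {\<omega> \<in> space M. enat t < \<tau> \<omega>} \<omega> \<partial>M)"
      using \<alpha>2_bounds s2_nonneg by (intro nn_integral_cong) (auto simp: ennreal_plus ennreal_mult)
    also have "\<dots> = ennreal \<alpha>2 * (\<integral>\<^sup>+\<omega>. (if enat t < \<tau> \<omega> then ennreal ((norm (X t \<omega>))\<^sup>2) else 0) \<partial>M)
        + ennreal (b\<^sup>2 * s2) * p t"
      by (subst nn_integral_add) (auto simp: nn_integral_cmult nn_integral_cmult_indicator p_def)
    finally show ?thesis .
  qed
  \<comment> \<open>Enlarging the event \<open>\<tau> > t + 1\<close> to \<open>\<tau> > t\<close>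
    gives back \<open>n t\<close>.\<close>
  have n_Suc: "n (Suc t) \<le> ennreal \<alpha>2 * n t + ennreal (b\<^sup>2 * s2) * p (Suc t)" for t
  proof -
    have "(\<integral>\<^sup>+\<omega>. (if enat (Suc t) < \<tau> \<omega> then ennreal ((norm (X (Suc t) \<omega>))\<^sup>2) else 0) \<partial>M) \<le> n t"
      unfolding n_def by (intro nn_integral_mono) (auto intro: less_trans[rotated])
    then show ?thesis unfolding n_eq[of "Suc t"] by (intro add_right_mono mult_left_mono) auto
  qed
  have n_0: "n 0 = ennreal (b\<^sup>2 * s2) * p 0" by (simp add: n_eq cong: if_cong)
  have step: "(\<Sum>t<Suc N. n t) \<le> ennreal \<alpha>2 * (\<Sum>t<N. n t) + ennreal (b\<^sup>2 * s2) * (\<Sum>t<Suc N. p t)" for N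
  proof (induction N)
    case (Suc N)
    have "(\<Sum>t<Suc (Suc N). n t) = (\<Sum>t<Suc N. n t) + n (Suc N)" by simp
    also have "\<dots> \<le> (ennreal \<alpha>2 * (\<Sum>t<N. n t) + ennreal (b\<^sup>2 * s2) * (\<Sum>t<Suc N. p t))
        + (ennreal \<alpha>2 * n N + ennreal (b\<^sup>2 * s2) * p (Suc N))"
      by (intro add_mono Suc n_Suc)
    also have "\<dots> = ennreal \<alpha>2 * (\<Sum>t<Suc N. n t) + ennreal (b\<^sup>2 * s2) * (\<Sum>t<Suc (Suc N). p t)"
      by (simp add: distrib_left add_ac)
    finally show ?case .
  qed (simp add: n_0)
  have psum: "(\<Sum>t<N. p t) \<le> ennreal e" for N
    unfolding tau_tail_sum[symmetric] p_def emeasure_eq_measure by (intro sum_le_suminf) auto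
  \<comment> \<open>The fixed point of \<open>x = \<alpha>2 * x + b^2 * s2 * e\<close>, so that the
    recursion preserves the bound; dividing by \<open>e\<close> gives the claim.\<close>
  define C where "C = b\<^sup>2 * s2 * e / (1 - \<alpha>2)"
  have C: "0 \<le> C" "\<alpha>2 * C + b\<^sup>2 * s2 * e = C"
    using \<alpha>2_bounds s2_nonneg e_ge_1 by (auto simp: C_def field_simps)
  have bound: "(\<Sum>t<N. n t) \<le> ennreal C" for N
  proof (induction N)
    case (Suc N)
    have "(\<Sum>t<Suc N. n t) \<le> ennreal \<alpha>2 * (\<Sum>t<N. n t) + ennreal (b\<^sup>2 * s2) * (\<Sum>t<Suc N. p t)"
      by (rule step)
    also have "\<dots> \<le> ennreal \<alpha>2 * ennreal C + ennreal (b\<^sup>2 * s2) * ennreal e"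
      by (intro add_mono mult_left_mono Suc psum) auto
    also have "\<dots> = ennreal (\<alpha>2 * C + b\<^sup>2 * s2 * e)"
      using C \<alpha>2_bounds s2_nonneg e_ge_1 by (simp add: ennreal_mult[symmetric] ennreal_plus[symmetric] del: ennreal_plus)
    finally show ?case unfolding C(2) .
  qed simp
  have "ennreal e * (\<integral>\<^sup>+y. ennreal ((norm y)\<^sup>2) \<partial>P) = (\<Sum>t. n t)"
    unfolding n_def by (rule occupation) measurable
  also have "\<dots> \<le> ennreal C" by (intro suminf_le_const summableI bound)
  also have "ennreal C = ennreal e * ennreal (b\<^sup>2 * s2 / (1 - \<alpha>2))"
    using e_ge_1 \<alpha>2_bounds s2_nonneg by (simp add: C_def ennreal_mult[symmetric] mult_ac)
  finally show ?thesis
    using e_ge_1 by (simp add: ennreal_mult_le_mult_iff)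
qed

lemma P_sq_int: "integrable P (\<lambda>y. (norm y)\<^sup>2)"
  by (rule integrableI_nonneg)
     (use P_sq_bound in \<open>auto simp: top.extremum_strict less_top[symmetric] top_unique\<close>)

lemma P_sq_le: "(\<integral>y. (norm y)\<^sup>2 \<partial>P) \<le> b\<^sup>2 * s2 / (1 - \<alpha>2)"
proof -
  have "ennreal (\<integral>y. (norm y)\<^sup>2 \<partial>P) = (\<integral>\<^sup>+y. ennreal ((norm y)\<^sup>2) \<partial>P)"
    by (rule nn_integral_eq_integral[symmetric]) (auto intro: P_sq_int)
  also have "\<dots> \<le> ennreal (b\<^sup>2 * s2 / (1 - \<alpha>2))" by (rule P_sq_bound)
  finally show ?thesis
    using \<alpha>2_bounds s2_nonneg by (subst (asm) ennreal_le_iff) auto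
qed

sublocale reset_law: reset_law La Lx P D b
  by unfold_locales (use al_sq xi_sq P_sq_int xi_mean stationary_distr in auto)

lemma G_eq: "e * reset_law.G u = (CLINT \<omega>|M. iexp (u \<bullet> Xstop \<omega>) - 1 - \<i> * (u \<bullet> Xstop \<omega>))"
  by (subst integral_Xstop[of "\<lambda>y. iexp (u \<bullet> y) - 1 - \<i> * (u \<bullet> y)"])
     (auto simp: reset_law.G_def scaleR_conv_of_real)

lemma X_1: "X (Suc 0) \<omega> = b *\<^sub>R xi (Suc 0) \<omega>"
  by (simp add: X_proc.simps(2))

lemma xi_sq_int: "integrable M (\<lambda>\<omega>. (norm (xi (Suc t) \<omega>))\<^sup>2)"
  using xi_sq integrable_distr_eq[of "xi (Suc t)" M borel "\<lambda>x. (norm x)\<^sup>2"]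
  by (simp add: xi_law)

lemma xi_sq_expectation: "expectation (\<lambda>\<omega>. (norm (xi (Suc t) \<omega>))\<^sup>2) = s2"
  using integral_distr[of "xi (Suc t)" M borel "\<lambda>x. (norm x)\<^sup>2"]
  by (simp add: xi_law s2_def)

lemma int_indicator_tau: "integrable M (indicat_real {\<omega> \<in> space M. enat k < \<tau> \<omega>})"
  by (rule integrable_const_bound[where B=1]) auto

lemma norm_Xstop_less:
  assumes "D \<subseteq> ball 0 \<rho>"
  shows "AE \<omega> in M. norm (Xstop \<omega>) < \<rho>"
  using tau_finite
proof eventually_elim
  case (elim \<omega>)
  show ?case using subsetD[OF assms Xstop_in_D[OF elim]] by simp
qed

lemma Xstop_sq_int:
  assumes "D \<subseteq> ball 0 \<rho>"
  shows "integrable M (\<lambda>\<omega>. (norm (Xstop \<omega>))\<^sup>2)"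
proof (rule integrable_const_bound[where B="\<rho>\<^sup>2"])
  show "AE \<omega> in M. norm ((norm (Xstop \<omega>))\<^sup>2) \<le> \<rho>\<^sup>2"
    using norm_Xstop_less[OF assms] by eventually_elim (simp add: power_mono)
qed simp

lemma Xstop_sq_tail:
  assumes "D \<subseteq> ball 0 \<rho>"
  shows "expectation (\<lambda>\<omega>. (norm (Xstop \<omega>))\<^sup>2 * indicator {\<omega> \<in> space M. enat k < \<tau> \<omega>} \<omega>)
    \<le> \<rho>\<^sup>2 * prob {\<omega> \<in> space M. enat k < \<tau> \<omega>}"
proof -
  have "expectation (\<lambda>\<omega>. (norm (Xstop \<omega>))\<^sup>2 * indicator {\<omega> \<in> space M. enat k < \<tau> \<omega>} \<omega>)
      \<le> expectation (\<lambda>\<omega>. \<rho>\<^sup>2 * indicator {\<omega> \<in> space M. enat k < \<tau> \<omega>} \<omega>)"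
  proof (rule integral_mono_AE)
    show "AE \<omega> in M. (norm (Xstop \<omega>))\<^sup>2 * indicator {\<omega> \<in> space M. enat k < \<tau> \<omega>} \<omega>
        \<le> \<rho>\<^sup>2 * indicator {\<omega> \<in> space M. enat k < \<tau> \<omega>} \<omega>"
      using norm_Xstop_less[OF assms] by eventually_elim (auto simp: indicator_def power_mono)
    show "integrable M (\<lambda>\<omega>. (norm (Xstop \<omega>))\<^sup>2 * indicator {\<omega> \<in> space M. enat k < \<tau> \<omega>} \<omega>)"
      by (rule integrable_real_mult_indicator) (auto intro: Xstop_sq_int[OF assms])
  qed (intro integrable_mult_right int_indicator_tau)
  then show ?thesis by simp
qed

text \<open>A cycle of more than one step needs a first state outside the inner ball, and that state
  is \<open>b\<close> times the first innovation. Chebyshev's inequality is applied with the moment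
  truncated to this event, which is small when \<open>r\<close> is large compared with
  \<open>b\<close>.\<close>

lemma prob_tau_gt_le:
  assumes r: "0 < r" "ball 0 r \<subseteq> D" and k: "1 \<le> k"
  shows "prob {\<omega> \<in> space M. enat k < \<tau> \<omega>}
    \<le> b\<^sup>2 / r\<^sup>2 * expectation (\<lambda>\<omega>. (norm (xi (Suc 0) \<omega>))\<^sup>2 * indicator {\<omega> \<in> space M. r \<le> \<bar>b\<bar> * norm (xi (Suc 0) \<omega>)} \<omega>)"
proof -
  have ind: "integrable M (\<lambda>\<omega>. (norm (xi (Suc 0) \<omega>))\<^sup>2 * indicator {\<omega> \<in> space M. r \<le> \<bar>b\<bar> * norm (xi (Suc 0) \<omega>)} \<omega>)"
    by (rule integrable_real_mult_indicator) (auto intro: xi_sq_int)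
  have "prob {\<omega> \<in> space M. enat k < \<tau> \<omega>} = expectation (indicator {\<omega> \<in> space M. enat k < \<tau> \<omega>})" by simp
  also have "\<dots> \<le> expectation (\<lambda>\<omega>. b\<^sup>2 / r\<^sup>2 * ((norm (xi (Suc 0) \<omega>))\<^sup>2 * indicator {\<omega> \<in> space M. r \<le> \<bar>b\<bar> * norm (xi (Suc 0) \<omega>)} \<omega>))"
  proof (rule integral_mono)
    fix \<omega> assume \<omega>: "\<omega> \<in> space M"
    have "r \<le> \<bar>b\<bar> * norm (xi (Suc 0) \<omega>)" if "enat k < \<tau> \<omega>"
    proof -
      have "\<forall>s\<in>{1..k}. X s \<omega> \<notin> D" using that unfolding less_first_hit_iff .
      then have "X 1 \<omega> \<notin> D" by (rule bspec) (use k in simp)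
      then have "X 1 \<omega> \<notin> ball 0 r" using r(2) by blast
      then show ?thesis by (simp add: X_1)
    qed
    moreover have "1 \<le> b\<^sup>2 / r\<^sup>2 * (norm (xi (Suc 0) \<omega>))\<^sup>2" if "r \<le> \<bar>b\<bar> * norm (xi (Suc 0) \<omega>)"
      using power_mono[OF that, of 2] r(1) by (simp add: power_mult_distrib field_simps)
    ultimately show "indicator {\<omega> \<in> space M. enat k < \<tau> \<omega>} \<omega>
        \<le> b\<^sup>2 / r\<^sup>2 * ((norm (xi (Suc 0) \<omega>))\<^sup>2 * indicator {\<omega> \<in> space M. r \<le> \<bar>b\<bar> * norm (xi (Suc 0) \<omega>)} \<omega>)"
      using \<omega> by (auto simp: indicator_def)
  qed (use ind int_indicator_tau in auto)
  also have "\<dots> = b\<^sup>2 / r\<^sup>2 * expectation (\<lambda>\<omega>. (norm (xi (Suc 0) \<omega>))\<^sup>2 * indicator {\<omega> \<in> space M. r \<le> \<bar>b\<bar> * norm (xi (Suc 0) \<omega>)} \<omega>)"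
    by simp
  finally show ?thesis .
qed

text \<open>Either the return comes at time 1 and the stopped state is \<open>b\<close> times the
  first innovation, or the outer radius bounds it on an event of probability at most
  \<open>b^2 * s2 / r^2\<close>. Only the ratio of the radii remains.\<close>

lemma Xstop_sq_le:
  assumes r: "0 < r" "ball 0 r \<subseteq> D" and \<rho>: "D \<subseteq> ball 0 \<rho>"
  shows "expectation (\<lambda>\<omega>. (norm (Xstop \<omega>))\<^sup>2) \<le> b\<^sup>2 * s2 * (1 + \<rho>\<^sup>2 / r\<^sup>2)"
proof -
  let ?I = "indicator {\<omega> \<in> space M. enat 1 < \<tau> \<omega>} :: 'a \<Rightarrow> real"
  have i1: "integrable M (\<lambda>\<omega>. (norm (Xstop \<omega>))\<^sup>2 * ?I \<omega>)"
    by (rule integrable_real_mult_indicator) (auto intro: Xstop_sq_int[OF \<rho>])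
  have i2: "integrable M (\<lambda>\<omega>. b\<^sup>2 * (norm (xi (Suc 0) \<omega>))\<^sup>2)" by (intro integrable_mult_right xi_sq_int)
  have "expectation (\<lambda>\<omega>. (norm (Xstop \<omega>))\<^sup>2)
      \<le> expectation (\<lambda>\<omega>. (norm (Xstop \<omega>))\<^sup>2 * ?I \<omega> + b\<^sup>2 * (norm (xi (Suc 0) \<omega>))\<^sup>2)"
  proof (rule integral_mono)
    fix \<omega> assume \<omega>: "\<omega> \<in> space M"
    show "(norm (Xstop \<omega>))\<^sup>2 \<le> (norm (Xstop \<omega>))\<^sup>2 * ?I \<omega> + b\<^sup>2 * (norm (xi (Suc 0) \<omega>))\<^sup>2"
    proof (cases "enat 1 < \<tau> \<omega>")
      case False
      then have "\<tau> \<omega> = enat 1"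
        using first_hit_pos[of X D \<omega>] by (cases "\<tau> \<omega>") (auto simp: zero_enat_def)
      then have "Xstop \<omega> = b *\<^sub>R xi (Suc 0) \<omega>" by (simp add: Xstop_def X_1)
      then show ?thesis by (simp add: power_mult_distrib indicator_def)
    qed (use \<omega> in \<open>simp add: indicator_def\<close>)
  qed (use i1 i2 Xstop_sq_int[OF \<rho>] in auto)
  also have "\<dots> = expectation (\<lambda>\<omega>. (norm (Xstop \<omega>))\<^sup>2 * ?I \<omega>) + b\<^sup>2 * s2"
    using i1 i2 by (simp add: xi_sq_expectation)
  also have "expectation (\<lambda>\<omega>. (norm (Xstop \<omega>))\<^sup>2 * ?I \<omega>) \<le> \<rho>\<^sup>2 * prob {\<omega> \<in> space M. enat 1 < \<tau> \<omega>}"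
    by (rule Xstop_sq_tail[OF \<rho>])
  also have "prob {\<omega> \<in> space M. enat 1 < \<tau> \<omega>} \<le> b\<^sup>2 / r\<^sup>2 * s2"
  proof -
    have "expectation (\<lambda>\<omega>. (norm (xi (Suc 0) \<omega>))\<^sup>2 * indicator {\<omega> \<in> space M. r \<le> \<bar>b\<bar> * norm (xi (Suc 0) \<omega>)} \<omega>)
        \<le> expectation (\<lambda>\<omega>. (norm (xi (Suc 0) \<omega>))\<^sup>2)"
      by (intro integral_mono xi_sq_int integrable_real_mult_indicator)
         (auto simp: indicator_def xi_sq_int)
    then have "b\<^sup>2 / r\<^sup>2 * expectation (\<lambda>\<omega>. (norm (xi (Suc 0) \<omega>))\<^sup>2 * indicator {\<omega> \<in> space M. r \<le> \<bar>b\<bar> * norm (xi (Suc 0) \<omega>)} \<omega>)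
        \<le> b\<^sup>2 / r\<^sup>2 * s2"
      unfolding xi_sq_expectation by (intro mult_left_mono) auto
    then show ?thesis using prob_tau_gt_le[OF r, of 1] by simp
  qed
  finally show ?thesis by (simp add: algebra_simps mult_right_mono)
qed

lemma al_X_sq:
  "integrable M (\<lambda>\<omega>. (al (Suc t) \<omega> - 1)\<^sup>2 * (u \<bullet> X t \<omega>)\<^sup>2)"
  "expectation (\<lambda>\<omega>. (al (Suc t) \<omega> - 1)\<^sup>2 * (u \<bullet> X t \<omega>)\<^sup>2)
    = (1 - 2 * reset_law.a1 + reset_law.a2) * expectation (\<lambda>\<omega>. (u \<bullet> X t \<omega>)\<^sup>2)"
  "integrable M (\<lambda>\<omega>. (u \<bullet> X t \<omega>)\<^sup>2)"
proof -
  have V: "(\<lambda>\<omega>. u \<bullet> X t \<omega>) \<in> borel_measurable (F t)"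
    by (intro borel_measurable_inner borel_measurable_const X_measurable_F order_refl)
  show i: "integrable M (\<lambda>\<omega>. (u \<bullet> X t \<omega>)\<^sup>2)"
  proof (rule Bochner_Integration.integrable_bound[OF integrable_mult_right[OF X_sq_int, of "(norm u)\<^sup>2"]])
    have "(u \<bullet> x)\<^sup>2 \<le> (norm u)\<^sup>2 * (norm x)\<^sup>2" for x
      using power_mono[OF Cauchy_Schwarz_ineq2[of u x], of 2] by (simp add: power_mult_distrib)
    then show "AE \<omega> in M. norm ((u \<bullet> X t \<omega>)\<^sup>2) \<le> norm ((norm u)\<^sup>2 * (norm (X t \<omega>))\<^sup>2)" by simp
  qed simp
  let ?v = "1 - 2 * reset_law.a1 + reset_law.a2"
  let ?f = "\<lambda>z. ennreal ((fst (snd z) - 1)\<^sup>2 * (fst z)\<^sup>2)"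
  have v: "(\<integral>\<^sup>+a. ennreal ((a - 1)\<^sup>2) \<partial>La) = ennreal ?v"
  proof -
    have eq: "(a - 1)\<^sup>2 = 1 - 2 * a + a\<^sup>2" for a :: real by (simp add: power2_eq_square algebra_simps)
    have "(\<integral>\<^sup>+a. ennreal ((a - 1)\<^sup>2) \<partial>La) = ennreal (\<integral>a. 1 - 2 * a + a\<^sup>2 \<partial>La)"
      unfolding eq using int_al al_sq zero_le_power2[of "_ - 1 :: real", unfolded eq]
      by (intro nn_integral_eq_integral) auto
    then show ?thesis using int_al al_sq by (simp add: reset_law.a1_def reset_law.a2_def La.prob_space)
  qed
  have "(\<integral>\<^sup>+\<omega>. ?f (u \<bullet> X t \<omega>, (al (Suc t) \<omega>, xi (Suc t) \<omega>)) \<partial>M)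
      = (\<integral>\<^sup>+\<omega>. \<integral>\<^sup>+z. ?f (u \<bullet> X t \<omega>, z) \<partial>(La \<Otimes>\<^sub>M Lx) \<partial>M)"
    by (rule nn_integral_next[OF V]) measurable
  also have "\<dots> = (\<integral>\<^sup>+\<omega>. ennreal ?v * ennreal ((u \<bullet> X t \<omega>)\<^sup>2) \<partial>M)"
  proof (rule nn_integral_cong)
    fix \<omega>
    have "(\<integral>\<^sup>+z. ?f (u \<bullet> X t \<omega>, z) \<partial>(La \<Otimes>\<^sub>M Lx)) = (\<integral>\<^sup>+a. \<integral>\<^sup>+y. ennreal ((a - 1)\<^sup>2) * ennreal ((u \<bullet> X t \<omega>)\<^sup>2) \<partial>Lx \<partial>La)"
      by (subst Lx.nn_integral_fst[symmetric]) (auto simp: ennreal_mult)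
    also have "\<dots> = ennreal ?v * ennreal ((u \<bullet> X t \<omega>)\<^sup>2)"
      using v by (simp add: Lx.emeasure_space_1 nn_integral_multc)
    finally show "(\<integral>\<^sup>+z. ?f (u \<bullet> X t \<omega>, z) \<partial>(La \<Otimes>\<^sub>M Lx)) = ennreal ?v * ennreal ((u \<bullet> X t \<omega>)\<^sup>2)" .
  qed
  also have "\<dots> = ennreal ?v * (\<integral>\<^sup>+\<omega>. ennreal ((u \<bullet> X t \<omega>)\<^sup>2) \<partial>M)"
    by (rule nn_integral_cmult) measurable
  also have "\<dots> = ennreal (?v * expectation (\<lambda>\<omega>. (u \<bullet> X t \<omega>)\<^sup>2))"
    using reset_law.a_var_nonneg by (simp add: nn_integral_eq_integral[OF i] ennreal_mult)
  finally have nn: "(\<integral>\<^sup>+\<omega>. ennreal ((al (Suc t) \<omega> - 1)\<^sup>2 * (u \<bullet> X t \<omega>)\<^sup>2) \<partial>M)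
      = ennreal (?v * expectation (\<lambda>\<omega>. (u \<bullet> X t \<omega>)\<^sup>2))" by simp
  show "integrable M (\<lambda>\<omega>. (al (Suc t) \<omega> - 1)\<^sup>2 * (u \<bullet> X t \<omega>)\<^sup>2)"
    by (rule integrableI_nonneg) (auto simp: nn)
  show "expectation (\<lambda>\<omega>. (al (Suc t) \<omega> - 1)\<^sup>2 * (u \<bullet> X t \<omega>)\<^sup>2) = ?v * expectation (\<lambda>\<omega>. (u \<bullet> X t \<omega>)\<^sup>2)"
    using reset_law.a_var_nonneg by (subst integral_eq_nn_integral) (auto simp: nn)
qed

section \<open>The random walk of the innovations and Wald's second identity, stepwise\<close>

definition S :: "nat \<Rightarrow> 'a \<Rightarrow> 'b" where "S k \<omega> = (\<Sum>j\<in>{1..k}. xi j \<omega>)"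

lemma S_measurable_F: "k \<le> t \<Longrightarrow> S k \<in> borel_measurable (F t)"
  unfolding S_def[abs_def] by (intro borel_measurable_sum xi_measurable_F) auto

lemma S_Suc: "S (Suc k) \<omega> = S k \<omega> + xi (Suc k) \<omega>"
  by (simp add: S_def add.commute)

text \<open>The event \<open>k < \<tau>\<close> is known at time \<open>k\<close>, and the next
  innovation is independent of the past and centred: the cross term vanishes and every surviving
  step adds \<open>Q u\<close>. Increments from a later start \<open>l\<close> serve the tail
  estimate in the limit.\<close>

lemma wald_step:
  assumes l: "l \<le> k" and fin: "integrable M (\<lambda>\<omega>. (u \<bullet> (S k \<omega> - S l \<omega>))\<^sup>2)"
  shows "integrable M (\<lambda>\<omega>. (u \<bullet> (S (Suc k) \<omega> - S l \<omega>))\<^sup>2)"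
    and "expectation (\<lambda>\<omega>. (u \<bullet> (S (Suc k) \<omega> - S l \<omega>))\<^sup>2 * indicator {\<omega> \<in> space M. enat k < \<tau> \<omega>} \<omega>)
      = expectation (\<lambda>\<omega>. (u \<bullet> (S k \<omega> - S l \<omega>))\<^sup>2 * indicator {\<omega> \<in> space M. enat k < \<tau> \<omega>} \<omega>)
        + Q u * prob {\<omega> \<in> space M. enat k < \<tau> \<omega>}"
proof -
  have [measurable]: "S k \<in> borel_measurable M" "S l \<in> borel_measurable M" "S (Suc k) \<in> borel_measurable M"
    using S_measurable_F[OF order_refl] measurable_F_imp_M by blast+
  have V: "(\<lambda>\<omega>. u \<bullet> (S k \<omega> - S l \<omega>)) \<in> borel_measurable (F k)"
    by (intro borel_measurable_inner borel_measurable_const borel_measurable_diff S_measurable_F order_refl l)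
  have Q0: "0 \<le> Q u" by (simp add: Q_def)
  \<comment> \<open>Stated for an arbitrary event of the past: the sure event gives integrability,
    the event \<open>k < \<tau>\<close> the identity.\<close>
  have nn: "(\<integral>\<^sup>+\<omega>. (if C \<omega> then ennreal ((u \<bullet> (S (Suc k) \<omega> - S l \<omega>))\<^sup>2) else 0) \<partial>M)
      = (\<integral>\<^sup>+\<omega>. (if C \<omega> then ennreal ((u \<bullet> (S k \<omega> - S l \<omega>))\<^sup>2 + Q u) else 0) \<partial>M)"
    if C: "Measurable.pred (F k) C" for C
  proof -
    let ?V = "\<lambda>\<omega>. (u \<bullet> (S k \<omega> - S l \<omega>), C \<omega>)"
    let ?f = "\<lambda>z. if snd (fst z) then ennreal ((fst (fst z) + u \<bullet> snd (snd z))\<^sup>2) else 0"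
    have "(\<integral>\<^sup>+\<omega>. ?f (?V \<omega>, (al (Suc k) \<omega>, xi (Suc k) \<omega>)) \<partial>M) = (\<integral>\<^sup>+\<omega>. \<integral>\<^sup>+z. ?f (?V \<omega>, z) \<partial>(La \<Otimes>\<^sub>M Lx) \<partial>M)"
      by (rule nn_integral_next[OF measurable_Pair[OF V C]]) measurable
    also have "\<dots> = (\<integral>\<^sup>+\<omega>. (if C \<omega> then ennreal ((u \<bullet> (S k \<omega> - S l \<omega>))\<^sup>2 + Q u) else 0) \<partial>M)"
    proof (rule nn_integral_cong)
      fix \<omega>
      have "(\<integral>\<^sup>+z. ennreal ((u \<bullet> (S k \<omega> - S l \<omega>) + u \<bullet> snd z)\<^sup>2) \<partial>(La \<Otimes>\<^sub>M Lx)) = ennreal ((u \<bullet> (S k \<omega> - S l \<omega>))\<^sup>2 + Q u)"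
        by (subst Lx.nn_integral_fst[symmetric]) (auto simp: nn_integral_shift_inner_sq La.emeasure_space_1)
      then show "(\<integral>\<^sup>+z. ?f (?V \<omega>, z) \<partial>(La \<Otimes>\<^sub>M Lx)) = (if C \<omega> then ennreal ((u \<bullet> (S k \<omega> - S l \<omega>))\<^sup>2 + Q u) else 0)"
        by auto
    qed
    finally show ?thesis by (simp add: S_Suc inner_add_right inner_diff_right algebra_simps cong: if_cong)
  qed
  show i: "integrable M (\<lambda>\<omega>. (u \<bullet> (S (Suc k) \<omega> - S l \<omega>))\<^sup>2)"
  proof (rule integrableI_nonneg)
    have "(\<integral>\<^sup>+\<omega>. ennreal ((u \<bullet> (S (Suc k) \<omega> - S l \<omega>))\<^sup>2) \<partial>M) = (\<integral>\<^sup>+\<omega>. ennreal ((u \<bullet> (S k \<omega> - S l \<omega>))\<^sup>2 + Q u) \<partial>M)"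
      using nn[of "\<lambda>_. True"] by simp
    also have "\<dots> = ennreal (expectation (\<lambda>\<omega>. (u \<bullet> (S k \<omega> - S l \<omega>))\<^sup>2 + Q u))"
      using fin Q0 by (intro nn_integral_eq_integral) auto
    finally show "(\<integral>\<^sup>+\<omega>. ennreal ((u \<bullet> (S (Suc k) \<omega> - S l \<omega>))\<^sup>2) \<partial>M) < \<infinity>" by simp
  qed auto
  let ?I = "indicator {\<omega> \<in> space M. enat k < \<tau> \<omega>} :: 'a \<Rightarrow> real"
  have iI: "integrable M (\<lambda>\<omega>. f \<omega> * ?I \<omega>)" if "integrable M f" for f :: "'a \<Rightarrow> real"
    using that by (intro integrable_real_mult_indicator) auto
  have "ennreal (expectation (\<lambda>\<omega>. (u \<bullet> (S (Suc k) \<omega> - S l \<omega>))\<^sup>2 * ?I \<omega>))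
      = (\<integral>\<^sup>+\<omega>. ennreal ((u \<bullet> (S (Suc k) \<omega> - S l \<omega>))\<^sup>2 * ?I \<omega>) \<partial>M)"
    by (intro nn_integral_eq_integral[symmetric] iI i) auto
  also have "\<dots> = (\<integral>\<^sup>+\<omega>. (if enat k < \<tau> \<omega> then ennreal ((u \<bullet> (S (Suc k) \<omega> - S l \<omega>))\<^sup>2) else 0) \<partial>M)"
    by (intro nn_integral_cong) (auto simp: indicator_def)
  also have "\<dots> = (\<integral>\<^sup>+\<omega>. (if enat k < \<tau> \<omega> then ennreal ((u \<bullet> (S k \<omega> - S l \<omega>))\<^sup>2 + Q u) else 0) \<partial>M)"
    by (rule nn[OF tau_gt_measurable_F])
  also have "\<dots> = (\<integral>\<^sup>+\<omega>. ennreal (((u \<bullet> (S k \<omega> - S l \<omega>))\<^sup>2 + Q u) * ?I \<omega>) \<partial>M)"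
    by (intro nn_integral_cong) (auto simp: indicator_def)
  also have "\<dots> = ennreal (expectation (\<lambda>\<omega>. ((u \<bullet> (S k \<omega> - S l \<omega>))\<^sup>2 + Q u) * ?I \<omega>))"
    using fin Q0 by (intro nn_integral_eq_integral iI) auto
  finally have "expectation (\<lambda>\<omega>. (u \<bullet> (S (Suc k) \<omega> - S l \<omega>))\<^sup>2 * ?I \<omega>)
      = expectation (\<lambda>\<omega>. ((u \<bullet> (S k \<omega> - S l \<omega>))\<^sup>2 + Q u) * ?I \<omega>)"
    using Q0 by (subst (asm) ennreal_inj) (auto intro!: integral_nonneg_AE)
  also have "\<dots> = expectation (\<lambda>\<omega>. (u \<bullet> (S k \<omega> - S l \<omega>))\<^sup>2 * ?I \<omega> + Q u * ?I \<omega>)"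
    by (simp add: distrib_right)
  also have "\<dots> = expectation (\<lambda>\<omega>. (u \<bullet> (S k \<omega> - S l \<omega>))\<^sup>2 * ?I \<omega>) + Q u * prob {\<omega> \<in> space M. enat k < \<tau> \<omega>}"
    using iI[OF fin] int_indicator_tau[of k] by (subst Bochner_Integration.integral_add) auto
  finally show "expectation (\<lambda>\<omega>. (u \<bullet> (S (Suc k) \<omega> - S l \<omega>))\<^sup>2 * ?I \<omega>)
      = expectation (\<lambda>\<omega>. (u \<bullet> (S k \<omega> - S l \<omega>))\<^sup>2 * ?I \<omega>) + Q u * prob {\<omega> \<in> space M. enat k < \<tau> \<omega>}" .
qed

end

text \<open>Where \<open>\<bar>f\<bar>\<close> is at most \<open>L\<close>, the probability of
  \<open>B n\<close> controls the integral; the part above \<open>L\<close> is small by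
  integrability, uniformly in \<open>n\<close>.\<close>

lemma (in prob_space) tendsto_expectation_null_events:
  fixes f :: "'a \<Rightarrow> real"
  assumes f: "integrable M f" and B [measurable]: "\<And>n. B n \<in> events" and lim: "(\<lambda>n. prob (B n)) \<longlonglongrightarrow> 0"
  shows "(\<lambda>n. expectation (\<lambda>\<omega>. \<bar>f \<omega>\<bar> * indicator (B n) \<omega>)) \<longlonglongrightarrow> 0"
proof (rule LIMSEQ_I)
  fix \<epsilon> :: real assume \<epsilon>: "0 < \<epsilon>"
  note [measurable] = borel_measurable_integrable[OF f]
  have "(\<lambda>L. expectation (\<lambda>\<omega>. \<bar>f \<omega>\<bar> * indicator {\<omega> \<in> space M. real L < \<bar>f \<omega>\<bar>} \<omega>)) \<longlonglongrightarrow> expectation (\<lambda>\<omega>. 0)"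
  proof (rule integral_dominated_convergence[where w="\<lambda>\<omega>. \<bar>f \<omega>\<bar>"])
    show "AE \<omega> in M. (\<lambda>L. \<bar>f \<omega>\<bar> * indicator {\<omega> \<in> space M. real L < \<bar>f \<omega>\<bar>} \<omega>) \<longlonglongrightarrow> 0"
    proof (intro AE_I2 tendsto_eventually)
      fix \<omega>
      obtain L0 :: nat where "\<bar>f \<omega>\<bar> \<le> real L0" using real_arch_simple by blast
      then show "\<forall>\<^sub>F L in sequentially. \<bar>f \<omega>\<bar> * indicator {\<omega> \<in> space M. real L < \<bar>f \<omega>\<bar>} \<omega> = 0"
        unfolding eventually_sequentially by (intro exI[of _ L0]) (auto simp: indicator_def)
    qed
  qed (use f in \<open>auto simp: indicator_def\<close>)
  then have "(\<lambda>L. expectation (\<lambda>\<omega>. \<bar>f \<omega>\<bar> * indicator {\<omega> \<in> space M. real L < \<bar>f \<omega>\<bar>} \<omega>)) \<longlonglongrightarrow> 0" by simp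
  from LIMSEQ_D[OF this, of "\<epsilon>/2"] \<epsilon> obtain L :: nat
    where L: "expectation (\<lambda>\<omega>. \<bar>f \<omega>\<bar> * indicator {\<omega> \<in> space M. real L < \<bar>f \<omega>\<bar>} \<omega>) < \<epsilon> / 2"
    by force
  have "0 < \<epsilon> / (2 * (real L + 1))" using \<epsilon> by simp
  from LIMSEQ_D[OF lim this] obtain n0 where n0: "\<And>n. n0 \<le> n \<Longrightarrow> prob (B n) < \<epsilon> / (2 * (real L + 1))" by auto
  show "\<exists>n0. \<forall>n\<ge>n0. norm (expectation (\<lambda>\<omega>. \<bar>f \<omega>\<bar> * indicator (B n) \<omega>) - 0) < \<epsilon>"
  proof (intro exI[of _ n0] allI impI)
    fix n assume n: "n0 \<le> n"
    have iB: "integrable M (indicat_real (B n))" by (rule integrable_const_bound[where B=1]) auto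
    have i1: "integrable M (\<lambda>\<omega>. \<bar>f \<omega>\<bar> * indicator {\<omega> \<in> space M. real L < \<bar>f \<omega>\<bar>} \<omega>)"
      "integrable M (\<lambda>\<omega>. \<bar>f \<omega>\<bar> * indicator (B n) \<omega>)"
      using f by (auto intro!: integrable_real_mult_indicator)
    have "expectation (\<lambda>\<omega>. \<bar>f \<omega>\<bar> * indicator (B n) \<omega>)
        \<le> expectation (\<lambda>\<omega>. real L * indicator (B n) \<omega> + \<bar>f \<omega>\<bar> * indicator {\<omega> \<in> space M. real L < \<bar>f \<omega>\<bar>} \<omega>)"
      by (intro integral_mono Bochner_Integration.integrable_add integrable_mult_right i1 iB)
         (auto simp: indicator_def)
    also have "\<dots> = real L * prob (B n) + expectation (\<lambda>\<omega>. \<bar>f \<omega>\<bar> * indicator {\<omega> \<in> space M. real L < \<bar>f \<omega>\<bar>} \<omega>)"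
      using i1 iB by (subst Bochner_Integration.integral_add) auto
    also have "real L * prob (B n) \<le> \<epsilon> / 2"
    proof -
      have "real L * prob (B n) \<le> (real L + 1) * (\<epsilon> / (2 * (real L + 1)))"
        using n0[OF n] by (intro mult_mono) auto
      also have "\<dots> = \<epsilon> / 2" by (simp add: field_simps)
      finally show ?thesis .
    qed
    finally have "expectation (\<lambda>\<omega>. \<bar>f \<omega>\<bar> * indicator (B n) \<omega>) < \<epsilon>" using L by simp
    moreover have "0 \<le> expectation (\<lambda>\<omega>. \<bar>f \<omega>\<bar> * indicator (B n) \<omega>)" by (intro integral_nonneg_AE) auto
    ultimately show "norm (expectation (\<lambda>\<omega>. \<bar>f \<omega>\<bar> * indicator (B n) \<omega>) - 0) < \<epsilon>" by simp
  qed
qed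

section \<open>The reset contribution along a family of chains\<close>

definition iexp2 :: "real \<Rightarrow> complex" where
  "iexp2 x = iexp x - 1 - \<i> * x"

lemma iexp2_measurable [measurable]: "iexp2 \<in> borel_measurable borel"
  unfolding iexp2_def[abs_def] by measurable

lemma norm_iexp2: "cmod (iexp2 x) \<le> x\<^sup>2 / 2"
  unfolding iexp2_def by (rule norm_iexp_taylor2)

lemma norm_iexp2_diff: "cmod (iexp2 x - iexp2 y) \<le> (x - y)\<^sup>2 / 2 + \<bar>x - y\<bar> * \<bar>y\<bar>"
proof -
  have "iexp x = iexp y * iexp (x - y)"
    by (simp add: exp_add[symmetric] algebra_simps)
  then have "iexp2 x - iexp2 y = iexp y * iexp2 (x - y) + \<i> * complex_of_real (x - y) * (iexp y - 1)"
    by (simp add: iexp2_def algebra_simps)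
  also have "cmod \<dots> \<le> cmod (iexp y * iexp2 (x - y)) + cmod (\<i> * complex_of_real (x - y) * (iexp y - 1))"
    by (rule norm_triangle_ineq)
  also have "\<dots> = cmod (iexp2 (x - y)) + \<bar>x - y\<bar> * cmod (iexp y - 1)"
    by (simp only: norm_mult norm_exp_i_times norm_of_real norm_ii mult_1)
  also have "\<dots> \<le> (x - y)\<^sup>2 / 2 + \<bar>x - y\<bar> * \<bar>y\<bar>"
    by (intro add_mono norm_iexp2 mult_left_mono norm_iexp_taylor1) auto
  finally show ?thesis .
qed

text \<open>The remainder is quadratic, so a difference contains the mixed term
  \<open>\<bar>y - s\<bar> * \<bar>s\<bar>\<close>. Young's inequality with free weight
  \<open>\<eta>\<close> charges it to \<open>(y - s)^2\<close>, which will tend to 0 in mean, up to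
  a small multiple of \<open>s^2\<close>.\<close>

lemma iexp2_scaled_diff:
  assumes "0 < c" "0 < \<eta>"
  shows "cmod (c * iexp2 (y / sqrt c) - c * iexp2 (s / sqrt c)) \<le> (1/2 + 1 / (2 * \<eta>)) * (y - s)\<^sup>2 + \<eta> / 2 * s\<^sup>2"
proof -
  have "cmod (c * iexp2 (y / sqrt c) - c * iexp2 (s / sqrt c)) = c * cmod (iexp2 (y / sqrt c) - iexp2 (s / sqrt c))"
    using assms by (simp add: norm_mult flip: right_diff_distrib)
  also have "\<dots> \<le> c * ((y / sqrt c - s / sqrt c)\<^sup>2 / 2 + \<bar>y / sqrt c - s / sqrt c\<bar> * \<bar>s / sqrt c\<bar>)"
    using assms by (intro mult_left_mono norm_iexp2_diff) auto
  also have "\<dots> = (y - s)\<^sup>2 / 2 + \<bar>y - s\<bar> * \<bar>s\<bar>"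
  proof -
    have "y / sqrt c - s / sqrt c = (y - s) / sqrt c" by (simp add: diff_divide_distrib)
    moreover have "sqrt c * sqrt c = c" using assms by simp
    ultimately show ?thesis using assms
      by (simp add: power_divide abs_divide distrib_left)
  qed
  also have "\<bar>y - s\<bar> * \<bar>s\<bar> \<le> (y - s)\<^sup>2 / (2 * \<eta>) + \<eta> / 2 * s\<^sup>2"
  proof -
    have "0 \<le> (\<bar>y - s\<bar> - \<eta> * \<bar>s\<bar>)\<^sup>2 / (2 * \<eta>)" using assms by simp
    also have "\<dots> = (y - s)\<^sup>2 / (2 * \<eta>) + \<eta> / 2 * s\<^sup>2 - \<bar>y - s\<bar> * \<bar>s\<bar>"
      using assms by (simp add: power2_diff power_mult_distrib field_simps power2_eq_square)
    finally show ?thesis by simp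
  qed
  finally show ?thesis by (simp add: algebra_simps)
qed

lemma tendsto_iexp2_scaled:
  assumes r: "filterlim r at_top sequentially" and pos: "\<And>n. 0 < r n"
  shows "(\<lambda>n. complex_of_real (r n) * iexp2 (s / sqrt (r n))) \<longlonglongrightarrow> complex_of_real (- s\<^sup>2 / 2)"
proof -
  have "(\<lambda>n. sqrt (inverse (r n))) \<longlonglongrightarrow> sqrt 0"
    by (intro tendsto_real_sqrt tendsto_inverse_0_at_top r)
  then have lim0: "(\<lambda>n. \<bar>s\<bar> ^ 3 / 6 * sqrt (inverse (r n))) \<longlonglongrightarrow> 0"
    by (auto intro!: tendsto_mult_right_zero)
  have "cmod (r n * iexp2 (s / sqrt (r n)) - complex_of_real (- s\<^sup>2 / 2)) \<le> \<bar>s\<bar> ^ 3 / 6 * sqrt (inverse (r n))" for n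
  proof -
    define x where "x = s / sqrt (r n)"
    have rx: "r n * x\<^sup>2 = s\<^sup>2" using pos[of n] by (simp add: x_def power_divide)
    have "complex_of_real (- s\<^sup>2 / 2) = r n * complex_of_real (- x\<^sup>2 / 2)"
      unfolding rx[symmetric] by simp
    then have "r n * iexp2 x - complex_of_real (- s\<^sup>2 / 2)
        = complex_of_real (r n) * (iexp x - (\<Sum>k\<le>2. (\<i> * complex_of_real x) ^ k / fact k))"
      by (simp add: iexp2_def numeral_2_eq_2 power2_eq_square algebra_simps)
    then have "cmod (r n * iexp2 x - complex_of_real (- s\<^sup>2 / 2)) \<le> r n * (\<bar>x\<bar> ^ Suc 2 / fact (Suc 2))"
      using pos[of n] iexp_approx1[of x 2] by (simp only: norm_mult norm_of_real abs_of_pos mult_left_mono less_imp_le)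
    also have "\<dots> = (r n * x\<^sup>2) * \<bar>x\<bar> / 6"
      by (simp add: power2_eq_square power3_eq_cube fact_numeral)
    also have "\<dots> = \<bar>s\<bar> ^ 3 / 6 * sqrt (inverse (r n))"
      unfolding rx using pos[of n]
      by (simp add: x_def abs_divide power2_eq_square power3_eq_cube real_sqrt_divide field_simps)
    finally show ?thesis unfolding x_def .
  qed
  then have "(\<lambda>n. r n * iexp2 (s / sqrt (r n)) - complex_of_real (- s\<^sup>2 / 2)) \<longlonglongrightarrow> 0"
    by (intro Lim_null_comparison[OF always_eventually lim0]) auto
  then show ?thesis by (rule LIM_zero_cancel)
qed

text \<open>All chains live on one space and share the innovations, so that they can be coupled with
  a single random walk. \<open>r\<close> is the rescaling index and \<open>g\<close> the scale of
  the return set, about whose growth nothing is assumed.\<close>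

locale chain_family = prob_space M
  for M :: "'a measure" +
  fixes al :: "nat \<Rightarrow> nat \<Rightarrow> 'a \<Rightarrow> real" and b :: "nat \<Rightarrow> real" and xi :: "nat \<Rightarrow> 'a \<Rightarrow> 'v::euclidean_space"
    and D :: "nat \<Rightarrow> 'v set" and La :: "nat \<Rightarrow> real measure" and Lx :: "'v measure" and P :: "nat \<Rightarrow> 'v measure"
    and r g :: "nat \<Rightarrow> real" and r0 R0 :: real
  assumes chain: "\<And>n. moment_chain M (al n) (b n) xi (D n) (La n) Lx (P n)"
    and radii: "0 < r0" "0 < R0" "\<And>n. 0 < g n"
    and inner_ball: "\<And>n. ball 0 (g n * r0) \<subseteq> D n" and outer_ball: "\<And>n. D n \<subseteq> ball 0 (g n * R0)"
    and r_pos: "\<And>n. 0 < r n" and r_lim: "filterlim r at_top sequentially"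
    and b_lim: "(\<lambda>n. sqrt (r n) * b n) \<longlonglongrightarrow> 1"
    and al_lim: "(\<lambda>n. 1 - 2 * reset_law.a1 (La n) + reset_law.a2 (La n)) \<longlonglongrightarrow> 0"
begin

abbreviation X :: "nat \<Rightarrow> nat \<Rightarrow> 'a \<Rightarrow> 'v" where "X n \<equiv> X_proc (al n) (b n) xi"
abbreviation \<tau> :: "nat \<Rightarrow> 'a \<Rightarrow> enat" where "\<tau> n \<equiv> first_hit (X n) (D n)"
definition e :: "nat \<Rightarrow> real" where "e n = enn2real (mean_time M (\<tau> n))"
definition Xstop :: "nat \<Rightarrow> 'a \<Rightarrow> 'v" where "Xstop n \<omega> = X n (the_enat (\<tau> n \<omega>)) \<omega>"
definition S :: "nat \<Rightarrow> 'a \<Rightarrow> 'v" where "S k \<omega> = (\<Sum>j\<in>{1..k}. xi j \<omega>)"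
definition Q :: "'v \<Rightarrow> real" where "Q u = (\<integral>x. (u \<bullet> x)\<^sup>2 \<partial>Lx)"
definition s2 :: real where "s2 = (\<integral>x. (norm x)\<^sup>2 \<partial>Lx)"

abbreviation gt :: "nat \<Rightarrow> nat \<Rightarrow> 'a set" where "gt n k \<equiv> {\<omega> \<in> space M. enat k < \<tau> n \<omega>}"

lemma X_measurable [measurable]: "X n k \<in> borel_measurable M"
proof -
  interpret C: moment_chain M "al n" "b n" xi "D n" "La n" Lx "P n" by (rule chain)
  show ?thesis by measurable
qed

lemma tau_measurable [measurable]: "\<tau> n \<in> measurable M (count_space UNIV)"
proof -
  interpret C: moment_chain M "al n" "b n" xi "D n" "La n" Lx "P n" by (rule chain)
  show ?thesis by measurable
qed

lemma Xstop_measurable [measurable]: "Xstop n \<in> borel_measurable M"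
proof -
  interpret C: moment_chain M "al n" "b n" xi "D n" "La n" Lx "P n" by (rule chain)
  show ?thesis using C.Xstop_measurable unfolding C.Xstop_def[abs_def] Xstop_def[abs_def] .
qed

lemma xi_measurable [measurable]: "xi (Suc k) \<in> borel_measurable M"
proof -
  interpret C: moment_chain M "al 0" "b 0" xi "D 0" "La 0" Lx "P 0" by (rule chain)
  show ?thesis by measurable
qed

lemma S_measurable [measurable]: "S k \<in> borel_measurable M"
proof -
  interpret C: moment_chain M "al 0" "b 0" xi "D 0" "La 0" Lx "P 0" by (rule chain)
  show ?thesis unfolding S_def[abs_def] using C.xi_rv by (intro borel_measurable_sum) auto
qed

lemma rb_sq_lim: "(\<lambda>n. r n * (b n)\<^sup>2) \<longlonglongrightarrow> 1"
proof -
  have "(\<lambda>n. (sqrt (r n) * b n)\<^sup>2) \<longlonglongrightarrow> 1\<^sup>2" by (intro tendsto_intros b_lim)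
  then show ?thesis using r_pos by (simp add: power_mult_distrib less_imp_le)
qed

lemma e_ge_1: "1 \<le> e n"
proof -
  interpret C: moment_chain M "al n" "b n" xi "D n" "La n" Lx "P n" by (rule chain)
  show ?thesis using C.e_ge_1 by (simp add: e_def C.e_def)
qed

lemma G_eq: "e n * reset_law.G (P n) (D n) u = (CLINT \<omega>|M. iexp2 (u \<bullet> Xstop n \<omega>))"
proof -
  interpret C: moment_chain M "al n" "b n" xi "D n" "La n" Lx "P n" by (rule chain)
  show ?thesis using C.G_eq[of u] by (simp add: e_def C.e_def Xstop_def C.Xstop_def iexp2_def)
qed

lemma Xstop_sq_int: "integrable M (\<lambda>\<omega>. (norm (Xstop n \<omega>))\<^sup>2)"
proof -
  interpret C: moment_chain M "al n" "b n" xi "D n" "La n" Lx "P n" by (rule chain)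
  show ?thesis using C.Xstop_sq_int[OF outer_ball] by (simp add: Xstop_def C.Xstop_def)
qed

lemma inner_sq_le: "(u \<bullet> x)\<^sup>2 \<le> (norm u)\<^sup>2 * (norm x)\<^sup>2" for u x :: 'v
  using power_mono[OF Cauchy_Schwarz_ineq2[of u x], of 2] by (simp add: power_mult_distrib)

lemma iexp2_inner_le: "cmod (iexp2 (u \<bullet> x)) \<le> (norm u)\<^sup>2 / 2 * (norm x)\<^sup>2" for u x :: 'v
  using norm_iexp2[of "u \<bullet> x"] inner_sq_le[of u x] unfolding times_divide_eq_left by linarith

text \<open>\<open>r * G\<close> is \<open>r / e\<close> times the expected remainder of the stopped
  state, whose second moment is of order \<open>b^2\<close> uniformly in the scale \<open>g\<close>.
  Since \<open>r * b^2\<close> is bounded, division by \<open>e\<close> sends it to 0.\<close>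

lemma tendsto_G_infinite:
  assumes e: "filterlim e at_top sequentially"
  shows "(\<lambda>n. r n * reset_law.G (P n) (D n) u) \<longlonglongrightarrow> 0"
proof (rule Lim_null_comparison)
  have "r n * reset_law.G (P n) (D n) u = (r n / e n) * (CLINT \<omega>|M. iexp2 (u \<bullet> Xstop n \<omega>))" for n
    unfolding G_eq[symmetric] using e_ge_1[of n] by simp
  then have "cmod (r n * reset_law.G (P n) (D n) u)
      \<le> (r n * (b n)\<^sup>2) * ((norm u)\<^sup>2 / 2 * (s2 * (1 + R0\<^sup>2 / r0\<^sup>2))) * inverse (e n)" for n
  proof -
    interpret C: moment_chain M "al n" "b n" xi "D n" "La n" Lx "P n" by (rule chain)
    have "cmod (CLINT \<omega>|M. iexp2 (u \<bullet> Xstop n \<omega>)) \<le> expectation (\<lambda>\<omega>. (norm u)\<^sup>2 / 2 * (norm (Xstop n \<omega>))\<^sup>2)"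
      using Xstop_sq_int[of n]
      by (intro order_trans[OF integral_norm_bound] integral_mono' integrable_mult_right iexp2_inner_le) auto
    also have "\<dots> = (norm u)\<^sup>2 / 2 * expectation (\<lambda>\<omega>. (norm (Xstop n \<omega>))\<^sup>2)" by simp
    also have "\<dots> \<le> (norm u)\<^sup>2 / 2 * ((b n)\<^sup>2 * s2 * (1 + (g n * R0)\<^sup>2 / (g n * r0)\<^sup>2))"
      using C.Xstop_sq_le[OF _ inner_ball outer_ball] radii
      by (intro mult_left_mono) (auto simp: Xstop_def C.Xstop_def s2_def C.s2_def)
    also have "(g n * R0)\<^sup>2 / (g n * r0)\<^sup>2 = R0\<^sup>2 / r0\<^sup>2"
      using radii(3)[of n] by (simp add: power_mult_distrib)
    finally have "cmod (CLINT \<omega>|M. iexp2 (u \<bullet> Xstop n \<omega>)) \<le> (norm u)\<^sup>2 / 2 * ((b n)\<^sup>2 * s2 * (1 + R0\<^sup>2 / r0\<^sup>2))" .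
    then have "(r n / e n) * cmod (CLINT \<omega>|M. iexp2 (u \<bullet> Xstop n \<omega>))
        \<le> (r n / e n) * ((norm u)\<^sup>2 / 2 * ((b n)\<^sup>2 * s2 * (1 + R0\<^sup>2 / r0\<^sup>2)))"
      using r_pos[of n] e_ge_1[of n] by (intro mult_left_mono) auto
    moreover have "cmod (r n * reset_law.G (P n) (D n) u) = (r n / e n) * cmod (CLINT \<omega>|M. iexp2 (u \<bullet> Xstop n \<omega>))"
    proof -
      have "r n * reset_law.G (P n) (D n) u = complex_of_real (r n / e n) * (CLINT \<omega>|M. iexp2 (u \<bullet> Xstop n \<omega>))"
        unfolding G_eq[symmetric] using e_ge_1[of n] by simp
      then show ?thesis using r_pos[of n] e_ge_1[of n]
        by (simp only: norm_mult norm_of_real) simp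
    qed
    ultimately show ?thesis by (simp add: field_simps)
  qed
  then show "\<forall>\<^sub>F n in sequentially. cmod (r n * reset_law.G (P n) (D n) u)
      \<le> (r n * (b n)\<^sup>2) * ((norm u)\<^sup>2 / 2 * (s2 * (1 + R0\<^sup>2 / r0\<^sup>2))) * inverse (e n)" by simp
  have "(\<lambda>n. (r n * (b n)\<^sup>2) * ((norm u)\<^sup>2 / 2 * (s2 * (1 + R0\<^sup>2 / r0\<^sup>2))) * inverse (e n))
      \<longlonglongrightarrow> 1 * ((norm u)\<^sup>2 / 2 * (s2 * (1 + R0\<^sup>2 / r0\<^sup>2))) * 0"
    by (intro tendsto_intros rb_sq_lim tendsto_inverse_0_at_top e)
  then show "(\<lambda>n. (r n * (b n)\<^sup>2) * ((norm u)\<^sup>2 / 2 * (s2 * (1 + R0\<^sup>2 / r0\<^sup>2))) * inverse (e n)) \<longlonglongrightarrow> 0" by simp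
qed

lemma xi_inner_sq_int: "integrable M (\<lambda>\<omega>. (u \<bullet> xi (Suc k) \<omega>)\<^sup>2)"
  and xi_inner_sq: "expectation (\<lambda>\<omega>. (u \<bullet> xi (Suc k) \<omega>)\<^sup>2) = Q u"
proof -
  interpret C: moment_chain M "al 0" "b 0" xi "D 0" "La 0" Lx "P 0" by (rule chain)
  show "integrable M (\<lambda>\<omega>. (u \<bullet> xi (Suc k) \<omega>)\<^sup>2)"
    using C.int_xi_inner_sq[of u] integrable_distr_eq[of "xi (Suc k)" M borel "\<lambda>x. (u \<bullet> x)\<^sup>2"]
    by (simp add: C.xi_law)
  show "expectation (\<lambda>\<omega>. (u \<bullet> xi (Suc k) \<omega>)\<^sup>2) = Q u"
    using integral_distr[of "xi (Suc k)" M borel "\<lambda>x. (u \<bullet> x)\<^sup>2"] by (simp add: C.xi_law Q_def)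
qed

lemma S_Suc: "S (Suc k) \<omega> = S k \<omega> + xi (Suc k) \<omega>"
  by (simp add: S_def add.commute)

lemma S_0 [simp]: "S 0 \<omega> = 0" by (simp add: S_def)

lemma wald_step:
  assumes l: "l \<le> k" and fin: "integrable M (\<lambda>\<omega>. (u \<bullet> (S k \<omega> - S l \<omega>))\<^sup>2)"
  shows "integrable M (\<lambda>\<omega>. (u \<bullet> (S (Suc k) \<omega> - S l \<omega>))\<^sup>2)"
    and "expectation (\<lambda>\<omega>. (u \<bullet> (S (Suc k) \<omega> - S l \<omega>))\<^sup>2 * indicator (gt n k) \<omega>)
      = expectation (\<lambda>\<omega>. (u \<bullet> (S k \<omega> - S l \<omega>))\<^sup>2 * indicator (gt n k) \<omega>) + Q u * prob (gt n k)"
proof -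
  interpret C: moment_chain M "al n" "b n" xi "D n" "La n" Lx "P n" by (rule chain)
  have S: "C.S = S" by (intro ext) (simp add: C.S_def S_def)
  have Q: "C.Q u = Q u" by (simp add: C.Q_def Q_def)
  show "integrable M (\<lambda>\<omega>. (u \<bullet> (S (Suc k) \<omega> - S l \<omega>))\<^sup>2)"
    "expectation (\<lambda>\<omega>. (u \<bullet> (S (Suc k) \<omega> - S l \<omega>))\<^sup>2 * indicator (gt n k) \<omega>)
      = expectation (\<lambda>\<omega>. (u \<bullet> (S k \<omega> - S l \<omega>))\<^sup>2 * indicator (gt n k) \<omega>) + Q u * prob (gt n k)"
    using C.wald_step[OF l, of u] fin unfolding S Q by auto
qed

lemma S_sq_int: "l \<le> k \<Longrightarrow> integrable M (\<lambda>\<omega>. (u \<bullet> (S k \<omega> - S l \<omega>))\<^sup>2)"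
proof (induction k)
  case (Suc k)
  then show ?case
    by (cases "l = Suc k") (auto intro!: wald_step(1))
qed simp

lemma S_sq_int0: "integrable M (\<lambda>\<omega>. (u \<bullet> S k \<omega>)\<^sup>2)"
  using S_sq_int[of 0 k u] by simp

text \<open>For a fixed number of steps the multipliers tend to 1 in mean square and
  \<open>sqrt r * b\<close> to 1, so the rescaled chain follows the random walk. The new error
  consists of the effect of the multiplier, the previous error and the mismatch of \<open>b\<close>;
  in the first, the rescaled second moment of the chain is bounded by the induction
  hypothesis.\<close>

lemma X_L2:
  "(\<lambda>n. expectation (\<lambda>\<omega>. (sqrt (r n) * (u \<bullet> X n k \<omega>) - u \<bullet> S k \<omega>)\<^sup>2)) \<longlonglongrightarrow> 0
    \<and> (\<forall>n. integrable M (\<lambda>\<omega>. (sqrt (r n) * (u \<bullet> X n k \<omega>) - u \<bullet> S k \<omega>)\<^sup>2))"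
proof (induction k)
  case 0
  then show ?case by simp
next
  case (Suc k)
  define d where "d n = expectation (\<lambda>\<omega>. (sqrt (r n) * (u \<bullet> X n k \<omega>) - u \<bullet> S k \<omega>)\<^sup>2)" for n
  define v where "v n = 1 - 2 * reset_law.a1 (La n) + reset_law.a2 (La n)" for n
  have d0: "d \<longlonglongrightarrow> 0" and d_int: "\<And>n. integrable M (\<lambda>\<omega>. (sqrt (r n) * (u \<bullet> X n k \<omega>) - u \<bullet> S k \<omega>)\<^sup>2)"
    using Suc unfolding d_def by auto
  have sq3: "(x + y + z)\<^sup>2 \<le> 3 * (x\<^sup>2 + y\<^sup>2 + z\<^sup>2)" for x y z :: real
    using zero_le_power2[of "x - y"] zero_le_power2[of "y - z"] zero_le_power2[of "x - z"]
    by (simp add: power2_eq_square algebra_simps)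
  have sq2: "x\<^sup>2 \<le> 2 * ((x - y)\<^sup>2 + y\<^sup>2)" for x y :: real
    using zero_le_power2[of "x - 2 * y"] by (simp add: power2_eq_square algebra_simps)
  define B where "B n \<omega> = 3 * (r n * ((al n (Suc k) \<omega> - 1)\<^sup>2 * (u \<bullet> X n k \<omega>)\<^sup>2)
      + (sqrt (r n) * (u \<bullet> X n k \<omega>) - u \<bullet> S k \<omega>)\<^sup>2 + (sqrt (r n) * b n - 1)\<^sup>2 * (u \<bullet> xi (Suc k) \<omega>)\<^sup>2)" for n \<omega>
  have le: "(sqrt (r n) * (u \<bullet> X n (Suc k) \<omega>) - u \<bullet> S (Suc k) \<omega>)\<^sup>2 \<le> B n \<omega>" for n \<omega>
  proof -
    have "sqrt (r n) * (u \<bullet> X n (Suc k) \<omega>) - u \<bullet> S (Suc k) \<omega>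
        = sqrt (r n) * ((al n (Suc k) \<omega> - 1) * (u \<bullet> X n k \<omega>)) + (sqrt (r n) * (u \<bullet> X n k \<omega>) - u \<bullet> S k \<omega>)
          + (sqrt (r n) * b n - 1) * (u \<bullet> xi (Suc k) \<omega>)"
      by (simp add: X_proc.simps(2) S_Suc inner_add_right algebra_simps)
    also have "\<dots>\<^sup>2 \<le> 3 * ((sqrt (r n) * ((al n (Suc k) \<omega> - 1) * (u \<bullet> X n k \<omega>)))\<^sup>2
        + (sqrt (r n) * (u \<bullet> X n k \<omega>) - u \<bullet> S k \<omega>)\<^sup>2 + ((sqrt (r n) * b n - 1) * (u \<bullet> xi (Suc k) \<omega>))\<^sup>2)"
      by (rule sq3)
    also have "\<dots> = B n \<omega>"
      using r_pos[of n] by (simp add: B_def power_mult_distrib)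
    finally show ?thesis .
  qed
  have al_X: "integrable M (\<lambda>\<omega>. (al n (Suc k) \<omega> - 1)\<^sup>2 * (u \<bullet> X n k \<omega>)\<^sup>2)"
    "expectation (\<lambda>\<omega>. (al n (Suc k) \<omega> - 1)\<^sup>2 * (u \<bullet> X n k \<omega>)\<^sup>2) = v n * expectation (\<lambda>\<omega>. (u \<bullet> X n k \<omega>)\<^sup>2)"
    "integrable M (\<lambda>\<omega>. (u \<bullet> X n k \<omega>)\<^sup>2)" "0 \<le> v n" for n
  proof -
    interpret C: moment_chain M "al n" "b n" xi "D n" "La n" Lx "P n" by (rule chain)
    show "integrable M (\<lambda>\<omega>. (al n (Suc k) \<omega> - 1)\<^sup>2 * (u \<bullet> X n k \<omega>)\<^sup>2)"
      "expectation (\<lambda>\<omega>. (al n (Suc k) \<omega> - 1)\<^sup>2 * (u \<bullet> X n k \<omega>)\<^sup>2) = v n * expectation (\<lambda>\<omega>. (u \<bullet> X n k \<omega>)\<^sup>2)"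
      "integrable M (\<lambda>\<omega>. (u \<bullet> X n k \<omega>)\<^sup>2)" "0 \<le> v n"
      using C.al_X_sq[where t=k and u=u] C.reset_law.a_var_nonneg unfolding v_def by auto
  qed
  have al_meas [measurable]: "al n (Suc k) \<in> borel_measurable M" for n
  proof -
    interpret C: moment_chain M "al n" "b n" xi "D n" "La n" Lx "P n" by (rule chain)
    show ?thesis by measurable
  qed
  have B_int: "integrable M (B n)" for n
    unfolding B_def[abs_def] using al_X d_int xi_inner_sq_int[of u k]
    by (intro integrable_mult_right Bochner_Integration.integrable_add) auto
  have int: "integrable M (\<lambda>\<omega>. (sqrt (r n) * (u \<bullet> X n (Suc k) \<omega>) - u \<bullet> S (Suc k) \<omega>)\<^sup>2)" for n
    by (rule Bochner_Integration.integrable_bound[OF B_int[of n]])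
       (auto intro!: AE_I2 order_trans[OF le abs_ge_self])
  have bnd: "expectation (\<lambda>\<omega>. (sqrt (r n) * (u \<bullet> X n (Suc k) \<omega>) - u \<bullet> S (Suc k) \<omega>)\<^sup>2)
      \<le> 3 * (v n * (2 * (d n + expectation (\<lambda>\<omega>. (u \<bullet> S k \<omega>)\<^sup>2))) + d n + (sqrt (r n) * b n - 1)\<^sup>2 * Q u)" for n
  proof -
    have "r n * expectation (\<lambda>\<omega>. (u \<bullet> X n k \<omega>)\<^sup>2) = expectation (\<lambda>\<omega>. (sqrt (r n) * (u \<bullet> X n k \<omega>))\<^sup>2)"
      using r_pos[of n] by (simp add: power_mult_distrib)
    also have "\<dots> \<le> expectation (\<lambda>\<omega>. 2 * ((sqrt (r n) * (u \<bullet> X n k \<omega>) - u \<bullet> S k \<omega>)\<^sup>2 + (u \<bullet> S k \<omega>)\<^sup>2))"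
      using al_X(3)[of n] d_int[of n] S_sq_int0[of u k]
      by (intro integral_mono sq2) (auto simp: power_mult_distrib)
    also have "\<dots> = 2 * (d n + expectation (\<lambda>\<omega>. (u \<bullet> S k \<omega>)\<^sup>2))"
      using d_int[of n] S_sq_int0[of u k] by (simp add: d_def)
    finally have "v n * (r n * expectation (\<lambda>\<omega>. (u \<bullet> X n k \<omega>)\<^sup>2)) \<le> v n * (2 * (d n + expectation (\<lambda>\<omega>. (u \<bullet> S k \<omega>)\<^sup>2)))"
      using al_X(4)[of n] by (intro mult_left_mono)
    moreover have "expectation (\<lambda>\<omega>. (sqrt (r n) * (u \<bullet> X n (Suc k) \<omega>) - u \<bullet> S (Suc k) \<omega>)\<^sup>2) \<le> expectation (B n)"
      by (intro integral_mono int B_int le)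
    moreover have "expectation (B n) = 3 * (v n * (r n * expectation (\<lambda>\<omega>. (u \<bullet> X n k \<omega>)\<^sup>2)) + d n + (sqrt (r n) * b n - 1)\<^sup>2 * Q u)"
    proof -
      have "integrable M (\<lambda>\<omega>. r n * ((al n (Suc k) \<omega> - 1)\<^sup>2 * (u \<bullet> X n k \<omega>)\<^sup>2))"
        "integrable M (\<lambda>\<omega>. (sqrt (r n) * b n - 1)\<^sup>2 * (u \<bullet> xi (Suc k) \<omega>)\<^sup>2)"
        using al_X(1)[of n] xi_inner_sq_int[of u k] by (intro integrable_mult_right; simp)+
      then show ?thesis
        unfolding B_def[abs_def] using d_int[of n] al_X(2)[of n] xi_inner_sq[of u k]
        by (simp add: d_def)
    qed
    ultimately show ?thesis by simp
  qed
  have "(\<lambda>n. 3 * (v n * (2 * (d n + expectation (\<lambda>\<omega>. (u \<bullet> S k \<omega>)\<^sup>2))) + d n + (sqrt (r n) * b n - 1)\<^sup>2 * Q u))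
      \<longlonglongrightarrow> 3 * (0 * (2 * (0 + expectation (\<lambda>\<omega>. (u \<bullet> S k \<omega>)\<^sup>2))) + 0 + (1 - 1)\<^sup>2 * Q u)"
    unfolding v_def by (intro tendsto_intros d0 al_lim b_lim)
  then have lim: "(\<lambda>n. 3 * (v n * (2 * (d n + expectation (\<lambda>\<omega>. (u \<bullet> S k \<omega>)\<^sup>2))) + d n + (sqrt (r n) * b n - 1)\<^sup>2 * Q u)) \<longlonglongrightarrow> 0"
    by simp
  have "(\<lambda>n. expectation (\<lambda>\<omega>. (sqrt (r n) * (u \<bullet> X n (Suc k) \<omega>) - u \<bullet> S (Suc k) \<omega>)\<^sup>2)) \<longlonglongrightarrow> 0"
    by (rule tendsto_sandwich[OF _ _ tendsto_const lim]) (use bnd in \<open>auto intro!: always_eventually integral_nonneg_AE\<close>)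
  with int show ?case by blast
qed

context
  fixes T :: "'a \<Rightarrow> nat" and eh :: real
  assumes T_meas [measurable]: "T \<in> measurable M (count_space UNIV)"
    and T_lim: "(\<lambda>n. prob {\<omega> \<in> space M. \<tau> n \<omega> \<noteq> enat (T \<omega>)}) \<longlonglongrightarrow> 0"
    and e_lim: "e \<longlonglongrightarrow> eh"
begin

abbreviation Tgt :: "nat \<Rightarrow> 'a set" where "Tgt k \<equiv> {\<omega> \<in> space M. k < T \<omega>}"

text \<open>The events differ only where \<open>\<tau> n\<close> differs from \<open>T\<close>,
  which has vanishing probability, and \<open>f\<close> is integrable.\<close>

lemma tendsto_expectation_event:
  fixes f :: "'a \<Rightarrow> real"
  assumes f: "integrable M f" and [measurable]: "\<And>n. A n \<in> events" "B \<in> events"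
    and AB: "\<And>n \<omega>. \<omega> \<in> space M \<Longrightarrow> \<tau> n \<omega> = enat (T \<omega>) \<Longrightarrow> \<omega> \<in> A n \<longleftrightarrow> \<omega> \<in> B"
  shows "(\<lambda>n. expectation (\<lambda>\<omega>. f \<omega> * indicator (A n) \<omega>)) \<longlonglongrightarrow> expectation (\<lambda>\<omega>. f \<omega> * indicator B \<omega>)"
proof -
  let ?N = "\<lambda>n. {\<omega> \<in> space M. \<tau> n \<omega> \<noteq> enat (T \<omega>)}"
  have [measurable]: "?N n \<in> events" for n
  proof -
    have "{\<omega> \<in> space M. \<forall>k. T \<omega> = k \<longrightarrow> \<tau> n \<omega> \<noteq> enat k} \<in> events" by measurable
    then show ?thesis by simp
  qed
  have i: "integrable M (\<lambda>\<omega>. f \<omega> * indicator (A n) \<omega>)" "integrable M (\<lambda>\<omega>. f \<omega> * indicator B \<omega>)"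
    "integrable M (\<lambda>\<omega>. \<bar>f \<omega>\<bar> * indicator (?N n) \<omega>)" for n
    using f by (auto intro!: integrable_real_mult_indicator)
  have "\<bar>expectation (\<lambda>\<omega>. f \<omega> * indicator (A n) \<omega>) - expectation (\<lambda>\<omega>. f \<omega> * indicator B \<omega>)\<bar>
      \<le> expectation (\<lambda>\<omega>. \<bar>f \<omega>\<bar> * indicator (?N n) \<omega>)" for n
  proof -
    have "\<bar>expectation (\<lambda>\<omega>. f \<omega> * indicator (A n) \<omega>) - expectation (\<lambda>\<omega>. f \<omega> * indicator B \<omega>)\<bar>
        = \<bar>expectation (\<lambda>\<omega>. f \<omega> * indicator (A n) \<omega> - f \<omega> * indicator B \<omega>)\<bar>"
      using i by simp
    also have "\<dots> \<le> expectation (\<lambda>\<omega>. \<bar>f \<omega> * indicator (A n) \<omega> - f \<omega> * indicator B \<omega>\<bar>)"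
      by (rule integral_abs_bound)
    also have "\<dots> \<le> expectation (\<lambda>\<omega>. \<bar>f \<omega>\<bar> * indicator (?N n) \<omega>)"
    proof (rule integral_mono)
      show "\<bar>f \<omega> * indicator (A n) \<omega> - f \<omega> * indicator B \<omega>\<bar> \<le> \<bar>f \<omega>\<bar> * indicator (?N n) \<omega>"
        if "\<omega> \<in> space M" for \<omega>
        using AB[OF that, of n] that by (auto simp: indicator_def)
    qed (use i in auto)
    finally show ?thesis .
  qed
  then have "(\<lambda>n. expectation (\<lambda>\<omega>. f \<omega> * indicator (A n) \<omega>) - expectation (\<lambda>\<omega>. f \<omega> * indicator B \<omega>)) \<longlonglongrightarrow> 0"
    by (intro Lim_null_comparison[OF always_eventually tendsto_expectation_null_events[OF f _ T_lim]]) auto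
  then show ?thesis by (simp add: LIM_zero_iff)
qed

lemma tendsto_prob_gt: "(\<lambda>n. prob (gt n k)) \<longlonglongrightarrow> prob (Tgt k)"
  using tendsto_expectation_event[of "\<lambda>_. 1" "\<lambda>n. gt n k" "Tgt k"] by simp

text \<open>Finitely many tail probabilities pass to the limit at a time, so the sum may fall short
  of \<open>eh\<close>; the relative shortfall is \<open>p\<close>.\<close>

lemma sum_prob_gt_le: "(\<Sum>k<N. prob (Tgt k)) \<le> eh"
proof (rule LIMSEQ_le)
  show "(\<lambda>n. \<Sum>k<N. prob (gt n k)) \<longlonglongrightarrow> (\<Sum>k<N. prob (Tgt k))"
    by (intro tendsto_sum tendsto_prob_gt)
  show "e \<longlonglongrightarrow> eh" by (rule e_lim)
  have "(\<Sum>k<N. prob (gt n k)) \<le> e n" for n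
  proof -
    interpret C: moment_chain M "al n" "b n" xi "D n" "La n" Lx "P n" by (rule chain)
    have "(\<Sum>k<N. ennreal (prob (gt n k))) \<le> ennreal (e n)"
      using sum_le_suminf[of "\<lambda>k. ennreal (prob (gt n k))" "{..<N}"] C.tau_tail_sum
      by (simp add: e_def C.e_def)
    then show ?thesis
      using e_ge_1[of n] by (simp add: sum_nonneg)
  qed
  then show "\<exists>n0. \<forall>n\<ge>n0. (\<Sum>k<N. prob (gt n k)) \<le> e n" by auto
qed

lemma summable_prob_gt: "summable (\<lambda>k. prob (Tgt k))"
  by (rule bounded_imp_summable[where B=eh])
     (use sum_prob_gt_le[of "Suc _"] in \<open>auto simp: lessThan_Suc_atMost\<close>)

lemma prob_Tgt_lim: "(\<lambda>k. prob (Tgt k)) \<longlonglongrightarrow> 0"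
  by (rule summable_LIMSEQ_zero[OF summable_prob_gt])

definition C :: "'v \<Rightarrow> nat \<Rightarrow> nat \<Rightarrow> real" where
  "C u l k = expectation (\<lambda>\<omega>. (u \<bullet> (S k \<omega> - S l \<omega>))\<^sup>2 * indicator (Tgt k) \<omega>)"

text \<open>\<open>T\<close> comes without a filtration that makes it a stopping time. Wald's step
  is therefore transferred from \<open>\<tau> n\<close> by letting \<open>n\<close> tend to infinity
  with \<open>k\<close> fixed.\<close>

lemma wald_limit:
  assumes l: "l \<le> k"
  shows "expectation (\<lambda>\<omega>. (u \<bullet> (S (Suc k) \<omega> - S l \<omega>))\<^sup>2 * indicator (Tgt k) \<omega>) = C u l k + Q u * prob (Tgt k)"
proof (rule LIMSEQ_unique)
  show "(\<lambda>n. expectation (\<lambda>\<omega>. (u \<bullet> (S (Suc k) \<omega> - S l \<omega>))\<^sup>2 * indicator (gt n k) \<omega>))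
      \<longlonglongrightarrow> expectation (\<lambda>\<omega>. (u \<bullet> (S (Suc k) \<omega> - S l \<omega>))\<^sup>2 * indicator (Tgt k) \<omega>)"
    by (rule tendsto_expectation_event) (use l in \<open>auto intro: S_sq_int\<close>)
  have "(\<lambda>n. expectation (\<lambda>\<omega>. (u \<bullet> (S k \<omega> - S l \<omega>))\<^sup>2 * indicator (gt n k) \<omega>) + Q u * prob (gt n k))
      \<longlonglongrightarrow> C u l k + Q u * prob (Tgt k)"
    unfolding C_def by (intro tendsto_intros tendsto_prob_gt tendsto_expectation_event) (use l in \<open>auto intro: S_sq_int\<close>)
  then show "(\<lambda>n. expectation (\<lambda>\<omega>. (u \<bullet> (S (Suc k) \<omega> - S l \<omega>))\<^sup>2 * indicator (gt n k) \<omega>)) \<longlonglongrightarrow> C u l k + Q u * prob (Tgt k)"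
    using wald_step(2)[OF l S_sq_int[OF l]] by simp
qed

lemma Q_nonneg: "0 \<le> Q u" by (simp add: Q_def)

lemma C_nonneg: "0 \<le> C u l k"
  unfolding C_def by (intro integral_nonneg_AE) auto

lemma C_le: "C u l (l + N) \<le> Q u * (\<Sum>k<N. prob (Tgt (l + k)))"
proof (induction N)
  case 0
  then show ?case by (simp add: C_def)
next
  case (Suc N)
  have "C u l (l + Suc N) \<le> expectation (\<lambda>\<omega>. (u \<bullet> (S (Suc (l + N)) \<omega> - S l \<omega>))\<^sup>2 * indicator (Tgt (l + N)) \<omega>)"
    unfolding C_def using S_sq_int[of l "Suc (l + N)" u]
    by (intro integral_mono integrable_real_mult_indicator) (auto simp: indicator_def)
  also have "\<dots> = C u l (l + N) + Q u * prob (Tgt (l + N))" by (rule wald_limit) simp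
  finally show ?case using Suc by (simp add: distrib_left)
qed

text \<open>This boundary term has to vanish in Wald's identity. The walk is split at a fixed time
  \<open>l\<close>: increments after \<open>l\<close> are controlled by the tail of the convergent
  sum of survival probabilities, and \<open>S l\<close> is a fixed square integrable variable on
  events of vanishing probability.\<close>

lemma C_lim: "(\<lambda>k. C u 0 k) \<longlonglongrightarrow> 0"
proof (rule LIMSEQ_I)
  fix \<epsilon> :: real assume \<epsilon>: "0 < \<epsilon>"
  \<comment> \<open>The summand 1 covers \<open>Q u = 0\<close>. With the factor 2 from splitting
    the square, both parts together give at most half of \<open>\<epsilon>\<close>.\<close>
  define \<epsilon>' where "\<epsilon>' = \<epsilon> / (8 * (Q u + 1))"
  have \<epsilon>': "0 < \<epsilon>'" using \<epsilon> Q_nonneg[of u] by (simp add: \<epsilon>'_def)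
  obtain l where l: "\<And>N. \<bar>\<Sum>k\<in>{l..<N}. prob (Tgt k)\<bar> < \<epsilon>'"
    using summable_prob_gt \<epsilon>' unfolding summable_Cauchy by fastforce
  have tail: "(\<Sum>k<N. prob (Tgt (l + k))) < \<epsilon>'" for N
  proof -
    have "(\<Sum>k<N. prob (Tgt (l + k))) = (\<Sum>k\<in>{l..<l + N}. prob (Tgt k))"
      using sum.shift_bounds_nat_ivl[of "\<lambda>k. prob (Tgt k)" 0 l N] by (simp add: add.commute lessThan_atLeast0)
    then show ?thesis using l[of "l + N"] by simp
  qed
  have "(\<lambda>k. expectation (\<lambda>\<omega>. \<bar>(u \<bullet> S l \<omega>)\<^sup>2\<bar> * indicator (Tgt k) \<omega>)) \<longlonglongrightarrow> 0"
    by (rule tendsto_expectation_null_events[OF S_sq_int0 _ prob_Tgt_lim]) measurable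
  from LIMSEQ_D[OF this, of "\<epsilon> / 8"] \<epsilon> obtain k0 where
    k0: "\<And>k. k0 \<le> k \<Longrightarrow> expectation (\<lambda>\<omega>. (u \<bullet> S l \<omega>)\<^sup>2 * indicator (Tgt k) \<omega>) < \<epsilon> / 8"
    by fastforce
  show "\<exists>k0. \<forall>k\<ge>k0. norm (C u 0 k - 0) < \<epsilon>"
  proof (intro exI[of _ "max k0 l"] allI impI)
    fix k assume k: "max k0 l \<le> k"
    then obtain N where N: "k = l + N" using le_Suc_ex by auto
    have sq2: "x\<^sup>2 \<le> 2 * (y\<^sup>2 + (x - y)\<^sup>2)" for x y :: real
      using zero_le_power2[of "x - 2 * y"] by (simp add: power2_eq_square algebra_simps)
    have i: "integrable M (\<lambda>\<omega>. (u \<bullet> S l \<omega>)\<^sup>2 * indicator (Tgt k) \<omega>)"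
      "integrable M (\<lambda>\<omega>. (u \<bullet> S k \<omega>)\<^sup>2 * indicator (Tgt k) \<omega>)"
      "integrable M (\<lambda>\<omega>. (u \<bullet> (S k \<omega> - S l \<omega>))\<^sup>2 * indicator (Tgt k) \<omega>)"
      using S_sq_int[of l k u] k by (auto intro!: integrable_real_mult_indicator S_sq_int0)
    have "C u 0 k \<le> expectation (\<lambda>\<omega>. 2 * ((u \<bullet> S l \<omega>)\<^sup>2 * indicator (Tgt k) \<omega> + (u \<bullet> (S k \<omega> - S l \<omega>))\<^sup>2 * indicator (Tgt k) \<omega>))"
      unfolding C_def
    proof (rule integral_mono)
      show "(u \<bullet> (S k \<omega> - S 0 \<omega>))\<^sup>2 * indicator (Tgt k) \<omega>
          \<le> 2 * ((u \<bullet> S l \<omega>)\<^sup>2 * indicator (Tgt k) \<omega> + (u \<bullet> (S k \<omega> - S l \<omega>))\<^sup>2 * indicator (Tgt k) \<omega>)" for \<omega>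
        using sq2[of "u \<bullet> S k \<omega>" "u \<bullet> S l \<omega>"] by (simp add: inner_diff_right indicator_def)
    qed (use i in auto)
    also have "\<dots> = 2 * (expectation (\<lambda>\<omega>. (u \<bullet> S l \<omega>)\<^sup>2 * indicator (Tgt k) \<omega>) + C u l k)"
      using i by (simp add: C_def)
    also have "\<dots> \<le> 2 * (\<epsilon> / 8 + Q u * \<epsilon>')"
    proof (intro mult_left_mono add_mono)
      show "expectation (\<lambda>\<omega>. (u \<bullet> S l \<omega>)\<^sup>2 * indicator (Tgt k) \<omega>) \<le> \<epsilon> / 8" using k0[of k] k by simp
      have "C u l k \<le> Q u * (\<Sum>k<N. prob (Tgt (l + k)))" unfolding N by (rule C_le)
      also have "\<dots> \<le> Q u * \<epsilon>'" using tail[of N] Q_nonneg[of u] by (intro mult_left_mono) auto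
      finally show "C u l k \<le> Q u * \<epsilon>'" .
    qed simp
    also have "Q u * \<epsilon>' \<le> (Q u + 1) * \<epsilon>'" using \<epsilon>' by simp
    also have "(Q u + 1) * \<epsilon>' = \<epsilon> / 8" using Q_nonneg[of u]
      by (simp add: \<epsilon>'_def del: distrib_left_numeral)
    finally show "norm (C u 0 k - 0) < \<epsilon>" using C_nonneg[of u 0 k] \<epsilon> by simp
  qed
qed

text \<open>The second moment of the walk stopped at \<open>T\<close>, restricted to
  \<open>1 \<le> T \<le> N\<close>.\<close>

definition Wsum :: "'v \<Rightarrow> nat \<Rightarrow> real" where
  "Wsum u N = (\<Sum>k<N. expectation (\<lambda>\<omega>. (u \<bullet> S (Suc k) \<omega>)\<^sup>2 * indicator {\<omega> \<in> space M. T \<omega> = Suc k} \<omega>))"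

text \<open>The event \<open>T = Suc N\<close> is the difference of the survival events at
  \<open>N\<close> and \<open>Suc N\<close>, so the sum telescopes and leaves the boundary term
  \<open>C u 0 N\<close>.\<close>

lemma Wsum_eq: "Wsum u N = Q u * (\<Sum>k<N. prob (Tgt k)) - C u 0 N"
proof (induction N)
  case 0
  then show ?case by (simp add: Wsum_def C_def)
next
  case (Suc N)
  have "expectation (\<lambda>\<omega>. (u \<bullet> S (Suc N) \<omega>)\<^sup>2 * indicator {\<omega> \<in> space M. T \<omega> = Suc N} \<omega>)
      = expectation (\<lambda>\<omega>. (u \<bullet> S (Suc N) \<omega>)\<^sup>2 * indicator (Tgt N) \<omega> - (u \<bullet> S (Suc N) \<omega>)\<^sup>2 * indicator (Tgt (Suc N)) \<omega>)"
    by (intro Bochner_Integration.integral_cong) (auto simp: indicator_def)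
  also have "\<dots> = expectation (\<lambda>\<omega>. (u \<bullet> S (Suc N) \<omega>)\<^sup>2 * indicator (Tgt N) \<omega>) - C u 0 (Suc N)"
    by (subst Bochner_Integration.integral_diff) (auto intro!: integrable_real_mult_indicator S_sq_int0 simp: C_def)
  also have "expectation (\<lambda>\<omega>. (u \<bullet> S (Suc N) \<omega>)\<^sup>2 * indicator (Tgt N) \<omega>) = C u 0 N + Q u * prob (Tgt N)"
    using wald_limit[of 0 N u] by simp
  finally show ?case using Suc by (simp add: Wsum_def distrib_left)
qed

lemma Wsum_lim: "(\<lambda>N. Wsum u N) \<longlonglongrightarrow> Q u * (\<Sum>k. prob (Tgt k))"
proof -
  have "(\<lambda>N. Q u * (\<Sum>k<N. prob (Tgt k)) - C u 0 N) \<longlonglongrightarrow> Q u * (\<Sum>k. prob (Tgt k)) - 0"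
    by (intro tendsto_intros summable_LIMSEQ summable_prob_gt C_lim)
  then show ?thesis by (simp add: Wsum_eq)
qed

text \<open>Three replacements, one at a time: the rescaled chain by the random walk, by mean square
  convergence; the rescaled remainder by \<open>- s^2 / 2\<close>, by domination; the event
  \<open>\<tau> n = k\<close> by \<open>T = k\<close>, by integrability of the now fixed
  square.\<close>

lemma tendsto_iexp2_X:
  "(\<lambda>n. CLINT \<omega>|M. indicator {\<omega> \<in> space M. \<tau> n \<omega> = enat k} \<omega> *\<^sub>R (r n * iexp2 (u \<bullet> X n k \<omega>)))
    \<longlonglongrightarrow> complex_of_real (- expectation (\<lambda>\<omega>. (u \<bullet> S k \<omega>)\<^sup>2 * indicator {\<omega> \<in> space M. T \<omega> = k} \<omega>) / 2)"
proof -
  let ?A = "\<lambda>n. {\<omega> \<in> space M. \<tau> n \<omega> = enat k}" and ?B = "{\<omega> \<in> space M. T \<omega> = k}"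
  have [measurable]: "?A n \<in> events" "?B \<in> events" for n by measurable
  let ?y = "\<lambda>n \<omega>. sqrt (r n) * (u \<bullet> X n k \<omega>)" and ?s = "\<lambda>\<omega>. u \<bullet> S k \<omega>"
  \<comment> \<open>The remainder in the rescaled variable; its bound \<open>s^2 / 2\<close> is free
    of \<open>n\<close>.\<close>
  define h where "h n s = complex_of_real (r n) * iexp2 (s / sqrt (r n))" for n s
  have h_meas [measurable]: "h n \<in> borel_measurable borel" for n unfolding h_def[abs_def] by measurable
  have h_le: "cmod (h n s) \<le> s\<^sup>2 / 2" for n s
  proof -
    have "cmod (h n s) \<le> r n * ((s / sqrt (r n))\<^sup>2 / 2)"
      unfolding h_def norm_mult norm_of_real using r_pos[of n] norm_iexp2[of "s / sqrt (r n)"]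
      by (intro mult_mono) auto
    then show ?thesis using r_pos[of n] by (simp add: power_divide)
  qed
  have hy: "h n (?y n \<omega>) = r n * iexp2 (u \<bullet> X n k \<omega>)" for n \<omega>
    using r_pos[of n] by (simp add: h_def)
  have d_int: "integrable M (\<lambda>\<omega>. (?y n \<omega> - ?s \<omega>)\<^sup>2)" for n using X_L2[of u k] by blast
  have s_int: "integrable M (\<lambda>\<omega>. (?s \<omega>)\<^sup>2)" by (rule S_sq_int0)
  have y_int: "integrable M (\<lambda>\<omega>. (?y n \<omega>)\<^sup>2)" for n
  proof (rule Bochner_Integration.integrable_bound)
    show "integrable M (\<lambda>\<omega>. 2 * ((?y n \<omega> - ?s \<omega>)\<^sup>2 + (?s \<omega>)\<^sup>2))" using d_int s_int by auto
    have sq2: "x\<^sup>2 \<le> 2 * ((x - y)\<^sup>2 + y\<^sup>2)" for x y :: real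
      using zero_le_power2[of "x - 2 * y"] by (simp add: power2_eq_square algebra_simps)
    show "AE \<omega> in M. norm ((?y n \<omega>)\<^sup>2) \<le> norm (2 * ((?y n \<omega> - ?s \<omega>)\<^sup>2 + (?s \<omega>)\<^sup>2))"
    proof (intro AE_I2)
      fix \<omega>
      show "norm ((?y n \<omega>)\<^sup>2) \<le> norm (2 * ((?y n \<omega> - ?s \<omega>)\<^sup>2 + (?s \<omega>)\<^sup>2))"
        using sq2[of "?y n \<omega>" "?s \<omega>"] by simp
    qed
  qed measurable
  have hy_int: "integrable M (\<lambda>\<omega>. h n (?y n \<omega>))" and hs_int: "integrable M (\<lambda>\<omega>. h n (?s \<omega>))" for n
  proof -
    have "cmod (h n x) \<le> norm (x\<^sup>2)" for x using h_le[of n x] zero_le_power2[of x] unfolding real_norm_def by linarith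
    then show "integrable M (\<lambda>\<omega>. h n (?y n \<omega>))" "integrable M (\<lambda>\<omega>. h n (?s \<omega>))"
      by (intro Bochner_Integration.integrable_bound[OF y_int[of n]] Bochner_Integration.integrable_bound[OF s_int] AE_I2; simp)+
  qed
  have ind: "integrable M (\<lambda>\<omega>. indicator (?A n) \<omega> *\<^sub>R f \<omega>)" if "integrable M f" for f :: "'a \<Rightarrow> complex" and n
    using that by (intro integrable_mult_indicator) auto
  have 1: "(\<lambda>n. (CLINT \<omega>|M. indicator (?A n) \<omega> *\<^sub>R h n (?y n \<omega>)) - (CLINT \<omega>|M. indicator (?A n) \<omega> *\<^sub>R h n (?s \<omega>))) \<longlonglongrightarrow> 0"
  proof (rule LIMSEQ_I)
    fix \<epsilon> :: real assume \<epsilon>: "0 < \<epsilon>"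
    define s where "s = expectation (\<lambda>\<omega>. (?s \<omega>)\<^sup>2)"
    have s0: "0 \<le> s" unfolding s_def by (intro integral_nonneg_AE) auto
    \<comment> \<open>\<open>\<eta>\<close> is fixed first, against the constant second moment
      \<open>s\<close>; the possibly large factor \<open>c\<close> then multiplies a term that tends
      to 0.\<close>
    define \<eta> where "\<eta> = \<epsilon> / (s + 1)"
    have \<eta>: "0 < \<eta>" using \<epsilon> s0 by (simp add: \<eta>_def)
    define c where "c = 1 / 2 + 1 / (2 * \<eta>)"
    have c: "0 < c" using \<eta> by (simp add: c_def add_pos_pos)
    have bound: "cmod ((CLINT \<omega>|M. indicator (?A n) \<omega> *\<^sub>R h n (?y n \<omega>)) - (CLINT \<omega>|M. indicator (?A n) \<omega> *\<^sub>R h n (?s \<omega>)))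
        \<le> c * expectation (\<lambda>\<omega>. (?y n \<omega> - ?s \<omega>)\<^sup>2) + \<eta> / 2 * s" for n
    proof -
      have "(CLINT \<omega>|M. indicator (?A n) \<omega> *\<^sub>R h n (?y n \<omega>)) - (CLINT \<omega>|M. indicator (?A n) \<omega> *\<^sub>R h n (?s \<omega>))
          = (CLINT \<omega>|M. indicator (?A n) \<omega> *\<^sub>R h n (?y n \<omega>) - indicator (?A n) \<omega> *\<^sub>R h n (?s \<omega>))"
        by (rule Bochner_Integration.integral_diff[symmetric]) (intro ind hy_int hs_int)+
      then have "cmod ((CLINT \<omega>|M. indicator (?A n) \<omega> *\<^sub>R h n (?y n \<omega>)) - (CLINT \<omega>|M. indicator (?A n) \<omega> *\<^sub>R h n (?s \<omega>)))
          \<le> expectation (\<lambda>\<omega>. cmod (indicator (?A n) \<omega> *\<^sub>R h n (?y n \<omega>) - indicator (?A n) \<omega> *\<^sub>R h n (?s \<omega>)))"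
        by (simp only: integral_norm_bound)
      also have "\<dots> \<le> expectation (\<lambda>\<omega>. c * (?y n \<omega> - ?s \<omega>)\<^sup>2 + \<eta> / 2 * (?s \<omega>)\<^sup>2)"
      proof (rule integral_mono)
        fix \<omega>
        have "cmod (indicator (?A n) \<omega> *\<^sub>R h n (?y n \<omega>) - indicator (?A n) \<omega> *\<^sub>R h n (?s \<omega>)) \<le> cmod (h n (?y n \<omega>) - h n (?s \<omega>))"
          by (simp add: indicator_def)
        also have "\<dots> \<le> c * (?y n \<omega> - ?s \<omega>)\<^sup>2 + \<eta> / 2 * (?s \<omega>)\<^sup>2"
          unfolding h_def c_def by (rule iexp2_scaled_diff[OF r_pos \<eta>])
        finally show "cmod (indicator (?A n) \<omega> *\<^sub>R h n (?y n \<omega>) - indicator (?A n) \<omega> *\<^sub>R h n (?s \<omega>))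
            \<le> c * (?y n \<omega> - ?s \<omega>)\<^sup>2 + \<eta> / 2 * (?s \<omega>)\<^sup>2" .
        show "integrable M (\<lambda>\<omega>. cmod (indicator (?A n) \<omega> *\<^sub>R h n (?y n \<omega>) - indicator (?A n) \<omega> *\<^sub>R h n (?s \<omega>)))"
          by (intro integrable_norm Bochner_Integration.integrable_diff ind hy_int hs_int)
        show "integrable M (\<lambda>\<omega>. c * (?y n \<omega> - ?s \<omega>)\<^sup>2 + \<eta> / 2 * (?s \<omega>)\<^sup>2)"
          using d_int s_int by (intro Bochner_Integration.integrable_add integrable_mult_right)
      qed
      also have "\<dots> = c * expectation (\<lambda>\<omega>. (?y n \<omega> - ?s \<omega>)\<^sup>2) + \<eta> / 2 * s"
        using integrable_mult_right[OF d_int[of n], of c] integrable_mult_right[OF s_int, of "\<eta> / 2"]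
        by (simp add: s_def)
      finally show ?thesis .
    qed
    have "0 < \<epsilon> / (2 * c)" using \<epsilon> c by simp
    from LIMSEQ_D[OF conjunct1[OF X_L2[of u k]] this] obtain n0
      where n0: "\<And>n. n0 \<le> n \<Longrightarrow> expectation (\<lambda>\<omega>. (?y n \<omega> - ?s \<omega>)\<^sup>2) < \<epsilon> / (2 * c)" by fastforce
    have "\<eta> / 2 * s \<le> \<epsilon> / 2"
    proof -
      have "\<eta> / 2 * s \<le> \<eta> / 2 * (s + 1)" using \<eta> by simp
      also have "\<eta> / 2 * (s + 1) = (\<eta> * (s + 1)) / 2" by simp
      also have "\<eta> * (s + 1) = \<epsilon>" using s0 by (simp add: \<eta>_def)
      finally show ?thesis .
    qed
    moreover have small: "c * expectation (\<lambda>\<omega>. (?y n \<omega> - ?s \<omega>)\<^sup>2) < \<epsilon> / 2" if "n0 \<le> n" for n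
      using n0[OF that] c by (simp add: field_simps)
    ultimately show "\<exists>n0. \<forall>n\<ge>n0. norm ((CLINT \<omega>|M. indicator (?A n) \<omega> *\<^sub>R h n (?y n \<omega>)) - (CLINT \<omega>|M. indicator (?A n) \<omega> *\<^sub>R h n (?s \<omega>)) - 0) < \<epsilon>"
    proof (intro exI[of _ n0] allI impI)
      fix n assume "n0 \<le> n"
      then have "c * expectation (\<lambda>\<omega>. (?y n \<omega> - ?s \<omega>)\<^sup>2) + \<eta> / 2 * s < \<epsilon>"
        using small[of n] \<open>\<eta> / 2 * s \<le> \<epsilon> / 2\<close> by linarith
      from le_less_trans[OF bound this]
      show "norm ((CLINT \<omega>|M. indicator (?A n) \<omega> *\<^sub>R h n (?y n \<omega>)) - (CLINT \<omega>|M. indicator (?A n) \<omega> *\<^sub>R h n (?s \<omega>)) - 0) < \<epsilon>"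
        by (simp only: diff_zero)
    qed
  qed
  have 2: "(\<lambda>n. (CLINT \<omega>|M. indicator (?A n) \<omega> *\<^sub>R h n (?s \<omega>)) - (CLINT \<omega>|M. indicator (?A n) \<omega> *\<^sub>R complex_of_real (- (?s \<omega>)\<^sup>2 / 2))) \<longlonglongrightarrow> 0"
  proof (rule Lim_null_comparison)
    have s2_int: "integrable M (\<lambda>\<omega>. complex_of_real (- (?s \<omega>)\<^sup>2 / 2))"
      using s_int by (intro integrable_of_real) auto
    show "\<forall>\<^sub>F n in sequentially. cmod ((CLINT \<omega>|M. indicator (?A n) \<omega> *\<^sub>R h n (?s \<omega>)) - (CLINT \<omega>|M. indicator (?A n) \<omega> *\<^sub>R complex_of_real (- (?s \<omega>)\<^sup>2 / 2)))
        \<le> expectation (\<lambda>\<omega>. cmod (h n (?s \<omega>) - complex_of_real (- (?s \<omega>)\<^sup>2 / 2)))"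
    proof (intro always_eventually allI)
      fix n
      have "(CLINT \<omega>|M. indicator (?A n) \<omega> *\<^sub>R h n (?s \<omega>)) - (CLINT \<omega>|M. indicator (?A n) \<omega> *\<^sub>R complex_of_real (- (?s \<omega>)\<^sup>2 / 2))
          = (CLINT \<omega>|M. indicator (?A n) \<omega> *\<^sub>R h n (?s \<omega>) - indicator (?A n) \<omega> *\<^sub>R complex_of_real (- (?s \<omega>)\<^sup>2 / 2))"
        by (rule Bochner_Integration.integral_diff[symmetric]) (intro ind s2_int hs_int)+
      then have "cmod ((CLINT \<omega>|M. indicator (?A n) \<omega> *\<^sub>R h n (?s \<omega>)) - (CLINT \<omega>|M. indicator (?A n) \<omega> *\<^sub>R complex_of_real (- (?s \<omega>)\<^sup>2 / 2)))
          \<le> expectation (\<lambda>\<omega>. cmod (indicator (?A n) \<omega> *\<^sub>R h n (?s \<omega>) - indicator (?A n) \<omega> *\<^sub>R complex_of_real (- (?s \<omega>)\<^sup>2 / 2)))"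
        by (simp only: integral_norm_bound)
      also have "\<dots> \<le> expectation (\<lambda>\<omega>. cmod (h n (?s \<omega>) - complex_of_real (- (?s \<omega>)\<^sup>2 / 2)))"
        by (intro integral_mono integrable_norm Bochner_Integration.integrable_diff ind hs_int s2_int)
           (simp add: indicator_def)
      finally show "cmod ((CLINT \<omega>|M. indicator (?A n) \<omega> *\<^sub>R h n (?s \<omega>)) - (CLINT \<omega>|M. indicator (?A n) \<omega> *\<^sub>R complex_of_real (- (?s \<omega>)\<^sup>2 / 2)))
        \<le> expectation (\<lambda>\<omega>. cmod (h n (?s \<omega>) - complex_of_real (- (?s \<omega>)\<^sup>2 / 2)))" .
    qed
    have "(\<lambda>n. expectation (\<lambda>\<omega>. cmod (h n (?s \<omega>) - complex_of_real (- (?s \<omega>)\<^sup>2 / 2)))) \<longlonglongrightarrow> expectation (\<lambda>\<omega>. 0)"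
    proof (rule integral_dominated_convergence[where w="\<lambda>\<omega>. (?s \<omega>)\<^sup>2"])
      show "AE \<omega> in M. (\<lambda>n. cmod (h n (?s \<omega>) - complex_of_real (- (?s \<omega>)\<^sup>2 / 2))) \<longlonglongrightarrow> 0"
        unfolding h_def by (intro AE_I2 tendsto_norm_zero) (rule LIM_zero[OF tendsto_iexp2_scaled[OF r_lim r_pos]])
      show "AE \<omega> in M. norm (cmod (h n (?s \<omega>) - complex_of_real (- (?s \<omega>)\<^sup>2 / 2))) \<le> (?s \<omega>)\<^sup>2" for n
      proof (intro AE_I2)
        fix \<omega>
        have "cmod (h n (?s \<omega>) - complex_of_real (- (?s \<omega>)\<^sup>2 / 2)) \<le> cmod (h n (?s \<omega>)) + cmod (complex_of_real (- (?s \<omega>)\<^sup>2 / 2))"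
          by (rule norm_triangle_ineq4)
        also have "\<dots> \<le> (?s \<omega>)\<^sup>2 / 2 + (?s \<omega>)\<^sup>2 / 2"
          using h_le[of n "?s \<omega>"] unfolding norm_of_real by (intro add_mono) auto
        finally show "norm (cmod (h n (?s \<omega>) - complex_of_real (- (?s \<omega>)\<^sup>2 / 2))) \<le> (?s \<omega>)\<^sup>2" by simp
      qed
    qed (use s_int in \<open>simp_all, measurable\<close>)
    then show "(\<lambda>n. expectation (\<lambda>\<omega>. cmod (h n (?s \<omega>) - complex_of_real (- (?s \<omega>)\<^sup>2 / 2)))) \<longlonglongrightarrow> 0" by simp
  qed
  have 3: "(\<lambda>n. CLINT \<omega>|M. indicator (?A n) \<omega> *\<^sub>R complex_of_real (- (?s \<omega>)\<^sup>2 / 2))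
      \<longlonglongrightarrow> complex_of_real (- expectation (\<lambda>\<omega>. (?s \<omega>)\<^sup>2 * indicator ?B \<omega>) / 2)"
  proof -
    have "(CLINT \<omega>|M. indicator (?A n) \<omega> *\<^sub>R complex_of_real (- (?s \<omega>)\<^sup>2 / 2))
        = complex_of_real (- expectation (\<lambda>\<omega>. (?s \<omega>)\<^sup>2 * indicator (?A n) \<omega>) / 2)" for n
    proof -
      have "(CLINT \<omega>|M. indicator (?A n) \<omega> *\<^sub>R complex_of_real (- (?s \<omega>)\<^sup>2 / 2))
          = (CLINT \<omega>|M. complex_of_real (- ((?s \<omega>)\<^sup>2 * indicator (?A n) \<omega>) / 2))"
        by (intro Bochner_Integration.integral_cong) (auto simp: indicator_def)
      then show ?thesis unfolding integral_complex_of_real by simp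
    qed
    moreover have "(\<lambda>n. expectation (\<lambda>\<omega>. (?s \<omega>)\<^sup>2 * indicator (?A n) \<omega>)) \<longlonglongrightarrow> expectation (\<lambda>\<omega>. (?s \<omega>)\<^sup>2 * indicator ?B \<omega>)"
      by (rule tendsto_expectation_event[OF s_int]) auto
    ultimately show ?thesis by (simp only:) (intro tendsto_intros; simp)
  qed
  from tendsto_add[OF tendsto_add[OF 1 2] 3] show ?thesis unfolding hy by simp
qed

text \<open>Two regimes handle the unknown scale \<open>g\<close>. If \<open>r * g^2\<close> is at
  most \<open>L\<close>, a small survival probability suffices. Otherwise a late return needs a
  first innovation whose square is at least \<open>L * r0^2 / 4\<close>, and the truncated second
  moment is small. \<open>L\<close> is chosen before \<open>k\<close>.\<close>

lemma tail_bound: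
  assumes \<epsilon>: "0 < \<epsilon>"
  obtains K where "1 \<le> K" "\<And>k. K \<le> k \<Longrightarrow> \<forall>\<^sub>F n in sequentially. r n * ((g n * R0)\<^sup>2 * prob (gt n k)) \<le> \<epsilon>"
proof -
  let ?x = "\<lambda>\<omega>. (norm (xi (Suc 0) \<omega>))\<^sup>2"
  have xint: "integrable M ?x"
  proof -
    interpret C: moment_chain M "al 0" "b 0" xi "D 0" "La 0" Lx "P 0" by (rule chain)
    show ?thesis by (rule C.xi_sq_int)
  qed
  define h where "h L = expectation (\<lambda>\<omega>. ?x \<omega> * indicator {\<omega> \<in> space M. real L * r0\<^sup>2 / 4 \<le> ?x \<omega>} \<omega>)" for L :: nat
  have "h \<longlonglongrightarrow> expectation (\<lambda>\<omega>. 0)"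
    unfolding h_def[abs_def]
  proof (rule integral_dominated_convergence[where w="?x"])
    show "AE \<omega> in M. (\<lambda>L. ?x \<omega> * indicator {\<omega> \<in> space M. real L * r0\<^sup>2 / 4 \<le> ?x \<omega>} \<omega>) \<longlonglongrightarrow> 0"
    proof (intro AE_I2 tendsto_eventually)
      fix \<omega>
      obtain L0 :: nat where "?x \<omega> < real L0 * (r0\<^sup>2 / 4)"
        using ex_less_of_nat_mult[of "r0\<^sup>2 / 4" "?x \<omega>"] radii(1) by (auto simp: mult.commute)
      moreover have "real L0 * (r0\<^sup>2 / 4) \<le> real L * (r0\<^sup>2 / 4)" if "L0 \<le> L" for L
        using that by (intro mult_right_mono) auto
      ultimately show "\<forall>\<^sub>F L in sequentially. ?x \<omega> * indicator {\<omega> \<in> space M. real L * r0\<^sup>2 / 4 \<le> ?x \<omega>} \<omega> = 0"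
        unfolding eventually_sequentially by (intro exI[of _ L0]) (force simp: indicator_def)
    qed
  qed (use xint in \<open>auto simp: indicator_def\<close>)
  then have "h \<longlonglongrightarrow> 0" by simp
  moreover have "0 < \<epsilon> * r0\<^sup>2 / (4 * R0\<^sup>2)" using \<epsilon> radii by simp
  ultimately have "\<forall>\<^sub>F L in sequentially. h L < \<epsilon> * r0\<^sup>2 / (4 * R0\<^sup>2)" by (rule order_tendstoD(2))
  then obtain L where L: "h L < \<epsilon> * r0\<^sup>2 / (4 * R0\<^sup>2)" by (auto simp: eventually_sequentially)
  have "0 < \<epsilon> / ((real L + 1) * R0\<^sup>2)" using \<epsilon> radii by simp
  with prob_Tgt_lim have "\<forall>\<^sub>F k in sequentially. prob (Tgt k) < \<epsilon> / ((real L + 1) * R0\<^sup>2)" by (rule order_tendstoD(2))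
  then obtain K0 where K0: "\<And>k. K0 \<le> k \<Longrightarrow> prob (Tgt k) < \<epsilon> / ((real L + 1) * R0\<^sup>2)"
    unfolding eventually_sequentially by blast
  show ?thesis
  proof (rule that[of "max 1 K0"])
    fix k assume k: "max 1 K0 \<le> k"
    have "\<forall>\<^sub>F n in sequentially. prob (gt n k) < \<epsilon> / ((real L + 1) * R0\<^sup>2)"
      by (rule order_tendstoD(2)[OF tendsto_prob_gt]) (use K0 k in simp)
    \<comment> \<open>Any constant above the limit 1 would serve; 4 is the one built into the
      truncation level in \<open>h\<close>.\<close>
    moreover have "\<forall>\<^sub>F n in sequentially. r n * (b n)\<^sup>2 < 4"
      by (rule order_tendstoD(2)[OF rb_sq_lim]) simp
    ultimately show "\<forall>\<^sub>F n in sequentially. r n * ((g n * R0)\<^sup>2 * prob (gt n k)) \<le> \<epsilon>"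
    proof eventually_elim
      case (elim n)
      show ?case
      proof (cases "r n * (g n)\<^sup>2 \<le> real L")
        case True
        have "r n * ((g n * R0)\<^sup>2 * prob (gt n k)) = (r n * (g n)\<^sup>2) * (R0\<^sup>2 * prob (gt n k))"
          by (simp add: power_mult_distrib)
        also have "\<dots> \<le> (real L + 1) * (R0\<^sup>2 * (\<epsilon> / ((real L + 1) * R0\<^sup>2)))"
          using True elim by (intro mult_mono) auto
        also have "\<dots> = ((real L + 1) * R0\<^sup>2) * (\<epsilon> / ((real L + 1) * R0\<^sup>2))" by simp
        also have "\<dots> = \<epsilon>" using radii by (subst nonzero_mult_div_cancel_left[symmetric, of "(real L + 1) * R0\<^sup>2" \<epsilon>]) auto
        finally show ?thesis .
      next
        case False
        interpret C: moment_chain M "al n" "b n" xi "D n" "La n" Lx "P n" by (rule chain)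
        have pos: "0 < g n * r0" using radii by simp
        have "prob (gt n k) \<le> (b n)\<^sup>2 / (g n * r0)\<^sup>2
            * expectation (\<lambda>\<omega>. ?x \<omega> * indicator {\<omega> \<in> space M. g n * r0 \<le> \<bar>b n\<bar> * norm (xi (Suc 0) \<omega>)} \<omega>)"
          using k by (intro C.prob_tau_gt_le pos inner_ball) simp
        also have "\<dots> \<le> (b n)\<^sup>2 / (g n * r0)\<^sup>2 * h L"
        proof (intro mult_left_mono)
          show "expectation (\<lambda>\<omega>. ?x \<omega> * indicator {\<omega> \<in> space M. g n * r0 \<le> \<bar>b n\<bar> * norm (xi (Suc 0) \<omega>)} \<omega>) \<le> h L"
            unfolding h_def
          proof (rule integral_mono)
            fix \<omega>
            have "real L * r0\<^sup>2 / 4 \<le> ?x \<omega>" if "g n * r0 \<le> \<bar>b n\<bar> * norm (xi (Suc 0) \<omega>)"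
            proof -
              have "(g n * r0)\<^sup>2 \<le> (\<bar>b n\<bar> * norm (xi (Suc 0) \<omega>))\<^sup>2" using that pos by (intro power_mono) auto
              then have "r n * (g n * r0)\<^sup>2 \<le> r n * ((b n)\<^sup>2 * ?x \<omega>)"
                using r_pos[of n] by (intro mult_left_mono) (auto simp: power_mult_distrib)
              also have "\<dots> = (r n * (b n)\<^sup>2) * ?x \<omega>" by simp
              also have "\<dots> \<le> 4 * ?x \<omega>" using elim by (intro mult_right_mono) auto
              finally have "(r n * (g n)\<^sup>2) * r0\<^sup>2 \<le> 4 * ?x \<omega>" by (simp add: power_mult_distrib)
              moreover have "real L * r0\<^sup>2 \<le> (r n * (g n)\<^sup>2) * r0\<^sup>2" using False by (intro mult_right_mono) auto
              ultimately show ?thesis by simp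
            qed
            then show "?x \<omega> * indicator {\<omega> \<in> space M. g n * r0 \<le> \<bar>b n\<bar> * norm (xi (Suc 0) \<omega>)} \<omega>
                \<le> ?x \<omega> * indicator {\<omega> \<in> space M. real L * r0\<^sup>2 / 4 \<le> ?x \<omega>} \<omega>"
              by (auto simp: indicator_def)
          qed (intro integrable_real_mult_indicator xint; measurable)+
        qed simp
        finally have "r n * ((g n * R0)\<^sup>2 * prob (gt n k)) \<le> r n * ((g n * R0)\<^sup>2 * ((b n)\<^sup>2 / (g n * r0)\<^sup>2 * h L))"
          using r_pos[of n] by (intro mult_left_mono) auto
        also have "\<dots> = (r n * (b n)\<^sup>2) * (R0\<^sup>2 / r0\<^sup>2 * h L)"
          using radii(3)[of n] by (simp add: power_mult_distrib)
        also have "\<dots> \<le> 4 * (R0\<^sup>2 / r0\<^sup>2 * h L)"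
          using elim by (intro mult_right_mono mult_nonneg_nonneg) (auto simp: h_def intro!: integral_nonneg_AE)
        also have "\<dots> \<le> 4 * (R0\<^sup>2 / r0\<^sup>2 * (\<epsilon> * r0\<^sup>2 / (4 * R0\<^sup>2)))"
          using L by (intro mult_left_mono) auto
        also have "\<dots> = \<epsilon>" using radii by (simp add: field_simps)
        finally show ?thesis .
      qed
    qed
  qed simp
qed

text \<open>The expectation over the stopped state is split by whether the return comes by time
  \<open>K\<close>. For fixed \<open>K\<close> the early part converges to the truncated Wald sum;
  the late part is small for all large \<open>n\<close>; then \<open>K\<close> grows. Only
  afterwards is \<open>e n\<close> divided out, so the denominator is \<open>eh\<close> and not the
  mean of \<open>T\<close>.\<close>

theorem tendsto_G_finite:
  "(\<lambda>n. r n * reset_law.G (P n) (D n) u) \<longlonglongrightarrow> complex_of_real (- ((\<Sum>k. prob (Tgt k)) / eh) * Q u / 2)"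
proof -
  let ?A = "\<lambda>n k. {\<omega> \<in> space M. \<tau> n \<omega> = enat k}"
  define A where "A K n = (\<Sum>k<K. CLINT \<omega>|M. indicator (?A n (Suc k)) \<omega> *\<^sub>R (r n * iexp2 (u \<bullet> X n (Suc k) \<omega>)))" for K n
  define B where "B K n = (CLINT \<omega>|M. indicator (gt n K) \<omega> *\<^sub>R (r n * iexp2 (u \<bullet> Xstop n \<omega>)))" for K n
  define l where "l = complex_of_real (- (Q u * (\<Sum>k. prob (Tgt k))) / 2)"
  have A_lim: "(\<lambda>n. A K n) \<longlonglongrightarrow> complex_of_real (- Wsum u K / 2)" for K
  proof -
    have "(\<lambda>n. A K n) \<longlonglongrightarrow> (\<Sum>k<K. complex_of_real (- expectation (\<lambda>\<omega>. (u \<bullet> S (Suc k) \<omega>)\<^sup>2 * indicator {\<omega> \<in> space M. T \<omega> = Suc k} \<omega>) / 2))"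
      unfolding A_def by (intro tendsto_sum tendsto_iexp2_X)
    then show ?thesis by (simp add: Wsum_def sum_negf sum_divide_distrib)
  qed
  have stop_int: "integrable M (\<lambda>\<omega>. r n * iexp2 (u \<bullet> Xstop n \<omega>))" for n
    by (rule Bochner_Integration.integrable_bound[OF integrable_mult_right[OF Xstop_sq_int[of n], of "r n * ((norm u)\<^sup>2 / 2)"]])
       (use r_pos[of n] iexp2_inner_le[of u] in \<open>auto simp: norm_mult intro!: AE_I2\<close>)
  have split: "r n * (e n * reset_law.G (P n) (D n) u) = A K n + B K n" for K n
  proof -
    interpret C: moment_chain M "al n" "b n" xi "D n" "La n" Lx "P n" by (rule chain)
    have pw: "r n * iexp2 (u \<bullet> Xstop n \<omega>)
        = (\<Sum>k<K. indicator (?A n (Suc k)) \<omega> *\<^sub>R (r n * iexp2 (u \<bullet> X n (Suc k) \<omega>))) + indicator (gt n K) \<omega> *\<^sub>R (r n * iexp2 (u \<bullet> Xstop n \<omega>))"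
      if \<omega>: "\<omega> \<in> space M" and fin: "\<tau> n \<omega> \<noteq> \<infinity>" for \<omega>
    proof -
      obtain j where j: "\<tau> n \<omega> = enat (Suc j)"
        using fin first_hit_pos[of "X n" "D n" \<omega>] by (cases "\<tau> n \<omega>") (auto simp: zero_enat_def gr0_conv_Suc)
      have "(\<Sum>k<K. indicator (?A n (Suc k)) \<omega> *\<^sub>R (r n * iexp2 (u \<bullet> X n (Suc k) \<omega>)))
          = (\<Sum>k<K. if k = j then r n * iexp2 (u \<bullet> Xstop n \<omega>) else 0)"
        using \<omega> by (intro sum.cong) (auto simp: indicator_def j Xstop_def)
      then show ?thesis using \<omega> by (auto simp: indicator_def j sum.delta)
    qed
    have i1: "integrable M (\<lambda>\<omega>. indicator (?A n (Suc k)) \<omega> *\<^sub>R (r n * iexp2 (u \<bullet> X n (Suc k) \<omega>)))" for k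
    proof (rule Bochner_Integration.integrable_bound[OF stop_int[of n]])
      show "AE \<omega> in M. norm (indicator (?A n (Suc k)) \<omega> *\<^sub>R (r n * iexp2 (u \<bullet> X n (Suc k) \<omega>))) \<le> norm (r n * iexp2 (u \<bullet> Xstop n \<omega>))"
        by (intro AE_I2) (auto simp: indicator_def Xstop_def)
    qed measurable
    have i2: "integrable M (\<lambda>\<omega>. indicator (gt n K) \<omega> *\<^sub>R (r n * iexp2 (u \<bullet> Xstop n \<omega>)))"
      by (rule integrable_mult_indicator[OF _ stop_int]) measurable
    have "r n * (e n * reset_law.G (P n) (D n) u) = (CLINT \<omega>|M. r n * iexp2 (u \<bullet> Xstop n \<omega>))"
      unfolding G_eq by simp
    also have "\<dots> = (CLINT \<omega>|M. (\<Sum>k<K. indicator (?A n (Suc k)) \<omega> *\<^sub>R (r n * iexp2 (u \<bullet> X n (Suc k) \<omega>)))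
        + indicator (gt n K) \<omega> *\<^sub>R (r n * iexp2 (u \<bullet> Xstop n \<omega>)))"
    proof (rule integral_cong_AE)
      show "AE \<omega> in M. r n * iexp2 (u \<bullet> Xstop n \<omega>)
        = (\<Sum>k<K. indicator (?A n (Suc k)) \<omega> *\<^sub>R (r n * iexp2 (u \<bullet> X n (Suc k) \<omega>))) + indicator (gt n K) \<omega> *\<^sub>R (r n * iexp2 (u \<bullet> Xstop n \<omega>))"
        using C.tau_finite AE_space by eventually_elim (rule pw)
    qed measurable
    also have "\<dots> = A K n + B K n"
      unfolding A_def B_def
      by (simp only: Bochner_Integration.integral_add[OF Bochner_Integration.integrable_sum[OF i1] i2]
          Bochner_Integration.integral_sum[OF i1])
    finally show ?thesis .
  qed
  have B_le: "cmod (B K n) \<le> (norm u)\<^sup>2 / 2 * (r n * ((g n * R0)\<^sup>2 * prob (gt n K)))" for K n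
  proof -
    interpret C: moment_chain M "al n" "b n" xi "D n" "La n" Lx "P n" by (rule chain)
    have i: "integrable M (\<lambda>\<omega>. (norm (Xstop n \<omega>))\<^sup>2 * indicator (gt n K) \<omega>)"
      by (intro integrable_real_mult_indicator Xstop_sq_int) measurable
    have "cmod (B K n) \<le> expectation (\<lambda>\<omega>. ((norm u)\<^sup>2 / 2 * r n) * ((norm (Xstop n \<omega>))\<^sup>2 * indicator (gt n K) \<omega>))"
      unfolding B_def
    proof (rule order_trans[OF integral_norm_bound], rule integral_mono')
      show "cmod (indicator (gt n K) \<omega> *\<^sub>R (r n * iexp2 (u \<bullet> Xstop n \<omega>)))
          \<le> ((norm u)\<^sup>2 / 2 * r n) * ((norm (Xstop n \<omega>))\<^sup>2 * indicator (gt n K) \<omega>)" for \<omega>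
        using mult_left_mono[OF iexp2_inner_le[of u "Xstop n \<omega>"], of "r n"] r_pos[of n]
        by (auto simp: indicator_def norm_mult mult_ac)
    qed (use i r_pos[of n] in auto)
    also have "\<dots> = ((norm u)\<^sup>2 / 2 * r n) * expectation (\<lambda>\<omega>. (norm (Xstop n \<omega>))\<^sup>2 * indicator (gt n K) \<omega>)"
      by simp
    also have "\<dots> \<le> ((norm u)\<^sup>2 / 2 * r n) * ((g n * R0)\<^sup>2 * prob (gt n K))"
      using C.Xstop_sq_tail[OF outer_ball, of K] r_pos[of n]
      by (intro mult_left_mono) (auto simp: Xstop_def C.Xstop_def)
    finally show ?thesis by simp
  qed
  have "(\<lambda>n. r n * (e n * reset_law.G (P n) (D n) u)) \<longlonglongrightarrow> l"
  proof (rule LIMSEQ_I)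
    fix \<epsilon> :: real assume \<epsilon>: "0 < \<epsilon>"
    define \<epsilon>' where "\<epsilon>' = \<epsilon> / (2 * ((norm u)\<^sup>2 + 1))"
    have "0 < (norm u)\<^sup>2 + 1" by (simp add: add_nonneg_pos)
    then have \<epsilon>': "0 < \<epsilon>'" "(norm u)\<^sup>2 / 2 * \<epsilon>' \<le> \<epsilon> / 4"
      using \<epsilon> by (auto simp: \<epsilon>'_def field_simps)
    obtain K where K: "1 \<le> K" "\<And>k. K \<le> k \<Longrightarrow> \<forall>\<^sub>F n in sequentially. r n * ((g n * R0)\<^sup>2 * prob (gt n k)) \<le> \<epsilon>'"
      using tail_bound[OF \<epsilon>'(1)] by blast
    have "(\<lambda>N. complex_of_real (- Wsum u N / 2)) \<longlonglongrightarrow> l"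
      unfolding l_def by (intro tendsto_intros Wsum_lim) simp
    from LIMSEQ_D[OF this, of "\<epsilon> / 4"] \<epsilon> obtain K1
      where K1: "\<And>N. K1 \<le> N \<Longrightarrow> cmod (complex_of_real (- Wsum u N / 2) - l) < \<epsilon> / 4" by force
    define N where "N = max K K1"
    have "\<forall>\<^sub>F n in sequentially. cmod (A N n - complex_of_real (- Wsum u N / 2)) < \<epsilon> / 4"
      using tendstoD[OF A_lim[of N], of "\<epsilon> / 4"] \<epsilon> by (simp add: dist_norm)
    moreover have "\<forall>\<^sub>F n in sequentially. r n * ((g n * R0)\<^sup>2 * prob (gt n N)) \<le> \<epsilon>'"
      by (rule K(2)) (simp add: N_def)
    ultimately have "\<forall>\<^sub>F n in sequentially. norm (r n * (e n * reset_law.G (P n) (D n) u) - l) < \<epsilon>"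
    proof eventually_elim
      case (elim n)
      have "cmod (B N n) \<le> \<epsilon> / 4"
        by (rule order_trans[OF B_le[of N n] order_trans[OF mult_left_mono[OF elim(2), of "(norm u)\<^sup>2 / 2"] \<epsilon>'(2)]]) simp
      moreover have eq: "r n * (e n * reset_law.G (P n) (D n) u) - l
          = (A N n - complex_of_real (- Wsum u N / 2)) + (complex_of_real (- Wsum u N / 2) - l) + B N n"
        unfolding split[of n N] by simp
      moreover have "cmod (complex_of_real (- Wsum u N / 2) - l) < \<epsilon> / 4"
        by (rule K1) (simp add: N_def)
      ultimately show ?case
        using elim(1) \<epsilon> norm_triangle_ineq[of "A N n - complex_of_real (- Wsum u N / 2) + (complex_of_real (- Wsum u N / 2) - l)" "B N n"]
          norm_triangle_ineq[of "A N n - complex_of_real (- Wsum u N / 2)" "complex_of_real (- Wsum u N / 2) - l"]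
        unfolding eq by linarith
    qed
    then show "\<exists>n0. \<forall>n\<ge>n0. norm (r n * (e n * reset_law.G (P n) (D n) u) - l) < \<epsilon>"
      by (simp add: eventually_sequentially)
  qed
  moreover have "1 \<le> eh" by (rule LIMSEQ_le_const[OF e_lim]) (use e_ge_1 in auto)
  ultimately have "(\<lambda>n. r n * (e n * reset_law.G (P n) (D n) u) / complex_of_real (e n)) \<longlonglongrightarrow> l / complex_of_real eh"
    using e_lim by (intro tendsto_intros) auto
  moreover have "r n * (e n * reset_law.G (P n) (D n) u) / complex_of_real (e n) = r n * reset_law.G (P n) (D n) u" for n
    using e_ge_1[of n] by simp
  ultimately show ?thesis by (simp add: l_def mult.commute)
qed

end

end

section \<open>Gaussian and signed half-normal laws\<close>

text \<open>Gram-Schmidt for the inner product \<open>x \<bullet> (S *v y)\<close>, along the index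
  type: as long as an index is left, the vectors found so far span a proper subspace, and a new
  direction exists.\<close>

lemma sq_form_orthonormal_family:
  fixes S :: "real^'n^'n"
  assumes sym: "transpose S = S" and pos: "\<And>x. x \<noteq> 0 \<Longrightarrow> 0 < quad S x"
  shows "\<exists>v :: 'n \<Rightarrow> real^'n. \<forall>i\<in>I. \<forall>j\<in>I. v i \<bullet> (S *v v j) = (if i = j then 1 else 0)"
proof (induction I rule: finite_induct[OF finite])
  case 1
  show ?case by simp
next
  case (2 k I)
  then obtain v :: "'n \<Rightarrow> real^'n" where v: "\<And>i j. i \<in> I \<Longrightarrow> j \<in> I \<Longrightarrow> v i \<bullet> (S *v v j) = (if i = j then 1 else 0)"
    by blast
  have S_sym: "x \<bullet> (S *v y) = y \<bullet> (S *v x)" for x y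
    by (metis dot_lmul_matrix inner_commute sym transpose_matrix_vector)
  have "I \<subset> UNIV" using 2 by auto
  then have "card I < CARD('n)" by (intro psubset_card_mono) auto
  then have "dim (v ` I) < DIM(real^'n)"
    using dim_le_card'[of "v ` I"] card_image_le[of I v] by simp
  then have "span (v ` I) \<noteq> UNIV" by (metis dim_span dim_UNIV less_irrefl)
  then obtain y where y: "y \<notin> span (v ` I)" by auto
  define y' where "y' = y - (\<Sum>i\<in>I. (y \<bullet> (S *v v i)) *\<^sub>R v i)"
  have "(\<Sum>i\<in>I. (y \<bullet> (S *v v i)) *\<^sub>R v i) \<in> span (v ` I)"
    by (intro span_sum span_scale span_base) auto
  then have "y' \<noteq> 0" using y by (auto simp: y'_def)
  then have q: "0 < quad S y'" by (rule pos)
  have orth: "y' \<bullet> (S *v v j) = 0" if "j \<in> I" for j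
  proof -
    have "y' \<bullet> (S *v v j) = y \<bullet> (S *v v j) - (\<Sum>i\<in>I. (y \<bullet> (S *v v i)) * (v i \<bullet> (S *v v j)))"
      by (simp add: y'_def inner_diff_left inner_sum_left)
    also have "(\<Sum>i\<in>I. (y \<bullet> (S *v v i)) * (v i \<bullet> (S *v v j))) = (\<Sum>i\<in>I. if i = j then y \<bullet> (S *v v j) else 0)"
      using that v by (intro sum.cong) auto
    finally show ?thesis using that by simp
  qed
  define z where "z = (1 / sqrt (quad S y')) *\<^sub>R y'"
  have zz: "z \<bullet> (S *v z) = 1"
    using q by (simp add: z_def quad_def matrix_vector_mult_scaleR real_sqrt_mult_self)
  have zv: "z \<bullet> (S *v v j) = 0" if "j \<in> I" for j using orth[OF that] by (simp add: z_def)
  have vz: "v j \<bullet> (S *v z) = 0" if "j \<in> I" for j using zv[OF that] S_sym by metis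
  show ?case
  proof (intro exI[of _ "v(k := z)"] ballI)
    fix i j assume "i \<in> insert k I" "j \<in> insert k I"
    then show "(v(k := z)) i \<bullet> (S *v (v(k := z)) j) = (if i = j then 1 else 0)"
      using zz zv vz v \<open>k \<notin> I\<close> by auto
  qed
qed

lemma whitening_matrix:
  fixes S :: "real^'n^'n"
  assumes sym: "transpose S = S" and pos: "\<And>x. x \<noteq> 0 \<Longrightarrow> 0 < quad S x"
  obtains P :: "real^'n^'n" where "transpose P ** S ** P = mat 1"
proof -
  obtain v :: "'n \<Rightarrow> real^'n" where v: "\<And>i j. v i \<bullet> (S *v v j) = (if i = j then 1 else 0)"
    using sq_form_orthonormal_family[OF sym pos, of UNIV] by auto
  define P where "P = transpose (\<chi> i. v i)"
  have "(transpose P ** S ** P) $ i $ j = v i \<bullet> (S *v v j)" for i j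
  proof -
    have "(transpose P ** S ** P) = transpose P ** (S ** P)" by (simp add: matrix_mul_assoc)
    then show ?thesis
      by (simp add: P_def matrix_matrix_mult_def transpose_def inner_vec_def matrix_vector_mult_def)
  qed
  then have "transpose P ** S ** P = mat 1"
    by (simp add: vec_eq_iff v mat_def)
  then show ?thesis by (rule that)
qed

text \<open>In the product representation the coordinate along \<open>j\<close> is integrated first;
  with the other coordinates fixed the shear only translates it.\<close>

lemma nn_integral_shear:
  fixes f :: "'v::euclidean_space \<Rightarrow> ennreal"
  assumes [measurable]: "f \<in> borel_measurable borel" and j: "j \<in> Basis" and k: "k \<in> Basis" and jk: "j \<noteq> k"
  shows "(\<integral>\<^sup>+x. f (x + (x \<bullet> k) *\<^sub>R j) \<partial>lborel) = (\<integral>\<^sup>+x. f x \<partial>lborel)"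
proof -
  interpret product_sigma_finite "\<lambda>_::'v. lborel :: real measure" by standard
  define B where "B = Basis - {j}"
  have B: "Basis = insert j B" "finite B" "j \<notin> B" "k \<in> B" using j k jk by (auto simp: B_def)
  define s :: "('v \<Rightarrow> real) \<Rightarrow> 'v" where "s h = (\<Sum>b\<in>Basis. h b *\<^sub>R b)" for h
  have s_meas [measurable]: "s \<in> measurable (\<Pi>\<^sub>M b\<in>Basis. lborel) borel"
    unfolding s_def by measurable
  have lb: "(\<integral>\<^sup>+x. g x \<partial>lborel) = (\<integral>\<^sup>+h. \<integral>\<^sup>+t. g (s (h(j := t))) \<partial>lborel \<partial>(\<Pi>\<^sub>M b\<in>B. lborel))"
    if [measurable]: "g \<in> borel_measurable borel" for g :: "'v \<Rightarrow> ennreal"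
  proof -
    have "(\<integral>\<^sup>+x. g x \<partial>lborel) = (\<integral>\<^sup>+h. g (s h) \<partial>(\<Pi>\<^sub>M b\<in>Basis. lborel))"
      by (subst lborel_eq, subst nn_integral_distr) (auto simp: s_def)
    also have "\<dots> = (\<integral>\<^sup>+h. \<integral>\<^sup>+t. g (s (h(j := t))) \<partial>lborel \<partial>(\<Pi>\<^sub>M b\<in>B. lborel))"
      unfolding B(1) by (rule product_nn_integral_insert) (use B in \<open>auto simp flip: B(1)\<close>)
    finally show ?thesis .
  qed
  have s_upd: "s (h(j := t)) = t *\<^sub>R j + (\<Sum>b\<in>B. h b *\<^sub>R b)" for h t
  proof -
    have "s (h(j := t)) = (\<Sum>b\<in>insert j B. (h(j := t)) b *\<^sub>R b)" by (simp only: s_def B(1))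
    also have "\<dots> = t *\<^sub>R j + (\<Sum>b\<in>B. (h(j := t)) b *\<^sub>R b)" using B(2,3) by simp
    also have "(\<Sum>b\<in>B. (h(j := t)) b *\<^sub>R b) = (\<Sum>b\<in>B. h b *\<^sub>R b)" using B(3) by (intro sum.cong) auto
    finally show ?thesis .
  qed
  have sk: "s (h(j := t)) \<bullet> k = h k" for h t
  proof -
    have "s (h(j := t)) \<bullet> k = (\<Sum>b\<in>B. h b * (b \<bullet> k))"
      unfolding s_upd using j k jk by (simp add: inner_add_left inner_sum_left inner_Basis)
    also have "\<dots> = (\<Sum>b\<in>B. if b = k then h k else 0)"
      using k by (intro sum.cong) (auto simp: B_def inner_Basis)
    finally show ?thesis using B by simp
  qed
  have "(\<integral>\<^sup>+x. f (x + (x \<bullet> k) *\<^sub>R j) \<partial>lborel)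
      = (\<integral>\<^sup>+h. \<integral>\<^sup>+t. f (s (h(j := h k + 1 * t))) \<partial>lborel \<partial>(\<Pi>\<^sub>M b\<in>B. lborel))"
    by (subst lb) (auto simp: sk, simp add: s_upd algebra_simps)
  also have "\<dots> = (\<integral>\<^sup>+h. \<integral>\<^sup>+t. f (s (h(j := t))) \<partial>lborel \<partial>(\<Pi>\<^sub>M b\<in>B. lborel))"
  proof (rule nn_integral_cong)
    fix h
    have "(\<lambda>t. f (s (h(j := t)))) \<in> borel_measurable borel" unfolding s_upd by measurable
    from nn_integral_real_affine[OF this, of 1 "h k"]
    show "(\<integral>\<^sup>+t. f (s (h(j := h k + 1 * t))) \<partial>lborel) = (\<integral>\<^sup>+t. f (s (h(j := t))) \<partial>lborel)" by simp
  qed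
  also have "\<dots> = (\<integral>\<^sup>+x. f x \<partial>lborel)" by (rule lb[symmetric]) measurable
  finally show ?thesis .
qed

lemma matrix_vector_mult_measurable [measurable]: "(\<lambda>x. (A :: real^'n^'m) *v x) \<in> borel_measurable borel"
  by (intro borel_measurable_continuous_onI linear_continuous_on matrix_vector_mul_bounded_linear)

text \<open>Matrices are generated by diagonal, swap and shear matrices and those with a zero row,
  and the determinant is multiplicative. The assumption of a nonzero determinant is part of the
  inductive statement, so a zero row is a vacuous case.\<close>

lemma nn_integral_linear:
  fixes A :: "real^'n^'n"
  assumes "f \<in> borel_measurable borel" "det A \<noteq> 0"
  shows "ennreal \<bar>det A\<bar> * (\<integral>\<^sup>+x. f (A *v x) \<partial>lborel) = (\<integral>\<^sup>+x. f x \<partial>lborel)"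
proof -
  let ?P = "\<lambda>A :: real^'n^'n. \<forall>f \<in> borel_measurable borel. det A \<noteq> 0 \<longrightarrow>
    ennreal \<bar>det A\<bar> * (\<integral>\<^sup>+x. f (A *v x) \<partial>lborel) = (\<integral>\<^sup>+x. f x \<partial>lborel)"
  have "?P A"
  proof (rule induct_matrix_elementary_alt[of ?P])
    fix A B :: "real^'n^'n"
    assume A: "?P A" and B: "?P B"
    show "?P (A ** B)"
    proof (intro ballI impI)
      fix f :: "real^'n \<Rightarrow> ennreal" assume f [measurable]: "f \<in> borel_measurable borel" and nz: "det (A ** B) \<noteq> 0"
      then have dets: "det A \<noteq> 0" "det B \<noteq> 0" by (auto simp: det_mul)
      have fA: "(\<lambda>x. f (A *v x)) \<in> borel_measurable borel" by measurable
      have "ennreal \<bar>det (A ** B)\<bar> * (\<integral>\<^sup>+x. f (A ** B *v x) \<partial>lborel)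
          = ennreal \<bar>det A\<bar> * (ennreal \<bar>det B\<bar> * (\<integral>\<^sup>+x. f (A *v (B *v x)) \<partial>lborel))"
        by (simp add: det_mul abs_mult ennreal_mult mult_ac matrix_vector_mul_assoc)
      also have "\<dots> = (\<integral>\<^sup>+x. f x \<partial>lborel)"
        using B[rule_format, OF fA dets(2)] A[rule_format, OF f dets(1)] by simp
      finally show "ennreal \<bar>det (A ** B)\<bar> * (\<integral>\<^sup>+x. f (A ** B *v x) \<partial>lborel) = (\<integral>\<^sup>+x. f x \<partial>lborel)" .
    qed
  next
    fix A :: "real^'n^'n" and i assume "row i A = 0"
    then show "?P A" by (simp add: det_zero_row)
  next
    fix A :: "real^'n^'n" assume diag: "\<And>i j. i \<noteq> j \<Longrightarrow> A $ i $ j = 0"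
    show "?P A"
    proof (intro ballI impI)
      fix f :: "real^'n \<Rightarrow> ennreal" assume f [measurable]: "f \<in> borel_measurable borel" and nz: "det A \<noteq> 0"
      have det: "det A = (\<Prod>i\<in>UNIV. A $ i $ i)" by (rule det_diagonal) (use diag in auto)
      define c where "c b = (A *v b) \<bullet> b" for b
      have c_axis: "c (axis i 1) = A $ i $ i" for i
        by (simp add: c_def inner_axis matrix_vector_mul_component inner_axis')
      have Basis_axis: "(Basis :: (real^'n) set) = (\<lambda>i. axis i 1) ` UNIV"
        by (auto simp: Basis_vec_def)
      have inj: "inj (\<lambda>i. axis i 1 :: real^'n)" by (auto simp: inj_def axis_eq_axis)
      have prod: "(\<Prod>j\<in>Basis. \<bar>c j\<bar>) = \<bar>det A\<bar>"
        unfolding det Basis_axis by (simp add: prod.reindex inj c_axis abs_prod)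
      have Av: "A *v x = 0 + (\<Sum>j\<in>Basis. (c j * (x \<bullet> j)) *\<^sub>R j)" for x
      proof -
        have "(A *v x) $ i = A $ i $ i * x $ i" for i
          using diag by (simp add: matrix_vector_mult_def) (subst sum.remove[of _ i], auto)
        moreover have "(\<Sum>j\<in>Basis. (c j * (x \<bullet> j)) *\<^sub>R j) $ i = A $ i $ i * x $ i" for i
        proof -
          have "(\<Sum>j\<in>Basis. (c j * (x \<bullet> j)) *\<^sub>R j) $ i = (\<Sum>j\<in>UNIV. (A $ j $ j * x $ j) * (axis j 1 :: real^'n) $ i)"
            unfolding Basis_axis by (simp add: sum.reindex inj c_axis inner_axis o_def)
          also have "\<dots> = (\<Sum>j\<in>UNIV. if j = i then A $ i $ i * x $ i else 0)"
            by (intro sum.cong) (auto simp: axis_def)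
          finally show ?thesis by simp
        qed
        ultimately show ?thesis by (simp add: vec_eq_iff)
      qed
      have "c j \<noteq> 0" if "j \<in> Basis" for j
        using nz that unfolding det Basis_axis by (auto simp: c_axis)
      from lborel_affine_euclidean[of c "0 :: real^'n", OF this]
      have "lborel = density (distr lborel borel (\<lambda>x. A *v x)) (\<lambda>_. \<bar>det A\<bar>)"
        unfolding Av[symmetric] prod .
      then have "(\<integral>\<^sup>+x. f x \<partial>lborel) = (\<integral>\<^sup>+x. f x \<partial>density (distr lborel borel (\<lambda>x. A *v x)) (\<lambda>_. \<bar>det A\<bar>))" by simp
      also have "\<dots> = ennreal \<bar>det A\<bar> * (\<integral>\<^sup>+x. f (A *v x) \<partial>lborel)"
        by (simp add: nn_integral_density nn_integral_distr nn_integral_cmult)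
      finally show "ennreal \<bar>det A\<bar> * (\<integral>\<^sup>+x. f (A *v x) \<partial>lborel) = (\<integral>\<^sup>+x. f x \<partial>lborel)" by simp
    qed
  next
    fix m n :: 'n assume "m \<noteq> n"
    let ?\<sigma> = "Transposition.transpose m n"
    define A :: "real^'n^'n" where "A = (\<chi> i j. mat 1 $ i $ ?\<sigma> j)"
    have Av: "(A *v x) $ i = x $ ?\<sigma> i" for x i
    proof -
      have "(A *v x) $ i = (\<Sum>j\<in>UNIV. if j = ?\<sigma> i then x $ j else 0)"
      proof -
        have "i = ?\<sigma> j \<longleftrightarrow> j = ?\<sigma> i" for j by (metis Transposition.transpose_involutory)
        then show ?thesis
          unfolding matrix_vector_mult_def vec_lambda_beta by (intro sum.cong refl) (simp add: A_def mat_def)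
      qed
      then show ?thesis by simp
    qed
    have "A ** A = mat 1"
    proof -
      have "A *v (A *v x) = x" for x by (simp add: vec_eq_iff Av)
      then show ?thesis by (simp add: matrix_eq matrix_vector_mul_assoc)
    qed
    then have "det A * det A = 1" by (metis det_I det_mul)
    then have det: "\<bar>det A\<bar> = 1" by (metis abs_mult_self_eq abs_one abs_ge_zero mult_1 power2_eq_square power2_eq_1_iff abs_minus_cancel)
    \<comment> \<open>A swap of coordinates maps boxes to boxes of the same volume, and the volumes
      of boxes determine Lebesgue measure.\<close>
    have lb: "lborel = distr lborel borel (\<lambda>x. A *v x)"
    proof (rule lborel_eqI)
      fix l u :: "real^'n" assume le: "\<And>b. b \<in> Basis \<Longrightarrow> l \<bullet> b \<le> u \<bullet> b"
      have le': "l $ i \<le> u $ i" for i using le[of "axis i 1"] by (simp add: inner_axis)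
      have Basis_axis: "(Basis :: (real^'n) set) = (\<lambda>i. axis i 1) ` UNIV"
        by (auto simp: Basis_vec_def)
      have inj: "inj (\<lambda>i. axis i 1 :: real^'n)" by (auto simp: inj_def axis_eq_axis)
      have "(\<lambda>x. A *v x) -` box l u = box (A *v l) (A *v u)"
      proof -
        have "(\<forall>i. l $ i < x $ ?\<sigma> i \<and> x $ ?\<sigma> i < u $ i) \<longleftrightarrow> (\<forall>i. l $ ?\<sigma> i < x $ i \<and> x $ i < u $ ?\<sigma> i)" for x
          by (metis Transposition.transpose_involutory)
        then show ?thesis by (auto simp: mem_box_cart Av set_eq_iff)
      qed
      then have "emeasure (distr lborel borel (\<lambda>x. A *v x)) (box l u) = emeasure lborel (box (A *v l) (A *v u))"
        by (simp add: emeasure_distr)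
      also have "\<dots> = ennreal (\<Prod>b\<in>Basis. (A *v u - A *v l) \<bullet> b)"
        by (rule emeasure_lborel_box) (auto simp: Basis_axis inner_axis Av le')
      also have "(\<Prod>b\<in>Basis. (A *v u - A *v l) \<bullet> b) = (\<Prod>i\<in>UNIV. (u - l) $ ?\<sigma> i)"
        unfolding Basis_axis by (simp add: prod.reindex inj inner_axis Av)
      also have "\<dots> = (\<Prod>i\<in>UNIV. (u - l) $ i)"
        by (rule prod.reindex_bij_betw[of ?\<sigma> UNIV UNIV "\<lambda>i. (u - l) $ i"]) (simp add: bij_transpose)
      also have "\<dots> = (\<Prod>b\<in>Basis. (u - l) \<bullet> b)"
        unfolding Basis_axis by (simp add: prod.reindex inj inner_axis)
      finally show "emeasure (distr lborel borel (\<lambda>x. A *v x)) (box l u) = ennreal (\<Prod>b\<in>Basis. (u - l) \<bullet> b)" .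
    qed simp
    have "(\<integral>\<^sup>+x. f (A *v x) \<partial>lborel) = (\<integral>\<^sup>+x. f x \<partial>lborel)" if f: "f \<in> borel_measurable borel" for f :: "real^'n \<Rightarrow> ennreal"
    proof -
      have "(\<integral>\<^sup>+x. f (A *v x) \<partial>lborel) = (\<integral>\<^sup>+x. f x \<partial>distr lborel borel (\<lambda>x. A *v x))"
        using f by (subst nn_integral_distr) auto
      then show ?thesis unfolding lb[symmetric] .
    qed
    then show "?P (\<chi> i j. mat 1 $ i $ ?\<sigma> j)"
      unfolding A_def[symmetric] det by simp
  next
    fix m n :: 'n assume mn: "m \<noteq> n"
    define A :: "real^'n^'n" where "A = (\<chi> i j. of_bool (i = m \<and> j = n \<or> i = j))"
    have Av: "A *v x = x + (x \<bullet> axis n 1) *\<^sub>R axis m 1" for x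
    proof -
      have "(A *v x) $ i = x $ i + (if i = m then x $ n else 0)" for i
      proof -
        have "(A *v x) $ i = (\<Sum>j\<in>UNIV. (if j = i then x $ j else 0) + (if j = n then (if i = m then x $ j else 0) else 0))"
          unfolding matrix_vector_mult_def A_def using mn by (auto intro!: sum.cong)
        then show ?thesis by (simp add: sum.distrib)
      qed
      moreover have "x \<bullet> axis n 1 = x $ n" by (simp add: inner_axis)
      ultimately show ?thesis by (simp add: vec_eq_iff axis_def)
    qed
    have det: "det A = 1"
    proof -
      have "A = (\<chi> i. if i = m then row m (mat 1) + 1 *s row n (mat 1) else row i (mat 1))"
        using mn by (auto simp: A_def vec_eq_iff row_def mat_def)
      then show ?thesis using det_row_operation[OF mn, of "mat 1 :: real^'n^'n" 1] by simp
    qed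
    show "?P (\<chi> i j. of_bool (i = m \<and> j = n \<or> i = j))"
      unfolding A_def[symmetric] det Av
      using mn by (auto intro!: nn_integral_shear simp: axis_eq_axis)
  qed
  then show ?thesis using assms by blast
qed

text \<open>The normal law with covariance matrix \<open>S / (2 a)\<close>.\<close>

definition gauss_dens :: "real \<Rightarrow> real^'n^'n \<Rightarrow> real^'n \<Rightarrow> real" where
  "gauss_dens a S x = a powr (real CARD('n) / 2) / (sqrt (det S) * pi powr (real CARD('n) / 2))
       * exp (- (a * quad (matrix_inv S) x))"

definition gauss_law :: "real \<Rightarrow> real^'n^'n \<Rightarrow> (real^'n) measure" where
  "gauss_law a S = density lborel (\<lambda>x. ennreal (gauss_dens a S x))"

section \<open>Normal laws with a given covariance matrix\<close>

lemma matrix_inv_eqI: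
  fixes A B :: "real^'n^'n"
  assumes "A ** B = mat 1" "B ** A = mat 1"
  shows "matrix_inv A = B"
  unfolding matrix_inv_def
proof (rule some_equality)
  fix C assume C: "A ** C = mat 1 \<and> C ** A = mat 1"
  have "C = C ** (A ** B)" using assms by simp
  also have "\<dots> = B" using C by (simp add: matrix_mul_assoc)
  finally show "C = B" .
qed (use assms in auto)

lemma sqrt_power_eq_powr: "0 < x \<Longrightarrow> sqrt x ^ n = x powr (real n / 2)"
  by (simp add: powr_half_sqrt[symmetric] powr_powr flip: powr_realpow)

locale covariance =
  fixes S :: "real^'n^'n" and a :: real
  assumes sym: "transpose S = S" and pos: "\<And>x. x \<noteq> 0 \<Longrightarrow> 0 < quad S x" and a_pos: "0 < a"
begin

lemma quad_nonneg: "0 \<le> quad S x"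
  using pos[of x] by (cases "x = 0") (auto simp: quad_def)

lemma quad_scale: "quad S (t *\<^sub>R x) = t\<^sup>2 * quad S x"
  by (simp add: quad_def matrix_vector_mult_scaleR power2_eq_square)

definition W :: "real^'n^'n" where "W = (SOME P. transpose P ** S ** P = mat 1)"

lemma W: "transpose W ** S ** W = mat 1"
  unfolding W_def by (rule someI_ex) (use whitening_matrix[OF sym pos] in blast)

lemma W_inverses: "W ** (transpose W ** S) = mat 1" "(transpose W ** S) ** W = mat 1"
  "S ** W ** transpose W = mat 1" "transpose W ** (S ** W) = mat 1"
proof -
  show 1: "(transpose W ** S) ** W = mat 1" "transpose W ** (S ** W) = mat 1"
    using W by (simp_all add: matrix_mul_assoc)
  then show "W ** (transpose W ** S) = mat 1" "S ** W ** transpose W = mat 1"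
    by (simp_all add: matrix_left_right_inverse)
qed

lemma matrix_inv_S: "matrix_inv S = W ** transpose W"
proof (rule matrix_inv_eqI)
  show 1: "S ** (W ** transpose W) = mat 1" using W_inverses(3) by (simp add: matrix_mul_assoc)
  show "W ** transpose W ** S = mat 1" using 1 matrix_left_right_inverse by metis
qed

lemma matrix_inv_S_mult: "S *v (matrix_inv S *v x) = x" "matrix_inv S *v (S *v x) = x"
  using W_inverses(1,3) by (simp_all add: matrix_inv_S matrix_vector_mul_assoc matrix_mul_assoc)

lemma quad_inv: "quad (matrix_inv S) x = (norm (transpose W *v x))\<^sup>2"
proof -
  have "x \<bullet> (W *v (transpose W *v x)) = (transpose W *v x) \<bullet> (transpose W *v x)"
    by (metis dot_lmul_matrix inner_commute transpose_matrix_vector transpose_transpose)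
  then show ?thesis
    unfolding quad_def matrix_inv_S power2_norm_eq_inner by (simp only: matrix_vector_mul_assoc)
qed

lemma det_W: "(det W)\<^sup>2 * det S = 1"
  using arg_cong[OF W, of det] by (simp add: det_mul det_transpose power2_eq_square mult_ac)

lemma det_S_pos: "0 < det S"
proof -
  have "0 < (det W)\<^sup>2 * det S" using det_W by simp
  then show ?thesis by (auto simp: zero_less_mult_iff)
qed

lemma abs_det_SW: "\<bar>det (S ** W)\<bar> = sqrt (det S)"
proof -
  have "(det (S ** W))\<^sup>2 = det S"
    using det_W by (simp add: det_mul power_mult_distrib power2_eq_square mult_ac)
  then show ?thesis by (metis real_sqrt_abs)
qed

definition c :: real where "c = 1 / sqrt (2 * a)"

lemma c_pos: "0 < c" and c_sq: "c\<^sup>2 = 1 / (2 * a)"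
  using a_pos by (simp_all add: c_def power_divide)

text \<open>\<open>S ** W\<close> times its transpose is \<open>S\<close>, because
  \<open>W ** transpose W\<close> is the inverse of \<open>S\<close>. Hence \<open>L\<close> carries
  the standard normal law to the normal law with covariance \<open>S / (2 a)\<close>.\<close>

definition L :: "real^'n \<Rightarrow> real^'n" where "L y = c *\<^sub>R ((S ** W) *v y)"

lemma L_measurable [measurable]: "L \<in> borel_measurable borel"
  unfolding L_def[abs_def] by measurable

lemma quad_inv_L: "quad (matrix_inv S) (L y) = (norm y)\<^sup>2 / (2 * a)"
proof -
  have "transpose W *v L y = c *\<^sub>R y"
    using W_inverses(4) by (simp add: L_def matrix_vector_mult_scaleR matrix_vector_mul_assoc)
  then show ?thesis by (simp add: quad_inv power_mult_distrib c_sq)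
qed

lemma nn_integral_L:
  assumes [measurable]: "f \<in> borel_measurable borel"
  shows "ennreal (c ^ CARD('n) * sqrt (det S)) * (\<integral>\<^sup>+y. f (L y) \<partial>lborel) = (\<integral>\<^sup>+x. f x \<partial>lborel)"
proof -
  have "det (S ** W) \<noteq> 0" using abs_det_SW det_S_pos by auto
  then have "(\<integral>\<^sup>+y. f (c *\<^sub>R y) \<partial>lborel) = ennreal (sqrt (det S)) * (\<integral>\<^sup>+y. f (L y) \<partial>lborel)"
    using nn_integral_linear[of "\<lambda>y. f (c *\<^sub>R y)" "S ** W"] by (simp add: abs_det_SW L_def)
  moreover have "(\<integral>\<^sup>+x. f x \<partial>lborel) = ennreal (c ^ CARD('n)) * (\<integral>\<^sup>+y. f (c *\<^sub>R y) \<partial>lborel)"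
  proof -
    have "(\<integral>\<^sup>+x. f x \<partial>lborel) = (\<integral>\<^sup>+x. f x \<partial>density (distr lborel borel (\<lambda>x. 0 + c *\<^sub>R x)) (\<lambda>_. ennreal (\<bar>c\<bar> ^ DIM(real^'n))))"
      using lborel_affine[of c "0 :: real^'n"] c_pos by simp
    then show ?thesis using c_pos by (simp add: nn_integral_density nn_integral_distr nn_integral_cmult)
  qed
  ultimately show ?thesis
    using c_pos det_S_pos by (simp add: ennreal_mult mult_ac)
qed

lemma gauss_dens_nonneg: "0 \<le> gauss_dens a S x"
  using det_S_pos by (simp add: gauss_dens_def)

lemma gauss_dens_measurable [measurable]: "gauss_dens a S \<in> borel_measurable borel"
  unfolding gauss_dens_def[abs_def] quad_def[abs_def] by measurable

text \<open>The Jacobian of \<open>L\<close> cancels \<open>sqrt (det S)\<close>, and the constants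
  match because \<open>c * sqrt a / sqrt pi = 1 / sqrt (2 * pi)\<close>.\<close>

lemma gauss_dens_L:
  "c ^ CARD('n) * sqrt (det S) * gauss_dens a S (L y) = (\<Prod>b\<in>Basis. std_normal_density (y \<bullet> b))"
proof -
  have "gauss_dens a S (L y) = sqrt a ^ CARD('n) / (sqrt (det S) * sqrt pi ^ CARD('n)) * exp (- (norm y)\<^sup>2 / 2)"
    using a_pos by (simp add: gauss_dens_def quad_inv_L sqrt_power_eq_powr)
  moreover have "c ^ CARD('n) * sqrt (det S) * (sqrt a ^ CARD('n) / (sqrt (det S) * sqrt pi ^ CARD('n)) * E)
      = (c ^ CARD('n) * sqrt a ^ CARD('n) / sqrt pi ^ CARD('n)) * E" for E
    using det_S_pos by simp
  moreover have "c ^ CARD('n) * sqrt a ^ CARD('n) / sqrt pi ^ CARD('n) = (1 / sqrt (2 * pi)) ^ CARD('n)"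
    using a_pos by (simp add: c_def power_divide[symmetric] power_mult_distrib[symmetric] real_sqrt_mult field_simps
        del: power_mult_distrib)
  ultimately show ?thesis
    by (simp only: prod_std_normal_density) simp
qed

lemma gauss_law_eq: "gauss_law a S = distr std_gauss borel L"
proof (rule measure_eqI)
  fix A assume "A \<in> sets (gauss_law a S)"
  then have [measurable]: "A \<in> sets borel" by (simp add: gauss_law_def)
  have "emeasure (gauss_law a S) A = (\<integral>\<^sup>+x. ennreal (gauss_dens a S x) * indicator A x \<partial>lborel)"
    unfolding gauss_law_def by (subst emeasure_density) auto
  also have "\<dots> = ennreal (c ^ CARD('n) * sqrt (det S)) * (\<integral>\<^sup>+y. ennreal (gauss_dens a S (L y)) * indicator A (L y) \<partial>lborel)"
    by (rule nn_integral_L[symmetric]) measurable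
  also have "\<dots> = (\<integral>\<^sup>+y. ennreal (\<Prod>b\<in>Basis. std_normal_density (y \<bullet> b)) * indicator A (L y) \<partial>lborel)"
    using c_pos det_S_pos gauss_dens_nonneg
    by (simp add: nn_integral_cmult[symmetric] gauss_dens_L[symmetric] ennreal_mult mult.assoc)
  also have "\<dots> = (\<integral>\<^sup>+y. indicator A (L y) \<partial>std_gauss)"
    unfolding std_gauss_def by (subst nn_integral_density) auto
  also have "\<dots> = emeasure (distr std_gauss borel L) A"
    by (simp add: nn_integral_indicator[symmetric] nn_integral_distr del: nn_integral_indicator)
  finally show "emeasure (gauss_law a S) A = emeasure (distr std_gauss borel L) A" .
qed (simp add: gauss_law_def)

lemma borel_prob_gauss_law: "borel_prob (gauss_law a S)"
  unfolding gauss_law_eq by (rule prob_space.borel_prob_distr[OF prob_space_std_gauss]) measurable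

lemma char_vec_gauss_law: "char_vec (gauss_law a S) u = complex_of_real (exp (- (quad S u / (4 * a))))"
proof -
  have inner_L: "u \<bullet> L y = (c *\<^sub>R (transpose W *v (S *v u))) \<bullet> y" for y
  proof -
    have "u \<bullet> ((S ** W) *v y) = (transpose (S ** W) *v u) \<bullet> y"
      by (metis dot_lmul_matrix transpose_matrix_vector)
    also have "transpose (S ** W) *v u = transpose W *v (S *v u)"
      by (simp add: matrix_transpose_mul sym matrix_vector_mul_assoc)
    finally show ?thesis by (simp add: L_def)
  qed
  have "(norm (transpose W *v (S *v u)))\<^sup>2 = quad S u"
    unfolding quad_inv[symmetric] by (simp add: quad_def matrix_inv_S_mult inner_commute)
  then have "(norm (c *\<^sub>R (transpose W *v (S *v u))))\<^sup>2 / 2 = quad S u / (4 * a)"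
    by (simp add: power_mult_distrib c_sq)
  moreover have "char_vec (gauss_law a S) u = char_vec std_gauss (c *\<^sub>R (transpose W *v (S *v u)))"
    unfolding gauss_law_eq char_vec_def by (subst integral_distr) (auto simp: inner_L)
  ultimately show ?thesis by (simp add: char_vec_std_gauss)
qed

end

section \<open>The half-normal law and its signed mixtures\<close>

definition half_normal_char :: "real \<Rightarrow> complex" where
  "half_normal_char x = complex_of_real (exp (- x\<^sup>2 / 2)) * (1 + \<i> * complex_of_real (x * sqrt (2 / pi) * gauss_ray (x\<^sup>2 / 2)))"

lemma std_normal_antiderivative:
  "((\<lambda>y. complex_of_real (std_normal_density y) * iexp (s * y)) has_vector_derivative
     complex_of_real (std_normal_density y) * ((- y + \<i> * s) * iexp (s * y))) (at y within A)"
proof -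
  have 1: "(std_normal_density has_real_derivative (- y * std_normal_density y)) (at y within A)"
  proof -
    have "((\<lambda>y::real. exp (- y\<^sup>2 / 2)) has_real_derivative (- y * exp (- y\<^sup>2 / 2))) (at y within A)"
      by (auto intro!: derivative_eq_intros)
    from DERIV_cmult[OF this, of "1 / sqrt (2 * pi)"]
    have "((\<lambda>y. 1 / sqrt (2 * pi) * exp (- y\<^sup>2 / 2)) has_real_derivative (- y * std_normal_density y)) (at y within A)"
      by (simp add: std_normal_density_def mult_ac)
    moreover have "std_normal_density = (\<lambda>y. 1 / sqrt (2 * pi) * exp (- y\<^sup>2 / 2))"
      by (rule ext) (simp add: std_normal_density_def)
    ultimately show ?thesis by simp
  qed
  have "((\<lambda>z. exp (\<i> * (complex_of_real s * z))) has_field_derivative (\<i> * s * iexp (s * y))) (at (complex_of_real y))"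
    by (auto intro!: derivative_eq_intros)
  from has_vector_derivative_real_field[OF this]
  have 2: "((\<lambda>y. iexp (s * y)) has_vector_derivative (\<i> * s * iexp (s * y))) (at y within A)"
    by (simp add: o_def has_vector_derivative_at_within)
  show ?thesis
    using has_vector_derivative_mult[OF has_vector_derivative_of_real[OF 1] 2]
    by (auto simp: algebra_simps elim!: has_vector_derivative_eq_rhs)
qed

lemma integrable_std_normal_moment1:
  "integrable std_normal_distribution (\<lambda>y. y)" "integrable std_normal_distribution (\<lambda>y. \<bar>y\<bar>)"
  using integrable_std_normal_distribution_moment[of 1] by (auto intro: integrable_abs)

text \<open>Multiplied by the normal density the integrand is the derivative of the density times
  \<open>iexp (s * y)\<close>, so the boundary value at 0 is all that remains; the half line is
  exhausted by bounded intervals.\<close>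

lemma half_line_integral:
  "(CLINT y|std_normal_distribution. indicator {0..} y *\<^sub>R ((- complex_of_real y + \<i> * s) * iexp (s * y))) = - complex_of_real (1 / sqrt (2 * pi))"
proof -
  interpret N: real_distribution std_normal_distribution by (rule real_dist_normal_dist)
  let ?h = "\<lambda>y. (- complex_of_real y + \<i> * s) * iexp (s * y)"
  have int: "integrable std_normal_distribution ?h"
  proof (rule Bochner_Integration.integrable_bound)
    show "integrable std_normal_distribution (\<lambda>y. \<bar>y\<bar> + \<bar>s\<bar>)" using integrable_std_normal_moment1 by auto
    show "AE y in std_normal_distribution. norm (?h y) \<le> norm (\<bar>y\<bar> + \<bar>s\<bar>)"
    proof (intro AE_I2)
      fix y
      have "cmod (- complex_of_real y + \<i> * s) \<le> \<bar>y\<bar> + \<bar>s\<bar>"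
        by (rule order_trans[OF norm_triangle_ineq]) (simp add: norm_mult)
      then show "norm (?h y) \<le> norm (\<bar>y\<bar> + \<bar>s\<bar>)" by (simp add: norm_mult)
    qed
  qed simp
  let ?I = "\<lambda>n::nat. (CLINT y|std_normal_distribution. indicator {0..real n} y *\<^sub>R ?h y)"
  have "?I \<longlonglongrightarrow> (CLINT y|std_normal_distribution. indicator {0..} y *\<^sub>R ?h y)"
  proof (rule integral_dominated_convergence[where w="\<lambda>y. cmod (?h y)"])
    show "AE y in std_normal_distribution. (\<lambda>n. indicator {0..real n} y *\<^sub>R ?h y) \<longlonglongrightarrow> indicator {0..} y *\<^sub>R ?h y"
    proof (intro AE_I2 tendsto_eventually)
      fix y :: real
      obtain n0 :: nat where "y \<le> real n0" using real_arch_simple by blast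
      then show "\<forall>\<^sub>F n in sequentially. indicator {0..real n} y *\<^sub>R ?h y = indicator {0..} y *\<^sub>R ?h y"
        unfolding eventually_sequentially by (intro exI[of _ n0]) (auto simp: indicator_def)
    qed
  qed (use int in \<open>auto simp: indicator_def intro: integrable_norm\<close>)
  moreover have "?I \<longlonglongrightarrow> - complex_of_real (1 / sqrt (2 * pi))"
  proof -
    let ?F = "\<lambda>y. complex_of_real (std_normal_density y) * iexp (s * y)"
    have Ieq: "?I n = ?F (real n) - ?F 0" for n
    proof -
      have "?I n = (CLBINT y. indicator {0..real n} y *\<^sub>R (complex_of_real (std_normal_density y) * ?h y))"
        by (subst integral_density) (auto simp: scaleR_conv_of_real mult_ac intro!: Bochner_Integration.integral_cong)
      also have "\<dots> = ?F (real n) - ?F 0"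
      proof (rule integral_FTC_Icc)
        show "(?F has_vector_derivative complex_of_real (std_normal_density y) * ?h y) (at y within {0..real n})" for y
          by (rule std_normal_antiderivative)
      qed (auto intro!: continuous_intros simp: std_normal_density_def)
      finally show ?thesis .
    qed
    have Flim: "(\<lambda>n. ?F (real n)) \<longlonglongrightarrow> 0"
    proof (rule Lim_null_comparison[where g="\<lambda>n. std_normal_density (real n)"])
      show "(\<lambda>n. std_normal_density (real n)) \<longlonglongrightarrow> 0"
        unfolding std_normal_density_def by real_asymp
    qed (simp add: norm_mult)
    have "?I \<longlonglongrightarrow> 0 - ?F 0" unfolding Ieq by (intro tendsto_diff Flim tendsto_const)
    then show ?thesis by (simp add: std_normal_density_def)
  qed
  ultimately show ?thesis using LIMSEQ_unique by (metis (no_types, lifting))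
qed

lemma std_normal_reflect:
  fixes f :: "real \<Rightarrow> 'b::{banach, second_countable_topology}"
  assumes [measurable]: "f \<in> borel_measurable borel"
  shows "(\<integral>y. f (- y) \<partial>std_normal_distribution) = (\<integral>y. f y \<partial>std_normal_distribution)"
proof -
  have "(\<integral>y. f y \<partial>std_normal_distribution) = (\<integral>y. std_normal_density y *\<^sub>R f y \<partial>lborel)"
    by (subst integral_density) auto
  also have "\<dots> = (\<integral>y. std_normal_density (- y) *\<^sub>R f (- y) \<partial>lborel)"
    by (subst lborel_integral_real_affine[where c="-1" and t=0]) auto
  also have "\<dots> = (\<integral>y. f (- y) \<partial>std_normal_distribution)"
    by (subst integral_density) (auto simp: std_normal_density_def)
  finally show ?thesis by simp
qed

lemma std_normal_AE_neq_0: "AE y in std_normal_distribution. y \<noteq> 0"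
  by (subst AE_density) (use AE_lborel_singleton[of "0::real"] in auto)

lemma std_normal_integral_abs:
  fixes f :: "real \<Rightarrow> complex"
  assumes [measurable]: "f \<in> borel_measurable borel" and int: "integrable std_normal_distribution f"
  shows "(CLINT y|std_normal_distribution. f \<bar>y\<bar>) = 2 * (CLINT y|std_normal_distribution. indicator {0..} y *\<^sub>R f y)"
proof -
  let ?h = "\<lambda>y. indicator {0..} y *\<^sub>R f y"
  have i: "integrable std_normal_distribution ?h"
    by (rule integrable_mult_indicator[OF _ int]) simp
  have i': "integrable std_normal_distribution (\<lambda>y. ?h (- y))"
  proof (rule integrableI_bounded)
    have "(\<integral>\<^sup>+y. ennreal (norm (?h (- y))) \<partial>std_normal_distribution)
        = (\<integral>\<^sup>+y. ennreal (std_normal_density (- y)) * ennreal (norm (?h (- y))) \<partial>lborel)"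
      by (subst nn_integral_density) (auto simp: std_normal_density_def)
    also have "\<dots> = (\<integral>\<^sup>+y. ennreal (std_normal_density y) * ennreal (norm (?h y)) \<partial>lborel)"
      using nn_integral_real_affine[of "\<lambda>y. ennreal (std_normal_density y) * ennreal (norm (?h y))" "-1" 0] by simp
    also have "\<dots> = (\<integral>\<^sup>+y. ennreal (norm (?h y)) \<partial>std_normal_distribution)"
      by (subst nn_integral_density) auto
    also have "\<dots> < \<infinity>" using i unfolding integrable_iff_bounded by auto
    finally show "(\<integral>\<^sup>+y. ennreal (norm (?h (- y))) \<partial>std_normal_distribution) < \<infinity>" .
  qed measurable
  have "(CLINT y|std_normal_distribution. f \<bar>y\<bar>) = (CLINT y|std_normal_distribution. ?h y + ?h (- y))"
  proof (rule integral_cong_AE)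
    show "AE y in std_normal_distribution. f \<bar>y\<bar> = ?h y + ?h (- y)"
      using std_normal_AE_neq_0 by eventually_elim (auto simp: indicator_def abs_if)
  qed measurable
  also have "\<dots> = (CLINT y|std_normal_distribution. ?h y) + (CLINT y|std_normal_distribution. ?h (- y))"
    by (rule Bochner_Integration.integral_add[OF i i'])
  also have "(CLINT y|std_normal_distribution. ?h (- y)) = (CLINT y|std_normal_distribution. ?h y)"
    by (rule std_normal_reflect) measurable
  finally show ?thesis by simp
qed

lemma integrable_linear_iexp:
  "integrable std_normal_distribution (\<lambda>y. (\<i> * complex_of_real y + complex_of_real s) * iexp (s * y))"
proof (rule Bochner_Integration.integrable_bound)
  interpret N: real_distribution std_normal_distribution by (rule real_dist_normal_dist)
  show "integrable std_normal_distribution (\<lambda>y. \<bar>y\<bar> + \<bar>s\<bar>)" using integrable_std_normal_moment1 by auto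
  show "AE y in std_normal_distribution. norm ((\<i> * complex_of_real y + complex_of_real s) * iexp (s * y)) \<le> norm (\<bar>y\<bar> + \<bar>s\<bar>)"
  proof (intro AE_I2)
    fix y
    have "cmod (\<i> * complex_of_real y + complex_of_real s) \<le> \<bar>y\<bar> + \<bar>s\<bar>"
      by (rule order_trans[OF norm_triangle_ineq]) (simp add: norm_mult)
    then show "norm ((\<i> * complex_of_real y + complex_of_real s) * iexp (s * y)) \<le> norm (\<bar>y\<bar> + \<bar>s\<bar>)" by (simp add: norm_mult)
  qed
qed simp

text \<open>For the characteristic function f of \<open>\<bar>N\<bar>\<close> this is the
  differential equation f' + s f = i sqrt (2 / pi). The constant is twice the normal density at
  0.\<close>

lemma half_normal_moment:
  "(CLINT y|std_normal_distribution. (\<i> * complex_of_real \<bar>y\<bar> + complex_of_real s) * iexp (s * \<bar>y\<bar>)) = \<i> * complex_of_real (sqrt (2 / pi))"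
proof -
  let ?f = "\<lambda>y. (\<i> * complex_of_real y + complex_of_real s) * iexp (s * y)"
  have "(CLINT y|std_normal_distribution. ?f \<bar>y\<bar>) = 2 * (CLINT y|std_normal_distribution. indicator {0..} y *\<^sub>R ?f y)"
    by (rule std_normal_integral_abs, measurable, rule integrable_linear_iexp)
  also have "(CLINT y|std_normal_distribution. indicator {0..} y *\<^sub>R ?f y)
      = (CLINT y|std_normal_distribution. - \<i> * (indicator {0..} y *\<^sub>R ((- complex_of_real y + \<i> * s) * iexp (s * y))))"
    by (intro Bochner_Integration.integral_cong refl) (simp add: algebra_simps scaleR_conv_of_real)
  also have "\<dots> = \<i> * complex_of_real (1 / sqrt (2 * pi))"
    by (simp only: integral_mult_right_zero half_line_integral) simp
  also have "2 * (\<i> * complex_of_real (1 / sqrt (2 * pi))) = \<i> * complex_of_real (sqrt (2 / pi))"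
  proof -
    have "2 * (1 / sqrt (2 * pi)) = sqrt (2 / pi)"
      by (simp add: real_sqrt_mult real_sqrt_divide field_simps)
    moreover have "2 * (\<i> * complex_of_real x) = \<i> * complex_of_real (2 * x)" for x by simp
    ultimately show ?thesis by (simp only:)
  qed
  finally show ?thesis .
qed

text \<open>The differential equation is integrated from 0 to \<open>x\<close> with the same
  integrating factor \<open>exp (c * t^2)\<close> as for the stationary laws, here with
  \<open>c = x^2 / 2\<close>.\<close>

lemma half_normal_char: "(CLINT y|std_normal_distribution. iexp (x * \<bar>y\<bar>)) = half_normal_char x"
proof -
  interpret N: real_distribution std_normal_distribution by (rule real_dist_normal_dist)
  interpret U: prob_space unit_unif by (rule prob_space_unit_unif)
  interpret NU: pair_sigma_finite std_normal_distribution unit_unif ..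
  define c where "c = x\<^sup>2 / 2"
  have c0: "0 \<le> c" by (simp add: c_def)
  let ?f = "\<lambda>y t. (\<i> * complex_of_real (x * \<bar>y\<bar>) + 2 * c * t) * iexp (t * (x * \<bar>y\<bar>)) * complex_of_real (exp (c * t\<^sup>2))"
  have int: "integrable (std_normal_distribution \<Otimes>\<^sub>M unit_unif) (\<lambda>(y, t). ?f y t)"
  proof (rule Bochner_Integration.integrable_bound)
    show "integrable (std_normal_distribution \<Otimes>\<^sub>M unit_unif) (\<lambda>z. ((\<bar>x\<bar> * \<bar>fst z\<bar> + 2 * c) * exp c) * 1)"
      using NU.integrable_prod_mult[of "\<lambda>y. (\<bar>x\<bar> * \<bar>y\<bar> + 2 * c) * exp c" "\<lambda>_. 1"] integrable_std_normal_moment1 by simp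
    have "AE z in std_normal_distribution \<Otimes>\<^sub>M unit_unif. 0 < snd z \<and> snd z \<le> 1"
    proof (rule NU.AE_pair_measure)
      show "{z \<in> space (std_normal_distribution \<Otimes>\<^sub>M unit_unif). 0 < snd z \<and> snd z \<le> 1} \<in> sets (std_normal_distribution \<Otimes>\<^sub>M unit_unif)"
        by measurable
    qed (use AE_unit_unif in auto)
    then show "AE z in std_normal_distribution \<Otimes>\<^sub>M unit_unif. norm (case z of (y, t) \<Rightarrow> ?f y t)
        \<le> norm (((\<bar>x\<bar> * \<bar>fst z\<bar> + 2 * c) * exp c) * 1)"
    proof eventually_elim
      case (elim z)
      then have t: "0 < snd z" "snd z \<le> 1" by auto
      have "cmod (\<i> * complex_of_real (x * \<bar>fst z\<bar>) + 2 * c * snd z) \<le> \<bar>x\<bar> * \<bar>fst z\<bar> + 2 * c * snd z"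
        using t c0 by (intro order_trans[OF norm_triangle_ineq]) (auto simp: norm_mult abs_mult)
      also have "\<dots> \<le> \<bar>x\<bar> * \<bar>fst z\<bar> + 2 * c"
        using t c0 by (simp add: mult_left_le)
      finally have 1: "cmod (\<i> * complex_of_real (x * \<bar>fst z\<bar>) + 2 * c * snd z) \<le> \<bar>x\<bar> * \<bar>fst z\<bar> + 2 * c" .
      have "c * (snd z)\<^sup>2 \<le> c" using t c0 by (intro mult_left_le power_le_one) auto
      then have "exp (c * (snd z)\<^sup>2) \<le> exp c" by simp
      then have "cmod (\<i> * complex_of_real (x * \<bar>fst z\<bar>) + 2 * c * snd z) * exp (c * (snd z)\<^sup>2) \<le> (\<bar>x\<bar> * \<bar>fst z\<bar> + 2 * c) * exp c"
        using 1 c0 by (intro mult_mono) auto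
      moreover have "norm (case z of (y, t) \<Rightarrow> ?f y t) = cmod (\<i> * complex_of_real (x * \<bar>fst z\<bar>) + 2 * c * snd z) * exp (c * (snd z)\<^sup>2)"
        by (cases z) (simp only: prod.case fst_conv snd_conv norm_mult norm_exp_i_times norm_of_real abs_exp_cancel mult_1_right)
      moreover have "0 \<le> (\<bar>x\<bar> * \<bar>fst z\<bar> + 2 * c) * exp c" using c0 by simp
      ultimately show ?case by (simp only: mult_1_right real_norm_def abs_of_nonneg)
    qed
  qed measurable
  have iN: "integrable std_normal_distribution (\<lambda>y. iexp (x * \<bar>y\<bar>))"
    by (rule N.integrable_const_bound[where B=1]) auto
  have "(CLINT y|std_normal_distribution. iexp (x * \<bar>y\<bar>)) * exp c - 1 = (CLINT y|std_normal_distribution. iexp (x * \<bar>y\<bar>) * exp c - 1)"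
    using iN N.prob_space by simp
  also have "\<dots> = (CLINT y|std_normal_distribution. CLINT t|unit_unif. ?f y t)"
    by (simp only: iexp_gauss_FTC exp_of_real)
  also have "\<dots> = (CLINT t|unit_unif. CLINT y|std_normal_distribution. ?f y t)"
    by (rule NU.Fubini_integral[symmetric, OF int])
  also have "\<dots> = (CLINT t|unit_unif. complex_of_real (exp (c * t\<^sup>2)) * (\<i> * complex_of_real (x * sqrt (2 / pi))))"
  proof (rule Bochner_Integration.integral_cong[OF refl])
    fix t
    have "(CLINT y|std_normal_distribution. ?f y t)
        = (CLINT y|std_normal_distribution. (x * complex_of_real (exp (c * t\<^sup>2))) * ((\<i> * complex_of_real \<bar>y\<bar> + complex_of_real (t * x)) * iexp ((t * x) * \<bar>y\<bar>)))"
      by (intro Bochner_Integration.integral_cong refl) (simp add: c_def power2_eq_square algebra_simps)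
    also have "\<dots> = (x * complex_of_real (exp (c * t\<^sup>2))) * (\<i> * complex_of_real (sqrt (2 / pi)))"
      by (simp only: integral_mult_right_zero half_normal_moment)
    finally show "(CLINT y|std_normal_distribution. ?f y t) = complex_of_real (exp (c * t\<^sup>2)) * (\<i> * complex_of_real (x * sqrt (2 / pi)))"
      by simp
  qed
  also have "\<dots> = complex_of_real (gauss_ray c) * (\<i> * complex_of_real (x * sqrt (2 / pi)))"
    by (simp only: integral_mult_left_zero integral_complex_of_real gauss_ray_def)
  finally have "(CLINT y|std_normal_distribution. iexp (x * \<bar>y\<bar>)) * exp c
      = 1 + \<i> * complex_of_real (x * sqrt (2 / pi) * gauss_ray c)"
    by (simp add: algebra_simps)
  moreover have "complex_of_real (exp c) * complex_of_real (exp (- c)) = 1"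
    by (simp add: exp_minus flip: of_real_mult)
  moreover have "I = e * R" if "I * E = R" "E * e = 1" for I E e R :: complex
    using that by (metis mult.assoc mult.commute mult_1)
  ultimately have "(CLINT y|std_normal_distribution. iexp (x * \<bar>y\<bar>)) = complex_of_real (exp (- c)) * (1 + \<i> * complex_of_real (x * sqrt (2 / pi) * gauss_ray c))"
    by blast
  then show ?thesis by (simp add: half_normal_char_def c_def)
qed

lemma half_normal_char_mix:
  "complex_of_real p1 * half_normal_char x + complex_of_real (1 - p1) * half_normal_char (- x)
    = complex_of_real (exp (- x\<^sup>2 / 2)) * (1 + \<i> * complex_of_real ((2 * p1 - 1) * x * sqrt (2 / pi) * gauss_ray (x\<^sup>2 / 2)))"
  by (simp add: half_normal_char_def algebra_simps)

text \<open>The two probabilities add up to 1, so \<open>B2\<close> is almost surely a sign. On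
  either event independence leaves the half-normal characteristic function, at \<open>t * c\<close>
  or at its negative.\<close>

lemma char_signed_half_normal:
  fixes B2 N :: "'q \<Rightarrow> real"
  assumes Q: "prob_space Q" and ind: "prob_space.indep_var Q borel B2 borel N"
    and N: "distributed Q lborel N std_normal_density"
    and p1: "measure Q {\<omega> \<in> space Q. B2 \<omega> = 1} = p1" and p2: "measure Q {\<omega> \<in> space Q. B2 \<omega> = - 1} = 1 - p1"
  shows "char (distr Q borel (\<lambda>\<omega>. c * B2 \<omega> * \<bar>N \<omega>\<bar>)) t
    = complex_of_real (exp (- (t * c)\<^sup>2 / 2)) * (1 + \<i> * complex_of_real ((2 * p1 - 1) * (t * c) * sqrt (2 / pi) * gauss_ray ((t * c)\<^sup>2 / 2)))"
proof -
  interpret Q: prob_space Q by fact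
  have [measurable]: "B2 \<in> borel_measurable Q" "N \<in> borel_measurable Q"
    using Q.indep_var_rv1[OF ind] Q.indep_var_rv2[OF ind] by auto
  let ?A = "{\<omega> \<in> space Q. B2 \<omega> = 1}" and ?B = "{\<omega> \<in> space Q. B2 \<omega> = - 1}"
  have "Q.prob (?A \<union> ?B) = 1"
    using p1 p2 by (subst Q.finite_measure_Union) auto
  then have "AE \<omega> in Q. \<omega> \<in> ?A \<union> ?B"
    by (subst (asm) Q.prob_eq_1) auto
  then have AE: "AE \<omega> in Q. B2 \<omega> = 1 \<or> B2 \<omega> = - 1" by eventually_elim auto
  have law: "distr Q borel N = std_normal_distribution"
    using distributed_distr_eq_density[OF N] by (simp cong: distr_cong)
  have tm: "(CLINT \<omega>|Q. complex_of_real (indicator {v} (B2 \<omega>)) * iexp (x * \<bar>N \<omega>\<bar>))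
      = complex_of_real (measure Q {\<omega> \<in> space Q. B2 \<omega> = v}) * half_normal_char x" for v x
  proof -
    have "Q.indep_var borel ((\<lambda>b. complex_of_real (indicator {v} b)) \<circ> B2) borel ((\<lambda>y. iexp (x * \<bar>y\<bar>)) \<circ> N)"
      by (rule Q.indep_var_compose[OF ind]) measurable
    then have "(CLINT \<omega>|Q. complex_of_real (indicator {v} (B2 \<omega>)) * iexp (x * \<bar>N \<omega>\<bar>))
        = (CLINT \<omega>|Q. complex_of_real (indicator {v} (B2 \<omega>))) * (CLINT \<omega>|Q. iexp (x * \<bar>N \<omega>\<bar>))"
      unfolding o_def
      by (rule Q.indep_var_lebesgue_integral)
         (auto intro!: Q.integrable_const_bound[where B=1] simp: indicator_def)
    also have "(CLINT \<omega>|Q. complex_of_real (indicator {v} (B2 \<omega>))) = complex_of_real (measure Q {\<omega> \<in> space Q. B2 \<omega> = v})"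
    proof -
      have "(\<integral>\<omega>. indicator {v} (B2 \<omega>) \<partial>Q) = (\<integral>\<omega>. indicator {\<omega> \<in> space Q. B2 \<omega> = v} \<omega> \<partial>Q :: real)"
        by (intro Bochner_Integration.integral_cong) (auto simp: indicator_def)
      then show ?thesis by (simp only: integral_complex_of_real) simp
    qed
    also have "(CLINT \<omega>|Q. iexp (x * \<bar>N \<omega>\<bar>)) = (CLINT y|distr Q borel N. iexp (x * \<bar>y\<bar>))"
      by (subst integral_distr) auto
    finally show ?thesis unfolding law half_normal_char .
  qed
  have int: "integrable Q (\<lambda>\<omega>. complex_of_real (indicator {v} (B2 \<omega>)) * iexp (x * \<bar>N \<omega>\<bar>))" for v x
    by (rule Q.integrable_const_bound[where B=1]) (auto simp: norm_mult indicator_def)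
  have "char (distr Q borel (\<lambda>\<omega>. c * B2 \<omega> * \<bar>N \<omega>\<bar>)) t = (CLINT \<omega>|Q. iexp (t * (c * B2 \<omega> * \<bar>N \<omega>\<bar>)))"
    unfolding char_def by (subst integral_distr) auto
  also have "\<dots> = (CLINT \<omega>|Q. complex_of_real (indicator {1} (B2 \<omega>)) * iexp ((t * c) * \<bar>N \<omega>\<bar>)
      + complex_of_real (indicator {- 1} (B2 \<omega>)) * iexp ((- (t * c)) * \<bar>N \<omega>\<bar>))"
  proof (rule integral_cong_AE)
    show "AE \<omega> in Q. iexp (t * (c * B2 \<omega> * \<bar>N \<omega>\<bar>)) = complex_of_real (indicator {1} (B2 \<omega>)) * iexp ((t * c) * \<bar>N \<omega>\<bar>)
      + complex_of_real (indicator {- 1} (B2 \<omega>)) * iexp ((- (t * c)) * \<bar>N \<omega>\<bar>)"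
      using AE by eventually_elim (auto simp: indicator_def mult.assoc)
  qed measurable
  also have "\<dots> = complex_of_real p1 * half_normal_char (t * c) + complex_of_real (1 - p1) * half_normal_char (- (t * c))"
    unfolding p1[symmetric] p2[unfolded p1[symmetric], symmetric]
    by (subst Bochner_Integration.integral_add[OF int int]) (simp only: tm)
  finally show ?thesis unfolding half_normal_char_mix .
qed

text \<open>The substitution of \<open>x * t\<close> for \<open>t\<close> relates the integral of
  the statement to \<open>gauss_ray\<close>. The latter is regular at 0, so one formula covers
  \<open>u = 0\<close>; times the Gaussian factor it is a form of Dawson's function.\<close>

lemma integral_exp_sq:
  assumes "0 \<le> x"
  shows "integral {0..x} (\<lambda>t. exp (t\<^sup>2 / 2)) = x * gauss_ray (x\<^sup>2 / 2)"
proof (cases "x = 0")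
  case False
  then have x: "0 < x" using assms by simp
  have si: "set_integrable lborel {0..x} (\<lambda>t. exp (t\<^sup>2 / 2))"
    unfolding set_integrable_def by (rule borel_integrable_compact) (auto intro!: continuous_intros)
  have "integral {0..x} (\<lambda>t. exp (t\<^sup>2 / 2)) = (\<integral>t. indicator {0..x} t * exp (t\<^sup>2 / 2) \<partial>lborel)"
    using set_borel_integral_eq_integral(2)[OF si] by (simp add: set_lebesgue_integral_def)
  also have "\<dots> = x * (\<integral>t. indicator {0..x} (x * t) * exp ((x * t)\<^sup>2 / 2) \<partial>lborel)"
    using x by (subst lborel_integral_real_affine[where c=x and t=0]) auto
  also have "(\<integral>t. indicator {0..x} (x * t) * exp ((x * t)\<^sup>2 / 2) \<partial>lborel) = (\<integral>t. indicator {0..1} t *\<^sub>R exp (x\<^sup>2 / 2 * t\<^sup>2) \<partial>lborel)"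
    using x by (intro Bochner_Integration.integral_cong) (auto simp: indicator_def power_mult_distrib zero_le_mult_iff)
  also have "\<dots> = gauss_ray (x\<^sup>2 / 2)"
    unfolding gauss_ray_def by (rule integral_unit_unif[symmetric]) measurable
  finally show ?thesis .
qed simp

section \<open>Two-point laws and mixtures\<close>

definition two_point :: "real \<Rightarrow> real \<Rightarrow> real \<Rightarrow> real measure" where
  "two_point p x y = distr (measure_pmf (bernoulli_pmf p)) borel (\<lambda>b. if b then x else y)"

lemma borel_prob_two_point: "borel_prob (two_point p x y)"
  unfolding two_point_def by (rule prob_space.borel_prob_distr[OF prob_space_measure_pmf]) simp

lemma integral_two_point:
  fixes f :: "real \<Rightarrow> 'b::{banach, second_countable_topology}"
  assumes "0 \<le> p" "p \<le> 1" "f \<in> borel_measurable borel"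
  shows "(\<integral>t. f t \<partial>two_point p x y) = p *\<^sub>R f x + (1 - p) *\<^sub>R f y"
  unfolding two_point_def using assms
  by (subst integral_distr) (auto simp: integral_measure_pmf[of UNIV] UNIV_bool add.commute)

lemma measure_two_point:
  assumes "0 \<le> p" "p \<le> 1" "x \<noteq> y"
  shows "measure (two_point p x y) {x} = p" "measure (two_point p x y) {y} = 1 - p"
proof -
  interpret prob_space "two_point p x y" using borel_prob_two_point by (rule borel_probD)
  have "measure (two_point p x y) {z} = (\<integral>t. indicator {z} t \<partial>two_point p x y)" for z
    by (simp add: borel_probD(3)[OF borel_prob_two_point])
  also have "(\<integral>t. indicator {z} t \<partial>two_point p x y) = p * indicator {z} x + (1 - p) * indicator {z} y" for z
    using assms by (subst integral_two_point) auto
  finally show "measure (two_point p x y) {x} = p" "measure (two_point p x y) {y} = 1 - p"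
    using assms by simp_all
qed

locale borel_prob_pair =
  fixes \<beta> :: "'v::second_countable_topology measure" and \<nu> :: "'w::second_countable_topology measure"
  assumes \<beta>: "borel_prob \<beta>" and \<nu>: "borel_prob \<nu>"
begin

sublocale B: prob_space \<beta> using \<beta> by (rule borel_probD)
sublocale V: prob_space \<nu> using \<nu> by (rule borel_probD)
sublocale pair_prob_space \<beta> \<nu> ..

lemma sets_eq [measurable_cong]: "sets \<beta> = sets borel" "sets \<nu> = sets borel"
  using \<beta> \<nu> by (auto dest: borel_probD)

lemma space_eq: "space \<beta> = UNIV" "space \<nu> = UNIV" "space (\<beta> \<Otimes>\<^sub>M \<nu>) = UNIV"
  using \<beta> \<nu> by (auto dest: borel_probD simp: space_pair_measure)

lemma measure_Times:
  assumes "A \<in> sets borel" "B \<in> sets borel"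
  shows "measure (\<beta> \<Otimes>\<^sub>M \<nu>) (A \<times> B) = measure \<beta> A * measure \<nu> B"
  using assms V.emeasure_pair_measure_Times[of A \<beta> B]
  by (simp add: sets_eq measure_def enn2real_mult)

lemma vimages: "fst -` A \<inter> space (\<beta> \<Otimes>\<^sub>M \<nu>) = A \<times> UNIV" "snd -` B \<inter> space (\<beta> \<Otimes>\<^sub>M \<nu>) = UNIV \<times> B"
  unfolding space_eq by auto

lemma measure_fst: "A \<in> sets borel \<Longrightarrow> measure (\<beta> \<Otimes>\<^sub>M \<nu>) (A \<times> UNIV) = measure \<beta> A"
  and measure_snd: "B \<in> sets borel \<Longrightarrow> measure (\<beta> \<Otimes>\<^sub>M \<nu>) (UNIV \<times> B) = measure \<nu> B"
  using measure_Times[of A UNIV] measure_Times[of UNIV B] B.prob_space V.prob_space by (auto simp: space_eq)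

lemma indep_rv_fst_snd: "indep_rv (\<beta> \<Otimes>\<^sub>M \<nu>) borel fst borel snd"
  unfolding indep_rv_def indep_sets2_eq vimages
proof (intro conjI ballI subsetI)
  fix a b :: "('v \<times> 'w) set" assume "a \<in> {A \<times> UNIV |A. A \<in> sets borel}" "b \<in> {UNIV \<times> B |B. B \<in> sets borel}"
  then obtain A B where "a = A \<times> UNIV" "b = UNIV \<times> B" "A \<in> sets borel" "B \<in> sets borel" by auto
  moreover have "A \<times> UNIV \<inter> UNIV \<times> B = A \<times> B" by auto
  ultimately show "measure (\<beta> \<Otimes>\<^sub>M \<nu>) (a \<inter> b) = measure (\<beta> \<Otimes>\<^sub>M \<nu>) a * measure (\<beta> \<Otimes>\<^sub>M \<nu>) b"
    by (simp only: measure_Times measure_fst measure_snd)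
qed (auto simp: sets_eq space_eq)

lemma distr_snd: "distr (\<beta> \<Otimes>\<^sub>M \<nu>) borel snd = \<nu>"
proof (rule measure_eqI)
  fix B assume "B \<in> sets (distr (\<beta> \<Otimes>\<^sub>M \<nu>) borel snd)"
  then have "B \<in> sets borel" by simp
  then show "emeasure (distr (\<beta> \<Otimes>\<^sub>M \<nu>) borel snd) B = emeasure \<nu> B"
    by (simp add: emeasure_distr vimages emeasure_eq_measure V.emeasure_eq_measure measure_snd)
qed (simp add: sets_eq)

lemma distr_fst: "distr (\<beta> \<Otimes>\<^sub>M \<nu>) borel fst = \<beta>"
proof (rule measure_eqI)
  fix A assume "A \<in> sets (distr (\<beta> \<Otimes>\<^sub>M \<nu>) borel fst)"
  then have "A \<in> sets borel" by simp
  then show "emeasure (distr (\<beta> \<Otimes>\<^sub>M \<nu>) borel fst) A = emeasure \<beta> A"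
    by (simp add: emeasure_distr vimages emeasure_eq_measure B.emeasure_eq_measure measure_fst)
qed (simp add: sets_eq)

end

text \<open>The law of a vector times an independent two-point factor. The values 1 and 0 give the
  limit law, the values 1 and -1 with weight 1/2 the symmetrisation.\<close>

definition scaled_mix :: "real \<Rightarrow> real \<Rightarrow> real \<Rightarrow> 'v::euclidean_space measure \<Rightarrow> 'v measure" where
  "scaled_mix p s t \<nu> = distr (two_point p s t \<Otimes>\<^sub>M \<nu>) borel (\<lambda>\<omega>. fst \<omega> *\<^sub>R snd \<omega>)"

context
  fixes \<nu> :: "'v::euclidean_space measure" and p :: real
  assumes \<nu>: "borel_prob \<nu>" and p: "0 \<le> p" "p \<le> 1"
begin

lemma borel_prob_scaled_mix: "borel_prob (scaled_mix p s t \<nu>)"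
proof -
  interpret borel_prob_pair "two_point p s t" \<nu> by standard (rule borel_prob_two_point, rule \<nu>)
  show ?thesis unfolding scaled_mix_def by (rule borel_prob_distr) measurable
qed

lemma integral_scaled_mix:
  fixes f :: "'v \<Rightarrow> 'b::{banach, second_countable_topology}"
  assumes [measurable]: "f \<in> borel_measurable borel" and bd: "\<And>x. norm (f x) \<le> C"
  shows "(\<integral>x. f x \<partial>scaled_mix p s t \<nu>) = p *\<^sub>R (\<integral>x. f (s *\<^sub>R x) \<partial>\<nu>) + (1 - p) *\<^sub>R (\<integral>x. f (t *\<^sub>R x) \<partial>\<nu>)"
proof -
  interpret borel_prob_pair "two_point p s t" \<nu> by standard (rule borel_prob_two_point, rule \<nu>)
  have "(\<integral>x. f x \<partial>scaled_mix p s t \<nu>) = (\<integral>\<omega>. f (fst \<omega> *\<^sub>R snd \<omega>) \<partial>(two_point p s t \<Otimes>\<^sub>M \<nu>))"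
    unfolding scaled_mix_def by (subst integral_distr) auto
  also have "\<dots> = (\<integral>b. \<integral>x. f (b *\<^sub>R x) \<partial>\<nu> \<partial>two_point p s t)"
    by (subst integral_fst'[symmetric]) (auto intro!: integrable_const_bound[where B=C] bd)
  also have "\<dots> = p *\<^sub>R (\<integral>x. f (s *\<^sub>R x) \<partial>\<nu>) + (1 - p) *\<^sub>R (\<integral>x. f (t *\<^sub>R x) \<partial>\<nu>)"
    using p by (rule integral_two_point) measurable
  finally show ?thesis .
qed

lemma char_vec_scaled_mix:
  "char_vec (scaled_mix p s t \<nu>) u = p *\<^sub>R char_vec \<nu> (s *\<^sub>R u) + (1 - p) *\<^sub>R char_vec \<nu> (t *\<^sub>R u)"
  unfolding char_vec_def by (subst integral_scaled_mix[where C=1]) auto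

end

lemma char_vec_0: "borel_prob \<nu> \<Longrightarrow> char_vec \<nu> 0 = 1"
  using prob_space.prob_space[of \<nu>] by (simp add: char_vec_def borel_prob_def)

lemma char_vec_uminus: "char_vec \<nu> (- u) = cnj (char_vec \<nu> u)"
  unfolding char_vec_def
  using integral_bounded_linear'[OF bounded_linear_cnj bounded_linear_cnj, of \<nu> "\<lambda>x. iexp (u \<bullet> x)"] by (simp add: exp_cnj)

section \<open>Characteristic function, density and projections of \<open>Z\<close>\<close>

definition zchar :: "real \<Rightarrow> real \<Rightarrow> real^'n \<Rightarrow> real^'n^'n \<Rightarrow> real^'n \<Rightarrow> complex" where
  "zchar a p \<mu> S u = complex_of_real (exp (- (quad S u / (4 * a))))
     * (1 + \<i> * complex_of_real ((u \<bullet> \<mu>) / p * gauss_ray (quad S u / (4 * a))))"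

lemma limit_char_eq_zchar:
  assumes "p \<noteq> 0"
  shows "limit_char (1 - p) (quad S u / (4 * a)) (u \<bullet> \<mu>) = complex_of_real (1 - p) + complex_of_real p * zchar a p \<mu> S u"
proof -
  have "limit_char (1 - p) c (p * x) = complex_of_real (1 - p)
      + complex_of_real p * (complex_of_real (exp (- c)) * (1 + \<i> * complex_of_real (x * gauss_ray c)))" for c x
    using exp_of_real[of "- c", where ?'a=complex] by (simp add: limit_char_def algebra_simps)
  from this[of "quad S u / (4 * a)" "(u \<bullet> \<mu>) / p"] show ?thesis
    using assms unfolding zchar_def by simp
qed

lemma char_distr_inner:
  fixes \<nu> :: "'v::euclidean_space measure"
  assumes \<nu>: "borel_prob \<nu>"
  shows "char (distr \<nu> borel (\<lambda>x. v \<bullet> x)) t = char_vec \<nu> (t *\<^sub>R v)"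
proof -
  have [measurable_cong]: "sets \<nu> = sets borel" using \<nu> by (rule borel_probD)
  have "(\<lambda>x. v \<bullet> x) \<in> borel_measurable \<nu>" by measurable
  then show ?thesis unfolding char_def char_vec_def by (subst integral_distr) auto
qed

context covariance
begin

text \<open>The square root of \<open>quad S u\<close> in the coefficient cancels against the one
  from the upper limit of the integral, which leaves a form valid at \<open>u = 0\<close>
  too.\<close>

lemma char_property_iff:
  assumes \<nu>: "borel_prob \<nu>"
  shows "char_property a p \<mu> S \<nu> \<longleftrightarrow> (\<forall>u. char_vec \<nu> u = zchar a p \<mu> S u)"
proof -
  have eq: "(1 + \<i> * complex_of_real
           (sqrt (2 * a) * (u \<bullet> \<mu>) / (p * sqrt (quad S u))
             * integral {0 .. sqrt (quad S u) / sqrt (2 * a)} (\<lambda>t. exp (t\<^sup>2 / 2))))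
         * complex_of_real (exp (- (quad S u / (4 * a)))) = zchar a p \<mu> S u" if "u \<noteq> 0" for u
  proof -
    define x where "x = sqrt (quad S u) / sqrt (2 * a)"
    have q: "0 < quad S u" using pos that by simp
    have x: "x\<^sup>2 / 2 = quad S u / (4 * a)" using q a_pos by (simp add: x_def power_divide)
    have "integral {0 .. x} (\<lambda>t. exp (t\<^sup>2 / 2)) = x * gauss_ray (x\<^sup>2 / 2)"
      by (rule integral_exp_sq) (use q a_pos in \<open>simp add: x_def\<close>)
    moreover have "sqrt (2 * a) * (u \<bullet> \<mu>) / (p * sqrt (quad S u)) * (x * G) = (u \<bullet> \<mu>) / p * G" for G
      using q a_pos by (simp add: x_def)
    ultimately show ?thesis
      unfolding zchar_def x_def[symmetric] by (simp only: x mult.commute[of _ "complex_of_real (exp _)"])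
  qed
  have "zchar a p \<mu> S 0 = 1" by (simp add: zchar_def quad_def)
  then show ?thesis
    unfolding char_property_def using eq char_vec_0[OF \<nu>] by metis
qed

text \<open>The factor \<open>sqrt (pi * a)\<close> in the two-point weights is made for this:
  \<open>sqrt (2 / pi)\<close> is the mean of \<open>\<bar>N\<bar>\<close>, and the product of the
  two is \<open>sqrt (2 * a)\<close>.\<close>

lemma projection_scale:
  assumes "v \<noteq> 0"
  shows "(2 * (1/2 + sqrt (pi * a) * (v \<bullet> \<mu>) / (2 * p * sqrt (quad S v))) - 1) * (t * (sqrt (quad S v) / sqrt (2 * a))) * sqrt (2 / pi)
    = ((t *\<^sub>R v) \<bullet> \<mu>) / p"
    "(t * (sqrt (quad S v) / sqrt (2 * a)))\<^sup>2 / 2 = quad S (t *\<^sub>R v) / (4 * a)"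
proof -
  have q: "0 < quad S v" using pos assms by simp
  have "sqrt (pi * a) * sqrt (2 / pi) = sqrt (2 * a)" by (simp add: real_sqrt_mult[symmetric])
  then have "(2 * (1/2 + sqrt (pi * a) * (v \<bullet> \<mu>) / (2 * p * sqrt (quad S v))) - 1) * (t * (sqrt (quad S v) / sqrt (2 * a))) * sqrt (2 / pi)
     = sqrt (2 * a) * t * (v \<bullet> \<mu>) * (sqrt (quad S v) / sqrt (quad S v)) / (p * sqrt (2 * a))"
    by (simp add: field_simps)
  also have "\<dots> = ((t *\<^sub>R v) \<bullet> \<mu>) / p" using q a_pos by simp
  finally show "(2 * (1/2 + sqrt (pi * a) * (v \<bullet> \<mu>) / (2 * p * sqrt (quad S v))) - 1) * (t * (sqrt (quad S v) / sqrt (2 * a))) * sqrt (2 / pi)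
    = ((t *\<^sub>R v) \<bullet> \<mu>) / p" .
  show "(t * (sqrt (quad S v) / sqrt (2 * a)))\<^sup>2 / 2 = quad S (t *\<^sub>R v) / (4 * a)"
    using q a_pos by (simp add: quad_scale power_mult_distrib power_divide)
qed

lemma char_projection:
  fixes B2 N :: "'q \<Rightarrow> real"
  assumes "v \<noteq> 0" and "prob_space Q" "prob_space.indep_var Q borel B2 borel N"
    "distributed Q lborel N std_normal_density"
    "measure Q {\<omega> \<in> space Q. B2 \<omega> = 1} = 1/2 + sqrt (pi * a) * (v \<bullet> \<mu>) / (2 * p * sqrt (quad S v))"
    "measure Q {\<omega> \<in> space Q. B2 \<omega> = - 1} = 1/2 - sqrt (pi * a) * (v \<bullet> \<mu>) / (2 * p * sqrt (quad S v))"
  shows "char (distr Q borel (\<lambda>\<omega>. sqrt (quad S v) / sqrt (2 * a) * B2 \<omega> * \<bar>N \<omega>\<bar>)) t = zchar a p \<mu> S (t *\<^sub>R v)"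
proof -
  have "measure Q {\<omega> \<in> space Q. B2 \<omega> = - 1} = 1 - (1/2 + sqrt (pi * a) * (v \<bullet> \<mu>) / (2 * p * sqrt (quad S v)))"
    using assms(6) by simp
  from char_signed_half_normal[OF assms(2-5) this] projection_scale[OF assms(1)]
  show ?thesis unfolding zchar_def minus_divide_left[symmetric] by (simp only:)
qed

text \<open>The Cramer-Wold device: the characteristic function at \<open>u\<close> is that of the
  projection on \<open>u\<close>, taken at 1.\<close>

lemma projection_property_imp_char:
  assumes \<nu>: "borel_prob \<nu>" and pr: "projection_property a p \<mu> S \<nu>"
  shows "char_vec \<nu> u = zchar a p \<mu> S u"
proof (cases "u = 0")
  case True
  then show ?thesis using char_vec_0[OF \<nu>] by (simp add: zchar_def quad_def)
next
  case False
  with pr obtain Q :: "(real \<times> real) measure" and B2 N where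
    "prob_space Q" "prob_space.indep_var Q borel B2 borel N"
    "distributed Q lborel N std_normal_density"
    "measure Q {\<omega> \<in> space Q. B2 \<omega> = 1} = 1/2 + sqrt (pi * a) * (u \<bullet> \<mu>) / (2 * p * sqrt (quad S u))"
    "measure Q {\<omega> \<in> space Q. B2 \<omega> = - 1} = 1/2 - sqrt (pi * a) * (u \<bullet> \<mu>) / (2 * p * sqrt (quad S u))"
    and law: "distr \<nu> borel (\<lambda>x. u \<bullet> x) = distr Q borel (\<lambda>\<omega>. sqrt (quad S u) / sqrt (2 * a) * B2 \<omega> * \<bar>N \<omega>\<bar>)"
    unfolding projection_property_def by meson
  from char_projection[OF False this(1-5), of 1] show ?thesis
    unfolding law[symmetric] char_distr_inner[OF \<nu>] by simp
qed

text \<open>The bound on \<open>\<mu>\<close> says that the prescribed weights lie between 0 and 1,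
  so sign and normal variable can be realised on a product space. The laws on the line are then
  compared through their characteristic functions.\<close>

lemma projection_propertyI:
  assumes nu: "borel_prob \<nu>" and ch: "\<And>u. char_vec \<nu> u = zchar a p \<mu> S u" and p: "0 < p"
    and bound: "\<And>v. sqrt (pi * a) * \<bar>v \<bullet> \<mu>\<bar> \<le> p * sqrt (quad S v)"
  shows "projection_property a p \<mu> S \<nu>"
  unfolding projection_property_def
proof (intro allI impI)
  fix v :: "real^'n" assume v: "v \<noteq> 0"
  have q: "0 < quad S v" using pos v by simp
  define d where "d = sqrt (pi * a) * (v \<bullet> \<mu>) / (2 * p * sqrt (quad S v))"
  have "\<bar>sqrt (pi * a) * (v \<bullet> \<mu>)\<bar> \<le> p * sqrt (quad S v)" using bound[of v] a_pos by (simp add: abs_mult)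
  then have d: "\<bar>d\<bar> \<le> 1/2" using p q by (simp add: d_def abs_mult field_simps)
  define P where "P = two_point (1/2 + d) 1 (-1)"
  interpret borel_prob_pair P std_normal_distribution
  proof
    show "borel_prob P" unfolding P_def by (rule borel_prob_two_point)
    show "borel_prob std_normal_distribution"
      using real_dist_normal_dist by (simp add: borel_prob_def real_distribution_def)
  qed
  let ?Q = "P \<Otimes>\<^sub>M std_normal_distribution"
  have iv: "indep_var borel fst borel snd"
    unfolding indep_var_distribution_eq distr_fst distr_snd
    by (auto intro!: distr_id2[symmetric] sets_pair_measure_cong simp: sets_eq)
  have dist: "distributed ?Q lborel snd std_normal_density"
    using distr_snd by (auto simp: distributed_def intro!: measurable_snd'' cong: distr_cong)
  have m1: "measure ?Q {\<omega> \<in> space ?Q. fst \<omega> = 1} = 1/2 + d"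
  proof -
    have "{\<omega> \<in> space ?Q. fst \<omega> = 1} = {1} \<times> UNIV" by (auto simp: space_eq)
    then show ?thesis using d measure_fst[of "{1}"] measure_two_point[of "1/2 + d" 1 "- 1"] by (simp add: P_def abs_le_iff)
  qed
  have m2: "measure ?Q {\<omega> \<in> space ?Q. fst \<omega> = -1} = 1/2 - d"
  proof -
    have "{\<omega> \<in> space ?Q. fst \<omega> = -1} = {-1} \<times> UNIV" by (auto simp: space_eq)
    then show ?thesis using d measure_fst[of "{-1}"] measure_two_point[of "1/2 + d" 1 "- 1"] by (simp add: P_def abs_le_iff)
  qed
  have "distr \<nu> borel (\<lambda>x. v \<bullet> x) = distr ?Q borel (\<lambda>\<omega>. sqrt (quad S v) / sqrt (2 * a) * fst \<omega> * \<bar>snd \<omega>\<bar>)"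
  proof (rule Levy_uniqueness)
    interpret v: prob_space \<nu> using nu by (rule borel_probD)
    have [measurable_cong]: "sets \<nu> = sets borel" using nu by (rule borel_probD)
    show "real_distribution (distr \<nu> borel (\<lambda>x. v \<bullet> x))" by (rule v.real_distribution_distr) measurable
    show "real_distribution (distr ?Q borel (\<lambda>\<omega>. sqrt (quad S v) / sqrt (2 * a) * fst \<omega> * \<bar>snd \<omega>\<bar>))"
      by (rule real_distribution_distr) measurable
    show "char (distr \<nu> borel (\<lambda>x. v \<bullet> x)) = char (distr ?Q borel (\<lambda>\<omega>. sqrt (quad S v) / sqrt (2 * a) * fst \<omega> * \<bar>snd \<omega>\<bar>))"
      using char_projection[OF v prob_space_axioms iv dist m1[unfolded d_def] m2[unfolded d_def]]
      by (simp add: fun_eq_iff char_distr_inner[OF nu] ch)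
  qed
  then show "\<exists>(Q :: (real \<times> real) measure) B2 N.
           prob_space Q \<and> prob_space.indep_var Q borel B2 borel N \<and>
           distributed Q lborel N std_normal_density \<and>
           measure Q {\<omega> \<in> space Q. B2 \<omega> = 1}
             = 1/2 + sqrt (pi * a) * (v \<bullet> \<mu>) / (2 * p * sqrt (quad S v)) \<and>
           measure Q {\<omega> \<in> space Q. B2 \<omega> = - 1}
             = 1/2 - sqrt (pi * a) * (v \<bullet> \<mu>) / (2 * p * sqrt (quad S v)) \<and>
           distr \<nu> borel (\<lambda>x. v \<bullet> x)
             = distr Q borel (\<lambda>\<omega>. sqrt (quad S v) / sqrt (2 * a) * B2 \<omega> * \<bar>N \<omega>\<bar>)"
    using prob_space_axioms iv dist m1 m2 unfolding d_def by blast
qed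

text \<open>The origin, where the density is not prescribed, is a Lebesgue null set.\<close>

lemma density_property_unique:
  assumes "density_property a p \<mu> S \<nu>" "density_property a p \<mu> S \<nu>'"
  shows "\<nu> = \<nu>'"
proof -
  obtain f where f: "f \<in> borel_measurable borel" "\<And>x. x \<noteq> 0 \<Longrightarrow> f x = f_Z a p \<mu> S x" "\<nu> = density lborel (\<lambda>x. ennreal (f x))"
    using assms(1) unfolding density_property_def by blast
  obtain g where g: "g \<in> borel_measurable borel" "\<And>x. x \<noteq> 0 \<Longrightarrow> g x = f_Z a p \<mu> S x" "\<nu>' = density lborel (\<lambda>x. ennreal (g x))"
    using assms(2) unfolding density_property_def by blast
  show ?thesis unfolding f(3) g(3)
  proof (rule density_cong)
    show "AE x in lborel. ennreal (f x) = ennreal (g x)"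
      using AE_lborel_singleton[of "0 :: real^'n"] by eventually_elim (simp add: f g)
  qed (use f(1) g(1) in measurable)
qed

text \<open>In both parities of the dimension \<open>f_tilde\<close> carries the factor
  \<open>matrix_inv S *v \<mu>\<close> and vanishes with it.\<close>

lemma density_property_mu_0: "density_property a p 0 S (gauss_law a S)"
  unfolding density_property_def
  by (intro exI[of _ "gauss_dens a S"])
     (auto simp: less_imp_le[OF det_S_pos] gauss_law_def f_Z_def f_tilde_def Let_def gauss_dens_def matrix_vector_mult_0_right)

lemma zchar_mu_0: "zchar a p 0 S u = char_vec (gauss_law a S) u"
  by (simp add: zchar_def char_vec_gauss_law)

end

lemma normal_projection:
  fixes \<nu> :: "'v::euclidean_space measure"
  assumes \<nu>: "borel_prob \<nu>" and ch: "\<And>t. char_vec \<nu> (t *\<^sub>R v) = complex_of_real (exp (- (t * \<sigma>)\<^sup>2 / 2))"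
  shows "distr \<nu> borel (\<lambda>x. v \<bullet> x) = distr std_normal_distribution borel (\<lambda>y. \<sigma> * y)"
proof (rule Levy_uniqueness)
  interpret v: prob_space \<nu> using \<nu> by (rule borel_probD)
  interpret N: real_distribution std_normal_distribution by (rule real_dist_normal_dist)
  have [measurable_cong]: "sets \<nu> = sets borel" using \<nu> by (rule borel_probD)
  show "real_distribution (distr \<nu> borel (\<lambda>x. v \<bullet> x))" by (rule v.real_distribution_distr) measurable
  show "real_distribution (distr std_normal_distribution borel (\<lambda>y. \<sigma> * y))" by (rule N.real_distribution_distr) measurable
  show "char (distr \<nu> borel (\<lambda>x. v \<bullet> x)) = char (distr std_normal_distribution borel (\<lambda>y. \<sigma> * y))"
  proof
    fix t
    have "char (distr \<nu> borel (\<lambda>x. v \<bullet> x)) t = char_vec \<nu> (t *\<^sub>R v)"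
      using \<nu> by (rule char_distr_inner)
    moreover have "char (distr std_normal_distribution borel (\<lambda>y. \<sigma> * y)) t = char std_normal_distribution (t * \<sigma>)"
      unfolding char_def by (subst integral_distr) (auto simp: mult.assoc)
    ultimately show "char (distr \<nu> borel (\<lambda>x. v \<bullet> x)) t = char (distr std_normal_distribution borel (\<lambda>y. \<sigma> * y)) t"
      unfolding ch by (simp add: char_std_normal_distribution)
  qed
qed

text \<open>Averaging over \<open>y\<close> and \<open>- y\<close> turns the tilt by
  \<open>sgn\<close> into the weights \<open>1 + \<kappa>\<close> and \<open>1 - \<kappa>\<close> on
  the half-normal characteristic function at \<open>x\<close> and at \<open>- x\<close>.\<close>

lemma std_normal_tilted_char:
  "(CLINT y|std_normal_distribution. (1 + \<kappa> * sgn y) *\<^sub>R iexp (x * y))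
    = complex_of_real (exp (- x\<^sup>2 / 2)) * (1 + \<i> * complex_of_real (\<kappa> * x * sqrt (2 / pi) * gauss_ray (x\<^sup>2 / 2)))"
proof -
  interpret N: real_distribution std_normal_distribution by (rule real_dist_normal_dist)
  let ?f = "\<lambda>y. (1 + \<kappa> * sgn y) *\<^sub>R iexp (x * y)"
  have bd: "\<bar>1 + \<kappa> * sgn y\<bar> \<le> 1 + \<bar>\<kappa>\<bar>" for y by (auto simp: sgn_real_def)
  have i: "integrable std_normal_distribution (\<lambda>y. ?f (b * y))" for b
    by (rule N.integrable_const_bound[where B="1 + \<bar>\<kappa>\<bar>"]) (use bd in auto)
  have ih: "integrable std_normal_distribution (\<lambda>y. iexp (b * \<bar>y\<bar>))" for b
    by (rule N.integrable_const_bound[where B=1]) auto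
  have "2 * (CLINT y|std_normal_distribution. ?f y)
      = (CLINT y|std_normal_distribution. ?f y) + (CLINT y|std_normal_distribution. ?f (- y))"
    by (subst std_normal_reflect[of ?f]) auto
  also have "\<dots> = (CLINT y|std_normal_distribution. ?f y + ?f (- y))"
    using i[of 1] i[of "-1"] by (subst Bochner_Integration.integral_add) auto
  also have "\<dots> = (CLINT y|std_normal_distribution. (1 + \<kappa>) *\<^sub>R iexp (x * \<bar>y\<bar>) + (1 - \<kappa>) *\<^sub>R iexp ((- x) * \<bar>y\<bar>))"
  proof (rule integral_cong_AE)
    show "AE y in std_normal_distribution. ?f y + ?f (- y) = (1 + \<kappa>) *\<^sub>R iexp (x * \<bar>y\<bar>) + (1 - \<kappa>) *\<^sub>R iexp ((- x) * \<bar>y\<bar>)"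
      using std_normal_AE_neq_0 by eventually_elim (auto simp: sgn_real_def abs_if)
  qed measurable
  also have "\<dots> = (1 + \<kappa>) *\<^sub>R half_normal_char x + (1 - \<kappa>) *\<^sub>R half_normal_char (- x)"
    using ih[of x] ih[of "- x"]
    by (subst Bochner_Integration.integral_add) (simp_all only: integrable_scaleR_right integral_scaleR_right half_normal_char)
  also have "\<dots> = 2 * (complex_of_real ((1 + \<kappa>) / 2) * half_normal_char x + complex_of_real (1 - (1 + \<kappa>) / 2) * half_normal_char (- x))"
  proof -
    have "2 * (complex_of_real ((1 + \<kappa>) / 2) * A + complex_of_real ((1 - \<kappa>) / 2) * B) = (1 + \<kappa>) *\<^sub>R A + (1 - \<kappa>) *\<^sub>R B" for A B :: complex
      by (simp add: scaleR_conv_of_real distrib_left)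
    moreover have "1 - (1 + \<kappa>) / 2 = (1 - \<kappa>) / 2" by (simp add: field_simps)
    ultimately show ?thesis by (simp only:)
  qed
  also have "\<dots> = 2 * (complex_of_real (exp (- x\<^sup>2 / 2)) * (1 + \<i> * complex_of_real (\<kappa> * x * sqrt (2 / pi) * gauss_ray (x\<^sup>2 / 2))))"
  proof -
    have "2 * ((1 + \<kappa>) / 2) - 1 = \<kappa>" by (simp add: field_simps)
    then show ?thesis unfolding half_normal_char_mix by (simp only:)
  qed
  finally show ?thesis by simp
qed

context covariance
begin

lemma gauss_law_projection:
  "distr (gauss_law a S) borel (\<lambda>x. v \<bullet> x) = distr std_normal_distribution borel (\<lambda>y. (sqrt (quad S v) / sqrt (2 * a)) * y)"
proof (rule normal_projection[OF borel_prob_gauss_law])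
  fix t
  have "quad S (t *\<^sub>R v) / (4 * a) = (t * (sqrt (quad S v) / sqrt (2 * a)))\<^sup>2 / 2"
    using a_pos quad_nonneg[of v] by (simp add: quad_scale power_mult_distrib power_divide)
  then show "char_vec (gauss_law a S) (t *\<^sub>R v) = complex_of_real (exp (- (t * (sqrt (quad S v) / sqrt (2 * a)))\<^sup>2 / 2))"
    unfolding char_vec_gauss_law by simp
qed

text \<open>In dimension one the denominator of \<open>hfun\<close> and the linear factor of
  \<open>f_tilde\<close> combine to \<open>y / \<bar>y\<bar>\<close>. The density is thus the
  Gaussian one times \<open>1 + \<kappa> * sgn y\<close>, and the bound on \<open>\<mu>\<close>
  makes it nonnegative.\<close>

lemma z_law_one_dim:
  assumes dim: "CARD('n) = 1" and p: "0 < p" and bound: "\<And>v. sqrt (pi * a) * \<bar>v \<bullet> \<mu>\<bar> \<le> p * sqrt (quad S v)"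
  shows "\<exists>\<nu>. borel_prob \<nu> \<and> density_property a p \<mu> S \<nu> \<and> (\<forall>u. char_vec \<nu> u = zchar a p \<mu> S u)"
proof -
  obtain k where UNIV: "(UNIV :: 'n set) = {k}" using dim by (metis card_1_singletonE)
  have all_k: "i = k" for i using UNIV by auto
  define s where "s = S $ k $ k"
  have inner_eq: "x \<bullet> y = x $ k * y $ k" for x y :: "real^'n" by (simp add: inner_vec_def UNIV)
  have mult_eq: "(A *v x) $ i = A $ k $ k * x $ k" for A :: "real^'n^'n" and x i
    using all_k[of i] by (simp add: matrix_vector_mult_def UNIV)
  have quad_eq: "quad A x = A $ k $ k * (x $ k)\<^sup>2" for A :: "real^'n^'n" and x
    by (simp add: quad_def inner_eq mult_eq power2_eq_square)
  have neq0: "x $ k \<noteq> 0" if "x \<noteq> 0" for x :: "real^'n"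
    using that all_k by (metis vec_eq_iff zero_index)
  have s: "0 < s" using pos[of "axis k 1"] by (simp add: quad_eq s_def axis_def vec_eq_iff)
  have inv: "matrix_inv S $ k $ k = 1 / s"
  proof -
    have "S *v (matrix_inv S *v axis k 1) = axis k 1" by (rule matrix_inv_S_mult)
    then have "(S *v (matrix_inv S *v axis k 1)) $ k = 1" by (simp add: axis_def)
    then have "s * matrix_inv S $ k $ k = 1" by (simp add: mult_eq s_def axis_def)
    then show ?thesis using s by (simp add: field_simps)
  qed
  have det: "det S = s"
  proof (subst det_diagonal)
    show "S $ i $ j = 0" if "i \<noteq> j" for i j using that all_k[of i] all_k[of j] by simp
  qed (simp add: UNIV s_def)
  \<comment> \<open>The drift bound at the unit vector reads
    \<open>\<bar>\<kappa>\<bar> \<le> 1\<close>; the weights in (iii) for this vector are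
    \<open>(1 + \<kappa>) / 2\<close> and \<open>(1 - \<kappa>) / 2\<close>.\<close>
  define \<kappa> where "\<kappa> = sqrt (pi * a) * \<mu> $ k / (p * sqrt s)"
  have "sqrt (pi * a) * \<bar>\<mu> $ k\<bar> \<le> p * sqrt s"
    using bound[of "axis k 1"] by (simp add: inner_eq quad_eq s_def axis_def)
  then have kappa: "\<bar>\<kappa>\<bar> \<le> 1" using p s a_pos by (simp add: \<kappa>_def abs_mult divide_le_eq)
  define g where "g x = 1 + \<kappa> * sgn ((x :: real^'n) $ k)" for x
  have g_nonneg: "0 \<le> g x" for x using kappa by (auto simp: g_def sgn_real_def)
  have [measurable]: "g \<in> borel_measurable borel" unfolding g_def[abs_def] by measurable
  have f_Z_eq: "f_Z a p \<mu> S x = gauss_dens a S x * g x" if "x \<noteq> 0" for x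
  proof -
    define E where "E = exp (- (a * quad (matrix_inv S) x))"
    define y where "y = x $ k"
    have y: "y \<noteq> 0" using neq0[OF that] by (simp add: y_def)
    have q: "a * quad (matrix_inv S) x = a * y\<^sup>2 / s" by (simp add: quad_eq inv y_def)
    have h: "hfun (a * quad (matrix_inv S) x) = E * (sqrt s / (sqrt a * \<bar>y\<bar>))"
      unfolding hfun_def E_def[symmetric] unfolding q by (simp add: real_sqrt_mult real_sqrt_divide)
    have si: "(matrix_inv S *v \<mu>) \<bullet> x = \<mu> $ k * y / s" by (simp add: inner_eq mult_eq inv y_def)
    have pw: "a powr ((1 + 2) / 2) = a * sqrt a" "a powr (1/2) = sqrt a" "pi powr (1/2) = sqrt pi"
    proof -
      have "a powr ((1 + 2) / 2) = a powr (1 + 1/2)" by simp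
      also have "\<dots> = a * sqrt a" unfolding powr_add using a_pos by (simp add: powr_half_sqrt)
      finally show "a powr ((1 + 2) / 2) = a * sqrt a" .
    qed (use a_pos in \<open>auto simp: powr_half_sqrt\<close>)
    have "f_tilde a p \<mu> S x = a * sqrt a / (sqrt s * p) * (\<mu> $ k * y / s) * (E * (sqrt s / (sqrt a * \<bar>y\<bar>)))"
      using pw by (simp add: f_tilde_def Let_def dim det si hderiv_def h)
    also have "\<dots> = E * (a * \<mu> $ k / (p * s)) * (y / \<bar>y\<bar>)"
      using a_pos s by (simp add: field_simps)
    also have "y / \<bar>y\<bar> = sgn y" by (simp add: sgn_real_def y)
    also have "a * \<mu> $ k / (p * s) = sqrt a / (sqrt s * sqrt pi) * \<kappa>"
    proof -
      have "sqrt a / (sqrt s * sqrt pi) * \<kappa> = (sqrt a * sqrt a) * \<mu> $ k / (p * (sqrt s * sqrt s))"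
        using s by (simp only: \<kappa>_def real_sqrt_mult times_divide_times_eq mult_ac) simp
      then show ?thesis using a_pos s by simp
    qed
    finally have "f_tilde a p \<mu> S x = (sqrt a / (sqrt s * sqrt pi) * E) * (\<kappa> * sgn y)" by simp
    moreover have "gauss_dens a S x = sqrt a / (sqrt s * sqrt pi) * E"
      using pw by (simp add: gauss_dens_def dim det E_def)
    moreover have "f_Z a p \<mu> S x = gauss_dens a S x + f_tilde a p \<mu> S x"
      by (simp add: f_Z_def gauss_dens_def)
    ultimately show ?thesis by (simp add: g_def y_def distrib_left)
  qed
  define \<nu> where "\<nu> = density lborel (\<lambda>x. ennreal (gauss_dens a S x * g x))"
  interpret G: prob_space "gauss_law a S" using borel_prob_gauss_law by (rule borel_probD)
  have [measurable_cong]: "sets (gauss_law a S) = sets borel" using borel_prob_gauss_law by (rule borel_probD)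
  have \<nu>_eq: "\<nu> = density (gauss_law a S) (\<lambda>x. ennreal (g x))"
    unfolding \<nu>_def gauss_law_def
    by (subst density_density_eq) (auto simp: ennreal_mult gauss_dens_nonneg g_nonneg)
  define \<sigma> where "\<sigma> = sqrt s / sqrt (2 * a)"
  have \<sigma>: "0 < \<sigma>" using s a_pos by (simp add: \<sigma>_def)
  have int_g: "(CLINT x|gauss_law a S. g x *\<^sub>R iexp (u \<bullet> x)) = zchar a p \<mu> S u" for u
  proof -
    define t where "t = u $ k"
    let ?h = "\<lambda>y. (1 + \<kappa> * sgn y) *\<^sub>R iexp (t * y)"
    have "(CLINT x|gauss_law a S. g x *\<^sub>R iexp (u \<bullet> x)) = (CLINT y|distr (gauss_law a S) borel (\<lambda>x. axis k 1 \<bullet> x). ?h y)"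
      by (subst integral_distr) (auto simp: g_def inner_eq t_def axis_def)
    also have "\<dots> = (CLINT y|distr std_normal_distribution borel (\<lambda>y. \<sigma> * y). ?h y)"
    proof -
      have "sqrt (quad S (axis k 1)) / sqrt (2 * a) = \<sigma>" by (simp add: quad_eq s_def[symmetric] \<sigma>_def axis_def)
      then show ?thesis unfolding gauss_law_projection by (simp only:)
    qed
    also have "\<dots> = (CLINT y|std_normal_distribution. (1 + \<kappa> * sgn y) *\<^sub>R iexp ((t * \<sigma>) * y))"
      using \<sigma> by (subst integral_distr) (auto simp: sgn_mult mult.assoc)
    also have "\<dots> = complex_of_real (exp (- (t * \<sigma>)\<^sup>2 / 2)) * (1 + \<i> * complex_of_real (\<kappa> * (t * \<sigma>) * sqrt (2 / pi) * gauss_ray ((t * \<sigma>)\<^sup>2 / 2)))"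
      by (rule std_normal_tilted_char)
    also have "(t * \<sigma>)\<^sup>2 / 2 = quad S u / (4 * a)"
      using s a_pos by (simp add: quad_eq s_def[symmetric] t_def[symmetric] \<sigma>_def power_mult_distrib power_divide)
    also have "- (t * \<sigma>)\<^sup>2 / 2 = - (quad S u / (4 * a))"
      using s a_pos by (simp add: quad_eq s_def[symmetric] t_def[symmetric] \<sigma>_def power_mult_distrib power_divide)
    also have "\<kappa> * (t * \<sigma>) * sqrt (2 / pi) = (u \<bullet> \<mu>) / p"
    proof -
      have "sqrt (pi * a) * sqrt (2 / pi) = sqrt (2 * a)" by (simp add: real_sqrt_mult[symmetric])
      then have "\<kappa> * (t * \<sigma>) * sqrt (2 / pi) = sqrt (2 * a) * (\<mu> $ k * t) * (sqrt s / sqrt s) / (p * sqrt (2 * a))"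
        by (simp add: \<kappa>_def \<sigma>_def field_simps)
      then show ?thesis using s a_pos by (simp add: inner_eq t_def mult.commute)
    qed
    finally show ?thesis by (simp add: zchar_def)
  qed
  have "integrable (gauss_law a S) g"
    by (rule G.integrable_const_bound[where B=2]) (use kappa in \<open>auto simp: g_def sgn_real_def\<close>)
  then have "(\<integral>\<^sup>+x. ennreal (g x) \<partial>gauss_law a S) = ennreal (\<integral>x. g x \<partial>gauss_law a S)"
    by (rule nn_integral_eq_integral) (simp add: g_nonneg)
  \<comment> \<open>The total mass is read off from the characteristic function at 0.\<close>
  also have "complex_of_real (\<integral>x. g x \<partial>gauss_law a S) = zchar a p \<mu> S 0"
    by (subst int_g[of 0, symmetric]) (simp add: scaleR_conv_of_real)
  then have "(\<integral>x. g x \<partial>gauss_law a S) = 1" by (simp add: zchar_def quad_eq)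
  finally have "emeasure \<nu> (space \<nu>) = 1"
    unfolding \<nu>_eq by (simp add: emeasure_density cong: nn_integral_cong)
  then have \<nu>: "borel_prob \<nu>" unfolding borel_prob_def by (auto intro: prob_spaceI simp: \<nu>_def)
  have "density_property a p \<mu> S \<nu>"
    unfolding density_property_def
  proof (intro exI[of _ "\<lambda>x. if x = 0 then 0 else gauss_dens a S x * g x"] conjI allI impI)
    show "\<nu> = density lborel (\<lambda>x. ennreal (if x = 0 then 0 else gauss_dens a S x * g x))"
      unfolding \<nu>_def
    proof (rule density_cong)
      show "AE x in lborel. ennreal (gauss_dens a S x * g x) = ennreal (if x = 0 then 0 else gauss_dens a S x * g x)"
        using AE_lborel_singleton[of "0 :: real^'n"] by eventually_elim simp
    qed measurable
  qed (simp_all add: f_Z_eq gauss_dens_nonneg g_nonneg)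
  moreover have "char_vec \<nu> u = zchar a p \<mu> S u" for u
    unfolding char_vec_def \<nu>_eq int_g[symmetric]
    by (subst integral_density) (auto simp: g_nonneg)
  ultimately show ?thesis using \<nu> by blast
qed

text \<open>One law is constructed and each of the three properties determines it: (i) and (iii)
  through the characteristic function, (ii) through the density off a null set.\<close>

lemma z_law_exists:
  assumes p: "0 < p" and bound: "\<And>v. sqrt (pi * a) * \<bar>v \<bullet> \<mu>\<bar> \<le> p * sqrt (quad S v)"
    and dim: "CARD('n) \<noteq> 1 \<Longrightarrow> \<mu> = 0"
  obtains \<zeta> where "borel_prob \<zeta>" "\<And>u. char_vec \<zeta> u = zchar a p \<mu> S u" "absolutely_continuous lborel \<zeta>"
    "\<And>\<nu>. borel_prob \<nu> \<Longrightarrow> char_property a p \<mu> S \<nu> \<longleftrightarrow> \<nu> = \<zeta>"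
    "\<And>\<nu>. borel_prob \<nu> \<Longrightarrow> density_property a p \<mu> S \<nu> \<longleftrightarrow> \<nu> = \<zeta>"
    "\<And>\<nu>. borel_prob \<nu> \<Longrightarrow> projection_property a p \<mu> S \<nu> \<longleftrightarrow> \<nu> = \<zeta>"
proof -
  have "\<exists>\<nu>. borel_prob \<nu> \<and> density_property a p \<mu> S \<nu> \<and> (\<forall>u. char_vec \<nu> u = zchar a p \<mu> S u)"
  proof (cases "CARD('n) = 1")
    case True
    show ?thesis by (rule z_law_one_dim[OF True p bound])
  next
    case False
    then show ?thesis
      using dim density_property_mu_0[of p] borel_prob_gauss_law zchar_mu_0[of p] by auto
  qed
  then obtain \<zeta> where \<zeta>: "borel_prob \<zeta>" "density_property a p \<mu> S \<zeta>" "\<And>u. char_vec \<zeta> u = zchar a p \<mu> S u" by blast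
  show ?thesis
  proof
    show "absolutely_continuous lborel \<zeta>"
      using \<zeta>(2) unfolding density_property_def by (auto intro!: absolutely_continuousI_density)
    have uniq: "\<nu> = \<zeta>" if "borel_prob \<nu>" "\<And>u. char_vec \<nu> u = zchar a p \<mu> S u" for \<nu>
      using that \<zeta> by (intro char_vec_uniqueness) auto
    show "char_property a p \<mu> S \<nu> \<longleftrightarrow> \<nu> = \<zeta>" if \<nu>: "borel_prob \<nu>" for \<nu>
      unfolding char_property_iff[OF \<nu>] using uniq[OF \<nu>] \<zeta>(3) by blast
    show "density_property a p \<mu> S \<nu> \<longleftrightarrow> \<nu> = \<zeta>" if "borel_prob \<nu>" for \<nu>
      using density_property_unique \<zeta>(2) by blast
    show "projection_property a p \<mu> S \<nu> \<longleftrightarrow> \<nu> = \<zeta>" if \<nu>: "borel_prob \<nu>" for \<nu>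
      using uniq[OF \<nu>] projection_property_imp_char[OF \<nu>] projection_propertyI[OF \<zeta>(1,3) p bound] by blast
  qed (use \<zeta> in auto)
qed

end

section \<open>Estimates for the ray integral and Stein's identity\<close>

lemma integrable_exp_sq_unit_unif: "integrable unit_unif (\<lambda>t. exp (c * t\<^sup>2))"
proof -
  interpret prob_space unit_unif by (rule prob_space_unit_unif)
  show ?thesis
  proof (rule integrable_const_bound[where B="exp \<bar>c\<bar>"])
    show "AE t in unit_unif. norm (exp (c * t\<^sup>2)) \<le> exp \<bar>c\<bar>"
      using AE_unit_unif
    proof eventually_elim
      case (elim t)
      then have "t\<^sup>2 \<le> 1" by (intro power_le_one) auto
      then have "\<bar>c\<bar> * t\<^sup>2 \<le> \<bar>c\<bar>" by (intro mult_left_le) auto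
      moreover have "c * t\<^sup>2 \<le> \<bar>c\<bar> * t\<^sup>2" by (intro mult_right_mono) auto
      ultimately show ?case by simp
    qed
  qed measurable
qed

lemma gauss_ray_ge_1:
  assumes "0 \<le> c"
  shows "1 \<le> gauss_ray c"
proof -
  interpret prob_space unit_unif by (rule prob_space_unit_unif)
  have "(\<integral>t. 1 \<partial>unit_unif) \<le> gauss_ray c"
    unfolding gauss_ray_def
    by (rule integral_mono[OF _ integrable_exp_sq_unit_unif]) (use assms in auto)
  then show ?thesis by (simp add: prob_space)
qed

text \<open>Near \<open>t = 1\<close> the two exponents almost cancel, so the product decays in
  \<open>R\<close> no faster than \<open>R\<close> to the power -2, whereas the Gaussian factor
  alone decays exponentially. This is the trace that a drift leaves at high frequencies.\<close>

lemma gauss_ray_lower: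
  assumes c: "0 \<le> c" and R: "1 \<le> R"
  shows "exp (- (2 * c)) / R\<^sup>2 \<le> exp (- (R\<^sup>2 * c)) * gauss_ray (R\<^sup>2 * c)"
proof -
  interpret prob_space unit_unif by (rule prob_space_unit_unif)
  \<comment> \<open>On the interval of length \<open>d\<close> below 1 the exponent
    \<open>R^2 * c * (1 - t^2)\<close> is at most \<open>2 * c\<close>.\<close>
  define d where "d = 1 / R\<^sup>2"
  have R2: "1 \<le> R\<^sup>2" using R by (rule one_le_power)
  then have d: "0 \<le> d" "d \<le> 1" "R\<^sup>2 * d = 1" by (auto simp: d_def divide_le_eq)
  have "exp (- (2 * c)) * d = (\<integral>t. exp (- (2 * c)) * indicator {1 - d..1} t \<partial>unit_unif)"
  proof -
    have "(\<integral>t. indicator {1 - d..1} t \<partial>unit_unif) = (\<integral>t. indicator {0..1} t *\<^sub>R indicator {1 - d..1} t \<partial>lborel :: real)"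
      by (rule integral_unit_unif) measurable
    also have "\<dots> = (\<integral>t. indicator {1 - d..1} t \<partial>lborel)"
      using d by (intro Bochner_Integration.integral_cong) (auto simp: indicator_def)
    also have "\<dots> = d" using d by simp
    finally show ?thesis by (simp only: integral_mult_right_zero)
  qed
  also have "\<dots> \<le> (\<integral>t. exp (- (R\<^sup>2 * c)) * exp (R\<^sup>2 * c * t\<^sup>2) \<partial>unit_unif)"
  proof (rule integral_mono)
    show "integrable unit_unif (\<lambda>t. exp (- (2 * c)) * indicator {1 - d..1} t)"
      by (rule integrable_const_bound[where B="exp (- (2 * c))"]) (auto simp: indicator_def)
    fix t :: real
    show "exp (- (2 * c)) * indicator {1 - d..1} t \<le> exp (- (R\<^sup>2 * c)) * exp (R\<^sup>2 * c * t\<^sup>2)"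
    proof (cases "t \<in> {1 - d..1}")
      case True
      then have "(1 - d)\<^sup>2 \<le> t\<^sup>2" using d by (intro power_mono) auto
      then have "1 - 2 * d \<le> t\<^sup>2" by (simp add: power2_eq_square algebra_simps) (smt (verit) zero_le_square)
      then have "R\<^sup>2 * (1 - t\<^sup>2) \<le> R\<^sup>2 * (2 * d)" by (intro mult_left_mono) auto
      also have "\<dots> = 2" using d(3) by simp
      finally have "c * (R\<^sup>2 * (1 - t\<^sup>2)) \<le> c * 2" using c by (rule mult_left_mono)
      then have "- (2 * c) \<le> - (R\<^sup>2 * c) + R\<^sup>2 * c * t\<^sup>2" by (simp add: algebra_simps)
      then show ?thesis using True by (simp flip: exp_add)
    qed simp
  qed (intro integrable_mult_right integrable_exp_sq_unit_unif)
  also have "\<dots> = exp (- (R\<^sup>2 * c)) * gauss_ray (R\<^sup>2 * c)" by (simp add: gauss_ray_def)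
  finally show ?thesis by (simp add: d_def)
qed

lemma std_gauss_projection:
  fixes v :: "'v::euclidean_space"
  shows "distr std_gauss borel (\<lambda>x. v \<bullet> x) = distr std_normal_distribution borel (\<lambda>y. norm v * y)"
  by (rule normal_projection[OF borel_prob_std_gauss])
     (simp add: char_vec_std_gauss power_mult_distrib)

lemma integrable_std_gauss_inner:
  fixes v :: "'v::euclidean_space"
  shows "integrable std_gauss (\<lambda>x. v \<bullet> x)"
proof -
  have "integrable (distr std_gauss borel (\<lambda>x. v \<bullet> x)) (\<lambda>y. y)"
    unfolding std_gauss_projection by (subst integrable_distr_eq) (auto intro: integrable_std_normal_moment1)
  then show ?thesis by (subst (asm) integrable_distr_eq) auto
qed

lemma AE_std_gauss_inner_neq_0:
  fixes v :: "'v::euclidean_space"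
  assumes "v \<noteq> 0"
  shows "AE x in std_gauss. v \<bullet> x \<noteq> 0"
proof -
  have "AE y in distr std_gauss borel (\<lambda>x. v \<bullet> x). y \<noteq> 0"
    unfolding std_gauss_projection by (subst AE_distr_iff) (use std_normal_AE_neq_0 assms in auto)
  then show ?thesis by (subst (asm) AE_distr_iff) auto
qed

text \<open>The derivative at \<open>t = 0\<close> of the characteristic function at
  \<open>z + t v\<close>, computed once under the integral and once from its closed form.\<close>

lemma std_gauss_stein:
  fixes v z :: "'v::euclidean_space"
  shows "(CLINT \<eta>|std_gauss. (v \<bullet> \<eta>) *\<^sub>R iexp (z \<bullet> \<eta>)) = \<i> * complex_of_real ((v \<bullet> z) * exp (- (norm z)\<^sup>2 / 2))"
proof -
  define h where "h n = 1 / real (Suc n)" for n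
  have h: "0 < h n" for n by (simp add: h_def)
  have h_lim: "h \<longlonglongrightarrow> 0" unfolding h_def[abs_def] by (rule LIMSEQ_Suc[OF lim_1_over_n])
  let ?f = "\<lambda>n \<eta>. (1 / h n) *\<^sub>R (iexp ((z + h n *\<^sub>R v) \<bullet> \<eta>) - iexp (z \<bullet> \<eta>))"
  let ?g = "\<lambda>\<eta>. \<i> * ((v \<bullet> \<eta>) *\<^sub>R iexp (z \<bullet> \<eta>))"
  have split: "?f n \<eta> = iexp (z \<bullet> \<eta>) * ((1 / h n) *\<^sub>R (iexp (h n * (v \<bullet> \<eta>)) - 1))" for n \<eta>
    by (simp add: inner_add_left exp_add algebra_simps scaleR_conv_of_real)
  have "(\<lambda>n. CLINT \<eta>|std_gauss. ?f n \<eta>) \<longlonglongrightarrow> (CLINT \<eta>|std_gauss. ?g \<eta>)"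
  proof (rule integral_dominated_convergence[where w="\<lambda>\<eta>. \<bar>v \<bullet> \<eta>\<bar>"])
    show "AE \<eta> in std_gauss. norm (?f n \<eta>) \<le> \<bar>v \<bullet> \<eta>\<bar>" for n
    proof (rule AE_I2)
      fix \<eta> :: 'v
      have "norm (iexp (h n * (v \<bullet> \<eta>)) - 1) \<le> \<bar>h n * (v \<bullet> \<eta>)\<bar>" by (rule norm_iexp_taylor1)
      then show "norm (?f n \<eta>) \<le> \<bar>v \<bullet> \<eta>\<bar>"
        unfolding split norm_mult norm_scaleR norm_exp_i_times
        using h[of n] by (simp add: abs_mult field_simps)
    qed
    show "AE \<eta> in std_gauss. (\<lambda>n. ?f n \<eta>) \<longlonglongrightarrow> ?g \<eta>"
    proof (rule AE_I2)
      fix \<eta> :: 'v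
      define s where "s = v \<bullet> \<eta>"
      have "(\<lambda>n. (1 / h n) *\<^sub>R (iexp (h n * s) - 1) - \<i> * s) \<longlonglongrightarrow> 0"
      proof (rule Lim_null_comparison)
        show "\<forall>\<^sub>F n in sequentially. norm ((1 / h n) *\<^sub>R (iexp (h n * s) - 1) - \<i> * s) \<le> h n * s\<^sup>2"
        proof (rule always_eventually, rule allI)
          fix n
          have "(1 / h n) *\<^sub>R (iexp (h n * s) - 1) - \<i> * s = (1 / h n) *\<^sub>R (iexp (h n * s) - 1 - \<i> * (h n * s))"
            using h[of n] by (simp add: algebra_simps scaleR_conv_of_real)
          then have "norm ((1 / h n) *\<^sub>R (iexp (h n * s) - 1) - \<i> * s) = (1 / h n) * norm (iexp (h n * s) - 1 - \<i> * (h n * s))"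
            using h[of n] by (simp only: norm_scaleR) simp
          also have "norm (iexp (h n * s) - 1 - \<i> * (h n * s)) \<le> (h n * s)\<^sup>2"
            by (rule order_trans[OF norm_iexp_taylor2]) simp
          finally show "norm ((1 / h n) *\<^sub>R (iexp (h n * s) - 1) - \<i> * s) \<le> h n * s\<^sup>2"
            using h[of n] by (simp add: power2_eq_square field_simps)
        qed
        show "(\<lambda>n. h n * s\<^sup>2) \<longlonglongrightarrow> 0" using tendsto_mult[OF h_lim tendsto_const] by simp
      qed
      then have "(\<lambda>n. (1 / h n) *\<^sub>R (iexp (h n * s) - 1)) \<longlonglongrightarrow> \<i> * s" by (simp add: LIM_zero_iff)
      from tendsto_mult[OF tendsto_const[of "iexp (z \<bullet> \<eta>)"] this]
      show "(\<lambda>n. ?f n \<eta>) \<longlonglongrightarrow> ?g \<eta>" unfolding split s_def by (simp add: scaleR_conv_of_real mult_ac)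
    qed
  qed (auto intro: integrable_abs integrable_std_gauss_inner)
  moreover have "(\<lambda>n. CLINT \<eta>|std_gauss. ?f n \<eta>) \<longlonglongrightarrow> complex_of_real (- (v \<bullet> z) * exp (- (norm z)\<^sup>2 / 2))"
  proof -
    define g where "g t = exp (- ((norm z)\<^sup>2 + 2 * t * (v \<bullet> z) + t\<^sup>2 * (norm v)\<^sup>2) / 2)" for t :: real
    have phi: "char_vec std_gauss (z + t *\<^sub>R v) = complex_of_real (g t)" for t
    proof -
      have "(norm (z + t *\<^sub>R v))\<^sup>2 = (norm z)\<^sup>2 + 2 * t * (v \<bullet> z) + t\<^sup>2 * (norm v)\<^sup>2"
        unfolding power2_norm_eq_inner by (simp add: inner_add_left inner_add_right inner_commute power2_eq_square algebra_simps)
      then show ?thesis by (simp add: char_vec_std_gauss g_def)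
    qed
    have "(g has_real_derivative - (v \<bullet> z) * exp (- (norm z)\<^sup>2 / 2)) (at 0)"
      unfolding g_def[abs_def] by (auto intro!: derivative_eq_intros)
    then have "(\<lambda>t. (g t - g 0) / t) \<midarrow>0\<rightarrow> - (v \<bullet> z) * exp (- (norm z)\<^sup>2 / 2)"
      by (simp add: DERIV_def)
    then have "(\<lambda>n. (g (h n) - g 0) / h n) \<longlonglongrightarrow> - (v \<bullet> z) * exp (- (norm z)\<^sup>2 / 2)"
      by (rule filterlim_compose) (use h h_lim in \<open>auto simp: filterlim_at less_imp_neq[symmetric]\<close>)
    moreover have "(CLINT \<eta>|std_gauss. ?f n \<eta>) = complex_of_real ((g (h n) - g 0) / h n)" for n
    proof -
      have "(CLINT \<eta>|std_gauss. ?f n \<eta>) = (1 / h n) *\<^sub>R (char_vec std_gauss (z + h n *\<^sub>R v) - char_vec std_gauss z)"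
        unfolding char_vec_def
        by (simp only: integral_scaleR_right Bochner_Integration.integral_diff[OF integrable_iexp_inner integrable_iexp_inner] borel_prob_std_gauss)
      then show ?thesis using phi[of "h n"] phi[of 0] by (simp add: scaleR_conv_of_real)
    qed
    ultimately show ?thesis by (simp only: tendsto_of_real_iff)
  qed
  ultimately have "(CLINT \<eta>|std_gauss. ?g \<eta>) = complex_of_real (- (v \<bullet> z) * exp (- (norm z)\<^sup>2 / 2))"
    by (rule LIMSEQ_unique)
  then have "\<i> * (CLINT \<eta>|std_gauss. (v \<bullet> \<eta>) *\<^sub>R iexp (z \<bullet> \<eta>)) = complex_of_real (- (v \<bullet> z) * exp (- (norm z)\<^sup>2 / 2))"
    by (simp only: integral_mult_right_zero)
  then have "(- \<i>) * (\<i> * (CLINT \<eta>|std_gauss. (v \<bullet> \<eta>) *\<^sub>R iexp (z \<bullet> \<eta>))) = (- \<i>) * complex_of_real (- (v \<bullet> z) * exp (- (norm z)\<^sup>2 / 2))"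
    by (simp only:)
  then show ?thesis by (simp add: mult.assoc[symmetric] del: integral_scaleR_left)
qed

lemma Im_char_vec:
  fixes \<nu> :: "'v::euclidean_space measure"
  assumes "borel_prob \<nu>"
  shows "Im (char_vec \<nu> u) = (\<integral>x. sin (u \<bullet> x) \<partial>\<nu>)"
  unfolding char_vec_def using integral_Im[OF integrable_iexp_inner[OF assms, of u]] by (simp add: Im_exp)

lemma limit_char_parts:
  "Re (limit_char q c m) = q + (1 - q) * exp (- c)" "Im (limit_char q c m) = m * (exp (- c) * gauss_ray c)"
  using exp_of_real[of "- c", where ?'a=complex] by (simp_all add: limit_char_def)

section \<open>The limit law\<close>

text \<open>The limit is given as a function only; that it is the characteristic function of a law
  has to be derived.\<close>

locale char_limit = covariance S a for S :: "real^'n^'n" and a :: real +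
  fixes P :: "nat \<Rightarrow> (real^'n) measure" and p :: real and \<mu> :: "real^'n"
  assumes P: "\<And>m. borel_prob (P m)" and p: "0 \<le> p" "p \<le> 1"
    and lim: "\<And>u. (\<lambda>m. char_vec (P m) u) \<longlonglongrightarrow> limit_char (1 - p) (quad S u / (4 * a)) (u \<bullet> \<mu>)"
begin

lemma sets_P [measurable_cong]: "sets (P m) = sets borel"
  using P by (rule borel_probD)

lemma Im_limit: "(\<lambda>m. Im (char_vec (P m) u)) \<longlonglongrightarrow> (u \<bullet> \<mu>) * (exp (- (quad S u / (4 * a))) * gauss_ray (quad S u / (4 * a)))"
  using tendsto_Im[OF lim[of u]] by (simp add: limit_char_parts)

text \<open>Even functions see only the symmetrised laws, whose characteristic functions are the
  real parts. Their limit belongs to a Gaussian law mixed with a point mass at 0, whatever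
  \<open>\<mu>\<close> is, so the continuity theorem applies before a law for the full limit is
  known.\<close>

lemma tendsto_even_integral:
  fixes f :: "real^'n \<Rightarrow> real"
  assumes cont: "continuous_on UNIV f" and bd: "\<And>x. \<bar>f x\<bar> \<le> C" and even: "\<And>x. f (- x) = f x"
  shows "(\<lambda>m. \<integral>x. f x \<partial>P m) \<longlonglongrightarrow> p * (\<integral>x. f x \<partial>gauss_law a S) + (1 - p) * f 0"
proof -
  have f[measurable]: "f \<in> borel_measurable borel" using cont by (rule borel_measurable_continuous_onI)
  have half: "(0::real) \<le> 1/2" "1/2 \<le> (1::real)" by auto
  have "weak_conv_law (\<lambda>m. scaled_mix (1/2) 1 (- 1) (P m)) (scaled_mix p 1 0 (gauss_law a S))"
  proof (rule char_vec_continuity)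
    fix u
    let ?c = "quad S u / (4 * a)"
    have "(\<lambda>m. complex_of_real (Re (char_vec (P m) u))) \<longlonglongrightarrow> complex_of_real (Re (limit_char (1 - p) ?c (u \<bullet> \<mu>)))"
      by (intro tendsto_of_real tendsto_Re lim)
    moreover have "char_vec (scaled_mix (1/2) 1 (- 1) (P m)) u = complex_of_real (Re (char_vec (P m) u))" for m
      by (subst char_vec_scaled_mix[OF P half]) (auto simp: char_vec_uminus complex_eq_iff)
    moreover have "char_vec (scaled_mix p 1 0 (gauss_law a S)) u = complex_of_real (Re (limit_char (1 - p) ?c (u \<bullet> \<mu>)))"
      by (subst char_vec_scaled_mix[OF borel_prob_gauss_law p])
         (simp add: char_vec_gauss_law quad_def[of S 0] limit_char_parts scaleR_conv_of_real)
    ultimately show "(\<lambda>m. char_vec (scaled_mix (1/2) 1 (- 1) (P m)) u) \<longlonglongrightarrow> char_vec (scaled_mix p 1 0 (gauss_law a S)) u"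
      by simp
  qed (intro borel_prob_scaled_mix P half borel_prob_gauss_law p)+
  moreover have "bounded (range f)" using bd by (auto simp: bounded_iff)
  ultimately have "(\<lambda>m. \<integral>x. f x \<partial>scaled_mix (1/2) 1 (- 1) (P m)) \<longlonglongrightarrow> (\<integral>x. f x \<partial>scaled_mix p 1 0 (gauss_law a S))"
    using cont unfolding weak_conv_law_def by blast
  moreover have "(\<integral>x. f x \<partial>scaled_mix (1/2) 1 (- 1) (P m)) = (\<integral>x. f x \<partial>P m)" for m
    by (subst integral_scaled_mix[OF P half f, where C=C]) (auto simp: bd even)
  moreover have "(\<integral>x. f x \<partial>scaled_mix p 1 0 (gauss_law a S)) = p * (\<integral>x. f x \<partial>gauss_law a S) + (1 - p) * f 0"
    using borel_probD(1)[OF borel_prob_gauss_law, THEN prob_space.prob_space]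
    by (subst integral_scaled_mix[OF borel_prob_gauss_law p f, where C=C]) (auto simp: bd)
  ultimately show ?thesis by simp
qed

text \<open>The imaginary part of the characteristic function at \<open>t v\<close> is at most the
  mean of \<open>\<bar>sin (t * (v \<bullet> y))\<bar>\<close>, an even function whose limit is
  explicit. Division by \<open>t\<close> and the limit at 0 compare the drift with the mean absolute
  value of a normal variable.\<close>

lemma drift_bound: "sqrt (pi * a) * \<bar>v \<bullet> \<mu>\<bar> \<le> p * sqrt (quad S v)"
proof -
  define c where "c = quad S v / (4 * a)"
  define \<sigma> where "\<sigma> = sqrt (quad S v) / sqrt (2 * a)"
  have c0: "0 \<le> c" using quad_nonneg a_pos by (simp add: c_def)
  have \<sigma>0: "0 \<le> \<sigma>" using quad_nonneg a_pos by (simp add: \<sigma>_def)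
  have step: "\<bar>v \<bullet> \<mu>\<bar> * exp (- (t\<^sup>2 * c)) \<le> p * (\<sigma> * sqrt (2 / pi))" if t: "0 < t" for t
  proof -
    let ?f = "\<lambda>y. \<bar>sin (t * (v \<bullet> y))\<bar>"
    have "\<bar>Im (char_vec (P m) (t *\<^sub>R v))\<bar> \<le> (\<integral>y. ?f y \<partial>P m)" for m
      unfolding Im_char_vec[OF P] using integral_norm_bound[of "P m" "\<lambda>y. sin (t * (v \<bullet> y))"] by simp
    then have "\<bar>(t *\<^sub>R v) \<bullet> \<mu> * (exp (- (quad S (t *\<^sub>R v) / (4 * a))) * gauss_ray (quad S (t *\<^sub>R v) / (4 * a)))\<bar>
        \<le> p * (\<integral>y. ?f y \<partial>gauss_law a S) + (1 - p) * ?f 0"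
      by (intro LIMSEQ_le[OF tendsto_rabs[OF Im_limit] tendsto_even_integral[where C=1]]) (auto intro!: continuous_intros)
    also have "quad S (t *\<^sub>R v) / (4 * a) = t\<^sup>2 * c" by (simp add: quad_scale c_def)
    also have "p * (\<integral>y. ?f y \<partial>gauss_law a S) + (1 - p) * ?f 0 \<le> p * (t * (\<sigma> * sqrt (2 / pi)))"
    proof -
      have [measurable_cong]: "sets (gauss_law a S) = sets borel" using borel_prob_gauss_law by (rule borel_probD)
      have "(\<integral>y. ?f y \<partial>gauss_law a S) = (\<integral>s. \<bar>sin (t * s)\<bar> \<partial>distr (gauss_law a S) borel (\<lambda>y. v \<bullet> y))"
        by (subst integral_distr) auto
      also have "\<dots> = (\<integral>y. \<bar>sin (t * (\<sigma> * y))\<bar> \<partial>std_normal_distribution)"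
        unfolding gauss_law_projection \<sigma>_def[symmetric] by (subst integral_distr) auto
      also have "\<dots> \<le> (\<integral>y. (t * \<sigma>) * \<bar>y\<bar> \<partial>std_normal_distribution)"
      proof (rule integral_mono)
        interpret N: real_distribution std_normal_distribution by (rule real_dist_normal_dist)
        show "integrable std_normal_distribution (\<lambda>y. \<bar>sin (t * (\<sigma> * y))\<bar>)"
          by (rule N.integrable_const_bound[where B=1]) auto
        show "integrable std_normal_distribution (\<lambda>y. (t * \<sigma>) * \<bar>y\<bar>)"
          by (intro integrable_mult_right integrable_std_normal_moment1)
        show "\<bar>sin (t * (\<sigma> * y))\<bar> \<le> t * \<sigma> * \<bar>y\<bar>" for y
          using abs_sin_x_le_abs_x[of "t * (\<sigma> * y)"] t \<sigma>0 by (simp add: abs_mult mult.assoc)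
      qed
      also have "\<dots> = t * (\<sigma> * sqrt (2 / pi))"
        using integral_std_normal_moment_abs_odd[of 0] by (simp add: integral_density)
      finally show ?thesis using mult_left_mono[OF _ p(1)] by simp
    qed
    finally have "t * (\<bar>v \<bullet> \<mu>\<bar> * (exp (- (t\<^sup>2 * c)) * gauss_ray (t\<^sup>2 * c))) \<le> t * (p * (\<sigma> * sqrt (2 / pi)))"
      using t gauss_ray_ge_1[of "t\<^sup>2 * c"] c0 by (simp add: abs_mult mult_ac)
    then have "\<bar>v \<bullet> \<mu>\<bar> * (exp (- (t\<^sup>2 * c)) * gauss_ray (t\<^sup>2 * c)) \<le> p * (\<sigma> * sqrt (2 / pi))"
      using t by (simp only: mult_le_cancel_left_pos)
    moreover have "exp (- (t\<^sup>2 * c)) * 1 \<le> exp (- (t\<^sup>2 * c)) * gauss_ray (t\<^sup>2 * c)"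
      using gauss_ray_ge_1[of "t\<^sup>2 * c"] c0 by (intro mult_left_mono) auto
    then have "\<bar>v \<bullet> \<mu>\<bar> * (exp (- (t\<^sup>2 * c)) * 1) \<le> \<bar>v \<bullet> \<mu>\<bar> * (exp (- (t\<^sup>2 * c)) * gauss_ray (t\<^sup>2 * c))"
      by (intro mult_left_mono) auto
    ultimately show ?thesis by simp
  qed
  have "(\<lambda>n. \<bar>v \<bullet> \<mu>\<bar> * exp (- ((1 / real (Suc n))\<^sup>2 * c))) \<longlonglongrightarrow> \<bar>v \<bullet> \<mu>\<bar> * exp (- (0\<^sup>2 * c))"
    by (intro tendsto_intros LIMSEQ_Suc[OF lim_1_over_n])
  then have "\<bar>v \<bullet> \<mu>\<bar> * exp (- (0\<^sup>2 * c)) \<le> p * (\<sigma> * sqrt (2 / pi))"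
    by (rule LIMSEQ_le_const2) (use step in auto)
  then have "sqrt (pi * a) * \<bar>v \<bullet> \<mu>\<bar> \<le> sqrt (pi * a) * (p * (\<sigma> * sqrt (2 / pi)))"
    using a_pos by (intro mult_left_mono) auto
  also have "\<dots> = p * (\<sigma> * (sqrt (pi * a) * sqrt (2 / pi)))" by (simp only: mult_ac)
  also have "sqrt (pi * a) * sqrt (2 / pi) = sqrt (2 * a)" by (simp add: real_sqrt_mult[symmetric])
  finally show ?thesis using a_pos by (simp add: \<sigma>_def)
qed

section \<open>The drift in dimension at least two\<close>

definition c0 :: "real^'n \<Rightarrow> real" where "c0 u = quad S u / (4 * a)"

lemma c0_nonneg: "0 \<le> c0 u" using quad_nonneg a_pos by (simp add: c0_def)

lemma c0_scale: "c0 (t *\<^sub>R u) = t\<^sup>2 * c0 u" by (simp add: c0_def quad_scale)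

lemma c0_measurable [measurable]: "c0 \<in> borel_measurable borel"
  unfolding c0_def[abs_def] quad_def[abs_def] by measurable

text \<open>The test function \<open>y \<mapsto> E (\<mu> \<bullet> \<eta>) sin (R \<eta> \<bullet> y)\<close>, with \<open>\<eta>\<close> standard normal, concentrates at
  scale \<open>1 / R\<close>. It has \<open>P m\<close>-integral at least of order \<open>\<bar>\<mu>\<bar>\<^sup>2 / R\<close> in the limit, while the
  Gaussian part of the limit gives its absolute value only a mass of order \<open>R\<close> to the power minus the dimension.\<close>

definition test_fun :: "real \<Rightarrow> real^'n \<Rightarrow> real" where
  "test_fun R y = R * (\<mu> \<bullet> y) * exp (- (norm (R *\<^sub>R y))\<^sup>2 / 2)"

text \<open>The imaginary part of Stein's identity at \<open>R y\<close>. The sines connect the test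
  function with the imaginary parts of characteristic functions, where the drift is visible.\<close>

lemma test_fun_eq: "test_fun R y = (\<integral>\<eta>. (\<mu> \<bullet> \<eta>) * sin (R * (\<eta> \<bullet> y)) \<partial>std_gauss)"
proof -
  interpret G: prob_space "std_gauss :: (real^'n) measure" by (rule prob_space_std_gauss)
  have "integrable std_gauss (\<lambda>\<eta>. (\<mu> \<bullet> \<eta>) *\<^sub>R iexp ((R *\<^sub>R y) \<bullet> \<eta>))"
    by (rule Bochner_Integration.integrable_bound[OF integrable_std_gauss_inner[of \<mu>]]) auto
  from integral_Im[OF this]
  have "(\<integral>\<eta>. (\<mu> \<bullet> \<eta>) * sin (R * (\<eta> \<bullet> y)) \<partial>std_gauss) = Im (CLINT \<eta>|std_gauss. (\<mu> \<bullet> \<eta>) *\<^sub>R iexp ((R *\<^sub>R y) \<bullet> \<eta>))"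
    by (simp add: Im_exp inner_commute)
  also have "\<dots> = test_fun R y"
    unfolding std_gauss_stein by (simp add: test_fun_def)
  finally show ?thesis by simp
qed

lemma test_fun_continuous: "continuous_on UNIV (test_fun R)"
  unfolding test_fun_def by (intro continuous_intros) auto

text \<open>One half of the Gaussian exponent absorbs the linear factor through
  \<open>s * exp (- s^2 / 4) \<le> 1\<close>; the other half is a Gaussian window with parameter
  \<open>R / sqrt 2\<close>.\<close>

lemma test_fun_bound: "\<bar>test_fun R y\<bar> \<le> norm \<mu> * exp (- (norm ((R / sqrt 2) *\<^sub>R y))\<^sup>2 / 2)"
proof -
  define s where "s = norm (R *\<^sub>R y)"
  have "0 \<le> (1 - s / 2)\<^sup>2" by simp
  then have "s \<le> 1 + s\<^sup>2 / 4" by (simp add: power2_eq_square algebra_simps)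
  also have "\<dots> \<le> exp (s\<^sup>2 / 4)" by (rule exp_ge_add_one_self)
  finally have s: "s * exp (- s\<^sup>2 / 4) \<le> 1" by (simp add: exp_minus field_simps)
  have "\<bar>test_fun R y\<bar> = \<bar>\<mu> \<bullet> (R *\<^sub>R y)\<bar> * exp (- s\<^sup>2 / 2)" by (simp add: test_fun_def s_def abs_mult)
  also have "\<dots> \<le> (norm \<mu> * s) * exp (- s\<^sup>2 / 2)"
    unfolding s_def by (intro mult_right_mono Cauchy_Schwarz_ineq2) auto
  also have "exp (- s\<^sup>2 / 2) = exp (- s\<^sup>2 / 4) * exp (- s\<^sup>2 / 4)" by (simp flip: exp_add)
  also have "norm \<mu> * s * (exp (- s\<^sup>2 / 4) * exp (- s\<^sup>2 / 4)) = norm \<mu> * (s * exp (- s\<^sup>2 / 4)) * exp (- s\<^sup>2 / 4)" by (simp only: mult_ac)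
  also have "\<dots> \<le> norm \<mu> * 1 * exp (- s\<^sup>2 / 4)"
    using s by (intro mult_right_mono mult_left_mono) auto
  also have "- s\<^sup>2 / 4 = - (norm ((R / sqrt 2) *\<^sub>R y))\<^sup>2 / 2"
    by (simp add: s_def power_mult_distrib power_divide)
  finally show ?thesis by simp
qed

text \<open>The Gaussian density is bounded, so a window of width \<open>1 / R\<close> has mass of
  the order of its volume. The smoothing formula for a point mass at 0 performs the change of
  variables.\<close>

lemma gauss_law_small_scale:
  obtains C where "\<And>R. 0 < R \<Longrightarrow> (\<integral>y. exp (- (norm (R *\<^sub>R y))\<^sup>2 / 2) \<partial>gauss_law a S) \<le> C / R ^ CARD('n)"
proof
  define g0 where "g0 = a powr (real CARD('n) / 2) / (sqrt (det S) * pi powr (real CARD('n) / 2))"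
  have g0: "0 \<le> g0" using det_S_pos by (simp add: g0_def)
  have dens: "gauss_dens a S x = g0 * exp (- (a * quad (matrix_inv S) x))" for x
    by (simp add: gauss_dens_def g0_def)
  have bd: "\<bar>gauss_dens a S x\<bar> \<le> g0" for x
    unfolding dens using g0 a_pos quad_inv[of x] by (simp add: abs_mult mult_left_le)
  have int: "integrable lborel (gauss_dens a S)"
  proof (rule integrableI_nonneg)
    have "(\<integral>\<^sup>+x. ennreal (gauss_dens a S x) \<partial>lborel) = emeasure (gauss_law a S) (space (gauss_law a S))"
      by (simp add: gauss_law_def emeasure_density cong: nn_integral_cong)
    also have "\<dots> = 1"
      using borel_probD(1)[OF borel_prob_gauss_law] by (rule prob_space.emeasure_space_1)
    finally show "(\<integral>\<^sup>+x. ennreal (gauss_dens a S x) \<partial>lborel) < \<infinity>" by simp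
  qed (auto simp: gauss_dens_nonneg)
  interpret G: prob_space "std_gauss :: (real^'n) measure" by (rule prob_space_std_gauss)
  fix R :: real assume R: "0 < R"
  define \<delta> where "\<delta> = return borel (0 :: real^'n)"
  have \<delta>: "borel_prob \<delta>" by (simp add: borel_prob_def \<delta>_def prob_space_return)
  have d: "(\<integral>x. f x \<partial>\<delta>) = f 0" if [measurable]: "f \<in> borel_measurable borel" for f :: "real^'n \<Rightarrow> real"
    unfolding \<delta>_def by (rule integral_return) auto
  have "(R / sqrt (2 * pi)) ^ DIM(real^'n) * (\<integral>y. gauss_dens a S y * (\<integral>x. exp (- (norm (R *\<^sub>R (y - x)))\<^sup>2 / 2) \<partial>\<delta>) \<partial>lborel)
      = (\<integral>x. \<integral>z. gauss_dens a S (x + (1 / R) *\<^sub>R z) \<partial>std_gauss \<partial>\<delta>)"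
    by (rule gauss_smoothing[OF \<delta> int _ bd R, symmetric]) measurable
  also have "\<dots> = (\<integral>z. gauss_dens a S ((1 / R) *\<^sub>R z) \<partial>std_gauss)"
    by (subst d) auto
  also have "\<dots> \<le> (\<integral>z. g0 \<partial>(std_gauss :: (real^'n) measure))"
  proof (rule integral_mono)
    show "integrable std_gauss (\<lambda>z. gauss_dens a S ((1 / R) *\<^sub>R z))"
      by (rule G.integrable_const_bound[where B=g0]) (use bd in auto)
    show "gauss_dens a S ((1 / R) *\<^sub>R z) \<le> g0" for z using bd[of "(1 / R) *\<^sub>R z"] by simp
  qed simp
  also have "\<dots> = g0" using G.prob_space by simp
  also have "(\<integral>y. gauss_dens a S y * (\<integral>x. exp (- (norm (R *\<^sub>R (y - x)))\<^sup>2 / 2) \<partial>\<delta>) \<partial>lborel)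
      = (\<integral>y. exp (- (norm (R *\<^sub>R y))\<^sup>2 / 2) \<partial>gauss_law a S)"
    unfolding gauss_law_def by (subst integral_density) (auto simp: gauss_dens_nonneg d)
  finally have "(R / sqrt (2 * pi)) ^ CARD('n) * (\<integral>y. exp (- (norm (R *\<^sub>R y))\<^sup>2 / 2) \<partial>gauss_law a S) \<le> g0" by simp
  then show "(\<integral>y. exp (- (norm (R *\<^sub>R y))\<^sup>2 / 2) \<partial>gauss_law a S) \<le> g0 * sqrt (2 * pi) ^ CARD('n) / R ^ CARD('n)"
    using R by (simp add: power_divide field_simps)
qed

text \<open>The point mass at 0 in the symmetrised limit cannot supply the mass that the drift
  requires, because the test function vanishes there. Only the Gaussian part is left, and from
  dimension two on its share is of smaller order than \<open>1 / R\<close>.\<close>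

lemma mu_eq_0:
  assumes dim: "CARD('n) \<noteq> 1"
  shows "\<mu> = 0"
proof (rule ccontr)
  assume mu: "\<mu> \<noteq> 0"
  interpret G: prob_space "std_gauss :: (real^'n) measure" by (rule prob_space_std_gauss)
  interpret Z: prob_space "gauss_law a S" using borel_prob_gauss_law by (rule borel_probD)
  have [measurable_cong]: "sets (gauss_law a S) = sets borel" using borel_prob_gauss_law by (rule borel_probD)
  have card: "2 \<le> CARD('n)" using dim by (metis One_nat_def Suc_1 Suc_leI le_neq_implies_less zero_less_card_finite)
  define w where "w u = exp (- c0 u) * gauss_ray (c0 u)" for u
  have fubini: "(\<integral>y. test_fun R y \<partial>P m) = (\<integral>\<eta>. (\<mu> \<bullet> \<eta>) * Im (char_vec (P m) (R *\<^sub>R \<eta>)) \<partial>std_gauss)" for R m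
  proof -
    interpret Pm: prob_space "P m" using P by (rule borel_probD)
    interpret pair_sigma_finite "std_gauss :: (real^'n) measure" "P m" ..
    have "integrable (std_gauss \<Otimes>\<^sub>M P m) (\<lambda>(\<eta>, y). (\<mu> \<bullet> \<eta>) * sin (R * (\<eta> \<bullet> y)))"
    proof (rule Bochner_Integration.integrable_bound)
      show "integrable (std_gauss \<Otimes>\<^sub>M P m) (\<lambda>z. (\<mu> \<bullet> fst z) * 1)"
        by (rule integrable_prod_mult) (auto intro: integrable_std_gauss_inner)
      show "AE z in std_gauss \<Otimes>\<^sub>M P m. norm (case z of (\<eta>, y) \<Rightarrow> (\<mu> \<bullet> \<eta>) * sin (R * (\<eta> \<bullet> y))) \<le> norm ((\<mu> \<bullet> fst z) * 1)"
        by (auto simp: abs_mult mult_left_le)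
    qed measurable
    from Fubini_integral[OF this]
    have "(\<integral>y. test_fun R y \<partial>P m) = (\<integral>\<eta>. \<integral>y. (\<mu> \<bullet> \<eta>) * sin (R * (\<eta> \<bullet> y)) \<partial>P m \<partial>std_gauss)"
      unfolding test_fun_eq by simp
    then show ?thesis unfolding Im_char_vec[OF P] by simp
  qed
  have Im_lim: "(\<lambda>m. Im (char_vec (P m) u)) \<longlonglongrightarrow> (u \<bullet> \<mu>) * w u" for u
    using Im_limit[of u] unfolding w_def c0_def .
  have Im_meas [measurable]: "(\<lambda>u. Im (char_vec (P m) u)) \<in> borel_measurable borel" for m
    using measurable_char_vec[OF P] by measurable
  \<comment> \<open>Measurability as a pointwise limit of imaginary parts of characteristic
    functions.\<close>
  have [measurable]: "(\<lambda>u. (u \<bullet> \<mu>) * w u) \<in> borel_measurable borel"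
    by (rule borel_measurable_LIMSEQ_metric[OF Im_meas]) (rule Im_lim)
  let ?h = "\<lambda>R \<eta>. (\<mu> \<bullet> \<eta>) * (((R *\<^sub>R \<eta>) \<bullet> \<mu>) * w (R *\<^sub>R \<eta>))"
  have Im_bd: "\<bar>Im (char_vec (P m) u)\<bar> \<le> 1" for m u
    using abs_Im_le_cmod[of "char_vec (P m) u"] norm_char_vec_le_1[OF P, of m u] by simp
  have h_int: "integrable std_gauss (?h R)"
    and h_lim: "(\<lambda>m. \<integral>y. test_fun R y \<partial>P m) \<longlonglongrightarrow> (\<integral>\<eta>. ?h R \<eta> \<partial>std_gauss)" for R
  proof -
    have 1: "(\<lambda>m. (\<mu> \<bullet> \<eta>) * Im (char_vec (P m) (R *\<^sub>R \<eta>))) \<longlonglongrightarrow> ?h R \<eta>" for \<eta>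
      by (intro tendsto_mult tendsto_const Im_lim)
    have 2: "norm ((\<mu> \<bullet> \<eta>) * Im (char_vec (P m) (R *\<^sub>R \<eta>))) \<le> \<bar>\<mu> \<bullet> \<eta>\<bar>" for m \<eta>
      using Im_bd[of m "R *\<^sub>R \<eta>"] by (simp add: abs_mult mult_left_le)
    have 3: "integrable std_gauss (\<lambda>\<eta>. \<bar>\<mu> \<bullet> \<eta>\<bar>)" by (intro integrable_abs integrable_std_gauss_inner)
    have "(\<lambda>\<eta>. ((R *\<^sub>R \<eta>) \<bullet> \<mu>) * w (R *\<^sub>R \<eta>)) \<in> borel_measurable borel"
      by (rule measurable_compose[of "\<lambda>\<eta>. R *\<^sub>R \<eta>" borel borel]) measurable
    then have m: "?h R \<in> borel_measurable std_gauss" by measurable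
    show "integrable std_gauss (?h R)"
    proof (rule integrable_dominated_convergence[OF m _ 3, where s="\<lambda>m \<eta>. (\<mu> \<bullet> \<eta>) * Im (char_vec (P m) (R *\<^sub>R \<eta>))"])
      show "(\<lambda>\<eta>. (\<mu> \<bullet> \<eta>) * Im (char_vec (P m) (R *\<^sub>R \<eta>))) \<in> borel_measurable std_gauss" for m by measurable
    qed (intro AE_I2 1, intro AE_I2 2)
    show "(\<lambda>m. \<integral>y. test_fun R y \<partial>P m) \<longlonglongrightarrow> (\<integral>\<eta>. ?h R \<eta> \<partial>std_gauss)"
      unfolding fubini
    proof (rule integral_dominated_convergence[OF m _ 3])
      show "(\<lambda>\<eta>. (\<mu> \<bullet> \<eta>) * Im (char_vec (P m) (R *\<^sub>R \<eta>))) \<in> borel_measurable std_gauss" for m by measurable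
    qed (intro AE_I2 1, intro AE_I2 2)
  qed
  \<comment> \<open>The exponential weight stems from the lower bound on \<open>gauss_ray\<close>.
    \<open>K\<close> is positive because \<open>\<mu> \<bullet> \<eta>\<close> is almost surely
    nonzero.\<close>
  define K where "K = (\<integral>\<eta>. (\<mu> \<bullet> \<eta>)\<^sup>2 * exp (- (2 * c0 \<eta>)) \<partial>std_gauss)"
  have K_le: "(\<mu> \<bullet> \<eta>)\<^sup>2 * exp (- (2 * c0 \<eta>)) / R \<le> ?h R \<eta>" if R: "1 \<le> R" for R \<eta>
  proof -
    have "exp (- (2 * c0 \<eta>)) / R\<^sup>2 \<le> w (R *\<^sub>R \<eta>)"
      using gauss_ray_lower[OF c0_nonneg R] by (simp add: w_def c0_scale)
    then have "(R * (\<mu> \<bullet> \<eta>)\<^sup>2) * (exp (- (2 * c0 \<eta>)) / R\<^sup>2) \<le> (R * (\<mu> \<bullet> \<eta>)\<^sup>2) * w (R *\<^sub>R \<eta>)"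
      using R by (intro mult_left_mono) auto
    then show ?thesis using R by (simp add: power2_eq_square inner_commute mult_ac)
  qed
  have K_int: "integrable std_gauss (\<lambda>\<eta>. (\<mu> \<bullet> \<eta>)\<^sup>2 * exp (- (2 * c0 \<eta>)))"
  proof (rule Bochner_Integration.integrable_bound[OF h_int[of 1]])
    show "AE \<eta> in std_gauss. norm ((\<mu> \<bullet> \<eta>)\<^sup>2 * exp (- (2 * c0 \<eta>))) \<le> norm (?h 1 \<eta>)"
    proof (rule AE_I2)
      fix \<eta>
      show "norm ((\<mu> \<bullet> \<eta>)\<^sup>2 * exp (- (2 * c0 \<eta>))) \<le> norm (?h 1 \<eta>)"
        using K_le[of 1 \<eta>] by simp
    qed
  qed measurable
  have "K \<noteq> 0"
  proof
    assume "K = 0"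
    then have "AE \<eta> in std_gauss. (\<mu> \<bullet> \<eta>)\<^sup>2 * exp (- (2 * c0 \<eta>)) = 0"
      unfolding K_def by (subst (asm) integral_nonneg_eq_0_iff_AE[OF K_int]) auto
    then have "AE \<eta> in (std_gauss :: (real^'n) measure). False"
      using AE_std_gauss_inner_neq_0[OF mu] by eventually_elim auto
    then show False by simp
  qed
  moreover have "0 \<le> K" unfolding K_def by (rule Bochner_Integration.integral_nonneg) simp
  ultimately have K: "0 < K" by simp
  obtain C where C: "\<And>R. 0 < R \<Longrightarrow> (\<integral>y. exp (- (norm (R *\<^sub>R y))\<^sup>2 / 2) \<partial>gauss_law a S) \<le> C / R ^ CARD('n)"
    using gauss_law_small_scale by blast
  have up: "K / R \<le> p * (norm \<mu> * (C / (R / sqrt 2) ^ CARD('n)))" if R: "1 \<le> R" for R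
  proof -
    have "K / R = (\<integral>\<eta>. (\<mu> \<bullet> \<eta>)\<^sup>2 * exp (- (2 * c0 \<eta>)) / R \<partial>std_gauss)" unfolding K_def by simp
    also have "\<dots> \<le> (\<integral>\<eta>. ?h R \<eta> \<partial>std_gauss)"
      by (rule integral_mono[OF _ h_int K_le[OF R]]) (use K_int in simp)
    also have "\<dots> \<le> p * (\<integral>y. \<bar>test_fun R y\<bar> \<partial>gauss_law a S) + (1 - p) * \<bar>test_fun R 0\<bar>"
    proof (rule LIMSEQ_le[OF h_lim tendsto_even_integral])
      show "continuous_on UNIV (\<lambda>y. \<bar>test_fun R y\<bar>)" by (intro continuous_intros test_fun_continuous)
      show "\<bar>\<bar>test_fun R y\<bar>\<bar> \<le> norm \<mu>" for y
      proof -
        have "norm \<mu> * exp (- (norm ((R / sqrt 2) *\<^sub>R y))\<^sup>2 / 2) \<le> norm \<mu> * 1" by (intro mult_left_mono) auto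
        then show ?thesis using test_fun_bound[of R y] by simp
      qed
      show "\<bar>test_fun R (- y)\<bar> = \<bar>test_fun R y\<bar>" for y by (simp add: test_fun_def)
      have "(\<integral>y. test_fun R y \<partial>P m) \<le> (\<integral>y. \<bar>test_fun R y\<bar> \<partial>P m)" for m
        by (rule order_trans[OF abs_ge_self integral_norm_bound[of "P m" "test_fun R", unfolded real_norm_def]])
      then show "\<exists>N. \<forall>m\<ge>N. (\<integral>y. test_fun R y \<partial>P m) \<le> (\<integral>y. \<bar>test_fun R y\<bar> \<partial>P m)" by blast
    qed
    also have "test_fun R 0 = 0" by (simp add: test_fun_def)
    also have "(\<integral>y. \<bar>test_fun R y\<bar> \<partial>gauss_law a S) \<le> (\<integral>y. norm \<mu> * exp (- (norm ((R / sqrt 2) *\<^sub>R y))\<^sup>2 / 2) \<partial>gauss_law a S)"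
    proof (rule integral_mono'[OF _ test_fun_bound])
      show "integrable (gauss_law a S) (\<lambda>y. norm \<mu> * exp (- (norm ((R / sqrt 2) *\<^sub>R y))\<^sup>2 / 2))"
        by (rule integrable_mult_right, rule Z.integrable_const_bound[where B=1]) auto
    qed auto
    also have "\<dots> \<le> norm \<mu> * (C / (R / sqrt 2) ^ CARD('n))"
      unfolding integral_mult_right_zero using R by (intro mult_left_mono C) auto
    finally show ?thesis using p by (simp add: mult_left_mono)
  qed
  define C1 where "C1 = p * (norm \<mu> * (C * sqrt 2 ^ CARD('n)))"
  have "K * R \<le> \<bar>C1\<bar>" if R: "1 \<le> R" for R
  proof -
    have "K / R \<le> C1 / R ^ CARD('n)" using up[OF R] by (simp add: C1_def power_divide)
    also have "\<dots> \<le> \<bar>C1\<bar> / R ^ CARD('n)" using R by (intro divide_right_mono) auto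
    also have "\<dots> \<le> \<bar>C1\<bar> / R ^ 2" using R card by (intro divide_left_mono power_increasing mult_pos_pos) auto
    finally show ?thesis using R by (simp add: power2_eq_square field_simps)
  qed
  \<comment> \<open>At this \<open>R\<close> the left side equals
    \<open>\<bar>C1\<bar> + K\<close>.\<close>
  from this[of "\<bar>C1\<bar> / K + 1"] K show False by (simp add: distrib_left)
qed

theorem limit_law:
  "\<exists>(N :: (real \<times> (real^'n)) measure) B1 Z.
       prob_space N \<and>
       indep_rv N borel B1 borel Z \<and>
       measure N {\<omega> \<in> space N. B1 \<omega> = 1} = p \<and>
       measure N {\<omega> \<in> space N. B1 \<omega> = 0} = 1 - p \<and>
       weak_conv_law P (distr N borel (\<lambda>\<omega>. B1 \<omega> *\<^sub>R Z \<omega>)) \<and>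
       (p = 0 \<longrightarrow> (AE \<omega> in N. B1 \<omega> *\<^sub>R Z \<omega> = 0)) \<and>
       (0 < p \<longrightarrow>
          absolutely_continuous lborel (distr N borel Z) \<and>
          (\<forall>\<nu>. borel_prob \<nu> \<longrightarrow>
             (char_property a p \<mu> S \<nu> \<longleftrightarrow> \<nu> = distr N borel Z) \<and>
             (density_property a p \<mu> S \<nu> \<longleftrightarrow> \<nu> = distr N borel Z) \<and>
             (projection_property a p \<mu> S \<nu> \<longleftrightarrow> \<nu> = distr N borel Z)))"
proof -
  have "\<exists>\<zeta>. borel_prob \<zeta> \<and> (0 < p \<longrightarrow> (\<forall>u. char_vec \<zeta> u = zchar a p \<mu> S u) \<and> absolutely_continuous lborel \<zeta> \<and>
      (\<forall>\<nu>. borel_prob \<nu> \<longrightarrow> (char_property a p \<mu> S \<nu> \<longleftrightarrow> \<nu> = \<zeta>) \<and>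
        (density_property a p \<mu> S \<nu> \<longleftrightarrow> \<nu> = \<zeta>) \<and> (projection_property a p \<mu> S \<nu> \<longleftrightarrow> \<nu> = \<zeta>)))"
  proof (cases "0 < p")
    case True
    then show ?thesis by (rule z_law_exists[OF _ drift_bound mu_eq_0]) auto
  next
    case False
    \<comment> \<open>For \<open>p = 0\<close> nothing is demanded of \<open>Z\<close>, and any law
      may stand for it.\<close>
    then show ?thesis using borel_prob_gauss_law by blast
  qed
  then obtain \<zeta> where \<zeta>: "borel_prob \<zeta>" "0 < p \<Longrightarrow> char_vec \<zeta> u = zchar a p \<mu> S u"
      "0 < p \<Longrightarrow> absolutely_continuous lborel \<zeta>"
      "0 < p \<Longrightarrow> borel_prob \<nu> \<Longrightarrow> (char_property a p \<mu> S \<nu> \<longleftrightarrow> \<nu> = \<zeta>) \<and>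
        (density_property a p \<mu> S \<nu> \<longleftrightarrow> \<nu> = \<zeta>) \<and> (projection_property a p \<mu> S \<nu> \<longleftrightarrow> \<nu> = \<zeta>)" for u \<nu>
    by blast
  define \<beta> where "\<beta> = two_point p 1 0"
  interpret borel_prob_pair \<beta> \<zeta>
    by standard (auto simp: \<beta>_def borel_prob_two_point \<zeta>(1))
  let ?N = "\<beta> \<Otimes>\<^sub>M \<zeta>"
  have fst_eq: "measure ?N {\<omega> \<in> space ?N. fst \<omega> = x} = measure \<beta> {x}" for x
  proof -
    have "{\<omega> \<in> space ?N. fst \<omega> = x} = {x} \<times> UNIV" by (auto simp: space_eq)
    then show ?thesis by (simp add: measure_fst)
  qed
  have weak: "weak_conv_law P (distr ?N borel (\<lambda>\<omega>. fst \<omega> *\<^sub>R snd \<omega>))"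
    unfolding \<beta>_def scaled_mix_def[symmetric]
  proof (rule char_vec_continuity[OF P borel_prob_scaled_mix[OF \<zeta>(1) p]])
    fix u
    have "char_vec (scaled_mix p 1 0 \<zeta>) u = limit_char (1 - p) (quad S u / (4 * a)) (u \<bullet> \<mu>)"
    proof (cases "p = 0")
      case True
      \<comment> \<open>For \<open>p = 0\<close> the drift bound makes the drift vanish, so the
        limit is the characteristic function of the point mass at 0.\<close>
      then have "sqrt (pi * a) * \<bar>u \<bullet> \<mu>\<bar> \<le> 0" using drift_bound[of u] by simp
      then have "u \<bullet> \<mu> = 0" using a_pos pi_gt_zero by (auto simp: mult_le_0_iff dest: leD)
      then show ?thesis
        using True by (subst char_vec_scaled_mix[OF \<zeta>(1) p]) (simp add: limit_char_def char_vec_0[OF \<zeta>(1)])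
    next
      case False
      then have "0 < p" using p by simp
      then show ?thesis
        by (subst char_vec_scaled_mix[OF \<zeta>(1) p])
           (simp add: limit_char_eq_zchar \<zeta>(2) char_vec_0[OF \<zeta>(1)] scaleR_conv_of_real)
    qed
    then show "(\<lambda>m. char_vec (P m) u) \<longlonglongrightarrow> char_vec (scaled_mix p 1 0 \<zeta>) u" using lim[of u] by simp
  qed
  have zero: "AE \<omega> in ?N. fst \<omega> *\<^sub>R snd \<omega> = 0" if "p = 0"
  proof -
    have "measure ?N {\<omega> \<in> space ?N. fst \<omega> = 0} = 1" unfolding fst_eq using that by (simp add: \<beta>_def measure_two_point)
    then have "AE \<omega> in ?N. fst \<omega> = 0" by (subst (asm) prob_Collect_eq_1) auto
    then show ?thesis by eventually_elim simp
  qed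
  show ?thesis
    by (rule exI[of _ ?N], rule exI[of _ fst], rule exI[of _ snd])
       (use prob_space_axioms indep_rv_fst_snd weak zero \<zeta>(3,4) p in
         \<open>simp add: distr_snd fst_eq, simp add: \<beta>_def measure_two_point\<close>)
qed

end

section \<open>Integer-valued limits in probability and the second moment matrix\<close>

lemma (in prob_space) expectation_nat_tail_sum:
  fixes T :: "'a \<Rightarrow> nat"
  assumes [measurable]: "T \<in> measurable M (count_space UNIV)"
    and sum: "summable (\<lambda>k. prob {\<omega> \<in> space M. k < T \<omega>})"
  shows "expectation (\<lambda>\<omega>. real (T \<omega>)) = (\<Sum>k. prob {\<omega> \<in> space M. k < T \<omega>})"
proof -
  have "(\<integral>\<^sup>+\<omega>. ennreal (real (T \<omega>)) \<partial>M) = (\<Sum>k. emeasure M {\<omega> \<in> space M. k < T \<omega>})"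
    using nn_integral_nat_function[OF assms(1)] by (simp add: ennreal_of_nat_eq_real_of_nat)
  also have "\<dots> = ennreal (\<Sum>k. prob {\<omega> \<in> space M. k < T \<omega>})"
    unfolding emeasure_eq_measure by (rule suminf_ennreal2[OF measure_nonneg sum])
  finally show ?thesis
    using suminf_nonneg[OF sum] by (subst integral_eq_nn_integral) auto
qed

text \<open>At most one integer lies within less than 1/2 of \<open>T\<close>, so wherever
  \<open>\<tau> n\<close> is that close to \<open>T\<close> it is the rounded value; the value
  infinity is never close. Hence \<open>T\<close> is almost surely a natural number and is attained
  by \<open>\<tau> n\<close> with probability tending to 1.\<close>

lemma (in prob_space) conv_in_prob_enat_round:
  fixes T :: "'a \<Rightarrow> real" and \<tau> :: "nat \<Rightarrow> 'a \<Rightarrow> enat"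
  assumes \<tau> [measurable]: "\<And>n. \<tau> n \<in> measurable M (count_space UNIV)" and [measurable]: "T \<in> borel_measurable M"
    and conv: "conv_in_prob_enat M \<tau> T"
  defines "T' \<equiv> \<lambda>\<omega>. nat (round (T \<omega>))"
  shows "T' \<in> measurable M (count_space UNIV)"
    and "(\<lambda>n. prob {\<omega> \<in> space M. \<tau> n \<omega> \<noteq> enat (T' \<omega>)}) \<longlonglongrightarrow> 0"
    and "AE \<omega> in M. T \<omega> = real (T' \<omega>)"
proof -
  show T' [measurable]: "T' \<in> measurable M (count_space UNIV)"
    unfolding T'_def round_def by measurable
  let ?far = "\<lambda>\<epsilon> n. {\<omega> \<in> space M. ereal \<epsilon> < \<bar>ereal_of_enat (\<tau> n \<omega>) - ereal (T \<omega>)\<bar>}"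
  have [measurable]: "(\<lambda>\<omega>. ereal_of_enat (\<tau> n \<omega>)) \<in> borel_measurable M" for n
    by (rule measurable_compose[OF \<tau>]) simp
  have far_meas: "?far \<epsilon> n \<in> sets M" for \<epsilon> n by measurable
  have conv': "(\<lambda>n. prob (?far \<epsilon> n)) \<longlonglongrightarrow> 0" if "0 < \<epsilon>" for \<epsilon>
    using conv that unfolding conv_in_prob_enat_def by blast
  have near: "\<tau> n \<omega> = enat (T' \<omega>) \<and> \<bar>real (T' \<omega>) - T \<omega>\<bar> \<le> \<epsilon>"
    if "\<omega> \<in> space M" "\<omega> \<notin> ?far \<epsilon> n" "\<epsilon> < 1/2" for \<omega> \<epsilon> n
  proof (cases "\<tau> n \<omega>")
    case (enat k)
    with that have k: "\<bar>real k - T \<omega>\<bar> \<le> \<epsilon>" by (simp add: not_less)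
    have "\<bar>T \<omega> - of_int (int k)\<bar> < 1 / 2" unfolding of_int_of_nat_eq using k that(3) by linarith
    then have "round (T \<omega>) = int k" by (rule round_unique')
    then show ?thesis using enat k by (simp add: T'_def)
  next
    case infinity
    with that show ?thesis by simp
  qed
  show lim: "(\<lambda>n. prob {\<omega> \<in> space M. \<tau> n \<omega> \<noteq> enat (T' \<omega>)}) \<longlonglongrightarrow> 0"
  proof (rule tendsto_sandwich[OF _ _ tendsto_const conv'[of "1/4"]])
    show "\<forall>\<^sub>F n in sequentially. prob {\<omega> \<in> space M. \<tau> n \<omega> \<noteq> enat (T' \<omega>)} \<le> prob (?far (1/4) n)"
      using near by (intro always_eventually allI finite_measure_mono far_meas) fastforce
  qed auto
  have null: "prob {\<omega> \<in> space M. \<epsilon> < \<bar>real (T' \<omega>) - T \<omega>\<bar>} = 0" if \<epsilon>: "0 < \<epsilon>" "\<epsilon> < 1/2" for \<epsilon>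
  proof -
    have "prob {\<omega> \<in> space M. \<epsilon> < \<bar>real (T' \<omega>) - T \<omega>\<bar>} \<le> prob (?far \<epsilon> n)" for n
      using near[of _ \<epsilon> n] \<epsilon> by (intro finite_measure_mono far_meas) fastforce
    then have "prob {\<omega> \<in> space M. \<epsilon> < \<bar>real (T' \<omega>) - T \<omega>\<bar>} \<le> 0"
      by (intro LIMSEQ_le_const[OF conv'[OF \<epsilon>(1)]]) auto
    then show ?thesis using measure_nonneg[of M] by (metis order_antisym)
  qed
  \<comment> \<open>The shift by 3 keeps the tolerance below 1/2.\<close>
  have "AE \<omega> in M. \<bar>real (T' \<omega>) - T \<omega>\<bar> \<le> 1 / real (n + 3)" for n
  proof -
    have "prob {\<omega> \<in> space M. 1 / real (n + 3) < \<bar>real (T' \<omega>) - T \<omega>\<bar>} = 0"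
      by (rule null) auto
    then have "AE \<omega> in M. \<omega> \<notin> {\<omega> \<in> space M. 1 / real (n + 3) < \<bar>real (T' \<omega>) - T \<omega>\<bar>}"
      by (intro AE_not_in) (simp add: null_sets_def emeasure_eq_measure)
    then show ?thesis using AE_space by eventually_elim (simp add: not_less)
  qed
  then have "AE \<omega> in M. \<forall>n. \<bar>real (T' \<omega>) - T \<omega>\<bar> \<le> 1 / real (n + 3)" by (simp add: AE_all_countable)
  then show "AE \<omega> in M. T \<omega> = real (T' \<omega>)"
  proof eventually_elim
    case (elim \<omega>)
    have "(\<lambda>n. 1 / real (n + 3)) \<longlonglongrightarrow> 0" using lim_1_over_n by (rule LIMSEQ_ignore_initial_segment)
    then have "\<bar>real (T' \<omega>) - T \<omega>\<bar> \<le> 0" by (rule LIMSEQ_le_const) (use elim in auto)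
    then show ?case by simp
  qed
qed

context prob_space
begin

lemma transpose_second_moment_matrix: "transpose (second_moment_matrix M xi) = second_moment_matrix M xi"
  by (simp add: transpose_def second_moment_matrix_def mult.commute)

context
  fixes xi :: "'a \<Rightarrow> real^'n"
  assumes xi [measurable]: "xi \<in> borel_measurable M" and sq: "integrable M (\<lambda>\<omega>. (norm (xi \<omega>))\<^sup>2)"
begin

lemma integrable_inner_mult: "integrable M (\<lambda>\<omega>. (u \<bullet> xi \<omega>) * (v \<bullet> xi \<omega>))"
proof (rule Bochner_Integration.integrable_bound)
  show "integrable M (\<lambda>\<omega>. norm u * norm v * (norm (xi \<omega>))\<^sup>2)" by (rule integrable_mult_right[OF sq])
  show "AE \<omega> in M. norm ((u \<bullet> xi \<omega>) * (v \<bullet> xi \<omega>)) \<le> norm (norm u * norm v * (norm (xi \<omega>))\<^sup>2)"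
  proof (rule AE_I2)
    fix \<omega>
    have "\<bar>u \<bullet> xi \<omega>\<bar> * \<bar>v \<bullet> xi \<omega>\<bar> \<le> (norm u * norm (xi \<omega>)) * (norm v * norm (xi \<omega>))"
      by (intro mult_mono Cauchy_Schwarz_ineq2) auto
    then show "norm ((u \<bullet> xi \<omega>) * (v \<bullet> xi \<omega>)) \<le> norm (norm u * norm v * (norm (xi \<omega>))\<^sup>2)"
      by (simp add: abs_mult power2_eq_square mult_ac)
  qed
qed measurable

lemma second_moment_matrix_mult_component:
  "(second_moment_matrix M xi *v u) $ i = (\<integral>\<omega>. xi \<omega> $ i * (u \<bullet> xi \<omega>) \<partial>M)"
proof -
  have int: "integrable M (\<lambda>\<omega>. xi \<omega> $ i * xi \<omega> $ j)" for j
    using integrable_inner_mult[of "axis i 1" "axis j 1"] by (simp add: inner_axis')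
  have "(second_moment_matrix M xi *v u) $ i = (\<Sum>j\<in>UNIV. (\<integral>\<omega>. xi \<omega> $ i * xi \<omega> $ j \<partial>M) * u $ j)"
    by (simp add: matrix_vector_mult_def second_moment_matrix_def)
  also have "\<dots> = (\<integral>\<omega>. (\<Sum>j\<in>UNIV. xi \<omega> $ i * xi \<omega> $ j * u $ j) \<partial>M)"
    using int by (subst Bochner_Integration.integral_sum) auto
  also have "\<dots> = (\<integral>\<omega>. xi \<omega> $ i * (u \<bullet> xi \<omega>) \<partial>M)"
    by (intro Bochner_Integration.integral_cong refl) (simp add: inner_vec_def sum_distrib_left mult_ac)
  finally show ?thesis .
qed

lemma quad_second_moment_matrix: "quad (second_moment_matrix M xi) u = (\<integral>\<omega>. (u \<bullet> xi \<omega>)\<^sup>2 \<partial>M)"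
proof -
  have int: "integrable M (\<lambda>\<omega>. xi \<omega> $ i * (u \<bullet> xi \<omega>))" for i
    using integrable_inner_mult[of "axis i 1" u] by (simp add: inner_axis')
  have "quad (second_moment_matrix M xi) u = (\<Sum>i\<in>UNIV. u $ i * (\<integral>\<omega>. xi \<omega> $ i * (u \<bullet> xi \<omega>) \<partial>M))"
    by (simp add: quad_def inner_vec_def[of u] second_moment_matrix_mult_component)
  also have "\<dots> = (\<integral>\<omega>. (\<Sum>i\<in>UNIV. u $ i * (xi \<omega> $ i * (u \<bullet> xi \<omega>))) \<partial>M)"
    using int by (subst Bochner_Integration.integral_sum) auto
  also have "\<dots> = (\<integral>\<omega>. (u \<bullet> xi \<omega>)\<^sup>2 \<partial>M)"
    by (intro Bochner_Integration.integral_cong refl)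
       (simp add: power2_eq_square inner_vec_def[of u] sum_distrib_right mult_ac)
  finally show ?thesis .
qed

text \<open>If the form vanished at \<open>u\<close>, then \<open>u\<close> would be almost surely
  orthogonal to \<open>xi\<close>, hence in the kernel of the matrix, which is trivial by full
  rank.\<close>

lemma quad_second_moment_matrix_pos:
  assumes rank: "rank (second_moment_matrix M xi) = CARD('n)" and u: "u \<noteq> 0"
  shows "0 < quad (second_moment_matrix M xi) u"
proof (rule ccontr)
  assume "\<not> 0 < quad (second_moment_matrix M xi) u"
  moreover have "0 \<le> quad (second_moment_matrix M xi) u"
    unfolding quad_second_moment_matrix by (rule Bochner_Integration.integral_nonneg) simp
  ultimately have "(\<integral>\<omega>. (u \<bullet> xi \<omega>)\<^sup>2 \<partial>M) = 0" unfolding quad_second_moment_matrix by linarith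
  then have "AE \<omega> in M. (u \<bullet> xi \<omega>)\<^sup>2 = 0"
    using integrable_inner_mult[of u u] by (subst (asm) integral_nonneg_eq_0_iff_AE) (auto simp: power2_eq_square)
  then have "(\<integral>\<omega>. xi \<omega> $ i * (u \<bullet> xi \<omega>) \<partial>M) = (\<integral>\<omega>. 0 \<partial>M)" for i
    using borel_measurable_integrable[OF integrable_inner_mult[of "axis i 1" u]]
    by (intro integral_cong_AE) (auto simp: inner_axis' elim!: eventually_mono)
  then have "second_moment_matrix M xi *v u = second_moment_matrix M xi *v 0"
    by (simp add: vec_eq_iff second_moment_matrix_mult_component)
  moreover have "inj ((*v) (second_moment_matrix M xi))" using rank by (simp add: full_rank_injective)
  ultimately have "u = 0" by (metis injD)
  with u show False by simp
qed

end

end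

section \<open>Application to the family indexed by m\<close>

lemma tendsto_scaled:
  fixes f :: "nat \<Rightarrow> real"
  assumes "f \<sim>[at_top] (\<lambda>m. c / s m)" "eventually (\<lambda>m. s m \<noteq> 0) at_top"
  shows "(\<lambda>m. s m * f m) \<longlonglongrightarrow> c"
proof (rule asymp_equivD_const)
  have "(\<lambda>m. s m * f m) \<sim>[at_top] (\<lambda>m. s m * (c / s m))" using assms(1) by (intro asymp_equiv_intros)
  also have "(\<lambda>m. s m * (c / s m)) \<sim>[at_top] (\<lambda>_. c)"
    by (intro asymp_equiv_refl_ev eventually_mono[OF assms(2)]) simp
  finally show "(\<lambda>m. s m * f m) \<sim>[at_top] (\<lambda>_. c)" .
qed

theorem theorem2p2:
  fixes M :: "'a measure"
    and alpha :: "nat \<Rightarrow> 'a \<Rightarrow> real" and alphas :: "nat \<Rightarrow> nat \<Rightarrow> 'a \<Rightarrow> real"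
    and beta gamma :: "nat \<Rightarrow> real"
    and xi :: "'a \<Rightarrow> real^'n" and xis :: "nat \<Rightarrow> 'a \<Rightarrow> real^'n"
    and A :: "(real^'n) set"
    and a r_in r_out :: real
    and X :: "nat \<Rightarrow> nat \<Rightarrow> 'a \<Rightarrow> real^'n" and tau :: "nat \<Rightarrow> 'a \<Rightarrow> enat"
    and Y :: "nat \<Rightarrow> 'a \<Rightarrow> real^'n"
    and \<Sigma> :: "real^'n^'n" and \<mu> :: "real^'n"
    and tau_hat :: ennreal and T :: "'a \<Rightarrow> real" and p :: real
  assumes M: "prob_space M"
    and alpha_rv: "\<And>m. 1 \<le> m \<Longrightarrow> alpha m \<in> borel_measurable M"
    and alpha_pos: "\<And>m. 1 \<le> m \<Longrightarrow> AE \<omega> in M. 0 < alpha m \<omega>"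
    and alpha_moment1: "\<And>m. 1 \<le> m \<Longrightarrow> integrable M (alpha m)"
    and alpha_moment2: "\<And>m. 1 \<le> m \<Longrightarrow> integrable M (\<lambda>\<omega>. (alpha m \<omega>)\<^sup>2)"
    and gamma_pos: "\<And>m. 1 \<le> m \<Longrightarrow> 0 < gamma m"
    and A_meas: "A \<in> sets borel"
    and radii: "0 < r_in" "0 < r_out"
    and A_balls: "ball 0 r_in \<subseteq> A" "A \<subseteq> ball 0 r_out"
    and xi_rv: "xi \<in> borel_measurable M"
    and xis_rv: "\<And>t. 1 \<le> t \<Longrightarrow> xis t \<in> borel_measurable M"
    and xis_copies: "\<And>t. 1 \<le> t \<Longrightarrow> distr M borel (xis t) = distr M borel xi"
    and xis_indep: "prob_space.indep_vars M (\<lambda>_. borel) xis {1..}"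
    and alphas_rv: "\<And>m t. 1 \<le> m \<Longrightarrow> 1 \<le> t \<Longrightarrow> alphas m t \<in> borel_measurable M"
    and alphas_copies: "\<And>m t. 1 \<le> m \<Longrightarrow> 1 \<le> t \<Longrightarrow> distr M borel (alphas m t) = distr M borel (alpha m)"
    and alphas_indep: "\<And>m. 1 \<le> m \<Longrightarrow> prob_space.indep_vars M (\<lambda>_. borel) (alphas m) {1..}"
    and alphas_xis_indep: "\<And>m. 1 \<le> m \<Longrightarrow>
          indep_rv M
            (PiM {1..} (\<lambda>_. borel)) (\<lambda>\<omega>. \<lambda>t\<in>{1..}. alphas m t \<omega>)
            (PiM {1..} (\<lambda>_. borel)) (\<lambda>\<omega>. \<lambda>t\<in>{1..}. xis t \<omega>)"
    and X_def: "\<And>m. X m = X_proc (alphas m) (beta m) xis"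
    and tau_def: "\<And>m. tau m = first_hit (X m) ((\<lambda>x. gamma m *\<^sub>R x) ` A)"
    and alpha_standing: "\<And>m. 1 \<le> m \<Longrightarrow>
          0 < measure M {\<omega> \<in> space M. real CARD('n) / (real CARD('n) + 1) \<le> alpha m \<omega> \<and> alpha m \<omega> < 1}"
    and alpha_mean: "\<And>m. 1 \<le> m \<Longrightarrow> (\<integral>\<omega>. alpha m \<omega> \<partial>M) < 1"
    and Y_rv: "\<And>m. 1 \<le> m \<Longrightarrow> Y m \<in> borel_measurable M"
    and Y_law: "\<And>m B. 1 \<le> m \<Longrightarrow> B \<in> sets borel \<Longrightarrow>
          emeasure (distr M borel (Y m)) B = cycle_occupation M (X m) (tau m) B"
    and a_pos: "0 < a"
    and alpha_asymp1: "(\<lambda>m. 1 - (\<integral>\<omega>. alpha m \<omega> \<partial>M)) \<sim>[at_top] (\<lambda>m. a / real m)"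
    and alpha_asymp2: "(\<lambda>m. 1 - (\<integral>\<omega>. (alpha m \<omega>)\<^sup>2 \<partial>M)) \<sim>[at_top] (\<lambda>m. 2 * a / real m)"
    and beta_asymp: "beta \<sim>[at_top] (\<lambda>m. 1 / sqrt (real m))"
    and xi_mean: "(\<integral>\<omega>. xi \<omega> \<partial>M) = 0"
    and xi_moment2: "integrable M (\<lambda>\<omega>. (norm (xi \<omega>))\<^sup>2)"
    and Sigma_def: "\<Sigma> = second_moment_matrix M xi"
    and Sigma_rank: "rank \<Sigma> = CARD('n)"
    and Y_mean: "(\<lambda>m. \<integral>\<omega>. Y m \<omega> \<partial>M) \<longlonglongrightarrow> \<mu>"
    and tau_hat: "1 \<le> tau_hat"
    and tau_mean: "(\<lambda>m. mean_time M (tau m)) \<longlonglongrightarrow> tau_hat"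
    and T_rv: "tau_hat < \<infinity> \<Longrightarrow> T \<in> borel_measurable M"
    and tau_conv: "tau_hat < \<infinity> \<Longrightarrow> conv_in_prob_enat M tau T"
    and p_def: "p = (if tau_hat < \<infinity> then 1 - (\<integral>\<omega>. T \<omega> \<partial>M) / enn2real tau_hat else 1)"
  shows "0 \<le> p \<and> p \<le> 1 \<and>
    (\<exists>(N :: (real \<times> (real^'n)) measure) B1 Z.
       prob_space N \<and>
       indep_rv N borel B1 borel Z \<and>
       measure N {\<omega> \<in> space N. B1 \<omega> = 1} = p \<and>
       measure N {\<omega> \<in> space N. B1 \<omega> = 0} = 1 - p \<and>
       weak_conv_law (\<lambda>m. distr M borel (Y m)) (distr N borel (\<lambda>\<omega>. B1 \<omega> *\<^sub>R Z \<omega>)) \<and>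
       (p = 0 \<longrightarrow> (AE \<omega> in N. B1 \<omega> *\<^sub>R Z \<omega> = 0)) \<and>
       (0 < p \<longrightarrow>
          absolutely_continuous lborel (distr N borel Z) \<and>
          (\<forall>\<nu>. borel_prob \<nu> \<longrightarrow>
             (char_property a p \<mu> \<Sigma> \<nu> \<longleftrightarrow> \<nu> = distr N borel Z) \<and>
             (density_property a p \<mu> \<Sigma> \<nu> \<longleftrightarrow> \<nu> = distr N borel Z) \<and>
             (projection_property a p \<mu> \<Sigma> \<nu> \<longleftrightarrow> \<nu> = distr N borel Z))))"
proof -
  interpret prob_space M by (rule M)
  have A1: "(\<lambda>m. real m * (1 - (\<integral>\<omega>. alpha m \<omega> \<partial>M))) \<longlonglongrightarrow> a"
    by (rule tendsto_scaled[OF alpha_asymp1]) (auto simp: eventually_sequentially intro: exI[of _ 1])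
  have A2: "(\<lambda>m. real m * (1 - (\<integral>\<omega>. (alpha m \<omega>)\<^sup>2 \<partial>M))) \<longlonglongrightarrow> 2 * a"
    by (rule tendsto_scaled[OF alpha_asymp2]) (auto simp: eventually_sequentially intro: exI[of _ 1])
  have Bt: "(\<lambda>m. sqrt (real m) * beta m) \<longlonglongrightarrow> 1"
    by (rule tendsto_scaled[OF beta_asymp]) (auto simp: eventually_sequentially intro: exI[of _ 1])
  have "eventually (\<lambda>m. 0 < real m * (1 - (\<integral>\<omega>. (alpha m \<omega>)\<^sup>2 \<partial>M))) sequentially"
    by (rule order_tendstoD[OF A2]) (use a_pos in simp)
  then obtain m1 where m1: "\<And>m. m1 \<le> m \<Longrightarrow> 0 < real m * (1 - (\<integral>\<omega>. (alpha m \<omega>)\<^sup>2 \<partial>M))"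
    unfolding eventually_sequentially by blast
  \<comment> \<open>Shifting all indices by \<open>m0\<close> excludes the index 0 and the early
    indices at which the second moment of the multiplier need not be below 1.\<close>
  define m0 where "m0 = Suc m1"
  have idx: "1 \<le> n + m0" for n by (simp add: m0_def)
  have sq_less_1: "(\<integral>\<omega>. (alpha (n + m0) \<omega>)\<^sup>2 \<partial>M) < 1" for n
    using m1[of "n + m0"] by (simp add: m0_def zero_less_mult_iff)
  define al where "al n = alphas (n + m0)" for n
  define b where "b n = beta (n + m0)" for n
  define g where "g n = gamma (n + m0)" for n
  define D where "D n = (\<lambda>x. g n *\<^sub>R x) ` A" for n
  define La where "La n = distr M borel (alpha (n + m0))" for n
  define Lx where "Lx = distr M borel xi"
  define P where "P n = distr M borel (Y (n + m0))" for n
  define r where "r n = real (n + m0)" for n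
  have g: "0 < g n" for n using gamma_pos[OF idx] by (simp add: g_def)
  \<comment> \<open>As a preimage under a continuous map the scaled set is Borel.\<close>
  have D_eq: "D n = (\<lambda>x. (1 / g n) *\<^sub>R x) -` A" for n
    unfolding D_def using g[of n] by (auto simp: image_iff intro!: bexI[of _ "(1 / g n) *\<^sub>R _"])
  have D_meas: "D n \<in> sets borel" for n
    using measurable_sets[of "\<lambda>x. (1 / g n) *\<^sub>R x" borel borel A] A_meas by (simp add: D_eq)
  have inner_D: "ball 0 (g n * r_in) \<subseteq> D n" for n
    using A_balls(1) g[of n] by (auto simp: D_eq subset_iff divide_less_eq mult.commute)
  have outer_D: "D n \<subseteq> ball 0 (g n * r_out)" for n
    using A_balls(2) g[of n] by (auto simp: D_def subset_iff abs_of_pos)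
  have X_eq: "X (n + m0) = X_proc (al n) (b n) xis" for n by (simp add: X_def al_def b_def)
  have tau_eq: "tau (n + m0) = first_hit (X_proc (al n) (b n) xis) (D n)" for n
    by (simp add: tau_def X_eq D_def g_def)
  have int_La: "(\<integral>x. f x \<partial>La n) = (\<integral>\<omega>. f (alpha (n + m0) \<omega>) \<partial>M)" if "f \<in> borel_measurable borel" for f :: "real \<Rightarrow> real" and n
    unfolding La_def using that alpha_rv[OF idx] by (subst integral_distr) auto
  have int_Lx: "(\<integral>x. f x \<partial>Lx) = (\<integral>\<omega>. f (xi \<omega>) \<partial>M)" if "f \<in> borel_measurable borel" for f :: "real^'n \<Rightarrow> real"
    unfolding Lx_def using that xi_rv by (subst integral_distr) auto
  have chain: "moment_chain M (al n) (b n) xis (D n) (La n) Lx (P n)" for n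
  proof (intro moment_chain.intro stationary_reset_chain.intro reset_chain.intro
      moment_chain_axioms.intro stationary_reset_chain_axioms.intro reset_chain_axioms.intro)
    show "prob_space M" by (rule M)
    show "al n t \<in> borel_measurable M" "distr M borel (al n t) = La n" if "1 \<le> t" for t
      using that alphas_rv[OF idx] alphas_copies[OF idx] by (auto simp: al_def La_def)
    show "xis t \<in> borel_measurable M" "distr M borel (xis t) = Lx" if "1 \<le> t" for t
      using that xis_rv xis_copies by (auto simp: Lx_def)
    show "indep_vars (\<lambda>_. borel) (al n) {1..}" unfolding al_def by (rule alphas_indep[OF idx])
    show "indep_vars (\<lambda>_. borel) xis {1..}" by (rule xis_indep)
    show "indep_rv M (PiM {1..} (\<lambda>_. borel)) (\<lambda>\<omega>. \<lambda>t\<in>{1..}. al n t \<omega>)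
        (PiM {1..} (\<lambda>_. borel)) (\<lambda>\<omega>. \<lambda>t\<in>{1..}. xis t \<omega>)"
      unfolding al_def by (rule alphas_xis_indep[OF idx])
    show "D n \<in> sets borel" by (rule D_meas)
    show "0 \<in> D n" using inner_D[of n] g[of n] radii(1) by (auto simp: subset_iff)
    show "prob_space (P n)" unfolding P_def using Y_rv[OF idx] by (rule prob_space_distr)
    show "sets (P n) = sets borel" by (simp add: P_def)
    show "emeasure (P n) B = cycle_occupation M (X_proc (al n) (b n) xis) (first_hit (X_proc (al n) (b n) xis) (D n)) B"
      if "B \<in> sets borel" for B
      using Y_law[OF idx that] unfolding P_def X_eq tau_eq .
    show "integrable (La n) (\<lambda>a. a\<^sup>2)"
      unfolding La_def using alpha_rv[OF idx] alpha_moment2[OF idx] by (subst integrable_distr_eq) auto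
    show "integrable Lx (\<lambda>x. (norm x)\<^sup>2)"
      unfolding Lx_def using xi_rv xi_moment2 by (subst integrable_distr_eq) auto
    show "(\<integral>x. x \<partial>Lx) = 0"
      unfolding Lx_def using xi_rv xi_mean by (subst integral_distr) auto
    show "(\<integral>a. a\<^sup>2 \<partial>La n) < 1" using sq_less_1 by (simp add: int_La)
  qed
  have a1: "reset_law.a1 (La n) = (\<integral>\<omega>. alpha (n + m0) \<omega> \<partial>M)"
    and a2: "reset_law.a2 (La n) = (\<integral>\<omega>. (alpha (n + m0) \<omega>)\<^sup>2 \<partial>M)"
    and V_eq: "reset_law.V (P n) = (\<integral>y. (norm y)\<^sup>2 \<partial>P n)" for n
  proof -
    interpret C: moment_chain M "al n" "b n" xis "D n" "La n" Lx "P n" by (rule chain)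
    show "reset_law.a1 (La n) = (\<integral>\<omega>. alpha (n + m0) \<omega> \<partial>M)"
      "reset_law.a2 (La n) = (\<integral>\<omega>. (alpha (n + m0) \<omega>)\<^sup>2 \<partial>M)"
      by (simp_all add: C.reset_law.a1_def C.reset_law.a2_def int_La)
    show "reset_law.V (P n) = (\<integral>y. (norm y)\<^sup>2 \<partial>P n)" by (rule C.reset_law.V_def)
  qed
  have A1': "(\<lambda>n. r n * (1 - reset_law.a1 (La n))) \<longlonglongrightarrow> a"
    unfolding a1 r_def by (rule LIMSEQ_ignore_initial_segment[OF A1])
  have A2': "(\<lambda>n. r n * (1 - reset_law.a2 (La n))) \<longlonglongrightarrow> 2 * a"
    unfolding a2 r_def by (rule LIMSEQ_ignore_initial_segment[OF A2])
  have B1': "(\<lambda>n. sqrt (r n) * b n) \<longlonglongrightarrow> 1"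
    unfolding b_def r_def by (rule LIMSEQ_ignore_initial_segment[OF Bt])
  have r_pos: "0 < r n" for n by (simp add: r_def m0_def)
  have r_lim: "filterlim r at_top sequentially"
    unfolding r_def by (intro filterlim_compose[OF filterlim_real_sequentially] filterlim_add_const_nat_at_top)
  have r_inv: "(\<lambda>n. 1 / r n) \<longlonglongrightarrow> 0"
    by (intro tendsto_divide_0[OF tendsto_const] filterlim_at_top_imp_at_infinity r_lim)
  have B2': "(\<lambda>n. r n * (b n)\<^sup>2) \<longlonglongrightarrow> 1"
    using tendsto_power[OF B1', of 2] r_pos by (simp add: power_mult_distrib less_imp_le)
  have al_lim: "(\<lambda>n. 1 - 2 * reset_law.a1 (La n) + reset_law.a2 (La n)) \<longlonglongrightarrow> 0"
  proof -
    have "(\<lambda>n. (2 * (r n * (1 - reset_law.a1 (La n))) - r n * (1 - reset_law.a2 (La n))) * (1 / r n)) \<longlonglongrightarrow> (2 * a - 2 * a) * 0"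
      by (intro tendsto_intros A1' A2' r_inv)
    moreover have "(2 * (r n * (1 - x)) - r n * (1 - y)) * (1 / r n) = 1 - 2 * x + y" for x y n
      using r_pos[of n] by (simp add: field_simps)
    ultimately show ?thesis by simp
  qed
  interpret F: chain_family M al b xis D La Lx P r g r_in r_out
    by (intro chain_family.intro chain_family_axioms.intro) (fact M chain radii g inner_D outer_D r_pos r_lim B1' al_lim)+
  have e_eq: "mean_time M (tau (n + m0)) = ennreal (F.e n)" for n
  proof -
    interpret C: moment_chain M "al n" "b n" xis "D n" "La n" Lx "P n" by (rule chain)
    show ?thesis unfolding tau_eq F.e_def using C.mean_time_eq unfolding C.e_def .
  qed
  have e_nonneg: "0 \<le> F.e n" for n by (simp add: F.e_def)
  have e_lim: "(\<lambda>n. ennreal (F.e n)) \<longlonglongrightarrow> tau_hat"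
    using LIMSEQ_ignore_initial_segment[OF tau_mean, of m0] by (simp only: e_eq)
  define q where "q = 1 - p"
  have main: "0 \<le> q \<and> q \<le> 1 \<and> (\<forall>u. (\<lambda>n. r n * reset_law.G (P n) (D n) u) \<longlonglongrightarrow> complex_of_real (- q * (\<integral>x. (u \<bullet> x)\<^sup>2 \<partial>Lx) / 2))"
  proof (cases "tau_hat < \<infinity>")
    case False
    then have "tau_hat = \<infinity>" by (simp add: not_less top_unique)
    then have "filterlim F.e at_top sequentially" using e_lim by (simp add: ennreal_tendsto_top_eq_at_top)
    then show ?thesis using F.tendsto_G_infinite False by (simp add: q_def p_def)
  next
    case True
    define eh where "eh = enn2real tau_hat"
    have eh: "tau_hat = ennreal eh" using True by (simp add: eh_def)
    have "F.e \<longlonglongrightarrow> eh" using tendsto_enn2real[OF e_lim[unfolded eh]] e_nonneg by (simp add: eh_def)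
    have eh1: "1 \<le> eh" using tau_hat unfolding eh by simp
    have T_meas: "T \<in> borel_measurable M" by (rule T_rv[OF True])
    define T' where "T' \<omega> = nat (round (T \<omega>))" for \<omega>
    have conv: "conv_in_prob_enat M F.\<tau> T"
      unfolding conv_in_prob_enat_def tau_eq[symmetric]
      using tau_conv[OF True] unfolding conv_in_prob_enat_def by (auto intro: LIMSEQ_ignore_initial_segment)
    note T' = conv_in_prob_enat_round[OF F.tau_measurable T_meas conv, folded T'_def]
    note sums = F.sum_prob_gt_le[OF T'(1,2) \<open>F.e \<longlonglongrightarrow> eh\<close>] F.summable_prob_gt[OF T'(1,2) \<open>F.e \<longlonglongrightarrow> eh\<close>]
    \<comment> \<open>\<open>T\<close> is almost surely its rounded version, so its mean is a sum of
      tail probabilities; the bound of this sum by \<open>eh\<close> gives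
      \<open>q \<le> 1\<close>.\<close>
    have "expectation T = expectation (\<lambda>\<omega>. real (T' \<omega>))"
      using T'(1,3) T_meas by (intro integral_cong_AE) auto
    also have "\<dots> = (\<Sum>k. prob {\<omega> \<in> space M. k < T' \<omega>})"
      by (rule expectation_nat_tail_sum[OF T'(1) sums(2)])
    finally have q: "q = (\<Sum>k. prob {\<omega> \<in> space M. k < T' \<omega>}) / eh"
      using True by (simp add: q_def p_def eh_def)
    have "0 \<le> q" unfolding q using eh1 by (intro divide_nonneg_nonneg suminf_nonneg sums(2)) auto
    moreover have "(\<Sum>k. prob {\<omega> \<in> space M. k < T' \<omega>}) \<le> eh"
      by (rule suminf_le_const[OF sums(2) sums(1)])
    then have "q \<le> 1" unfolding q using eh1 by simp
    moreover have "(\<lambda>n. r n * reset_law.G (P n) (D n) u) \<longlonglongrightarrow> complex_of_real (- q * (\<integral>x. (u \<bullet> x)\<^sup>2 \<partial>Lx) / 2)" for u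
      using F.tendsto_G_finite[OF T'(1,2) \<open>F.e \<longlonglongrightarrow> eh\<close>, of u] unfolding q F.Q_def by simp
    ultimately show ?thesis by blast
  qed
  then have p01: "0 \<le> p" "p \<le> 1" by (auto simp: q_def)
  have quad_eq: "quad \<Sigma> u = (\<integral>x. (u \<bullet> x)\<^sup>2 \<partial>Lx)" for u
    unfolding Sigma_def quad_second_moment_matrix[OF xi_rv xi_moment2] by (rule int_Lx[symmetric]) measurable
  \<comment> \<open>The second moment bound is a quotient whose numerator and denominator both
    converge after multiplication by \<open>r\<close>, hence it is bounded.\<close>
  obtain C where V: "\<And>n. reset_law.V (P n) \<le> C"
  proof -
    define s2 where "s2 = (\<integral>x. (norm x)\<^sup>2 \<partial>Lx)"
    have "(\<lambda>n. (r n * (b n)\<^sup>2) * s2 / (r n * (1 - reset_law.a2 (La n)))) \<longlonglongrightarrow> 1 * s2 / (2 * a)"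
      using a_pos by (intro tendsto_intros A2' B2') auto
    then have "Bseq (\<lambda>n. (r n * (b n)\<^sup>2) * s2 / (r n * (1 - reset_law.a2 (La n))))"
      by (intro convergent_imp_Bseq convergentI)
    then obtain C where C: "\<And>n. norm ((r n * (b n)\<^sup>2) * s2 / (r n * (1 - reset_law.a2 (La n)))) \<le> C"
      unfolding Bseq_def by blast
    have "reset_law.V (P n) \<le> C" for n
    proof -
      interpret C: moment_chain M "al n" "b n" xis "D n" "La n" Lx "P n" by (rule chain)
      have "reset_law.V (P n) \<le> (b n)\<^sup>2 * s2 / (1 - reset_law.a2 (La n))"
        using C.P_sq_le unfolding V_eq C.s2_def C.\<alpha>2_def C.reset_law.a2_def s2_def .
      also have "\<dots> = (r n * (b n)\<^sup>2) * s2 / (r n * (1 - reset_law.a2 (La n)))" using r_pos[of n] by simp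
      also have "\<dots> \<le> C" using C[of n] by (simp only: real_norm_def)
      finally show ?thesis .
    qed
    then show ?thesis by (rule that)
  qed
  have mean: "(\<lambda>n. \<integral>y. y \<partial>P n) \<longlonglongrightarrow> \<mu>"
  proof -
    have "(\<integral>y. y \<partial>P n) = (\<integral>\<omega>. Y (n + m0) \<omega> \<partial>M)" for n
      unfolding P_def using Y_rv[OF idx] by (subst integral_distr) auto
    then show ?thesis using LIMSEQ_ignore_initial_segment[OF Y_mean, of m0] by simp
  qed
  have RL: "reset_law (La n) Lx (P n) (D n) (b n)" for n
  proof -
    interpret C: moment_chain M "al n" "b n" xis "D n" "La n" Lx "P n" by (rule chain)
    show ?thesis by (rule C.reset_law.reset_law_axioms)
  qed
  interpret L: char_limit \<Sigma> a P p \<mu>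
  proof unfold_locales
    show "transpose \<Sigma> = \<Sigma>" unfolding Sigma_def by (rule transpose_second_moment_matrix)
    show "0 < quad \<Sigma> x" if "x \<noteq> 0" for x
      using quad_second_moment_matrix_pos[OF xi_rv xi_moment2 Sigma_rank[unfolded Sigma_def] that] by (simp add: Sigma_def)
    show "borel_prob (P n)" for n unfolding P_def by (rule borel_prob_distr[OF Y_rv[OF idx]])
    show "(\<lambda>n. char_vec (P n) u) \<longlonglongrightarrow> limit_char (1 - p) (quad \<Sigma> u / (4 * a)) (u \<bullet> \<mu>)" for u
      unfolding quad_eq q_def[symmetric]
      by (rule tendsto_char_reset_law[OF RL r_lim a_pos A1' A2' B2' V _ mean]) (use main in blast)
  qed (use a_pos p01 in auto)
  \<comment> \<open>Weak convergence is not affected by the first \<open>m0\<close> laws, so the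
    shift of the index is undone here.\<close>
  have shift: "weak_conv_law (\<lambda>m. distr M borel (Y m)) \<nu>" if "weak_conv_law P \<nu>" for \<nu>
    using that unfolding weak_conv_law_def P_def by (auto intro: LIMSEQ_offset[where k=m0])
  show ?thesis
    by (intro conjI p01, rule ex_forward[OF L.limit_law], (erule ex_forward)+, elim conjE, intro conjI shift) assumption+
qed

end
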